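(* Let $\mu$ be a finite measure on $\mathbb{R}^d$ with compact support. If $f\in\mathcal{P}$ satisfies $\alpha>2\gamma(f)b$, then, as $t\to\infty$, $$e^{-(\alpha-\gamma(f)b)t}\langle f,X_t\rangle\;\to\;\sum_{|p|=\gamma(f)}a_pH^p_\infty\qquad\text{in }L^2(\mathbb{P}_\mu).$$
   Context: Setting. $d\ge1$ is an integer, $b>0$, $\sigma>0$. $\xi=\{\xi_t\}_{t\ge0}$ is the Ornstein–Uhlenbeck process on $\mathbb{R}^d$ with generator $L=\frac12\sigma^2\Delta-b\,x\cdot\nabla$; $\Pi_x$ is its law started from $x$ and $T_tf(x)=\Pi_x f(\xi_t)$ its semigroup. The branching mechanism is $\psi(\lambda)=-\alpha\lambda+\beta\lambda^2+\int_{(0,\infty)}(e^{-\lambda x}-1+\lambda x)\,n(dx)$, $\lambda>0$, with $\alpha=-\psi'(0+)>0$, $\beta\ge0$, $n$ a measure on $(0,\infty)$ with $\int_{(0,\infty)}x^2n(dx)<\infty$, and $\psi(\infty)=\infty$. $X=\{X_t\}_{t\ge0}$ is the $(\xi,\psi)$-superprocess: the càdlàg Markov process with values in the finite measures $\mathcal{M}_F(\mathbb{R}^d)$ such that, with $\mathbb{P}_\mu$ its law when $X_0=\mu$, for all bounded nonnegative measurable $f$, $-\log\mathbb{P}_\mu(e^{-\langle f,X_t\rangle})=\langle u_f(\cdot,t),\mu\rangle$, where $u_f$ is the unique nonnegative solution of $u_f(x,t)+\Pi_x\int_0^t\psi(u_f(\xi_s,t-s))ds=\Pi_xf(\xi_t)$.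 Here $\langle f,\mu\rangle=\int f\,d\mu$, and $\mathbb{P}_\mu$ also denotes expectation. Eigenfunctions. $\varphi(x)=(b/(\pi\sigma^2))^{d/2}\exp(-b\|x\|^2/\sigma^2)$ is the invariant density of $\xi$; $L^2(\varphi)$ is the $L^2$ space of $\varphi(x)dx$ with inner product $\langle\cdot,\cdot\rangle_\varphi$. For $p\in\mathbb{Z}_+^d$, $|p|=\sum_jp_j$, $p!=\prod_jp_j!$, $H_p(x)=(-1)^{|p|}e^{\|x\|^2}\frac{\partial^{|p|}}{\partial x_1^{p_1}\cdots\partial x_d^{p_d}}e^{-\|x\|^2}$ and $\phi_p(x)=\frac{1}{\sqrt{p!\,2^{|p|}}}H_p(\frac{\sqrt b}{\sigma}x)$. The $\phi_p$ form an orthonormal basis of $L^2(\varphi)$ with $T_t\phi_p=e^{-|p|bt}\phi_p$. For $f\in L^2(\varphi)$, $a_p=\langle f,\phi_p\rangle_\varphi$ and $\gamma(f)=\inf\{n\ge0:\exists\,p\in\mathbb{Z}_+^d,\ |p|=n,\ a_p\ne0\}$ ($\inf\emptyset=\infty$). $\mathcal{P}$ is the set of $f\in C(\mathbb{R}^d)$ for which there is $k\in\mathbb{N}$ with $|f(x)|/\|x\|^k\to0$ as $\|x\|\to\infty$. Martingale limits. $H_t^p:=e^{-(\alpha-|p|b)t}\langle\phi_p,X_t\rangle$; when $\alpha>2|p|b$ this is a martingale under $\mathbb{P}_\mu$ bounded in $L^2(\mathbb{P}_\mu)$, and $H^p_\infty:=\lim_{t\to\infty}H^p_t$ ($\mathbb{P}_\mu$-a.s.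 and in $L^2(\mathbb{P}_\mu)$). *)

theory Defs
  imports "HOL-Probability.Probability"
begin

section \<open>Partial derivatives\<close>

definition partial :: "'d::finite \<Rightarrow> (real^'d \<Rightarrow> real) \<Rightarrow> real^'d \<Rightarrow> real" where
  "partial i f x = frechet_derivative f (at x) (axis i 1)"

definition iter_partial :: "'d::finite list \<Rightarrow> (real^'d \<Rightarrow> real) \<Rightarrow> real^'d \<Rightarrow> real" where
  "iter_partial js f = foldr partial js f"

text \<open>The index type carries no order, so the operator for a multi-index \<open>p\<close> (differentiate \<open>p i\<close>
  times in direction \<open>i\<close>, for every \<open>i\<close>) picks an arbitrary order of differentiation. It is only
  applied to a smooth function, where the order is irrelevant.\<close>

definition mixed_partial :: "('d::finite \<Rightarrow> nat) \<Rightarrow> (real^'d \<Rightarrow> real) \<Rightarrow> real^'d \<Rightarrow> real" where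
  "mixed_partial p f = iter_partial (SOME js. \<forall>i. count_list js i = p i) f"

definition C2_compact_support :: "(real^'d::finite \<Rightarrow> real) \<Rightarrow> bool" where
  "C2_compact_support f \<longleftrightarrow>
     f differentiable_on UNIV \<and>
     (\<forall>i. partial i f differentiable_on UNIV) \<and>
     (\<forall>i j. continuous_on UNIV (partial j (partial i f))) \<and>
     compact (closure {x. f x \<noteq> 0})"


section \<open>Markov families\<close>

text \<open>Processes are indexed by \<^typ>\<open>real\<close>, but only times \<open>t \<ge> 0\<close> are ever constrained or used.
  Only the \<open>\<sigma>\<close>-algebra of the sample space \<open>M\<close> matters, not its measure.\<close>

definition natural_filtration :: "'s measure \<Rightarrow> 'w measure \<Rightarrow> (real \<Rightarrow> 'w \<Rightarrow> 's) \<Rightarrow> real \<Rightarrow> 'w measure"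
  where "natural_filtration S M Y s =
    sigma (space M) {Y u -` B \<inter> space M | u B. 0 \<le> u \<and> u \<le> s \<and> B \<in> sets S}"

locale markov_family =
  fixes S :: "'s measure" and M :: "'w measure"
    and Y :: "real \<Rightarrow> 'w \<Rightarrow> 's" and P :: "'s \<Rightarrow> 'w measure"
  assumes prob: "x \<in> space S \<Longrightarrow> prob_space (P x)"
    and sets_P: "x \<in> space S \<Longrightarrow> sets (P x) = sets M"
    and measurable_Y: "0 \<le> t \<Longrightarrow> Y t \<in> M \<rightarrow>\<^sub>M S"
    and start: "x \<in> space S \<Longrightarrow> AE \<omega> in P x. Y 0 \<omega> = x"
    and kernel: "0 \<le> t \<Longrightarrow> B \<in> sets S \<Longrightarrow>
      (\<lambda>x. measure (P x) (Y t -` B \<inter> space M)) \<in> borel_measurable S"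
    and markov: "x \<in> space S \<Longrightarrow> 0 \<le> s \<Longrightarrow> 0 \<le> t \<Longrightarrow> B \<in> sets S \<Longrightarrow>
      AE \<omega> in P x. real_cond_exp (P x) (natural_filtration S M Y s)
          (indicat_real (Y (s + t) -` B \<inter> space M)) \<omega>
        = measure (P (Y s \<omega>)) (Y t -` B \<inter> space M)"


section \<open>The Ornstein--Uhlenbeck process\<close>

definition OU_operator :: "real \<Rightarrow> real \<Rightarrow> (real^'d::finite \<Rightarrow> real) \<Rightarrow> real^'d \<Rightarrow> real" where
  "OU_operator b \<sigma> f x =
     1 / 2 * \<sigma>\<^sup>2 * (\<Sum>i\<in>UNIV. partial i (partial i f) x) - b * (\<Sum>i\<in>UNIV. x $ i * partial i f x)"

definition semigroup_of :: "(real \<Rightarrow> 'v \<Rightarrow> 's) \<Rightarrow> ('s \<Rightarrow> 'v measure) \<Rightarrow> real \<Rightarrow> ('s \<Rightarrow> real) \<Rightarrow> 's \<Rightarrow> real"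
  where "semigroup_of \<xi> Pr t f x = (\<integral>\<omega>. f (\<xi> t \<omega>) \<partial>Pr x)"

text \<open>Having generator \<open>L\<close> means that \<open>(T\<^sub>t f - f) / t\<close> converges to \<open>L f\<close> in the sup norm as
  \<open>t\<close> decreases to 0, for all \<open>f\<close> in the core of twice continuously differentiable functions with
  compact support.\<close>

locale OU_process = markov_family "borel :: (real^'d::finite) measure" N \<xi> Pr
  for b \<sigma> :: real and N :: "'v measure"
    and \<xi> :: "real \<Rightarrow> 'v \<Rightarrow> real^'d" and Pr :: "real^'d \<Rightarrow> 'v measure" +
  assumes b_pos: "0 < b" and \<sigma>_pos: "0 < \<sigma>"
    and continuous_paths: "\<omega> \<in> space N \<Longrightarrow> continuous_on {0..} (\<lambda>t. \<xi> t \<omega>)"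
    and generator: "C2_compact_support f \<Longrightarrow>
      uniform_limit UNIV (\<lambda>t x. (semigroup_of \<xi> Pr t f x - f x) / t) (OU_operator b \<sigma> f) (at_right 0)"


section \<open>The branching mechanism\<close>

definition branching_psi :: "real \<Rightarrow> real \<Rightarrow> real measure \<Rightarrow> real \<Rightarrow> real" where
  "branching_psi \<alpha> \<beta> n z = - \<alpha> * z + \<beta> * z\<^sup>2 + (\<integral>x. (exp (- z * x) - 1 + z * x) \<partial>n)"

text \<open>The second-moment condition on \<open>n\<close> gives \<open>\<psi>'(0+) = - \<alpha>\<close>.\<close>

locale branching_mechanism =
  fixes \<alpha> \<beta> :: real and n :: "real measure"
  assumes \<alpha>_pos: "0 < \<alpha>" and \<beta>_nonneg: "0 \<le> \<beta>"
    and sets_n: "sets n = sets (restrict_space borel {0<..})"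
    and second_moment_n: "(\<integral>\<^sup>+x. ennreal (x\<^sup>2) \<partial>n) < \<infinity>"
    and psi_at_top: "filterlim (branching_psi \<alpha> \<beta> n) at_top at_top"


section \<open>The superprocess\<close>

text \<open>The measurable space of finite measures; cf. \<^const>\<open>subprob_algebra\<close>. For a Borel space
  of a Polish space its \<open>\<sigma>\<close>-algebra is the Borel \<open>\<sigma>\<close>-algebra of the weak topology.\<close>

definition finite_measure_algebra :: "'a measure \<Rightarrow> 'a measure measure" where
  "finite_measure_algebra K =
    (SUP A \<in> sets K. vimage_algebra {\<mu>. finite_measure \<mu> \<and> sets \<mu> = sets K} (\<lambda>\<mu>. emeasure \<mu> A) borel)"

abbreviation MF :: "(real^'d::finite) measure measure" where
  "MF \<equiv> finite_measure_algebra borel"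

definition weakly_tendsto ::
    "('t \<Rightarrow> 'a::topological_space measure) \<Rightarrow> 'a measure \<Rightarrow> 't filter \<Rightarrow> bool" where
  "weakly_tendsto \<nu> \<mu> F \<longleftrightarrow>
     (\<forall>g :: 'a \<Rightarrow> real. continuous_on UNIV g \<longrightarrow> bounded (range g) \<longrightarrow>
        ((\<lambda>t. \<integral>x. g x \<partial>\<nu> t) \<longlongrightarrow> (\<integral>x. g x \<partial>\<mu>)) F)"

definition cadlag_MF :: "(real \<Rightarrow> (real^'d::finite) measure) \<Rightarrow> bool" where
  "cadlag_MF Z \<longleftrightarrow>
     (\<forall>t\<ge>0. weakly_tendsto Z (Z t) (at_right t)) \<and>
     (\<forall>t>0. \<exists>\<nu>\<in>space MF. weakly_tendsto Z \<nu> (at_left t))"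

text \<open>Nonnegative solutions \<open>u(x, t)\<close>, \<open>t \<ge> 0\<close>, of the mild equation with initial value \<open>f\<close>.
  Integrability is demanded because the Bochner integral of a non-integrable function is 0.\<close>

definition mild_solution ::
    "(real \<Rightarrow> real) \<Rightarrow> (real \<Rightarrow> 'v \<Rightarrow> real^'d::finite) \<Rightarrow> (real^'d \<Rightarrow> 'v measure) \<Rightarrow>
     (real^'d \<Rightarrow> real) \<Rightarrow> (real^'d \<Rightarrow> real \<Rightarrow> real) \<Rightarrow> bool" where
  "mild_solution \<psi> \<xi> Pr f u \<longleftrightarrow>
     (\<lambda>(x, t). u x t) \<in> borel_measurable (borel \<Otimes>\<^sub>M restrict_space borel {0..}) \<and>
     (\<forall>x. \<forall>t\<ge>0. 0 \<le> u x t) \<and>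
     (\<forall>x. \<forall>t\<ge>0.
        set_integrable (Pr x \<Otimes>\<^sub>M lborel) (space (Pr x) \<times> {0..t}) (\<lambda>(\<omega>, s). \<psi> (u (\<xi> s \<omega>) (t - s))) \<and>
        u x t + (\<integral>\<omega>. (LINT s:{0..t}|lborel. \<psi> (u (\<xi> s \<omega>) (t - s))) \<partial>Pr x) = (\<integral>\<omega>. f (\<xi> t \<omega>) \<partial>Pr x))"

locale super_OU_process =
  OU_process b \<sigma> N \<xi> Pr + branching_mechanism \<alpha> \<beta> n +
  X: markov_family "MF :: (real^'d) measure measure" M X P
  for b \<sigma> :: real and N :: "'v measure"
    and \<xi> :: "real \<Rightarrow> 'v \<Rightarrow> real^'d::finite" and Pr :: "real^'d \<Rightarrow> 'v measure"
    and \<alpha> \<beta> :: real and n :: "real measure"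
    and M :: "'w measure" and X :: "real \<Rightarrow> 'w \<Rightarrow> (real^'d) measure"
    and P :: "(real^'d) measure \<Rightarrow> 'w measure" +
  assumes cadlag: "\<omega> \<in> space M \<Longrightarrow> cadlag_MF (\<lambda>t. X t \<omega>)"
    and log_Laplace: "f \<in> borel_measurable borel \<Longrightarrow> bounded (range f) \<Longrightarrow> (\<And>x. 0 \<le> f x) \<Longrightarrow>
      \<exists>u. mild_solution (branching_psi \<alpha> \<beta> n) \<xi> Pr f u \<and>
          (\<forall>v. mild_solution (branching_psi \<alpha> \<beta> n) \<xi> Pr f v \<longrightarrow> (\<forall>x. \<forall>t\<ge>0. v x t = u x t)) \<and>
          (\<forall>\<mu>\<in>space MF. \<forall>t\<ge>0.
             - ln (\<integral>\<omega>. exp (- (\<integral>x. f x \<partial>X t \<omega>)) \<partial>P \<mu>) = (\<integral>x. u x t \<partial>\<mu>))"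


section \<open>Eigenfunctions\<close>

definition OU_density :: "real \<Rightarrow> real \<Rightarrow> real^'d::finite \<Rightarrow> real" where
  "OU_density b \<sigma> x =
     (b / (pi * \<sigma>\<^sup>2)) powr (real CARD('d) / 2) * exp (- b * (norm x)\<^sup>2 / \<sigma>\<^sup>2)"

definition mi_size :: "('d::finite \<Rightarrow> nat) \<Rightarrow> nat" where
  "mi_size p = (\<Sum>i\<in>UNIV. p i)"

definition mi_fact :: "('d::finite \<Rightarrow> nat) \<Rightarrow> real" where
  "mi_fact p = (\<Prod>i\<in>UNIV. fact (p i))"

definition hermite :: "('d::finite \<Rightarrow> nat) \<Rightarrow> real^'d \<Rightarrow> real" where
  "hermite p x =
     (- 1) ^ mi_size p * exp ((norm x)\<^sup>2) * mixed_partial p (\<lambda>y. exp (- (norm y)\<^sup>2)) x"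

definition eigenfun :: "real \<Rightarrow> real \<Rightarrow> ('d::finite \<Rightarrow> nat) \<Rightarrow> real^'d \<Rightarrow> real" where
  "eigenfun b \<sigma> p x =
     1 / sqrt (mi_fact p * 2 ^ mi_size p) * hermite p ((sqrt b / \<sigma>) *\<^sub>R x)"

definition OU_coeff :: "real \<Rightarrow> real \<Rightarrow> (real^'d::finite \<Rightarrow> real) \<Rightarrow> ('d \<Rightarrow> nat) \<Rightarrow> real" where
  "OU_coeff b \<sigma> f p = (\<integral>x. f x * eigenfun b \<sigma> p x * OU_density b \<sigma> x \<partial>lborel)"

definition OU_order :: "real \<Rightarrow> real \<Rightarrow> (real^'d::finite \<Rightarrow> real) \<Rightarrow> enat" where
  "OU_order b \<sigma> f = Inf {enat k | k. \<exists>p. mi_size p = k \<and> OU_coeff b \<sigma> f p \<noteq> 0}"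

definition poly_growth :: "(real^'d::finite \<Rightarrow> real) set" where
  "poly_growth =
     {f. continuous_on UNIV f \<and> (\<exists>k::nat. ((\<lambda>x. \<bar>f x\<bar> / norm x ^ k) \<longlongrightarrow> 0) at_infinity)}"

definition compactly_supported :: "'a::topological_space measure \<Rightarrow> bool" where
  "compactly_supported \<mu> \<longleftrightarrow> (\<exists>K. compact K \<and> emeasure \<mu> (- K) = 0)"


section \<open>Convergence in mean square and martingale limits\<close>

definition square_integrable :: "'w measure \<Rightarrow> ('w \<Rightarrow> real) \<Rightarrow> bool" where
  "square_integrable Q Z \<longleftrightarrow> Z \<in> borel_measurable Q \<and> integrable Q (\<lambda>\<omega>. (Z \<omega>)\<^sup>2)"

definition tendsto_L2 :: "'w measure \<Rightarrow> ('t \<Rightarrow> 'w \<Rightarrow> real) \<Rightarrow> ('w \<Rightarrow> real) \<Rightarrow> 't filter \<Rightarrow> bool" where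
  "tendsto_L2 Q Z Z' F \<longleftrightarrow>
     (\<forall>\<^sub>F t in F. square_integrable Q (Z t)) \<and> square_integrable Q Z' \<and>
     ((\<lambda>t. \<integral>\<omega>. (Z t \<omega> - Z' \<omega>)\<^sup>2 \<partial>Q) \<longlongrightarrow> 0) F"

definition mart_H :: "real \<Rightarrow> real \<Rightarrow> real \<Rightarrow> (real \<Rightarrow> 'w \<Rightarrow> (real^'d::finite) measure) \<Rightarrow>
    ('d \<Rightarrow> nat) \<Rightarrow> real \<Rightarrow> 'w \<Rightarrow> real" where
  "mart_H b \<sigma> \<alpha> X p t \<omega> = exp (- (\<alpha> - real (mi_size p) * b) * t) * (\<integral>x. eigenfun b \<sigma> p x \<partial>X t \<omega>)"

text \<open>The limit as an element of \<open>L\<^sup>2(Q)\<close>: it is determined up to \<open>Q\<close>-null sets, and it agrees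
  \<open>Q\<close>-almost surely with the almost sure limit.\<close>

definition mart_H_lim :: "real \<Rightarrow> real \<Rightarrow> real \<Rightarrow> (real \<Rightarrow> 'w \<Rightarrow> (real^'d::finite) measure) \<Rightarrow>
    'w measure \<Rightarrow> ('d \<Rightarrow> nat) \<Rightarrow> 'w \<Rightarrow> real" where
  "mart_H_lim b \<sigma> \<alpha> X Q p = (SOME Z. tendsto_L2 Q (mart_H b \<sigma> \<alpha> X p) Z at_top)"

end

theory Submission
  imports Defs
begin

text \<open>The generator determines the semigroup \<open>T\<^sub>t\<close> through Gaussian bumps, a class of test functions that
  the Mehler semigroup maps to itself and that separates measures. So \<open>T\<^sub>t\<close> is the Mehler semigroup,
  which is diagonal in the Hermite basis. Expanding the Laplace functional of \<open>\<theta> f\<close> to second order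
  as \<open>\<theta>\<close> tends to 0 gives
  \<open>E \<langle>f, X\<^sub>t\<rangle> = e\<^bsup>\<alpha>t\<^esup> \<langle>T\<^sub>t f, \<mu>\<rangle>\<close> and
  \<open>Var \<langle>f, X\<^sub>t\<rangle> = \<psi>''(0) \<integral>\<^sub>0\<^sup>t e\<^bsup>\<alpha>s\<^esup> \<langle>T\<^sub>s (e\<^bsup>\<alpha>(t-s)\<^esup> T\<^bsub>t-s\<^esub> f)\<^sup>2, \<mu>\<rangle> ds\<close>.
  Write \<open>f\<close> as its component of order \<open>\<gamma>\<close> plus a remainder \<open>g\<close> orthogonal to all eigenfunctions of
  order at most \<open>\<gamma>\<close>. Then \<open>T\<^sub>t g\<close> decays like \<open>e\<^bsup>-(\<gamma>+1)bt\<^esup>\<close> in \<open>L\<^sup>2(\<phi>)\<close>, and the Mehler kernel turns this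
  into a bound that is uniform on the support of \<open>\<mu>\<close>, so the normalised remainder tends to 0 in
  \<open>L\<^sup>2\<close>. The main component is a finite combination of the martingales \<open>H\<^sup>p\<close>, which converge in
  \<open>L\<^sup>2\<close> because their second moments converge exponentially fast when \<open>\<alpha> > 2|p|b\<close>.\<close>

section \<open>Gaussian integrals\<close>

text \<open>The generator is prescribed only on compactly supported functions, so each bump is first
  cut off and the radius sent to infinity by dominated convergence. Bumps have positive width
  \<epsilon>, so what they determine is the law smoothed by an independent Gaussian; \<epsilon> then
  tends to 0. The decay rate is read off the Hilbert-Schmidt norm of the Mehler kernel, an explicit
  Gaussian integral with square (1 - w^2)^(-d), after the finitely many low modes are removed. Since
  \<psi> changes sign, its linear part is split off: the mild equation becomes an identity between
  nonnegative integrals, and a Volterra argument resolves the linear part. The growth of \<psi> to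
  infinity supplies the finiteness this requires. Laplace functionals see only bounded nonnegative
  f: truncation removes the bound, and the parallelogram law for the second moments removes the
  sign. Passing from L2 decay to a bound at a fixed starting point costs one unit of smoothing time,
  taken from the outer average or borrowed from the inner semigroup; hence the estimates start at
  time 2.\<close>

lemma prod_Basis_vec:
  "(\<Prod>b\<in>(Basis :: (real^'d::finite) set). F b) = (\<Prod>i\<in>UNIV. F (axis i 1))"
proof -
  have "(Basis :: (real^'d) set) = range (\<lambda>i. axis i 1)"
    by (auto simp: Basis_vec_def)
  moreover have "inj (\<lambda>i. axis i (1::real) :: real^'d)"
    by (auto simp: inj_on_def axis_eq_axis)
  ultimately show ?thesis
    using prod.reindex[of "\<lambda>i. axis i (1::real) :: real^'d" UNIV F] by (simp add: o_def)
qed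

text \<open>\<open>lborel\<close> on vectors is the image of a product measure indexed by
  \<open>Basis\<close>, so Fubini for finite products applies once the factors are re-indexed from
  \<open>'d\<close> to basis vectors; that is the role of \<open>G\<close>.\<close>

lemma has_bochner_integral_lborel_prod:
  fixes F :: "'d::finite \<Rightarrow> real \<Rightarrow> real"
  assumes int: "\<And>i. integrable lborel (F i)"
  shows "has_bochner_integral lborel (\<lambda>x::real^'d. \<Prod>i\<in>UNIV. F i (x $ i)) (\<Prod>i\<in>UNIV. \<integral>t. F i t \<partial>lborel)"
proof -
  interpret product_sigma_finite "\<lambda>_ :: real^'d. lborel :: real measure" ..
  define G where "G b = F (THE i. b = axis i (1::real))" for b :: "real^'d"
  have G_axis: "G (axis i 1) = F i" for i
    by (auto simp: G_def axis_eq_axis)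
  have intG: "integrable lborel (G b)" for b
    unfolding G_def by (rule int)
  have [measurable]: "F i \<in> borel_measurable borel" for i
    using int[of i] by auto
  have eq: "(\<Prod>i\<in>UNIV. F i ((\<Sum>b\<in>Basis. z b *\<^sub>R b) $ i)) = (\<Prod>b\<in>Basis. G b (z b))" for z :: "real^'d \<Rightarrow> real"
  proof -
    have "(\<Sum>b\<in>Basis. z b *\<^sub>R b) $ i = z (axis i 1)" for i
    proof -
      have "(\<Sum>b\<in>Basis. z b *\<^sub>R b) $ i = (\<Sum>b\<in>Basis. z b *\<^sub>R b) \<bullet> axis i 1"
        by (simp add: inner_axis)
      also have "\<dots> = z (axis i 1)"
        by (rule inner_sum_left_Basis) (auto simp: Basis_vec_def)
      finally show ?thesis .
    qed
    then show ?thesis by (simp add: prod_Basis_vec G_axis)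
  qed
  have "has_bochner_integral (\<Pi>\<^sub>M b\<in>(Basis::(real^'d) set). lborel) (\<lambda>z. \<Prod>b\<in>Basis. G b (z b)) (\<Prod>b\<in>Basis. \<integral>t. G b t \<partial>lborel)"
    using product_integrable_prod[of Basis G] product_integral_prod[of Basis G] intG
    by (auto simp: has_bochner_integral_iff)
  moreover have "(\<Prod>b\<in>(Basis::(real^'d) set). \<integral>t. G b t \<partial>lborel) = (\<Prod>i\<in>UNIV. \<integral>t. F i t \<partial>lborel)"
    by (simp add: prod_Basis_vec G_axis)
  ultimately show ?thesis
    by (subst lborel_eq) (intro has_bochner_integral_distr, auto simp: eq simp del: vector_scaleR_component sum_component)
qed

text \<open>Completing the square: up to a constant the integrand is the normal density with mean B
  / (2 A) and variance 1 / (2 A).\<close>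

lemma gaussian_integral_real:
  fixes A B :: real
  assumes "A > 0"
  shows "has_bochner_integral lborel (\<lambda>t. exp (- A * t\<^sup>2 + B * t)) (sqrt (pi / A) * exp (B\<^sup>2 / (4 * A)))"
proof -
  define s where "s = sqrt (1 / (2 * A))"
  have s: "s > 0" "s\<^sup>2 = 1 / (2 * A)" using assms by (auto simp: s_def)
  define m where "m = B / (2 * A)"
  have "has_bochner_integral lborel (normal_density m s) 1"
    using s by (simp add: has_bochner_integral_iff)
  then have "has_bochner_integral lborel (\<lambda>t. (sqrt (pi / A) * exp (B\<^sup>2 / (4 * A))) * normal_density m s t)
     ((sqrt (pi / A) * exp (B\<^sup>2 / (4 * A))) * 1)"
    by (rule has_bochner_integral_mult_right)
  moreover have "(sqrt (pi / A) * exp (B\<^sup>2 / (4 * A))) * normal_density m s t = exp (- A * t\<^sup>2 + B * t)" for t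
  proof -
    have "sqrt (pi / A) * (1 / sqrt (2 * pi * s\<^sup>2)) = 1"
      using assms by (simp add: s(2))
    moreover have "B\<^sup>2 / (4 * A) + - (t - m)\<^sup>2 / (2 * s\<^sup>2) = - A * t\<^sup>2 + B * t"
      using assms unfolding s(2) m_def by (simp add: field_simps power2_eq_square)
    moreover have "(sqrt (pi / A) * exp (B\<^sup>2 / (4 * A))) * normal_density m s t =
      (sqrt (pi / A) * (1 / sqrt (2 * pi * s\<^sup>2))) * exp (B\<^sup>2 / (4 * A) + - (t - m)\<^sup>2 / (2 * s\<^sup>2))"
      unfolding normal_density_def exp_add by (simp only: mult.assoc mult.left_commute)
    ultimately show ?thesis using assms by simp
  qed
  ultimately show ?thesis by simp
qed

lemma norm_vec_sq: "(norm (x :: real^'d::finite))\<^sup>2 = (\<Sum>i\<in>UNIV. (x $ i)\<^sup>2)"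
  unfolding power2_norm_eq_inner by (simp add: inner_vec_def power2_eq_square)

lemma gaussian_integral_vec:
  fixes B :: "real^'d::finite"
  assumes "A > 0"
  shows "has_bochner_integral lborel (\<lambda>y. exp (- A * (norm y)\<^sup>2 + B \<bullet> y))
    (sqrt (pi / A) ^ CARD('d) * exp ((norm B)\<^sup>2 / (4 * A)))"
proof -
  have 1: "exp (- A * (norm y)\<^sup>2 + B \<bullet> y) = (\<Prod>i\<in>UNIV. exp (- A * (y $ i)\<^sup>2 + B $ i * y $ i))" for y :: "real^'d"
    by (simp add: exp_sum[symmetric] sum.distrib sum_subtractf norm_vec_sq inner_vec_def sum_negf sum_distrib_left)
  have 2: "sqrt (pi / A) ^ CARD('d) * exp ((norm B)\<^sup>2 / (4 * A)) =
    (\<Prod>i\<in>UNIV. sqrt (pi / A) * exp ((B $ i)\<^sup>2 / (4 * A)))"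
    by (simp add: prod.distrib exp_sum[symmetric] norm_vec_sq sum_divide_distrib)
  show ?thesis unfolding 1 2
    using has_bochner_integral_lborel_prod[of "\<lambda>i t. exp (- A * t\<^sup>2 + B $ i * t)"]
      gaussian_integral_real[OF assms]
    by (simp add: has_bochner_integral_iff)
qed

text \<open>For \<open>a = b / \<sigma>\<^sup>2\<close> this is the invariant density of \<xi>. The
  parameter is the coefficient in the exponent because the Mehler kernel depends on b and \<sigma>
  only through this quotient and \<open>exp (- b * t)\<close>.\<close>

definition gauss_dens :: "real \<Rightarrow> real^'d::finite \<Rightarrow> real" where
  "gauss_dens a x = sqrt (a / pi) ^ CARD('d) * exp (- a * (norm x)\<^sup>2)"

definition gauss :: "real \<Rightarrow> (real^'d::finite) measure" where
  "gauss a = density lborel (\<lambda>x. ennreal (gauss_dens a x))"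

lemma gauss_dens_nonneg [simp]: "a \<ge> 0 \<Longrightarrow> gauss_dens a x \<ge> 0"
  by (simp add: gauss_dens_def)

lemma gauss_dens_measurable [measurable]: "gauss_dens a \<in> borel_measurable borel"
  unfolding gauss_dens_def by measurable

lemma sets_gauss [simp, measurable_cong]: "sets (gauss a) = sets borel"
  by (simp add: gauss_def)

lemma space_gauss [simp]: "space (gauss a) = UNIV"
  by (simp add: gauss_def)

lemma OU_density_eq: "b > 0 \<Longrightarrow> \<sigma> > 0 \<Longrightarrow> OU_density b \<sigma> (x :: real^'a::finite) = gauss_dens (b / \<sigma>\<^sup>2) x"
proof -
  assume "b > 0" "\<sigma> > 0"
  then have z: "b / \<sigma>\<^sup>2 / pi > 0" by simp
  have "(b / (pi * \<sigma>\<^sup>2)) powr (real CARD('a) / 2) = ((b / \<sigma>\<^sup>2 / pi) powr (1 / 2)) powr real CARD('a)"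
    unfolding powr_powr by (simp add: mult.commute)
  also have "\<dots> = sqrt (b / \<sigma>\<^sup>2 / pi) ^ CARD('a)"
    using z by (simp only: powr_half_sqrt[OF less_imp_le[OF z]] powr_realpow real_sqrt_gt_zero)
  finally show ?thesis
    unfolding OU_density_def gauss_dens_def by simp
qed

lemma has_bochner_integral_gauss:
  fixes f :: "real^'d::finite \<Rightarrow> real"
  assumes "a > 0" and [measurable]: "f \<in> borel_measurable borel"
  shows "has_bochner_integral (gauss a) f v \<longleftrightarrow> has_bochner_integral lborel (\<lambda>x. gauss_dens a x * f x) v"
  unfolding gauss_def using assms(1)
  by (auto simp: has_bochner_integral_iff integrable_real_density integral_real_density)

lemma prob_space_gauss:
  assumes "a > 0"
  shows "prob_space (gauss a :: (real^'d::finite) measure)"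
proof
  have "has_bochner_integral lborel (\<lambda>y::real^'d. sqrt (a / pi) ^ CARD('d) * exp (- a * (norm y)\<^sup>2 + 0 \<bullet> y))
    (sqrt (a / pi) ^ CARD('d) * (sqrt (pi / a) ^ CARD('d) * exp ((norm (0::real^'d))\<^sup>2 / (4 * a))))"
    by (intro has_bochner_integral_mult_right gaussian_integral_vec assms)
  then have "has_bochner_integral lborel (gauss_dens a :: real^'d \<Rightarrow> real) 1"
    using assms by (simp add: gauss_dens_def[abs_def] power_mult_distrib[symmetric] real_sqrt_mult[symmetric])
  then show "emeasure (gauss a :: (real^'d) measure) (space (gauss a)) = 1"
    using assms by (simp add: gauss_def emeasure_density has_bochner_integral_iff nn_integral_eq_integral)
qed

lemma has_bochner_integral_gauss_prod:
  fixes F :: "'d::finite \<Rightarrow> real \<Rightarrow> real"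
  assumes a: "a > 0" and int: "\<And>i. has_bochner_integral lborel (\<lambda>t. sqrt (a / pi) * exp (- a * t\<^sup>2) * F i t) (v i)"
    and [measurable]: "\<And>i. F i \<in> borel_measurable borel"
  shows "has_bochner_integral (gauss a) (\<lambda>x::real^'d. \<Prod>i\<in>UNIV. F i (x $ i)) (\<Prod>i\<in>UNIV. v i)"
proof -
  have "has_bochner_integral lborel (\<lambda>x::real^'d. \<Prod>i\<in>UNIV. sqrt (a / pi) * exp (- a * (x $ i)\<^sup>2) * F i (x $ i))
      (\<Prod>i\<in>UNIV. \<integral>t. sqrt (a / pi) * exp (- a * t\<^sup>2) * F i t \<partial>lborel)"
    by (intro has_bochner_integral_lborel_prod) (use int in \<open>auto simp: has_bochner_integral_iff\<close>)
  moreover have "(\<Prod>i\<in>UNIV. sqrt (a / pi) * exp (- a * (x $ i)\<^sup>2) * F i (x $ i))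
     = gauss_dens a x * (\<Prod>i\<in>UNIV. F i (x $ i))" for x :: "real^'d"
    by (simp add: gauss_dens_def prod.distrib norm_vec_sq exp_sum[symmetric] sum_distrib_left sum_negf)
  moreover have "(\<Prod>i\<in>UNIV. \<integral>t. sqrt (a / pi) * exp (- a * t\<^sup>2) * F i t \<partial>lborel) = (\<Prod>i\<in>UNIV. v i)"
    using int by (simp add: has_bochner_integral_iff)
  ultimately show ?thesis using a by (subst has_bochner_integral_gauss) auto
qed

section \<open>Functions of polynomial growth\<close>

text \<open>A class containing \<open>poly_growth\<close> that asks for Borel measurability only: it
  is closed under products, positive parts and the semigroup, and no continuity has to be carried
  along.\<close>

definition poly_bdd :: "(real^'d::finite \<Rightarrow> real) \<Rightarrow> bool" where
  "poly_bdd f \<longleftrightarrow> f \<in> borel_measurable borel \<and> (\<exists>C m. \<forall>x. \<bar>f x\<bar> \<le> C * (1 + (norm x) ^ m))"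

lemma poly_bdd_measurable [measurable_dest]: "poly_bdd f \<Longrightarrow> f \<in> borel_measurable borel"
  by (simp add: poly_bdd_def)

lemma power_le_one_plus_power:
  fixes z :: real
  assumes "0 \<le> z" "m \<le> k"
  shows "z ^ m \<le> 1 + z ^ k"
proof (cases "z \<le> 1")
  case True
  then have "z ^ m \<le> 1" using assms by (simp add: power_le_one)
  then show ?thesis using assms by (smt (verit) zero_le_power)
next
  case False
  then have "z ^ m \<le> z ^ k" using assms by (intro power_increasing) auto
  then show ?thesis by simp
qed

lemma poly_bddE:
  assumes "poly_bdd f"
  obtains C m where "C \<ge> 0" "\<And>x. \<bar>f x\<bar> \<le> C * (1 + (norm x) ^ m)"
proof -
  obtain C m where C: "\<And>x. \<bar>f x\<bar> \<le> C * (1 + (norm x) ^ m)"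
    using assms by (auto simp: poly_bdd_def)
  have "C * (1 + (norm x) ^ m) \<le> \<bar>C\<bar> * (1 + (norm x) ^ m)" for x :: "real^'a"
    by (intro mult_right_mono) auto
  then show thesis using C by (intro that[of "\<bar>C\<bar>" m]) (auto intro: order_trans)
qed

lemma poly_bddI:
  "f \<in> borel_measurable borel \<Longrightarrow> (\<And>x. \<bar>f x\<bar> \<le> C * (1 + (norm x) ^ m)) \<Longrightarrow> poly_bdd f"
  by (auto simp: poly_bdd_def)

lemma poly_bdd_mono:
  "poly_bdd g \<Longrightarrow> f \<in> borel_measurable borel \<Longrightarrow> (\<And>x. \<bar>f x\<bar> \<le> \<bar>g x\<bar>) \<Longrightarrow> poly_bdd f"
  unfolding poly_bdd_def by (meson order_trans)

lemma poly_bdd_const: "poly_bdd (\<lambda>_. c)"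
  by (rule poly_bddI[of _ "\<bar>c\<bar>" 0]) auto

lemma poly_bdd_component: "poly_bdd (\<lambda>x. x $ i)"
proof (rule poly_bddI[of _ 1 1])
  show "\<bar>x $ i\<bar> \<le> 1 * (1 + norm x ^ 1)" for x :: "real^'a"
    using component_le_norm_cart[of x i] by simp
qed measurable

lemma poly_bdd_norm: "poly_bdd norm"
  by (rule poly_bddI[of _ 1 1]) auto

lemma poly_bdd_add:
  assumes "poly_bdd f" "poly_bdd g" shows "poly_bdd (\<lambda>x. f x + g x)"
proof -
  note [measurable] = assms[THEN poly_bdd_measurable]
  obtain C m where C: "C \<ge> 0" "\<And>x. \<bar>f x\<bar> \<le> C * (1 + (norm x) ^ m)"
    using poly_bddE[OF assms(1)] by metis
  obtain D k where D: "D \<ge> 0" "\<And>x. \<bar>g x\<bar> \<le> D * (1 + (norm x) ^ k)"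
    using poly_bddE[OF assms(2)] by metis
  show ?thesis
  proof (rule poly_bddI)
    fix x :: "real^'a"
    have "\<bar>f x + g x\<bar> \<le> C * (1 + (norm x) ^ m) + D * (1 + (norm x) ^ k)"
      using C(2)[of x] D(2)[of x] by linarith
    also have "\<dots> \<le> C * (2 * (1 + norm x ^ (m + k))) + D * (2 * (1 + norm x ^ (m + k)))"
    proof (intro add_mono mult_left_mono C D)
      have z: "0 \<le> norm x ^ (m + k)" by simp
      show "1 + norm x ^ m \<le> 2 * (1 + norm x ^ (m + k))"
        using power_le_one_plus_power[of "norm x" m "m + k"] z by (simp add: distrib_left del: zero_le_power)
      show "1 + norm x ^ k \<le> 2 * (1 + norm x ^ (m + k))"
        using power_le_one_plus_power[of "norm x" k "m + k"] z by (simp add: distrib_left del: zero_le_power)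
    qed
    finally show "\<bar>f x + g x\<bar> \<le> (2 * (C + D)) * (1 + norm x ^ (m + k))"
      by (simp add: algebra_simps)
  qed measurable
qed

lemma poly_bdd_mult:
  assumes "poly_bdd f" "poly_bdd g" shows "poly_bdd (\<lambda>x. f x * g x)"
proof -
  note [measurable] = assms[THEN poly_bdd_measurable]
  obtain C m where C: "C \<ge> 0" "\<And>x. \<bar>f x\<bar> \<le> C * (1 + (norm x) ^ m)"
    using poly_bddE[OF assms(1)] by metis
  obtain D k where D: "D \<ge> 0" "\<And>x. \<bar>g x\<bar> \<le> D * (1 + (norm x) ^ k)"
    using poly_bddE[OF assms(2)] by metis
  show ?thesis
  proof (rule poly_bddI)
    fix x :: "real^'a"
    have "\<bar>f x * g x\<bar> \<le> (C * (1 + (norm x) ^ m)) * (D * (1 + (norm x) ^ k))"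
      unfolding abs_mult using C D by (intro mult_mono) auto
    also have "\<dots> = C * D * (1 + norm x ^ m + norm x ^ k + norm x ^ (m + k))"
      by (simp add: algebra_simps power_add)
    also have "\<dots> \<le> C * D * (3 * (1 + norm x ^ (m + k)))"
      using power_le_one_plus_power[of "norm x" m "m + k"] power_le_one_plus_power[of "norm x" k "m + k"]
      by (intro mult_left_mono) (auto simp: C D)
    finally show "\<bar>f x * g x\<bar> \<le> (3 * (C * D)) * (1 + norm x ^ (m + k))"
      by (simp add: algebra_simps)
  qed measurable
qed

lemma poly_bdd_cmult: "poly_bdd f \<Longrightarrow> poly_bdd (\<lambda>x. c * f x)"
  by (intro poly_bdd_mult poly_bdd_const)

lemma poly_bdd_diff: "poly_bdd f \<Longrightarrow> poly_bdd g \<Longrightarrow> poly_bdd (\<lambda>x. f x - g x)"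
  using poly_bdd_add[OF _ poly_bdd_cmult[of g "-1"], of f] by simp

lemma poly_bdd_power: "poly_bdd f \<Longrightarrow> poly_bdd (\<lambda>x. f x ^ k)"
  by (induction k) (auto intro: poly_bdd_const poly_bdd_mult)

lemma poly_bdd_sum: "(\<And>i. i \<in> I \<Longrightarrow> poly_bdd (f i)) \<Longrightarrow> poly_bdd (\<lambda>x. \<Sum>i\<in>I. f i x)"
  by (induction I rule: infinite_finite_induct) (auto intro: poly_bdd_const poly_bdd_add)

lemma poly_bdd_prod: "(\<And>i. i \<in> I \<Longrightarrow> poly_bdd (f i)) \<Longrightarrow> poly_bdd (\<lambda>x. \<Prod>i\<in>I. f i x)"
  by (induction I rule: infinite_finite_induct) (auto intro: poly_bdd_const poly_bdd_mult)

lemma poly_bdd_abs: "poly_bdd f \<Longrightarrow> poly_bdd (\<lambda>x. \<bar>f x\<bar>)"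
  by (rule poly_bdd_mono) (auto dest: poly_bdd_measurable)

text \<open>A single term of the exponential series is at most the whole sum.\<close>

lemma power_le_fact_exp:
  fixes z :: real assumes "z \<ge> 0" shows "z ^ m \<le> fact m * exp z"
proof -
  have "z ^ m / fact m \<le> exp z"
  proof -
    have "(\<Sum>k\<in>{m}. z ^ k / fact k) \<le> (\<Sum>k. z ^ k / fact k)"
      using assms summable_exp[of z] by (intro sum_le_suminf) (auto simp: divide_inverse mult.commute)
    then show ?thesis by (simp add: exp_def divide_inverse mult.commute)
  qed
  then show ?thesis by (simp add: field_simps)
qed

text \<open>Half of the Gaussian exponent absorbs the polynomial, by
  \<open>power_le_fact_exp\<close>; the other half is integrable.\<close>

lemma poly_bdd_integrable_gauss:
  fixes f :: "real^'d::finite \<Rightarrow> real"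
  assumes a: "a > 0" and f: "poly_bdd f"
  shows "integrable (gauss a) f"
proof -
  note [measurable] = f[THEN poly_bdd_measurable]
  obtain C m where C: "C \<ge> 0" "\<And>x. \<bar>f x\<bar> \<le> C * (1 + (norm x) ^ m)"
    using poly_bddE[OF f] by metis
  define D where "D = sqrt (a / pi) ^ CARD('d) * (C * (2 + (2 / a) ^ m * fact m))"
  have D: "gauss_dens a x * \<bar>f x\<bar> \<le> D * exp (- (a / 2) * (norm x)\<^sup>2 + 0 \<bullet> x)" for x :: "real^'d"
  proof -
    have "(norm x) ^ m \<le> 1 + ((norm x)\<^sup>2) ^ m"
      using power_le_one_plus_power[of "norm x" m "2 * m"] by (simp add: power_mult)
    also have "((norm x)\<^sup>2) ^ m = (2 / a) ^ m * ((a / 2) * (norm x)\<^sup>2) ^ m"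
      using a by (simp add: power_mult_distrib[symmetric])
    also have "\<dots> \<le> (2 / a) ^ m * (fact m * exp ((a / 2) * (norm x)\<^sup>2))"
      using a by (intro mult_left_mono power_le_fact_exp) auto
    finally have "(norm x) ^ m \<le> 1 + (2 / a) ^ m * fact m * exp ((a / 2) * (norm x)\<^sup>2)"
      by (simp add: algebra_simps)
    moreover have "1 \<le> exp ((a / 2) * (norm x)\<^sup>2)" using a by (intro one_le_exp_iff[THEN iffD2]) simp
    ultimately have "1 + (norm x) ^ m \<le> (2 + (2 / a) ^ m * fact m) * exp ((a / 2) * (norm x)\<^sup>2)"
      unfolding distrib_right by linarith
    then have "\<bar>f x\<bar> \<le> C * ((2 + (2 / a) ^ m * fact m) * exp ((a / 2) * (norm x)\<^sup>2))"
      using C by (meson mult_left_mono order_trans)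
    then have "gauss_dens a x * \<bar>f x\<bar> \<le> gauss_dens a x * (C * ((2 + (2 / a) ^ m * fact m) * exp ((a / 2) * (norm x)\<^sup>2)))"
      using a by (intro mult_left_mono) auto
    also have "\<dots> = D * (exp (- a * (norm x)\<^sup>2) * exp ((a / 2) * (norm x)\<^sup>2))"
      by (simp add: D_def gauss_dens_def)
    also have "\<dots> = D * exp (- (a / 2) * (norm x)\<^sup>2 + 0 \<bullet> x)"
      by (simp add: exp_add[symmetric] algebra_simps)
    finally show ?thesis .
  qed
  have "integrable lborel (\<lambda>x::real^'d. gauss_dens a x * f x)"
  proof (rule Bochner_Integration.integrable_bound)
    show "integrable lborel (\<lambda>x::real^'d. D * exp (- (a / 2) * (norm x)\<^sup>2 + 0 \<bullet> x))"
      using gaussian_integral_vec[of "a / 2" "0::real^'d"] a by (auto simp: has_bochner_integral_iff)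
    show "AE x in lborel. norm (gauss_dens a x * f x) \<le> norm (D * exp (- (a / 2) * (norm x)\<^sup>2 + 0 \<bullet> x))"
      using D a by (intro AE_I2) (auto simp: abs_mult intro: order_trans[OF D order_trans[OF abs_ge_self]])
  qed measurable
  then show ?thesis
    using has_bochner_integral_gauss[OF a, of f "\<integral>x. gauss_dens a x * f x \<partial>lborel"]
    by (auto simp: has_bochner_integral_iff)
qed

lemma poly_growth_imp_poly_bdd:
  assumes "f \<in> poly_growth" shows "poly_bdd f"
proof -
  obtain k where cont: "continuous_on UNIV f" and k: "((\<lambda>x. \<bar>f x\<bar> / norm x ^ k) \<longlongrightarrow> 0) at_infinity"
    using assms by (auto simp: poly_growth_def)
  have "\<forall>\<^sub>F x in at_infinity. \<bar>f x\<bar> / norm x ^ k < 1"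
    using k by (rule order_tendstoD) simp
  then obtain R where R: "\<And>x. R \<le> norm x \<Longrightarrow> \<bar>f x\<bar> / norm x ^ k < 1"
    by (auto simp: eventually_at_infinity)
  \<comment> \<open>A radius of at least 1 keeps the complement away from the origin, so that the
    division by \<open>norm x ^ k\<close> can be undone there.\<close>
  have "bounded (f ` cball 0 (max R 1))"
    by (intro compact_imp_bounded compact_continuous_image continuous_on_subset[OF cont]) auto
  then obtain C where C: "\<And>x. norm x \<le> max R 1 \<Longrightarrow> \<bar>f x\<bar> \<le> C"
    unfolding bounded_iff by (metis imageI mem_cball_0 real_norm_def)
  show ?thesis
  proof (rule poly_bddI)
    show "f \<in> borel_measurable borel" using cont by (rule borel_measurable_continuous_onI)
    fix x :: "real^'a"
    show "\<bar>f x\<bar> \<le> (1 + \<bar>C\<bar>) * (1 + (norm x) ^ k)"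
    proof (cases "norm x \<le> max R 1")
      case True
      have "\<bar>f x\<bar> \<le> (1 + \<bar>C\<bar>) * 1" using C[OF True] by simp
      also have "\<dots> \<le> (1 + \<bar>C\<bar>) * (1 + (norm x) ^ k)" by (intro mult_left_mono) auto
      finally show ?thesis .
    next
      case False
      then have n: "norm x > 0" by (auto intro: less_le_trans[of 0 1])
      have "\<bar>f x\<bar> \<le> 1 * norm x ^ k" using R[of x] False n by (cases "R \<le> norm x") (auto simp: divide_simps)
      also have "\<dots> \<le> (1 + \<bar>C\<bar>) * (1 + (norm x) ^ k)" by (intro mult_mono) auto
      finally show ?thesis .
    qed
  qed
qed

section \<open>The Mehler kernel\<close>

text \<open>The integral of \<open>(f - l g)\<^sup>2\<close> is a nonnegative quadratic polynomial
  in l, and its discriminant gives the bound.\<close>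

lemma integral_Cauchy_Schwarz:
  fixes f g :: "'a \<Rightarrow> real"
  assumes [measurable]: "f \<in> borel_measurable M" "g \<in> borel_measurable M"
    and f2: "integrable M (\<lambda>x. (f x)\<^sup>2)" and g2: "integrable M (\<lambda>x. (g x)\<^sup>2)"
  shows "integrable M (\<lambda>x. f x * g x)"
    and "(\<integral>x. f x * g x \<partial>M)\<^sup>2 \<le> (\<integral>x. (f x)\<^sup>2 \<partial>M) * (\<integral>x. (g x)\<^sup>2 \<partial>M)"
proof -
  show fg: "integrable M (\<lambda>x. f x * g x)"
  proof (rule Bochner_Integration.integrable_bound)
    show "integrable M (\<lambda>x. (f x)\<^sup>2 + (g x)\<^sup>2)" using f2 g2 by simp
    have "\<bar>u * v\<bar> \<le> u\<^sup>2 + v\<^sup>2" for u v :: real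
    proof -
      have "0 \<le> (\<bar>u\<bar> - \<bar>v\<bar>)\<^sup>2" by simp
      also have "\<dots> = u\<^sup>2 + v\<^sup>2 - 2 * \<bar>u * v\<bar>" by (simp add: power2_diff abs_mult)
      finally show ?thesis by linarith
    qed
    then show "AE x in M. norm (f x * g x) \<le> norm ((f x)\<^sup>2 + (g x)\<^sup>2)"
      by (intro AE_I2) simp
  qed measurable
  define A where "A = (\<integral>x. (f x)\<^sup>2 \<partial>M)"
  define B where "B = (\<integral>x. f x * g x \<partial>M)"
  define C where "C = (\<integral>x. (g x)\<^sup>2 \<partial>M)"
  have quad: "0 \<le> A - 2 * l * B + l\<^sup>2 * C" for l
  proof -
    have "0 \<le> (\<integral>x. (f x - l * g x)\<^sup>2 \<partial>M)" by simp
    also have "\<dots> = (\<integral>x. (f x)\<^sup>2 - 2 * l * (f x * g x) + l\<^sup>2 * (g x)\<^sup>2 \<partial>M)"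
      by (intro Bochner_Integration.integral_cong) (auto simp: power2_diff power_mult_distrib)
    also have "\<dots> = A - 2 * l * B + l\<^sup>2 * C"
      using f2 g2 fg by (simp add: A_def B_def C_def)
    finally show ?thesis .
  qed
  have C0: "0 \<le> C" by (simp add: C_def)
  have "B\<^sup>2 \<le> A * C"
  proof (cases "C = 0")
    case True
    have "B = 0"
    proof (rule ccontr)
      assume "B \<noteq> 0"
      \<comment> \<open>If C = 0 the polynomial is affine in l; a nonzero slope would make it equal
        to -1 at this value of l.\<close>
      then have "A - 2 * ((A + 1) / (2 * B)) * B = -1" by (simp add: field_simps)
      then show False using quad[of "(A + 1) / (2 * B)"] True by simp
    qed
    then show ?thesis using True by simp
  next
    case False
    with C0 have "C > 0" by simp
    have "A - 2 * (B / C) * B + (B / C)\<^sup>2 * C = A - B\<^sup>2 / C"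
      using False by (simp add: power2_eq_square field_simps)
    then have "B\<^sup>2 / C \<le> A" using quad[of "B / C"] by simp
    then show ?thesis using \<open>C > 0\<close> by (simp add: field_simps)
  qed
  then show "(\<integral>x. f x * g x \<partial>M)\<^sup>2 \<le> (\<integral>x. (f x)\<^sup>2 \<partial>M) * (\<integral>x. (g x)\<^sup>2 \<partial>M)"
    by (simp add: A_def B_def C_def)
qed

section \<open>The law at a fixed time as an affine image of a Gaussian, and its density\<close>

definition ou_map :: "real \<Rightarrow> real^'d::finite \<Rightarrow> real^'d \<Rightarrow> real^'d" where
  "ou_map w x y = w *\<^sub>R x + sqrt (1 - w\<^sup>2) *\<^sub>R y"

lemma ou_map_measurable [measurable]:
  assumes [measurable]: "f \<in> borel_measurable M" "g \<in> borel_measurable M" "h \<in> borel_measurable M"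
  shows "(\<lambda>x. ou_map (f x) (g x) (h x)) \<in> borel_measurable M"
  unfolding ou_map_def by measurable

lemma norm_ou_map_le:
  assumes "0 \<le> w" "w \<le> 1"
  shows "norm (ou_map w x y) \<le> norm x + norm y"
proof -
  have "norm (ou_map w x y) \<le> w * norm x + sqrt (1 - w\<^sup>2) * norm y"
    unfolding ou_map_def using assms by (intro order_trans[OF norm_triangle_ineq]) (simp add: power_le_one)
  also have "\<dots> \<le> 1 * norm x + 1 * norm y"
    using assms by (intro add_mono mult_right_mono) auto
  finally show ?thesis by simp
qed

text \<open>The law at time \<open>t\<close> of the Ornstein--Uhlenbeck process started from \<open>x\<close>, where
  \<open>w = exp (- b t)\<close> and \<open>a = b / \<sigma>\<^sup>2\<close>.\<close>

definition ou_law :: "real \<Rightarrow> real \<Rightarrow> real^'d::finite \<Rightarrow> (real^'d) measure" where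
  "ou_law a w x = distr (gauss a) borel (ou_map w x)"

lemma sets_ou_law [simp, measurable_cong]: "sets (ou_law a w x) = sets borel"
  by (simp add: ou_law_def)

lemma space_ou_law [simp]: "space (ou_law a w x) = UNIV"
  by (simp add: ou_law_def)

lemma prob_space_ou_law: "a > 0 \<Longrightarrow> prob_space (ou_law a w x)"
  unfolding ou_law_def by (intro prob_space.prob_space_distr prob_space_gauss) measurable

lemma integral_ou_law:
  fixes f :: "real^'d::finite \<Rightarrow> real"
  shows "f \<in> borel_measurable borel \<Longrightarrow> (\<integral>z. f z \<partial>ou_law a w x) = (\<integral>y. f (ou_map w x y) \<partial>gauss a)"
  unfolding ou_law_def by (subst integral_distr) auto

lemma integrable_ou_law:
  fixes f :: "real^'d::finite \<Rightarrow> real"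
  shows "f \<in> borel_measurable borel \<Longrightarrow> integrable (ou_law a w x) f \<longleftrightarrow> integrable (gauss a) (\<lambda>y. f (ou_map w x y))"
  unfolding ou_law_def by (subst integrable_distr_eq) auto

lemma ou_law_1: "a > 0 \<Longrightarrow> ou_law a 1 x = return borel x"
  unfolding ou_law_def ou_map_def
  by (auto intro!: measure_eqI simp: emeasure_distr prob_space.emeasure_space_1[OF prob_space_gauss, simplified]
      split: split_indicator)

text \<open>Mehler's kernel: the density of \<open>ou_law a w x\<close> with respect to the
  invariant measure \<open>gauss a\<close>, not Lebesgue measure, for \<open>0 \<le> w < 1\<close>.
  In this form it is symmetric in x and y.\<close>

definition mker :: "real \<Rightarrow> real \<Rightarrow> real^'d::finite \<Rightarrow> real^'d \<Rightarrow> real" where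
  "mker a w x y = (1 / sqrt (1 - w\<^sup>2)) ^ CARD('d) *
     exp (- a * (w\<^sup>2 * (norm x)\<^sup>2 + w\<^sup>2 * (norm y)\<^sup>2 - 2 * w * (x \<bullet> y)) / (1 - w\<^sup>2))"

lemma mker_measurable [measurable]:
  assumes [measurable]: "f \<in> borel_measurable M" "g \<in> borel_measurable M"
  shows "(\<lambda>x. mker a w (f x) (g x)) \<in> borel_measurable M"
  unfolding mker_def by measurable

lemma norm_scaled_diff: "(norm (x - c *\<^sub>R (y :: real^'d::finite)))\<^sup>2 = (norm x)\<^sup>2 + c\<^sup>2 * (norm y)\<^sup>2 - 2 * c * (x \<bullet> y)"
  unfolding power2_norm_eq_inner
  by (simp add: inner_diff_left inner_diff_right inner_commute power2_eq_square algebra_simps)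

lemma one_minus_sq_pos: "0 \<le> w \<Longrightarrow> w < 1 \<Longrightarrow> 0 < 1 - (w::real)\<^sup>2"
  by (simp add: power_less_one_iff abs_square_less_1)

lemma mker_nonneg: "0 \<le> w \<Longrightarrow> w \<le> 1 \<Longrightarrow> 0 \<le> mker a w x y"
  by (simp add: mker_def power_le_one)

text \<open>Passing to a density with respect to Lebesgue measure completes the square in the
  exponent around \<open>w *\<^sub>R x\<close>.\<close>

lemma mker_gauss_dens:
  fixes x z :: "real^'d::finite"
  assumes w: "0 \<le> w" "w < 1"
  shows "mker a w x z * gauss_dens a z =
    (sqrt (a / pi) / sqrt (1 - w\<^sup>2)) ^ CARD('d) * exp (- a * (norm (z - w *\<^sub>R x))\<^sup>2 / (1 - w\<^sup>2))"
proof -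
  note s = one_minus_sq_pos[OF w]
  have "- a * (w\<^sup>2 * (norm x)\<^sup>2 + w\<^sup>2 * (norm z)\<^sup>2 - 2 * w * (x \<bullet> z)) / (1 - w\<^sup>2) + - a * (norm z)\<^sup>2
     = - a * (norm (z - w *\<^sub>R x))\<^sup>2 / (1 - w\<^sup>2)"
    using s unfolding norm_scaled_diff by (simp add: divide_simps inner_commute) (simp add: algebra_simps)
  then show ?thesis
    unfolding mker_def gauss_dens_def
    by (simp add: power_divide exp_add[symmetric] mult_ac)
qed

text \<open>Affine change of variables for Lebesgue measure; \<open>\<bar>c\<bar> ^ CARD('d)\<close>
  is the Jacobian.\<close>

lemma gauss_affine:
  fixes y :: "real^'d::finite"
  assumes a: "a > 0" and c: "c > 0"
  shows "distr (gauss a) borel (\<lambda>z. y + c *\<^sub>R z) =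
    density lborel (\<lambda>z. ennreal ((sqrt (a / pi) / c) ^ CARD('d) * exp (- a * (norm (z - y))\<^sup>2 / c\<^sup>2)))"
    (is "?D = density lborel ?d")
proof (rule measure_eqI)
  fix A :: "(real^'d) set" assume "A \<in> sets ?D"
  then have [measurable]: "A \<in> sets borel" by simp
  have d: "?d (y + c *\<^sub>R z) * ennreal (\<bar>c\<bar> ^ CARD('d)) = ennreal (gauss_dens a z)" for z
    using c a by (subst ennreal_mult[symmetric])
      (auto simp: gauss_dens_def power_mult_distrib power_divide intro!: arg_cong[where f=ennreal])
  have "emeasure (density lborel ?d) A = (\<integral>\<^sup>+z. ?d z * indicator A z \<partial>lborel)"
    by (rule emeasure_density) auto
  also have "\<dots> = (\<integral>\<^sup>+z. ?d (y + c *\<^sub>R z) * indicator A (y + c *\<^sub>R z) * ennreal (\<bar>c\<bar> ^ CARD('d)) \<partial>lborel)"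
    using c by (subst lborel_affine[of c y], simp)
      (subst nn_integral_density, simp, measurable, subst nn_integral_distr, simp_all add: mult_ac ennreal_power)
  also have "\<dots> = (\<integral>\<^sup>+z. (?d (y + c *\<^sub>R z) * ennreal (\<bar>c\<bar> ^ CARD('d))) * indicator A (y + c *\<^sub>R z) \<partial>lborel)"
    by (simp add: mult_ac)
  also have "\<dots> = (\<integral>\<^sup>+z. indicator A (y + c *\<^sub>R z) \<partial>gauss a)"
    unfolding gauss_def d by (subst nn_integral_density) auto
  also have "\<dots> = emeasure ?D A"
    by (subst nn_integral_distr[where M = "gauss a" and T = "\<lambda>z. y + c *\<^sub>R z" and M' = borel and f = "indicator A", symmetric]) auto
  finally show "emeasure ?D A = emeasure (density lborel ?d) A" by simp
qed simp

lemma ou_law_density_lborel: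
  fixes x :: "real^'d::finite"
  assumes a: "a > 0" and w: "0 \<le> w" "w < 1"
  shows "ou_law a w x = density lborel (\<lambda>z. ennreal ((sqrt (a / pi) / sqrt (1 - w\<^sup>2)) ^ CARD('d) *
     exp (- a * (norm (z - w *\<^sub>R x))\<^sup>2 / (1 - w\<^sup>2))))"
  using gauss_affine[OF a, of "sqrt (1 - w\<^sup>2)" "w *\<^sub>R x"] one_minus_sq_pos[OF w]
  by (simp add: ou_law_def ou_map_def[abs_def])

lemma ou_law_density:
  fixes x :: "real^'d::finite"
  assumes a: "a > 0" and w: "0 \<le> w" "w < 1"
  shows "ou_law a w x = density (gauss a) (\<lambda>z. ennreal (mker a w x z))"
proof -
  have "density (gauss a) (\<lambda>z. ennreal (mker a w x z)) = density lborel (\<lambda>z. ennreal (gauss_dens a z) * ennreal (mker a w x z))"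
    unfolding gauss_def by (rule density_density_eq) auto
  also have "(\<lambda>z. ennreal (gauss_dens a z) * ennreal (mker a w x z)) = (\<lambda>z. ennreal (mker a w x z * gauss_dens a z))"
    using w a by (auto simp: ennreal_mult[symmetric] mker_nonneg mult.commute)
  finally show ?thesis
    unfolding ou_law_density_lborel[OF a w] mker_gauss_dens[OF w] by simp
qed

text \<open>Expanding \<open>|x - w y|\<^sup>2 \<ge> 0\<close> bounds the exponent by
  \<open>a |x|\<^sup>2\<close>, uniformly in y. This later turns an L2 estimate under the invariant
  law into an estimate for a fixed starting point.\<close>

lemma mker_le:
  fixes x y :: "real^'d::finite"
  assumes a: "a > 0" and w: "0 \<le> w" "w < 1"
  shows "mker a w x y \<le> (1 / sqrt (1 - w\<^sup>2)) ^ CARD('d) * exp (a * (norm x)\<^sup>2)"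
proof -
  note s = one_minus_sq_pos[OF w]
  have "0 \<le> (norm (x - w *\<^sub>R y))\<^sup>2" by simp
  then have "- (w\<^sup>2 * (norm x)\<^sup>2 + w\<^sup>2 * (norm y)\<^sup>2 - 2 * w * (x \<bullet> y)) \<le> (norm x)\<^sup>2 * (1 - w\<^sup>2)"
    unfolding norm_scaled_diff by (simp add: algebra_simps)
  then have "a * - (w\<^sup>2 * (norm x)\<^sup>2 + w\<^sup>2 * (norm y)\<^sup>2 - 2 * w * (x \<bullet> y)) \<le> a * ((norm x)\<^sup>2 * (1 - w\<^sup>2))"
    using a by (intro mult_left_mono) auto
  then have "- a * (w\<^sup>2 * (norm x)\<^sup>2 + w\<^sup>2 * (norm y)\<^sup>2 - 2 * w * (x \<bullet> y)) / (1 - w\<^sup>2) \<le> a * (norm x)\<^sup>2"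
    by (subst pos_divide_le_eq[OF s]) (simp add: algebra_simps)
  then show ?thesis
    unfolding mker_def using s by (intro mult_left_mono) auto
qed

text \<open>For w away from 1 the transition law is dominated by a multiple of the invariant
  law.\<close>

lemma nn_integral_ou_law_le:
  fixes x :: "real^'d::finite"
  assumes a: "a > 0" and w: "0 \<le> w" "w < 1" and [measurable]: "f \<in> borel_measurable borel"
  shows "(\<integral>\<^sup>+z. f z \<partial>ou_law a w x) \<le> ennreal ((1 / sqrt (1 - w\<^sup>2)) ^ CARD('d) * exp (a * (norm x)\<^sup>2)) * (\<integral>\<^sup>+z. f z \<partial>gauss a)"
proof -
  have "(\<integral>\<^sup>+z. f z \<partial>ou_law a w x) = (\<integral>\<^sup>+z. ennreal (mker a w x z) * f z \<partial>gauss a)"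
    unfolding ou_law_density[OF a w] by (rule nn_integral_density) auto
  also have "\<dots> \<le> (\<integral>\<^sup>+z. ennreal ((1 / sqrt (1 - w\<^sup>2)) ^ CARD('d) * exp (a * (norm x)\<^sup>2)) * f z \<partial>gauss a)"
    using mker_le[OF a w] by (intro nn_integral_mono mult_right_mono ennreal_leI) auto
  finally show ?thesis by (simp add: nn_integral_cmult)
qed

lemma integral_ou_law_mker:
  fixes f :: "real^'d::finite \<Rightarrow> real"
  assumes a: "a > 0" and w: "0 \<le> w" "w < 1" and [measurable]: "f \<in> borel_measurable borel"
  shows "(\<integral>z. f z \<partial>ou_law a w x) = (\<integral>z. mker a w x z * f z \<partial>gauss a)"
    and "integrable (ou_law a w x) f \<longleftrightarrow> integrable (gauss a) (\<lambda>z. mker a w x z * f z)"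
  unfolding ou_law_density[OF a w] using w
  by (auto simp: integral_real_density integrable_real_density mker_nonneg)

lemma poly_bdd_ou_map:
  assumes "poly_bdd f" "0 \<le> w" "w \<le> 1"
  shows "poly_bdd (\<lambda>y. f (ou_map w x y))"
proof -
  note [measurable] = assms(1)[THEN poly_bdd_measurable]
  obtain C m where C: "C \<ge> 0" "\<And>x. \<bar>f x\<bar> \<le> C * (1 + (norm x) ^ m)"
    using poly_bddE[OF assms(1)] by metis
  have "poly_bdd (\<lambda>y::real^'a. C * (1 + (norm x + norm y) ^ m))"
    by (intro poly_bdd_mult poly_bdd_add poly_bdd_power poly_bdd_const poly_bdd_norm)
  then show ?thesis
  proof (rule poly_bdd_mono)
    fix y
    have "\<bar>f (ou_map w x y)\<bar> \<le> C * (1 + (norm (ou_map w x y)) ^ m)" by (rule C)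
    also have "\<dots> \<le> C * (1 + (norm x + norm y) ^ m)"
      using norm_ou_map_le[OF assms(2,3)] by (intro mult_left_mono add_mono power_mono C) auto
    finally show "\<bar>f (ou_map w x y)\<bar> \<le> \<bar>C * (1 + (norm x + norm y) ^ m)\<bar>" by simp
  qed measurable
qed

lemma poly_bdd_integrable_ou_law:
  "a > 0 \<Longrightarrow> poly_bdd f \<Longrightarrow> 0 \<le> w \<Longrightarrow> w \<le> 1 \<Longrightarrow> integrable (ou_law a w x) f"
  by (subst integrable_ou_law) (auto intro: poly_bdd_integrable_gauss poly_bdd_ou_map dest: poly_bdd_measurable)

text \<open>The constants precede w and x because the bound in \<open>norm_ou_map_le\<close> does
  not involve w: polynomial bounds hold uniformly in time.\<close>

lemma ou_law_poly_bound:
  fixes f :: "real^'d::finite \<Rightarrow> real"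
  assumes a: "a > 0" and f: "poly_bdd f"
  obtains C m where "C \<ge> 0"
    "\<And>w x. 0 \<le> w \<Longrightarrow> w \<le> 1 \<Longrightarrow> (\<integral>z. \<bar>f z\<bar> \<partial>ou_law a w x) \<le> C * (1 + norm x ^ m)"
proof -
  note [measurable] = f[THEN poly_bdd_measurable]
  obtain C m where C: "C \<ge> 0" "\<And>x. \<bar>f x\<bar> \<le> C * (1 + (norm x) ^ m)"
    using poly_bddE[OF f] by metis
  define D where "D = (\<integral>y. C * 2 ^ m * (1 + norm y ^ m) \<partial>(gauss a :: (real^'d) measure))"
  have intD: "integrable (gauss a) (\<lambda>y::real^'d. C * 2 ^ m * (1 + norm y ^ m))"
    by (intro poly_bdd_integrable_gauss a poly_bdd_mult poly_bdd_add poly_bdd_power poly_bdd_const poly_bdd_norm)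
  have D0: "D \<ge> 0" unfolding D_def using C by (intro integral_nonneg_AE AE_I2) auto
  interpret prob_space "gauss a :: (real^'d) measure" by (rule prob_space_gauss[OF a])
  show thesis
  proof (rule that)
    show "D + C * 2 ^ m \<ge> 0" using C D0 by simp
    fix w :: real and x :: "real^'d" assume w: "0 \<le> w" "w \<le> 1"
    have bd: "\<bar>f (ou_map w x y)\<bar> \<le> C * 2 ^ m * (1 + norm y ^ m) + C * 2 ^ m * norm x ^ m" for y
    proof -
      have "norm (ou_map w x y) ^ m \<le> (2 * max (norm x) (norm y)) ^ m"
        using norm_ou_map_le[OF w, of x y] by (intro power_mono) auto
      also have "\<dots> \<le> 2 ^ m * (norm x ^ m + norm y ^ m)"
        by (auto simp: power_mult_distrib max_def)
      finally have "1 + norm (ou_map w x y) ^ m \<le> 2 ^ m * (1 + norm y ^ m) + 2 ^ m * norm x ^ m"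
        using one_le_power[of "2::real" m, OF one_le_numeral] unfolding distrib_left mult_1_right by linarith
      then have "C * (1 + norm (ou_map w x y) ^ m) \<le> C * (2 ^ m * (1 + norm y ^ m) + 2 ^ m * norm x ^ m)"
        using C by (intro mult_left_mono) auto
      then show ?thesis using C(2)[of "ou_map w x y"] by (simp add: algebra_simps)
    qed
    have "(\<integral>z. \<bar>f z\<bar> \<partial>ou_law a w x) = (\<integral>y. \<bar>f (ou_map w x y)\<bar> \<partial>gauss a)"
      by (rule integral_ou_law) measurable
    also have "\<dots> \<le> (\<integral>y. C * 2 ^ m * (1 + norm y ^ m) + C * 2 ^ m * norm x ^ m \<partial>(gauss a :: (real^'d) measure))"
    proof (rule Bochner_Integration.integral_mono)
      show "integrable (gauss a) (\<lambda>y. \<bar>f (ou_map w x y)\<bar>)"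
        by (intro poly_bdd_integrable_gauss[OF a] poly_bdd_abs poly_bdd_ou_map f w)
    qed (use intD bd in auto)
    also have "\<dots> = D + C * 2 ^ m * norm x ^ m"
      using intD by (simp add: D_def prob_space[simplified])
    also have "\<dots> \<le> (D + C * 2 ^ m) * (1 + norm x ^ m)"
      using C D0 by (simp add: algebra_simps)
    finally show "(\<integral>z. \<bar>f z\<bar> \<partial>ou_law a w x) \<le> (D + C * 2 ^ m) * (1 + norm x ^ m)" .
  qed
qed

text \<open>Measurability as a kernel, jointly in the time parameter and the starting point, is what
  permits the Tonelli arguments in time and space below.\<close>

lemma ou_law_measurable [measurable]:
  assumes [measurable]: "f \<in> borel_measurable M" "g \<in> borel_measurable M" and a: "a > 0"
  shows "(\<lambda>x. ou_law a (f x) (g x)) \<in> M \<rightarrow>\<^sub>M subprob_algebra borel"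
proof -
  interpret prob_space "gauss a" by (rule prob_space_gauss[OF a])
  have "(\<lambda>x. distr (gauss a) borel (ou_map (f x) (g x))) \<in> M \<rightarrow>\<^sub>M subprob_algebra borel"
  proof (rule measurable_distr2)
    show "(\<lambda>(x, y). ou_map (f x) (g x) y) \<in> M \<Otimes>\<^sub>M borel \<rightarrow>\<^sub>M borel" by measurable
    show "(\<lambda>x. gauss a) \<in> M \<rightarrow>\<^sub>M subprob_algebra borel"
      by (rule measurable_const) (auto simp: space_subprob_algebra intro: prob_space_imp_subprob_space prob_space_axioms)
  qed
  then show ?thesis by (simp add: ou_law_def)
qed

lemma poly_bdd_mehler:
  fixes f :: "real^'d::finite \<Rightarrow> real"
  assumes a: "a > 0" and f: "poly_bdd f" and w: "0 \<le> w" "w \<le> 1"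
  shows "poly_bdd (\<lambda>x. \<integral>z. f z \<partial>ou_law a w x)"
proof -
  note [measurable] = f[THEN poly_bdd_measurable] ou_law_measurable[OF _ _ a]
  obtain C m where C: "\<And>w x. 0 \<le> w \<Longrightarrow> w \<le> 1 \<Longrightarrow> (\<integral>z. \<bar>f z\<bar> \<partial>ou_law a w x) \<le> C * (1 + norm x ^ m)"
    using ou_law_poly_bound[OF a f] by metis
  show ?thesis
  proof (rule poly_bddI)
    show "(\<lambda>x. \<integral>z. f z \<partial>ou_law a w x) \<in> borel_measurable borel" by measurable
    show "\<bar>\<integral>z. f z \<partial>ou_law a w x\<bar> \<le> C * (1 + norm x ^ m)" for x
      using integral_abs_bound[of "ou_law a w x" f] C[OF w, of x] by linarith
  qed
qed

text \<open>A Gaussian integral whose value is \<open>mker a (w\<^sup>2) x x\<close>, as the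
  semigroup property predicts. In Hermite terms it is the sum over p of \<open>w ^ (2 |p|)\<close>
  times the squared eigenfunction at x.\<close>

lemma mker_sq_integral:
  fixes x :: "real^'d::finite"
  assumes a: "a > 0" and w: "0 \<le> w" "w < 1"
  shows "has_bochner_integral (gauss a) (\<lambda>y. (mker a w x y)\<^sup>2)
    ((1 / sqrt (1 - w ^ 4)) ^ CARD('d) * exp (2 * a * w\<^sup>2 * (norm x)\<^sup>2 / (1 + w\<^sup>2)))"
proof -
  note s = one_minus_sq_pos[OF w]
  \<comment> \<open>A and B collect the quadratic and the linear coefficient in y of the exponent of
    \<open>gauss_dens\<close> times the squared kernel; c is the factor free of y.\<close>
  define A where "A = a * (1 + w\<^sup>2) / (1 - w\<^sup>2)"
  define B where "B = (4 * a * w / (1 - w\<^sup>2)) *\<^sub>R x"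
  define c where "c = ((1 / sqrt (1 - w\<^sup>2)) ^ CARD('d))\<^sup>2 * sqrt (a / pi) ^ CARD('d) * exp (- (2 * a * w\<^sup>2 * (norm x)\<^sup>2 / (1 - w\<^sup>2)))"
  have A: "A > 0" using a s unfolding A_def by (intro divide_pos_pos mult_pos_pos) (auto simp: add_pos_nonneg)
  have f: "gauss_dens a y * (mker a w x y)\<^sup>2 = c * exp (- A * (norm y)\<^sup>2 + B \<bullet> y)" for y
  proof -
    have e: "2 * (- a * (w\<^sup>2 * (norm x)\<^sup>2 + w\<^sup>2 * (norm y)\<^sup>2 - 2 * w * (x \<bullet> y)) / (1 - w\<^sup>2)) + - a * (norm y)\<^sup>2
       = - (2 * a * w\<^sup>2 * (norm x)\<^sup>2 / (1 - w\<^sup>2)) + (- A * (norm y)\<^sup>2 + B \<bullet> y)"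
      using s unfolding A_def B_def by (simp add: divide_simps) (simp add: algebra_simps)
    have "gauss_dens a y * (mker a w x y)\<^sup>2 = ((1 / sqrt (1 - w\<^sup>2)) ^ CARD('d))\<^sup>2 * sqrt (a / pi) ^ CARD('d) *
       exp (2 * (- a * (w\<^sup>2 * (norm x)\<^sup>2 + w\<^sup>2 * (norm y)\<^sup>2 - 2 * w * (x \<bullet> y)) / (1 - w\<^sup>2)) + - a * (norm y)\<^sup>2)"
      unfolding gauss_dens_def mker_def power_mult_distrib exp_add exp_double by (simp add: mult_ac)
    then show ?thesis unfolding e exp_add c_def by (simp add: mult_ac)
  qed
  have w4: "1 - w ^ 4 = (1 - w\<^sup>2) * (1 + w\<^sup>2)" by (simp add: algebra_simps power2_eq_square power4_eq_xxxx)
  have p2: "1 + w\<^sup>2 > 0" by (simp add: add_pos_nonneg)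
  have v1: "(1 / sqrt (1 - w\<^sup>2))\<^sup>2 * (sqrt (a / pi) * sqrt (pi / A)) = 1 / sqrt (1 - w ^ 4)"
  proof -
    have 1: "sqrt (a / pi) * sqrt (pi / A) = sqrt (1 - w\<^sup>2) / sqrt (1 + w\<^sup>2)"
      using a s p2 by (simp add: real_sqrt_mult[symmetric] real_sqrt_divide[symmetric] A_def)
    have "(1 / p)\<^sup>2 * (p / q) = 1 / (p * q)" if "p > 0" "q > 0" for p q :: real
      using that by (simp add: field_simps power2_eq_square)
    then show ?thesis
      unfolding 1 w4 real_sqrt_mult using s p2 by simp
  qed
  have v2: "- (2 * a * w\<^sup>2 * (norm x)\<^sup>2 / (1 - w\<^sup>2)) + (norm B)\<^sup>2 / (4 * A) = 2 * a * w\<^sup>2 * (norm x)\<^sup>2 / (1 + w\<^sup>2)"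
  proof -
    have "(norm B)\<^sup>2 / (4 * A) = 4 * a * w\<^sup>2 * (norm x)\<^sup>2 / ((1 - w\<^sup>2) * (1 + w\<^sup>2))"
    proof -
      have gen: "(4 * a * w / u)\<^sup>2 * X / (4 * (a * v / u)) = 4 * a * w\<^sup>2 * X / (u * v)" if "u > 0" "v > 0" for u v X
        using that a by (simp add: field_simps power2_eq_square)
      have "(norm B)\<^sup>2 = (4 * a * w / (1 - w\<^sup>2))\<^sup>2 * (norm x)\<^sup>2"
        unfolding B_def norm_scaleR power_mult_distrib power2_abs ..
      then show ?thesis unfolding A_def using gen[OF s p2] by simp
    qed
    moreover have "- (2 * k / u) + 4 * k / (u * v) = 2 * k / v" if "u > 0" "v > 0" "v = 2 - u" for k u v :: real
      using that(1,2) unfolding that(3) by (simp add: field_simps)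
    note this[OF s p2, of "a * w\<^sup>2 * (norm x)\<^sup>2"]
    ultimately show ?thesis by (simp add: mult.assoc)
  qed
  have "c * (sqrt (pi / A) ^ CARD('d) * exp ((norm B)\<^sup>2 / (4 * A))) =
     ((1 / sqrt (1 - w\<^sup>2))\<^sup>2 * (sqrt (a / pi) * sqrt (pi / A))) ^ CARD('d) *
     exp (- (2 * a * w\<^sup>2 * (norm x)\<^sup>2 / (1 - w\<^sup>2)) + (norm B)\<^sup>2 / (4 * A))"
    unfolding c_def exp_add power_mult_distrib by (simp add: power_mult[symmetric] mult_ac)
  then have v: "c * (sqrt (pi / A) ^ CARD('d) * exp ((norm B)\<^sup>2 / (4 * A))) =
    (1 / sqrt (1 - w ^ 4)) ^ CARD('d) * exp (2 * a * w\<^sup>2 * (norm x)\<^sup>2 / (1 + w\<^sup>2))"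
    unfolding v1 v2 .
  show ?thesis
    using has_bochner_integral_mult_right[OF gaussian_integral_vec[OF A, of B], of c]
    by (subst has_bochner_integral_gauss[OF a]) (measurable, simp only: f v)
qed

text \<open>The squared Hilbert-Schmidt norm of the Mehler operator, that is, the sum of all squared
  eigenvalues \<open>w ^ (2 |p|)\<close>.\<close>

lemma mker_sq_double_integral:
  assumes a: "a > 0" and w: "0 \<le> w" "w < 1"
  shows "has_bochner_integral (gauss a :: (real^'d::finite) measure)
    (\<lambda>x. \<integral>y. (mker a w x y)\<^sup>2 \<partial>gauss a) ((1 / (1 - w\<^sup>2)) ^ CARD('d))"
proof -
  note s = one_minus_sq_pos[OF w]
  have p2: "1 + w\<^sup>2 > 0" by (simp add: add_pos_nonneg)
  have w4: "1 - w ^ 4 = (1 - w\<^sup>2) * (1 + w\<^sup>2)" by (simp add: algebra_simps power2_eq_square power4_eq_xxxx)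
  define A where "A = a * (1 - w\<^sup>2) / (1 + w\<^sup>2)"
  have A: "A > 0" using a s p2 by (simp add: A_def)
  define c where "c = sqrt (a / pi) ^ CARD('d) * (1 / sqrt (1 - w ^ 4)) ^ CARD('d)"
  have f: "gauss_dens a x * ((1 / sqrt (1 - w ^ 4)) ^ CARD('d) * exp (2 * a * w\<^sup>2 * (norm x)\<^sup>2 / (1 + w\<^sup>2))) =
    c * exp (- A * (norm x)\<^sup>2 + 0 \<bullet> x)" for x :: "real^'d"
  proof -
    have "- a * (norm x)\<^sup>2 + 2 * a * w\<^sup>2 * (norm x)\<^sup>2 / (1 + w\<^sup>2) = - A * (norm x)\<^sup>2 + 0 \<bullet> x"
      using p2 unfolding A_def by (simp add: divide_simps) (simp add: algebra_simps)
    then have "exp (- a * (norm x)\<^sup>2) * exp (2 * a * w\<^sup>2 * (norm x)\<^sup>2 / (1 + w\<^sup>2)) = exp (- A * (norm x)\<^sup>2 + 0 \<bullet> x)"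
      by (simp only: exp_add[symmetric])
    then show ?thesis unfolding gauss_dens_def c_def by (simp add: mult_ac)
  qed
  have "sqrt (a / pi) * (1 / sqrt (1 - w ^ 4)) * sqrt (pi / A) = 1 / (1 - w\<^sup>2)"
  proof -
    have 1: "sqrt (a / pi) * sqrt (pi / A) = sqrt (1 + w\<^sup>2) / sqrt (1 - w\<^sup>2)"
      using a s p2 by (simp add: real_sqrt_mult[symmetric] real_sqrt_divide[symmetric] A_def)
    have 2: "sqrt (a / pi) * (1 / sqrt (1 - w ^ 4)) * sqrt (pi / A) = sqrt (a / pi) * sqrt (pi / A) / sqrt (1 - w ^ 4)"
      by simp
    have "(q / p) / (p * q) = 1 / p\<^sup>2" if "p > 0" "q > 0" for p q :: real
      using that by (simp add: field_simps power2_eq_square)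
    then have "sqrt (1 + w\<^sup>2) / sqrt (1 - w\<^sup>2) / sqrt (1 - w ^ 4) = 1 / (1 - w\<^sup>2)"
      unfolding w4 real_sqrt_mult using s p2 by simp
    then show ?thesis by (simp only: 2 1)
  qed
  then have v: "c * (sqrt (pi / A) ^ CARD('d) * exp ((norm (0::real^'d))\<^sup>2 / (4 * A))) = (1 / (1 - w\<^sup>2)) ^ CARD('d)"
    unfolding c_def by (simp add: power_mult_distrib[symmetric])
  show ?thesis
    using has_bochner_integral_mult_right[OF gaussian_integral_vec[OF A, of "0::real^'d"], of c]
    unfolding has_bochner_integral_integral_eq[OF mker_sq_integral[OF a w]]
    by (subst has_bochner_integral_gauss[OF a]) (measurable, simp only: f v)
qed

section \<open>Hermite polynomials\<close>

text \<open>The physicists' Hermite polynomials. The recursion is what differentiating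
  \<open>(-1)^n H_n(t) exp (- t\<^sup>2)\<close> produces.\<close>

primrec hermite_poly :: "nat \<Rightarrow> real poly" where
  "hermite_poly 0 = 1"
| "hermite_poly (Suc n) = [:0, 2:] * hermite_poly n - pderiv (hermite_poly n)"

lemma pderiv_hermite_poly_Suc:
  "pderiv (hermite_poly (Suc n)) = smult (2 * real (Suc n)) (hermite_poly n)"
proof (induction n)
  case 0
  show ?case by (simp add: pderiv_pCons)
next
  case (Suc n)
  have "pderiv (hermite_poly (Suc (Suc n))) =
      pderiv [:0, 2:] * hermite_poly (Suc n) + [:0, 2:] * pderiv (hermite_poly (Suc n)) - pderiv (pderiv (hermite_poly (Suc n)))"
    by (simp only: hermite_poly.simps(2)[of "Suc n"] pderiv_diff pderiv_mult) (simp add: algebra_simps)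
  also have "\<dots> = smult 2 (hermite_poly (Suc n)) + smult (2 * real (Suc n)) ([:0, 2:] * hermite_poly n - pderiv (hermite_poly n))"
    unfolding Suc.IH pderiv_smult by (simp add: pderiv_pCons smult_diff_right)
  also have "\<dots> = smult (2 * real (Suc (Suc n))) (hermite_poly (Suc n))"
    unfolding hermite_poly.simps(2)[symmetric] smult_add_left[symmetric] by (simp add: algebra_simps)
  finally show ?case .
qed

lemma pderiv_hermite_poly: "pderiv (hermite_poly n) = smult (2 * real n) (hermite_poly (n - 1))"
  by (cases n) (simp_all only: pderiv_hermite_poly_Suc diff_Suc_1, simp)

text \<open>The k-th moment of the centred normal law with variance 1/2.\<close>

definition gauss_mom :: "nat \<Rightarrow> real" where
  "gauss_mom k = (if even k then fact k / (2 ^ k * fact (k div 2)) else 0)"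

text \<open>Integration by parts at the level of moments. For k = 0 the truncated
  \<open>k - 1\<close> is harmless, as its factor vanishes.\<close>

lemma gauss_mom_rec: "2 * gauss_mom (Suc k) = real k * gauss_mom (k - 1)"
proof (cases "odd k")
  case True
  then obtain j where k: "k = Suc (2 * j)" by (metis oddE Suc_eq_plus1)
  have "fact (Suc (Suc (2 * j))) / (2 ^ Suc (Suc (2 * j)) * fact (Suc j)) * 2 =
     real (Suc (2 * j)) * (fact (2 * j) / (2 ^ (2 * j) * fact j :: real))"
  proof -
    have "(fact (Suc (Suc (2 * j))) :: real) = 2 * real (Suc j) * real (Suc (2 * j)) * fact (2 * j)"
      by (simp add: algebra_simps)
    moreover have "(fact (Suc j) :: real) = real (Suc j) * fact j" by simp
    ultimately show ?thesis by (simp del: fact_Suc of_nat_Suc add: field_simps)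
  qed
  then show ?thesis unfolding k gauss_mom_def by (simp del: fact_Suc)
next
  case False
  then show ?thesis by (cases "k = 0") (auto simp: gauss_mom_def)
qed

lemma gauss_mom: "has_bochner_integral lborel (\<lambda>t::real. exp (- t\<^sup>2) / sqrt pi * t ^ k) (gauss_mom k)"
proof (cases "even k")
  case True
  then obtain j where k: "k = 2 * j" by auto
  have "has_bochner_integral lborel (\<lambda>t::real. exp (- t\<^sup>2) * t ^ (2 * j))
      (2 *\<^sub>R ((sqrt pi / 2) * (fact (2 * j) / (2 ^ (2 * j) * fact j))))"
    by (rule has_bochner_integral_even_function[OF gaussian_moment_even_pos]) simp
  from has_bochner_integral_divide_zero[OF this, of "sqrt pi"] show ?thesis
    unfolding k by (simp add: gauss_mom_def)
next
  case False
  then obtain j where k: "k = 2 * j + 1" by (rule oddE)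
  have "has_bochner_integral lborel (\<lambda>t::real. exp (- t\<^sup>2) * t ^ (2 * j + 1)) 0"
    by (rule has_bochner_integral_odd_function[OF gaussian_moment_odd_pos]) simp
  from has_bochner_integral_divide_zero[OF this, of "sqrt pi"] show ?thesis
    using False unfolding k by (simp add: gauss_mom_def)
qed

text \<open>The expectation of a polynomial under the density \<open>exp (- t\<^sup>2) / sqrt pi\<close>.\<close>

definition gauss_E :: "real poly \<Rightarrow> real" where
  "gauss_E p = (\<Sum>i\<le>degree p. coeff p i * gauss_mom i)"

lemma gauss_E: "has_bochner_integral lborel (\<lambda>t. exp (- t\<^sup>2) / sqrt pi * poly p t) (gauss_E p)"
proof -
  have "has_bochner_integral lborel (\<lambda>t. \<Sum>i\<le>degree p. coeff p i * (exp (- t\<^sup>2) / sqrt pi * t ^ i)) (gauss_E p)"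
    unfolding gauss_E_def by (intro has_bochner_integral_sum has_bochner_integral_mult_right gauss_mom)
  then show ?thesis
    by (simp add: poly_altdef sum_distrib_left mult_ac)
qed

lemma gauss_E_unique:
  "has_bochner_integral lborel (\<lambda>t. exp (- t\<^sup>2) / sqrt pi * poly p t) v \<Longrightarrow> gauss_E p = v"
  using gauss_E has_bochner_integral_eq by blast

lemma gauss_E_add: "gauss_E (p + q) = gauss_E p + gauss_E q"
  using has_bochner_integral_add[OF gauss_E[of p] gauss_E[of q]]
  by (intro gauss_E_unique) (simp add: algebra_simps add_divide_distrib diff_divide_distrib)

lemma gauss_E_diff: "gauss_E (p - q) = gauss_E p - gauss_E q"
  using has_bochner_integral_diff[OF gauss_E[of p] gauss_E[of q]]
  by (intro gauss_E_unique) (simp add: algebra_simps add_divide_distrib diff_divide_distrib)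

lemma gauss_E_smult: "gauss_E (smult c p) = c * gauss_E p"
  using has_bochner_integral_mult_right[OF gauss_E[of p], of c]
  by (intro gauss_E_unique) (simp add: mult_ac)

lemma gauss_E_0: "gauss_E 0 = 0"
  by (simp add: gauss_E_def)

lemma gauss_E_monom: "gauss_E (monom c k) = c * gauss_mom k"
  using has_bochner_integral_mult_right[OF gauss_mom[of k], of c]
  by (intro gauss_E_unique) (simp add: poly_monom mult_ac)

text \<open>Gaussian integration by parts, done algebraically: on monomials it is
  \<open>gauss_mom_rec\<close>, and both sides are linear in p.\<close>

lemma gauss_E_ibp: "gauss_E ([:0, 2:] * p) = gauss_E (pderiv p)"
proof -
  have mon: "gauss_E ([:0, 2:] * monom c k) = gauss_E (pderiv (monom c k))" for c k
  proof -
    have "[:0, 2:] * monom c k = monom (2 * c) (Suc k)"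
      by (simp add: monom_Suc smult_monom)
    then show ?thesis
      using gauss_mom_rec[of k] by (simp add: gauss_E_monom pderiv_monom)
  qed
  have "gauss_E ([:0, 2:] * (\<Sum>i\<le>k. monom (coeff p i) i)) = gauss_E (pderiv (\<Sum>i\<le>k. monom (coeff p i) i))" for k
  proof (induction k)
    case 0
    show ?case using mon[of "coeff p 0" 0] by simp
  next
    case (Suc k)
    then show ?case
      using mon[of "coeff p (Suc k)" "Suc k"] by (simp only: sum.atMost_Suc distrib_left pderiv_add gauss_E_add)
  qed
  from this[of "degree p"] show ?thesis by (simp only: poly_as_sum_of_monoms)
qed

text \<open>The degree-raising operator, sending q to \<open>2 t q - q'\<close>, is the adjoint of
  differentiation under the Gaussian weight.\<close>

lemma gauss_E_hermite_Suc: "gauss_E (hermite_poly (Suc n) * q) = gauss_E (hermite_poly n * pderiv q)"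
proof -
  have "hermite_poly (Suc n) * q = [:0, 2:] * (hermite_poly n * q) - pderiv (hermite_poly n * q) + hermite_poly n * pderiv q"
    by (simp add: pderiv_mult algebra_simps)
  then show ?thesis by (simp only: gauss_E_add gauss_E_diff gauss_E_ibp)
qed

text \<open>Each use of \<open>gauss_E_hermite_Suc\<close> moves a derivative to the other factor,
  where it lowers the degree n by one and produces the factor 2 n.\<close>

lemma gauss_E_hermite_orthogonal:
  "gauss_E (hermite_poly m * hermite_poly n) = (if m = n then 2 ^ n * fact n else 0)"
proof (induction m arbitrary: n)
  case 0
  show ?case
  proof (cases n)
    case 0
    then show ?thesis using gauss_E_monom[of 1 0] by (simp add: gauss_mom_def)
  next
    case (Suc k)
    then show ?thesis
      using gauss_E_hermite_Suc[of k 1] by (simp add: gauss_E_0 mult.commute del: hermite_poly.simps(2))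
  qed
next
  case (Suc m)
  have "gauss_E (hermite_poly (Suc m) * hermite_poly n) = 2 * real n * gauss_E (hermite_poly m * hermite_poly (n - 1))"
    by (simp only: gauss_E_hermite_Suc pderiv_hermite_poly mult_smult_right gauss_E_smult)
  then show ?case
    by (cases n) (auto simp: Suc.IH)
qed

text \<open>The eigenvalue relation in one dimension. Integration by parts turns the s-part of the
  recursion into \<open>s\<^sup>2\<close> times the derivative term, and
  \<open>s\<^sup>2 = 1 - c\<^sup>2\<close> makes one copy of that term cancel. The derivative term
  reaches back to n - 2, hence the strong induction.\<close>

lemma gauss_E_hermite_mehler:
  assumes cs: "c\<^sup>2 + s\<^sup>2 = 1"
  shows "gauss_E (hermite_poly n \<circ>\<^sub>p [:c * x, s:]) = c ^ n * poly (hermite_poly n) x"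
proof (induction n rule: less_induct)
  case (less n)
  show ?case
  proof (cases n)
    case 0
    then show ?thesis using gauss_E_monom[of 1 0] by (simp add: gauss_mom_def pcompose_1)
  next
    case (Suc k)
    let ?q = "[:c * x, s:]"
    have s2: "s\<^sup>2 = 1 - c\<^sup>2" using cs by simp
    have 1: "[:0, 2:] \<circ>\<^sub>p ?q = [:2 * c * x:] + smult s [:0, 2:]"
      by (simp add: pcompose_pCons)
    have IHk: "gauss_E (hermite_poly k \<circ>\<^sub>p ?q) = c ^ k * poly (hermite_poly k) x"
      using less Suc by simp
    have d: "gauss_E (pderiv (hermite_poly k) \<circ>\<^sub>p ?q) = 2 * real k * (c ^ (k - 1) * poly (hermite_poly (k - 1)) x)"
      using less[of "k - 1"] Suc by (simp only: pderiv_hermite_poly pcompose_smult gauss_E_smult)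
    have "gauss_E (hermite_poly n \<circ>\<^sub>p ?q) =
        gauss_E (smult (2 * c * x) (hermite_poly k \<circ>\<^sub>p ?q)) + gauss_E (smult s ([:0, 2:] * (hermite_poly k \<circ>\<^sub>p ?q)))
          - gauss_E (pderiv (hermite_poly k) \<circ>\<^sub>p ?q)"
      unfolding Suc hermite_poly.simps(2) pcompose_diff pcompose_mult 1 distrib_right gauss_E_add gauss_E_diff
      by simp
    also have "\<dots> = 2 * c * x * (c ^ k * poly (hermite_poly k) x) + s\<^sup>2 * gauss_E (pderiv (hermite_poly k) \<circ>\<^sub>p ?q)
          - gauss_E (pderiv (hermite_poly k) \<circ>\<^sub>p ?q)"
      unfolding gauss_E_smult gauss_E_ibp pderiv_pcompose IHk
      by (simp add: pderiv_pCons gauss_E_smult power2_eq_square)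
    also have "\<dots> = 2 * x * (c ^ Suc k * poly (hermite_poly k) x) - c\<^sup>2 * gauss_E (pderiv (hermite_poly k) \<circ>\<^sub>p ?q)"
      unfolding s2 by (simp add: algebra_simps)
    also have "\<dots> = c ^ n * (2 * x * poly (hermite_poly k) x - 2 * real k * poly (hermite_poly (k - 1)) x)"
      unfolding d Suc by (cases k) (simp_all add: algebra_simps power2_eq_square)
    also have "\<dots> = c ^ n * poly (hermite_poly n) x"
      unfolding Suc hermite_poly.simps(2) pderiv_hermite_poly by simp
    finally show ?thesis .
  qed
qed

section \<open>The eigenfunctions\<close>

text \<open>The n-th derivative of \<open>exp (- t\<^sup>2)\<close>, as iterating the next lemma
  shows.\<close>

definition hermite_deriv :: "nat \<Rightarrow> real \<Rightarrow> real" where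
  "hermite_deriv n t = (- 1) ^ n * poly (hermite_poly n) t * exp (- t\<^sup>2)"

lemma hermite_deriv_has_derivative:
  "(hermite_deriv n has_real_derivative hermite_deriv (Suc n) t) (at t)"
  unfolding hermite_deriv_def
  by (auto intro!: derivative_eq_intros simp: algebra_simps)

text \<open>The Gaussian is a product over coordinates, and each partial derivative raises the order
  of one factor. The result depends on js only through its counts, so the choice made in
  \<open>mixed_partial\<close> does not affect it.\<close>

lemma iter_partial_gauss:
  "iter_partial js (\<lambda>y::real^'d::finite. exp (- (norm y)\<^sup>2)) = (\<lambda>x. \<Prod>i\<in>UNIV. hermite_deriv (count_list js i) (x $ i))"
proof (induction js)
  case Nil
  show ?case
    by (simp add: iter_partial_def hermite_deriv_def norm_vec_sq exp_sum[symmetric] sum_negf)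
next
  case (Cons j js)
  show ?case
  proof
    fix x :: "real^'d"
    define f where "f = (\<lambda>x::real^'d. \<Prod>i\<in>UNIV. hermite_deriv (count_list js i) (x $ i))"
    define f' where "f' i y = hermite_deriv (Suc (count_list js i)) (x $ i) * y $ i" for i and y :: "real^'d"
    have comp: "((\<lambda>x::real^'d. hermite_deriv (count_list js i) (x $ i)) has_derivative f' i) (at x)" for i
    proof -
      have "((\<lambda>x::real^'d. x $ i) has_derivative (\<lambda>y. y $ i)) (at x)"
        by (rule bounded_linear_imp_has_derivative[OF bounded_linear_vec_nth])
      from has_derivative_compose[OF this has_field_derivative_imp_has_derivative[OF hermite_deriv_has_derivative]]
      show ?thesis by (simp add: f'_def[abs_def])
    qed
    have "(f has_derivative (\<lambda>y. \<Sum>i\<in>UNIV. f' i y * (\<Prod>k\<in>UNIV - {i}. hermite_deriv (count_list js k) (x $ k)))) (at x)"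
      unfolding f_def by (rule has_derivative_prod) (rule comp)
    then have "partial j f x = (\<Sum>i\<in>UNIV. f' i (axis j 1) * (\<Prod>k\<in>UNIV - {i}. hermite_deriv (count_list js k) (x $ k)))"
      unfolding partial_def by (simp add: frechet_derivative_at[symmetric])
    also have "\<dots> = (\<Sum>i\<in>UNIV. if i = j then hermite_deriv (Suc (count_list js j)) (x $ j) *
        (\<Prod>k\<in>UNIV - {j}. hermite_deriv (count_list js k) (x $ k)) else 0)"
      by (intro sum.cong) (auto simp: f'_def axis_def)
    also have "\<dots> = hermite_deriv (count_list (j # js) j) (x $ j) *
        (\<Prod>k\<in>UNIV - {j}. hermite_deriv (count_list (j # js) k) (x $ k))"
      by simp
    also have "\<dots> = (\<Prod>k\<in>UNIV. hermite_deriv (count_list (j # js) k) (x $ k))"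
      by (rule prod.remove[symmetric]) auto
    finally have "partial j f x = (\<Prod>k\<in>UNIV. hermite_deriv (count_list (j # js) k) (x $ k))" .
    moreover have "iter_partial (j # js) (\<lambda>y::real^'d. exp (- (norm y)\<^sup>2)) x = partial j f x"
      using Cons.IH by (simp add: iter_partial_def f_def)
    ultimately show "iter_partial (j # js) (\<lambda>y::real^'d. exp (- (norm y)\<^sup>2)) x =
       (\<Prod>i\<in>UNIV. hermite_deriv (count_list (j # js) i) (x $ i))" by simp
  qed
qed

text \<open>Provides the witness for the \<open>SOME\<close> in
  \<open>mixed_partial\<close>.\<close>

lemma ex_count_list:
  fixes p :: "'d::finite \<Rightarrow> nat"
  shows "\<exists>js. \<forall>i. count_list js i = p i"
proof -
  obtain js where "mset js = Abs_multiset p" using ex_mset by blast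
  then have "count (mset js) i = p i" for i by (simp add: count_Abs_multiset)
  then show ?thesis by (auto simp: count_mset count_list_eq_length_filter)
qed

lemma hermite_eq_prod: "hermite p (x :: real^'d::finite) = (\<Prod>i\<in>UNIV. poly (hermite_poly (p i)) (x $ i))"
proof -
  define js where "js = (SOME js. \<forall>i. count_list js i = p i)"
  have js: "count_list js i = p i" for i
    using someI_ex[OF ex_count_list[of p]] unfolding js_def by blast
  have "hermite p x = (- 1) ^ mi_size p * exp ((norm x)\<^sup>2) * (\<Prod>i\<in>UNIV. hermite_deriv (p i) (x $ i))"
    unfolding hermite_def mixed_partial_def js_def[symmetric] iter_partial_gauss js ..
  also have "(\<Prod>i\<in>UNIV. hermite_deriv (p i) (x $ i)) =
     (- 1) ^ mi_size p * (\<Prod>i\<in>UNIV. poly (hermite_poly (p i)) (x $ i)) * exp (- (norm x)\<^sup>2)"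
    unfolding hermite_deriv_def prod.distrib mi_size_def
    by (simp add: power_sum norm_vec_sq exp_sum[symmetric] sum_negf)
  finally show ?thesis
    by (simp add: exp_minus field_simps power_mult_distrib[symmetric] flip: power_add)
qed

text \<open>The one-dimensional factor of \<open>eigenfun\<close>, normalised in L2 of the
  one-dimensional invariant law.\<close>

definition hermite_fun :: "real \<Rightarrow> nat \<Rightarrow> real \<Rightarrow> real" where
  "hermite_fun a n t = poly (hermite_poly n) (sqrt a * t) / sqrt (fact n * 2 ^ n)"

lemma hermite_fun_measurable [measurable]: "hermite_fun a n \<in> borel_measurable borel"
  unfolding hermite_fun_def
  by (intro borel_measurable_continuous_onI continuous_intros) simp

lemma eigenfun_eq_prod:
  assumes "b > 0" "\<sigma> > 0"
  shows "eigenfun b \<sigma> p (x :: real^'d::finite) = (\<Prod>i\<in>UNIV. hermite_fun (b / \<sigma>\<^sup>2) (p i) (x $ i))"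
proof -
  have "sqrt (b / \<sigma>\<^sup>2) = sqrt b / \<sigma>" using assms by (simp add: real_sqrt_divide)
  moreover have "sqrt (mi_fact p * 2 ^ mi_size p) = (\<Prod>i\<in>UNIV. sqrt (fact (p i) * 2 ^ p i))"
    unfolding mi_fact_def mi_size_def power_sum prod.distrib[symmetric] by (induction rule: infinite_finite_induct) (auto simp: real_sqrt_mult)
  ultimately show ?thesis
    unfolding eigenfun_def hermite_eq_prod hermite_fun_def prod_dividef by simp
qed

lemma poly_bdd_eigenfun:
  assumes "b > 0" "\<sigma> > 0"
  shows "poly_bdd (eigenfun b \<sigma> p)"
  unfolding eigenfun_eq_prod[OF assms, abs_def] hermite_fun_def poly_altdef divide_inverse power_mult_distrib
  by (intro poly_bdd_prod poly_bdd_mult poly_bdd_sum poly_bdd_power poly_bdd_component poly_bdd_const)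

lemma gauss_scale:
  assumes a: "a > 0" and F: "has_bochner_integral lborel (\<lambda>t. exp (- t\<^sup>2) / sqrt pi * F t) v"
  shows "has_bochner_integral lborel (\<lambda>t. sqrt (a / pi) * exp (- a * t\<^sup>2) * F (sqrt a * t)) v"
proof -
  have "has_bochner_integral lborel (\<lambda>t. exp (- (0 + sqrt a * t)\<^sup>2) / sqrt pi * F (0 + sqrt a * t)) (v /\<^sub>R \<bar>sqrt a\<bar>)"
    using a by (intro lborel_has_bochner_integral_real_affine_iff[THEN iffD1] F) auto
  from has_bochner_integral_mult_right[OF this, of "sqrt a"] show ?thesis
    using a by (simp add: power_mult_distrib real_sqrt_divide mult_ac)
qed

text \<open>Both the measure and the eigenfunctions factorise, so one coordinate in which p and q
  differ already makes the product vanish.\<close>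

lemma eigenfun_orthonormal:
  assumes b: "b > 0" "\<sigma> > 0"
  shows "has_bochner_integral (gauss (b / \<sigma>\<^sup>2) :: (real^'d::finite) measure)
    (\<lambda>x. eigenfun b \<sigma> p x * eigenfun b \<sigma> q x) (if p = q then 1 else 0)"
proof -
  define a where "a = b / \<sigma>\<^sup>2"
  have a: "a > 0" using b by (simp add: a_def)
  have 1: "has_bochner_integral lborel (\<lambda>t. sqrt (a / pi) * exp (- a * t\<^sup>2) * (hermite_fun a m t * hermite_fun a n t))
     (if m = n then 1 else 0)" for m n
  proof -
    have "has_bochner_integral lborel (\<lambda>t. sqrt (a / pi) * exp (- a * t\<^sup>2) * poly (hermite_poly m * hermite_poly n) (sqrt a * t))
      (if m = n then 2 ^ n * fact n else 0)"
      using gauss_scale[OF a gauss_E] unfolding gauss_E_hermite_orthogonal[symmetric] .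
    from has_bochner_integral_divide_zero[OF this, of "sqrt (fact m * 2 ^ m) * sqrt (fact n * 2 ^ n)"]
    show ?thesis unfolding hermite_fun_def by (cases "m = n") (auto simp: mult.commute)
  qed
  have "has_bochner_integral (gauss a :: (real^'d) measure)
    (\<lambda>x. \<Prod>i\<in>UNIV. hermite_fun a (p i) (x $ i) * hermite_fun a (q i) (x $ i)) (\<Prod>i\<in>UNIV. if p i = q i then 1 else 0)"
    by (rule has_bochner_integral_gauss_prod[OF a 1]) measurable
  moreover have "(\<Prod>i\<in>UNIV. if p i = q i then 1 else 0) = (if p = q then 1 else (0::real))"
    by (auto simp: fun_eq_iff prod_zero_iff)
  ultimately show ?thesis
    unfolding eigenfun_eq_prod[OF b] a_def[symmetric] prod.distrib by simp
qed

text \<open>The average factorises over coordinates, the i-th contributing \<open>w ^ p i\<close>.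
  For \<open>w = exp (- b * t)\<close> this is the eigenvalue \<open>exp (- |p| b t)\<close> of the
  semigroup.\<close>

lemma eigenfun_mehler:
  fixes x :: "real^'d::finite"
  assumes b: "b > 0" "\<sigma> > 0" and w: "0 \<le> w" "w \<le> 1"
  shows "(\<integral>z. eigenfun b \<sigma> p z \<partial>ou_law (b / \<sigma>\<^sup>2) w x) = w ^ mi_size p * eigenfun b \<sigma> p x"
proof -
  define a where "a = b / \<sigma>\<^sup>2"
  have a: "a > 0" using b by (simp add: a_def)
  define s where "s = sqrt (1 - w\<^sup>2)"
  have ws: "w\<^sup>2 + s\<^sup>2 = 1" using w by (simp add: s_def power_le_one)
  have 1: "has_bochner_integral lborel (\<lambda>t. sqrt (a / pi) * exp (- a * t\<^sup>2) * hermite_fun a n (w * u + s * t))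
     (w ^ n * hermite_fun a n u)" for n u
  proof -
    have "has_bochner_integral lborel (\<lambda>t. sqrt (a / pi) * exp (- a * t\<^sup>2) * poly (hermite_poly n \<circ>\<^sub>p [:w * (sqrt a * u), s:]) (sqrt a * t))
      (w ^ n * poly (hermite_poly n) (sqrt a * u))"
      using gauss_scale[OF a gauss_E] unfolding gauss_E_hermite_mehler[OF ws, symmetric] .
    from has_bochner_integral_divide_zero[OF this, of "sqrt (fact n * 2 ^ n)"]
    show ?thesis unfolding hermite_fun_def by (simp add: poly_pcompose algebra_simps)
  qed
  have "has_bochner_integral (gauss a)
    (\<lambda>y. \<Prod>i\<in>UNIV. hermite_fun a (p i) (w * x $ i + s * y $ i)) (\<Prod>i\<in>UNIV. w ^ p i * hermite_fun a (p i) (x $ i))"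
    by (rule has_bochner_integral_gauss_prod[OF a 1]) measurable
  then have "(\<integral>y. eigenfun b \<sigma> p (ou_map w x y) \<partial>gauss a) = w ^ mi_size p * eigenfun b \<sigma> p x"
    unfolding eigenfun_eq_prod[OF b] a_def[symmetric]
    by (simp add: has_bochner_integral_iff ou_map_def s_def mi_size_def power_sum prod.distrib)
  then show ?thesis
    unfolding a_def[symmetric] using poly_bdd_measurable[OF poly_bdd_eigenfun[OF b]] by (subst integral_ou_law) auto
qed

section \<open>Decay of the semigroup on the orthogonal complement of low eigenfunctions\<close>

lemma finite_mi_le: "finite {p :: 'd::finite \<Rightarrow> nat. mi_size p \<le> k}"
proof (rule finite_subset)
  show "{p :: 'd \<Rightarrow> nat. mi_size p \<le> k} \<subseteq> PiE UNIV (\<lambda>_. {..k})"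
  proof
    fix p :: "'d \<Rightarrow> nat" assume "p \<in> {p. mi_size p \<le> k}"
    moreover have "p i \<le> mi_size p" for i
      unfolding mi_size_def by (rule member_le_sum) auto
    ultimately show "p \<in> PiE UNIV (\<lambda>_. {..k})" by (auto intro: order_trans)
  qed
qed (intro finite_PiE, auto)

text \<open>\<open>(1 / (1 - z))\<^sup>d\<close> is the generating function of the number of multi-indices of a given size.\<close>

lemma multiindex_tail_bound:
  fixes z z0 :: real
  assumes z: "0 \<le> z" "z \<le> z0" "z0 < 1"
  shows "(1 / (1 - z)) ^ CARD('d::finite) - (\<Sum>p\<in>{p :: 'd \<Rightarrow> nat. mi_size p \<le> k}. z ^ mi_size p)
    \<le> ((1 / (1 - z0)) ^ CARD('d) * real CARD('d) + real (card (PiE (UNIV :: 'd set) (\<lambda>_. {..k})))) * z ^ Suc k"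
proof -
  define B where "B = PiE (UNIV :: 'd set) (\<lambda>_. {..k})"
  define A where "A = {p :: 'd \<Rightarrow> nat. mi_size p \<le> k}"
  have finB: "finite B" unfolding B_def by (intro finite_PiE) auto
  have AB: "A \<subseteq> B"
  proof
    fix p :: "'d \<Rightarrow> nat" assume "p \<in> A"
    moreover have "p i \<le> mi_size p" for i
      unfolding mi_size_def by (rule member_le_sum) auto
    ultimately show "p \<in> B" by (auto simp: A_def B_def intro: order_trans)
  qed
  \<comment> \<open>Over the box of multi-indices with entries at most k the sum is a product of
    finite geometric sums. The box contains the simplex A, and its remaining indices all have size
    above k.\<close>
  have "(\<Sum>p\<in>B. z ^ mi_size p) = (\<Prod>i\<in>(UNIV :: 'd set). \<Sum>j\<le>k. z ^ j)"
    unfolding B_def by (subst prod_sum_PiE) (auto simp: mi_size_def power_sum)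
  also have "\<dots> = ((1 - z ^ Suc k) / (1 - z)) ^ CARD('d)"
    using z by (simp add: sum_gp0)
  finally have box: "(\<Sum>p\<in>B. z ^ mi_size p) = ((1 - z ^ Suc k) / (1 - z)) ^ CARD('d)" .
  have "(\<Sum>p\<in>B. z ^ mi_size p) = (\<Sum>p\<in>A. z ^ mi_size p) + (\<Sum>p\<in>B - A. z ^ mi_size p)"
    using sum.subset_diff[OF AB finB, of "\<lambda>p. z ^ mi_size p"] by simp
  also have "(\<Sum>p\<in>B - A. z ^ mi_size p) \<le> (\<Sum>p\<in>B - A. z ^ Suc k)"
    using z by (intro sum_mono power_decreasing) (auto simp: A_def)
  also have "\<dots> \<le> real (card B) * z ^ Suc k"
    using z finB by (auto intro!: mult_right_mono card_mono)
  finally have le1: "((1 - z ^ Suc k) / (1 - z)) ^ CARD('d) \<le> (\<Sum>p\<in>A. z ^ mi_size p) + real (card B) * z ^ Suc k"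
    unfolding box by simp
  have zk: "z ^ Suc k \<le> 1" using z by (intro power_le_one) auto
  \<comment> \<open>Bernoulli's inequality: truncating every geometric series at k loses only a
    multiple of \<open>z ^ Suc k\<close>.\<close>
  have "1 + real CARD('d) * (- (z ^ Suc k)) \<le> (1 + - (z ^ Suc k)) ^ CARD('d)"
    using zk by (intro Bernoulli_inequality) simp
  then have "1 - (1 - z ^ Suc k) ^ CARD('d) \<le> real CARD('d) * z ^ Suc k" by simp
  then have "(1 / (1 - z)) ^ CARD('d) * (1 - (1 - z ^ Suc k) ^ CARD('d)) \<le> (1 / (1 - z0)) ^ CARD('d) * (real CARD('d) * z ^ Suc k)"
    using z zk by (intro mult_mono power_mono divide_left_mono) (auto intro!: power_le_one)
  then have "(1 / (1 - z)) ^ CARD('d) - ((1 - z ^ Suc k) / (1 - z)) ^ CARD('d) \<le> (1 / (1 - z0)) ^ CARD('d) * (real CARD('d) * z ^ Suc k)"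
    unfolding power_divide right_diff_distrib by simp
  with le1 show ?thesis
    unfolding A_def[symmetric] B_def[symmetric] distrib_right mult.assoc by linarith
qed

text \<open>Jensen's inequality for the square, as Cauchy-Schwarz against the constant 1.\<close>

lemma integral_sq_le_prob:
  fixes f :: "'a \<Rightarrow> real"
  assumes "prob_space Q" and [measurable]: "f \<in> borel_measurable Q" and "integrable Q (\<lambda>x. (f x)\<^sup>2)"
  shows "(\<integral>x. f x \<partial>Q)\<^sup>2 \<le> (\<integral>x. (f x)\<^sup>2 \<partial>Q)"
proof -
  interpret prob_space Q by fact
  show ?thesis
    using integral_Cauchy_Schwarz(2)[of f Q "\<lambda>_. 1"] assms(3) by (simp add: prob_space)
qed

context
  fixes b \<sigma> :: real
  assumes b: "b > 0" "\<sigma> > 0"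
begin

text \<open>Since g is orthogonal to the low eigenfunctions, the kernel K may be replaced by K - S
  before Cauchy-Schwarz, where S is the projection of K onto their span. The coefficients of K are
  given by \<open>eigenfun_mehler\<close>, and by Pythagoras the squared norm drops by exactly the
  sum of their squares.\<close>

lemma mehler_sq_le:
  fixes g :: "real^'d::finite \<Rightarrow> real" and x :: "real^'d"
  assumes g: "poly_bdd g" and w: "0 \<le> w" "w < 1"
    and orth: "\<And>p. mi_size p \<le> k \<Longrightarrow> (\<integral>y. g y * eigenfun b \<sigma> p y \<partial>gauss (b / \<sigma>\<^sup>2)) = 0"
  shows "(\<integral>z. g z \<partial>ou_law (b / \<sigma>\<^sup>2) w x)\<^sup>2 \<le>
    ((\<integral>y. (mker (b / \<sigma>\<^sup>2) w x y)\<^sup>2 \<partial>gauss (b / \<sigma>\<^sup>2)) - (\<Sum>p | mi_size p \<le> k. (w\<^sup>2) ^ mi_size p * (eigenfun b \<sigma> p x)\<^sup>2))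
     * (\<integral>y. (g y)\<^sup>2 \<partial>gauss (b / \<sigma>\<^sup>2))"
proof -
  define a where "a = b / \<sigma>\<^sup>2"
  have a: "a > 0" using b by (simp add: a_def)
  define A where "A = {p :: 'd \<Rightarrow> nat. mi_size p \<le> k}"
  have finA: "finite A" unfolding A_def by (rule finite_mi_le)
  define c where "c p = w ^ mi_size p * eigenfun b \<sigma> p x" for p
  define S where "S y = (\<Sum>p\<in>A. c p * eigenfun b \<sigma> p y)" for y
  define K where "K = mker a w x"
  note pe = poly_bdd_eigenfun[OF b]
  note pint = poly_bdd_integrable_gauss[OF a]
  have pS: "poly_bdd S" unfolding S_def[abs_def] by (intro poly_bdd_sum poly_bdd_cmult pe)
  note [measurable] = poly_bdd_measurable[OF g] poly_bdd_measurable[OF pS] poly_bdd_measurable[OF pe]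
  have [measurable]: "K \<in> borel_measurable borel" unfolding K_def by measurable
  have K2: "integrable (gauss a) (\<lambda>y. (K y)\<^sup>2)"
    using mker_sq_integral[OF a w, of x] by (simp add: K_def has_bochner_integral_iff)
  have Kint: "integrable (gauss a) (\<lambda>y. K y * h y)" if "poly_bdd h" for h
    using integral_Cauchy_Schwarz(1)[of K "gauss a" h] K2 pint[OF poly_bdd_power[OF that, of 2]] that
    by (simp add: poly_bdd_measurable)
  have Kval: "(\<integral>y. K y * h y \<partial>gauss a) = (\<integral>z. h z \<partial>ou_law a w x)" if "poly_bdd h" for h
    using integral_ou_law_mker(1)[OF a w, of h x] that by (simp add: poly_bdd_measurable K_def)
  have KS: "(\<integral>y. K y * S y \<partial>gauss a) = (\<Sum>p\<in>A. (c p)\<^sup>2)"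
  proof -
    have "(\<integral>y. K y * S y \<partial>gauss a) = (\<integral>y. (\<Sum>p\<in>A. c p * (K y * eigenfun b \<sigma> p y)) \<partial>gauss a)"
      by (simp add: S_def sum_distrib_left mult_ac)
    also have "\<dots> = (\<Sum>p\<in>A. c p * (\<integral>y. K y * eigenfun b \<sigma> p y \<partial>gauss a))"
      by (subst Bochner_Integration.integral_sum) (auto intro!: Kint pe)
    also have "\<dots> = (\<Sum>p\<in>A. (c p)\<^sup>2)"
      using w by (simp add: Kval[OF pe] eigenfun_mehler[OF b, folded a_def] c_def power2_eq_square)
    finally show ?thesis .
  qed
  have SS: "(\<integral>y. S y * S y \<partial>gauss a) = (\<Sum>p\<in>A. (c p)\<^sup>2)"
  proof -
    have "has_bochner_integral (gauss a) (\<lambda>y. \<Sum>p\<in>A. \<Sum>q\<in>A. (c p * c q) * (eigenfun b \<sigma> p y * eigenfun b \<sigma> q y))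
       (\<Sum>p\<in>A. \<Sum>q\<in>A. (c p * c q) * (if p = q then 1 else 0))"
      unfolding a_def by (intro has_bochner_integral_sum has_bochner_integral_mult_right eigenfun_orthonormal b)
    then have "(\<integral>y. S y * S y \<partial>gauss a) = (\<Sum>p\<in>A. \<Sum>q\<in>A. (c p * c q) * (if p = q then 1 else 0))"
      by (simp add: has_bochner_integral_iff S_def sum_product mult_ac)
    also have "\<dots> = (\<Sum>p\<in>A. \<Sum>q\<in>A. if q = p then (c p)\<^sup>2 else 0)"
      by (intro sum.cong) (auto simp: power2_eq_square)
    also have "\<dots> = (\<Sum>p\<in>A. (c p)\<^sup>2)"
      using finA by simp
    finally show ?thesis .
  qed
  have gS: "(\<integral>y. S y * g y \<partial>gauss a) = 0"
  proof -
    have "(\<integral>y. S y * g y \<partial>gauss a) = (\<integral>y. (\<Sum>p\<in>A. c p * (g y * eigenfun b \<sigma> p y)) \<partial>gauss a)"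
      by (simp add: S_def sum_distrib_right sum_distrib_left mult_ac)
    also have "\<dots> = (\<Sum>p\<in>A. c p * (\<integral>y. g y * eigenfun b \<sigma> p y \<partial>gauss a))"
      using pint[OF poly_bdd_mult[OF g pe]]
      by (subst Bochner_Integration.integral_sum) simp_all
    also have "\<dots> = 0" using orth by (simp add: A_def a_def)
    finally show ?thesis .
  qed
  have intKS: "integrable (gauss a) (\<lambda>y. K y * S y)" "integrable (gauss a) (\<lambda>y. S y * S y)"
    by (rule Kint[OF pS]) (rule pint[OF poly_bdd_mult[OF pS pS]])
  have sq: "(K y - S y)\<^sup>2 = (K y)\<^sup>2 - 2 * (K y * S y) + S y * S y" for y
    by (simp add: power2_eq_square algebra_simps)
  have int2: "integrable (gauss a) (\<lambda>y. (K y - S y)\<^sup>2)"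
    unfolding sq using K2 intKS by simp
  have D2: "(\<integral>y. (K y - S y)\<^sup>2 \<partial>gauss a) = (\<integral>y. (K y)\<^sup>2 \<partial>gauss a) - (\<Sum>p\<in>A. (c p)\<^sup>2)"
    unfolding sq using K2 intKS by (simp add: KS SS)
  \<comment> \<open>Subtracting S changes nothing, as g integrates to 0 against it.\<close>
  have "(\<integral>z. g z \<partial>ou_law a w x) = (\<integral>y. (K y - S y) * g y \<partial>gauss a)"
    unfolding left_diff_distrib using gS Kint[OF g] pint[OF poly_bdd_mult[OF pS g]] by (simp add: Kval[OF g])
  also have "\<dots>\<^sup>2 \<le> (\<integral>y. (K y - S y)\<^sup>2 \<partial>gauss a) * (\<integral>y. (g y)\<^sup>2 \<partial>gauss a)"
    by (rule integral_Cauchy_Schwarz(2)) (use int2 pint[OF poly_bdd_power[OF g]] in auto)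
  finally show ?thesis
    unfolding D2 unfolding a_def K_def A_def c_def by (simp add: power_mult_distrib power_mult[symmetric] mult.commute)
qed

text \<open>Integrating the pointwise bound in x leaves the squared Hilbert-Schmidt norm minus the
  squared eigenvalues of the removed modes, which is the tail estimated by
  \<open>multiindex_tail_bound\<close>.\<close>

lemma mehler_L2_le:
  fixes g :: "real^'d::finite \<Rightarrow> real"
  assumes g: "poly_bdd g" and w: "0 \<le> w" "w < 1"
    and orth: "\<And>p. mi_size p \<le> k \<Longrightarrow> (\<integral>y. g y * eigenfun b \<sigma> p y \<partial>gauss (b / \<sigma>\<^sup>2)) = 0"
  shows "(\<integral>x. (\<integral>z. g z \<partial>ou_law (b / \<sigma>\<^sup>2) w x)\<^sup>2 \<partial>gauss (b / \<sigma>\<^sup>2)) \<le>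
    ((1 / (1 - w\<^sup>2)) ^ CARD('d) - (\<Sum>p\<in>{p :: 'd \<Rightarrow> nat. mi_size p \<le> k}. (w\<^sup>2) ^ mi_size p))
     * (\<integral>y. (g y)\<^sup>2 \<partial>gauss (b / \<sigma>\<^sup>2))"
proof -
  define a where "a = b / \<sigma>\<^sup>2"
  have a: "a > 0" using b by (simp add: a_def)
  define A where "A = {p :: 'd \<Rightarrow> nat. mi_size p \<le> k}"
  define J where "J x = (\<integral>y. (mker a w x y)\<^sup>2 \<partial>gauss a) - (\<Sum>p\<in>A. (w\<^sup>2) ^ mi_size p * (eigenfun b \<sigma> p x * eigenfun b \<sigma> p x))" for x :: "real^'d"
  have on: "has_bochner_integral (gauss a) (\<lambda>x. eigenfun b \<sigma> p x * eigenfun b \<sigma> p x) 1" for p :: "'d \<Rightarrow> nat"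
    using eigenfun_orthonormal[OF b, of p p] by (simp add: a_def)
  have "has_bochner_integral (gauss a) J ((1 / (1 - w\<^sup>2)) ^ CARD('d) - (\<Sum>p\<in>A. (w\<^sup>2) ^ mi_size p * 1))"
    unfolding J_def
    by (intro has_bochner_integral_diff has_bochner_integral_sum has_bochner_integral_mult_right mker_sq_double_integral a w on)
  then have J: "has_bochner_integral (gauss a) (\<lambda>x. J x * (\<integral>y. (g y)\<^sup>2 \<partial>gauss a))
     (((1 / (1 - w\<^sup>2)) ^ CARD('d) - (\<Sum>p\<in>A. (w\<^sup>2) ^ mi_size p)) * (\<integral>y. (g y)\<^sup>2 \<partial>gauss a))"
    by (intro has_bochner_integral_mult_left) simp
  have "(\<integral>x. (\<integral>z. g z \<partial>ou_law a w x)\<^sup>2 \<partial>gauss a) \<le> (\<integral>x. J x * (\<integral>y. (g y)\<^sup>2 \<partial>gauss a) \<partial>gauss a)"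
  proof (rule Bochner_Integration.integral_mono)
    show "integrable (gauss a) (\<lambda>x. (\<integral>z. g z \<partial>ou_law a w x)\<^sup>2)"
      using w by (intro poly_bdd_integrable_gauss[OF a] poly_bdd_power poly_bdd_mehler[OF a g]) auto
    show "integrable (gauss a) (\<lambda>x. J x * (\<integral>y. (g y)\<^sup>2 \<partial>gauss a))"
      using J by (simp add: has_bochner_integral_iff)
    show "(\<integral>z. g z \<partial>ou_law a w x)\<^sup>2 \<le> J x * (\<integral>y. (g y)\<^sup>2 \<partial>gauss a)" for x
      using mehler_sq_le[where k = k and x = x, OF g w orth] by (simp add: J_def A_def a_def power2_eq_square)
  qed
  then show ?thesis
    unfolding has_bochner_integral_integral_eq[OF J] unfolding a_def A_def .
qed

text \<open>With \<open>w = exp (- b * t)\<close> the tail is of order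
  \<open>w ^ (2 * Suc k)\<close>, which is the stated rate. The Hilbert-Schmidt norm blows up as t
  tends to 0, so times below 1 are treated separately.\<close>

lemma mehler_decay:
  fixes g :: "real^'d::finite \<Rightarrow> real"
  assumes g: "poly_bdd g"
    and orth: "\<And>p. mi_size p \<le> k \<Longrightarrow> (\<integral>y. g y * eigenfun b \<sigma> p y \<partial>gauss (b / \<sigma>\<^sup>2)) = 0"
  obtains C where "C \<ge> 0" "\<And>t. t \<ge> 0 \<Longrightarrow> (\<integral>x. (\<integral>z. g z \<partial>ou_law (b / \<sigma>\<^sup>2) (exp (- b * t)) x)\<^sup>2 \<partial>gauss (b / \<sigma>\<^sup>2))
     \<le> C * exp (- 2 * real (Suc k) * b * t)"
proof -
  define a where "a = b / \<sigma>\<^sup>2"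
  have a: "a > 0" using b by (simp add: a_def)
  obtain C1 m where C1: "C1 \<ge> 0" "\<And>w x. 0 \<le> w \<Longrightarrow> w \<le> 1 \<Longrightarrow> (\<integral>z. \<bar>g z\<bar> \<partial>ou_law a w x) \<le> C1 * (1 + norm x ^ m)"
    using ou_law_poly_bound[OF a g] by metis
  define C2 where "C2 = (\<integral>x. (C1 * (1 + norm x ^ m))\<^sup>2 \<partial>(gauss a :: (real^'d) measure))"
  \<comment> \<open>The largest value of \<open>w\<^sup>2\<close> for times t \<ge> 1.\<close>
  define z0 where "z0 = exp (- 2 * b)"
  define C3 where "C3 = ((1 / (1 - z0)) ^ CARD('d) * real CARD('d) + real (card (PiE (UNIV :: 'd set) (\<lambda>_. {..k})))) * (\<integral>y. (g y)\<^sup>2 \<partial>gauss a)"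
  have z0: "z0 < 1" using b by (simp add: z0_def)
  have C2: "C2 \<ge> 0" by (simp add: C2_def)
  have C3: "C3 \<ge> 0" using z0 unfolding C3_def by (intro mult_nonneg_nonneg add_nonneg_nonneg) auto
  have C4: "C2 * exp (2 * real (Suc k) * b) \<ge> 0" using C2 by simp
  show thesis
  proof (rule that[of "C3 + C2 * exp (2 * real (Suc k) * b)"])
    show "C3 + C2 * exp (2 * real (Suc k) * b) \<ge> 0" using C3 C4 by simp
    fix t :: real assume t: "t \<ge> 0"
    define E where "E = exp (- 2 * real (Suc k) * b * t)"
    have E: "E > 0" by (simp add: E_def)
    define w where "w = exp (- b * t)"
    have w: "0 \<le> w" "w \<le> 1" using t b by (auto simp: w_def)
    have zE: "(w\<^sup>2) ^ Suc k = E"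
      unfolding w_def E_def exp_of_nat_mult[symmetric] by (simp add: algebra_simps)
    have "(\<integral>x. (\<integral>z. g z \<partial>ou_law a w x)\<^sup>2 \<partial>gauss a) \<le> C3 * E + C2 * exp (2 * real (Suc k) * b) * E"
    proof (cases "t \<ge> 1")
      case True
      have w1: "w < 1" using True b by (simp add: w_def)
      have "w\<^sup>2 \<le> z0" using True b unfolding w_def z0_def exp_of_nat_mult[symmetric] by (simp add: mult.assoc)
      then have "(1 / (1 - w\<^sup>2)) ^ CARD('d) - (\<Sum>p\<in>{p :: 'd \<Rightarrow> nat. mi_size p \<le> k}. (w\<^sup>2) ^ mi_size p)
         \<le> ((1 / (1 - z0)) ^ CARD('d) * real CARD('d) + real (card (PiE (UNIV :: 'd set) (\<lambda>_. {..k})))) * E"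
        unfolding zE[symmetric] using z0 by (intro multiindex_tail_bound) auto
      then have "((1 / (1 - w\<^sup>2)) ^ CARD('d) - (\<Sum>p\<in>{p :: 'd \<Rightarrow> nat. mi_size p \<le> k}. (w\<^sup>2) ^ mi_size p)) * (\<integral>y. (g y)\<^sup>2 \<partial>gauss a)
         \<le> C3 * E"
        unfolding C3_def by (subst mult.commute[of _ E], subst mult.assoc[symmetric], subst mult.commute[of E]) (intro mult_right_mono, auto)
      then have "(\<integral>x. (\<integral>z. g z \<partial>ou_law a w x)\<^sup>2 \<partial>gauss a) \<le> C3 * E"
        using mehler_L2_le[where k = k, OF g w(1) w1 orth] unfolding a_def by linarith
      then show ?thesis using C4 E by (simp add: add_increasing2)
    next
      case False
      \<comment> \<open>For t < 1 the polynomial bound uniform in time suffices; the factor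
        \<open>exp (2 * real (Suc k) * b)\<close> compensates the decay over one unit of
        time.\<close>
      have "(\<integral>x. (\<integral>z. g z \<partial>ou_law a w x)\<^sup>2 \<partial>gauss a) \<le> C2"
        unfolding C2_def
      proof (rule Bochner_Integration.integral_mono)
        show "integrable (gauss a) (\<lambda>x. (\<integral>z. g z \<partial>ou_law a w x)\<^sup>2)"
          using w by (intro poly_bdd_integrable_gauss[OF a] poly_bdd_power poly_bdd_mehler[OF a g]) auto
        show "integrable (gauss a) (\<lambda>x::real^'d. (C1 * (1 + norm x ^ m))\<^sup>2)"
          by (intro poly_bdd_integrable_gauss[OF a] poly_bdd_power poly_bdd_cmult poly_bdd_add poly_bdd_const poly_bdd_norm)
        fix x :: "real^'d"
        have "\<bar>\<integral>z. g z \<partial>ou_law a w x\<bar> \<le> C1 * (1 + norm x ^ m)"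
          using integral_abs_bound[of "ou_law a w x" g] C1(2)[OF w, of x] by linarith
        then show "(\<integral>z. g z \<partial>ou_law a w x)\<^sup>2 \<le> (C1 * (1 + norm x ^ m))\<^sup>2"
          by (metis abs_ge_zero power2_abs power_mono)
      qed
      also have "\<dots> = C2 * 1" by simp
      also have "\<dots> \<le> C2 * (exp (2 * real (Suc k) * b) * E)"
      proof (intro mult_left_mono C2)
        have "2 * real (Suc k) * b * t \<le> 2 * real (Suc k) * b * 1"
          using False b by (intro mult_left_mono) auto
        then have "0 \<le> 2 * real (Suc k) * b + - 2 * real (Suc k) * b * t" by linarith
        then show "1 \<le> exp (2 * real (Suc k) * b) * E"
          unfolding E_def exp_add[symmetric] by (rule one_le_exp_iff[THEN iffD2])
      qed
      finally show ?thesis using C3 E by (simp add: add_increasing mult.assoc)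
    qed
    then show "(\<integral>x. (\<integral>z. g z \<partial>ou_law (b / \<sigma>\<^sup>2) (exp (- b * t)) x)\<^sup>2 \<partial>gauss (b / \<sigma>\<^sup>2))
     \<le> (C3 + C2 * exp (2 * real (Suc k) * b)) * exp (- 2 * real (Suc k) * b * t)"
      by (simp add: a_def w_def E_def distrib_right)
  qed
qed

end

section \<open>The Markov property for functions\<close>

context markov_family
begin

text \<open>The transition kernel as a map into \<open>subprob_algebra\<close>, so that integrals
  are measurable in the starting point and kernels can be composed by \<open>bind\<close>.\<close>

definition trans_kernel :: "real \<Rightarrow> 's \<Rightarrow> 's measure" where
  "trans_kernel t x = distr (P x) S (Y t)"

lemma space_P: "x \<in> space S \<Longrightarrow> space (P x) = space M"
  by (rule sets_eq_imp_space_eq[OF sets_P])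

lemma measurable_Y_P: "x \<in> space S \<Longrightarrow> 0 \<le> t \<Longrightarrow> Y t \<in> P x \<rightarrow>\<^sub>M S"
  by (subst measurable_cong_sets[OF sets_P refl]) (auto intro: measurable_Y)

lemma emeasure_trans_kernel:
  assumes "x \<in> space S" "0 \<le> t" "B \<in> sets S"
  shows "emeasure (trans_kernel t x) B = ennreal (measure (P x) (Y t -` B \<inter> space M))"
proof -
  interpret prob_space "P x" by (rule prob[OF assms(1)])
  show ?thesis
    using measurable_Y_P[OF assms(1,2)] assms
    by (simp add: trans_kernel_def emeasure_distr emeasure_eq_measure space_P)
qed

lemma prob_space_trans_kernel: "x \<in> space S \<Longrightarrow> 0 \<le> t \<Longrightarrow> prob_space (trans_kernel t x)"
  unfolding trans_kernel_def by (intro prob_space.prob_space_distr prob measurable_Y_P)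

lemma measurable_trans_kernel:
  assumes t: "0 \<le> t" shows "trans_kernel t \<in> S \<rightarrow>\<^sub>M subprob_algebra S"
proof (rule measurable_subprob_algebra)
  fix x assume x: "x \<in> space S"
  show "subprob_space (trans_kernel t x)"
    by (rule prob_space_imp_subprob_space[OF prob_space_trans_kernel[OF x t]])
  show "sets (trans_kernel t x) = sets S" by (simp add: trans_kernel_def)
next
  fix B assume B: "B \<in> sets S"
  have "(\<lambda>x. ennreal (measure (P x) (Y t -` B \<inter> space M))) \<in> borel_measurable S"
    using kernel[OF t B] by measurable
  then show "(\<lambda>x. emeasure (trans_kernel t x) B) \<in> borel_measurable S"
    by (subst measurable_cong[where g = "\<lambda>x. ennreal (measure (P x) (Y t -` B \<inter> space M))"])
      (auto simp: emeasure_trans_kernel t B)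
qed

lemma subalgebra_natural_filtration:
  assumes "x \<in> space S" "0 \<le> s"
  shows "subalgebra (P x) (natural_filtration S M Y s)"
proof -
  have sub: "{Y u -` B \<inter> space M | u B. 0 \<le> u \<and> u \<le> s \<and> B \<in> sets S} \<subseteq> sets M"
    using measurable_Y by (auto intro: measurable_sets)
  then have "{Y u -` B \<inter> space M | u B. 0 \<le> u \<and> u \<le> s \<and> B \<in> sets S} \<subseteq> Pow (space M)"
    using sets.space_closed by blast
  then show ?thesis
    unfolding subalgebra_def natural_filtration_def
    using sets.sigma_sets_subset[OF sub] by (simp add: space_P sets_P assms)
qed

text \<open>The event that \<open>Y s\<close> lies in C belongs to the natural filtration, so the
  conditional expectation can be integrated over it.\<close>

lemma markov_sets:
  assumes x: "x \<in> space S" and s: "0 \<le> s" and t: "0 \<le> t" and B: "B \<in> sets S" and C: "C \<in> sets S"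
  shows "(\<integral>\<^sup>+w. indicator C (Y s w) * indicator B (Y (s + t) w) \<partial>P x) =
    (\<integral>\<^sup>+w. indicator C (Y s w) * emeasure (trans_kernel t (Y s w)) B \<partial>P x)"
proof -
  interpret prob_space "P x" by (rule prob[OF x])
  define F where "F = natural_filtration S M Y s"
  interpret finite_measure_subalgebra "P x" F
    by standard (simp add: F_def subalgebra_natural_filtration[OF x s])
  note Ys = measurable_Y_P[OF x s]
  have Yst: "Y (s + t) \<in> P x \<rightarrow>\<^sub>M S" using s t by (intro measurable_Y_P[OF x]) auto
  define A where "A = Y s -` C \<inter> space M"
  define D where "D = Y (s + t) -` B \<inter> space M"
  have AF: "A \<in> sets F"
  proof -
    have "{Y u -` B \<inter> space M | u B. 0 \<le> u \<and> u \<le> s \<and> B \<in> sets S} \<subseteq> Pow (space M)"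
      by auto
    then show ?thesis
      unfolding F_def natural_filtration_def A_def using s C by (auto intro!: sigma_sets.Basic)
  qed
  have AM: "A \<in> sets (P x)" "D \<in> sets (P x)"
    using measurable_sets[OF Ys C] measurable_sets[OF Yst B] by (simp_all add: A_def D_def space_P x)
  define k where "k y = measure (P y) (Y t -` B \<inter> space M)" for y
  have k: "k \<in> borel_measurable S" unfolding k_def by (rule kernel[OF t B])
  have kY: "(\<lambda>w. k (Y s w)) \<in> borel_measurable (P x)" using measurable_compose[OF Ys k] .
  have k01: "0 \<le> k y" "y \<in> space S \<Longrightarrow> k y \<le> 1" for y
    using prob_space.prob_le_1[OF prob] by (auto simp: k_def)
  have intD: "integrable (P x) (indicat_real D)"
    using AM by (intro integrable_const_bound[where B=1]) (auto split: split_indicator)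
  have AE: "AE w in P x. real_cond_exp (P x) F (indicat_real D) w = k (Y s w)"
    using markov[OF x s t B] by (simp add: F_def D_def k_def)
  have YsS: "w \<in> space (P x) \<Longrightarrow> Y s w \<in> space S" for w
    using measurable_space[OF Ys] .
  have "(\<integral>w. indicat_real A w * indicat_real D w \<partial>P x) = (\<integral>w. indicat_real A w * k (Y s w) \<partial>P x)"
  proof -
    have "(\<integral>w\<in>A. indicat_real D w \<partial>P x) = (\<integral>w\<in>A. real_cond_exp (P x) F (indicat_real D) w \<partial>P x)"
      by (rule real_cond_exp_intA[OF intD AF])
    also have "\<dots> = (\<integral>w\<in>A. k (Y s w) \<partial>P x)"
      using AE kY AM unfolding set_lebesgue_integral_def by (intro integral_cong_AE) auto
    finally show ?thesis by (simp add: set_lebesgue_integral_def)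
  qed
  moreover have "(\<integral>\<^sup>+w. ennreal (indicat_real A w * indicat_real D w) \<partial>P x) = ennreal (\<integral>w. indicat_real A w * indicat_real D w \<partial>P x)"
    using AM by (intro nn_integral_eq_integral) (auto simp: integrable_mult_indicator intD
        intro!: integrable_const_bound[where B=1] split: split_indicator)
  moreover have "(\<integral>\<^sup>+w. ennreal (indicat_real A w * k (Y s w)) \<partial>P x) = ennreal (\<integral>w. indicat_real A w * k (Y s w) \<partial>P x)"
    using AM kY k01 YsS by (intro nn_integral_eq_integral integrable_const_bound[where B=1])
      (auto split: split_indicator)
  ultimately have "(\<integral>\<^sup>+w. ennreal (indicat_real A w * indicat_real D w) \<partial>P x) = (\<integral>\<^sup>+w. ennreal (indicat_real A w * k (Y s w)) \<partial>P x)"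
    by simp
  moreover have "(\<integral>\<^sup>+w. ennreal (indicat_real A w * indicat_real D w) \<partial>P x) = (\<integral>\<^sup>+w. indicator C (Y s w) * indicator B (Y (s + t) w) \<partial>P x)"
    by (intro nn_integral_cong) (auto simp: A_def D_def space_P x split: split_indicator)
  moreover have "(\<integral>\<^sup>+w. ennreal (indicat_real A w * k (Y s w)) \<partial>P x) = (\<integral>\<^sup>+w. indicator C (Y s w) * emeasure (trans_kernel t (Y s w)) B \<partial>P x)"
    using YsS by (intro nn_integral_cong) (auto simp: A_def k_def emeasure_trans_kernel t B space_P x split: split_indicator)
  ultimately show ?thesis by simp
qed

text \<open>Extension from sets to functions in two steps, each an equality of measures: with C
  fixed, as measures in B, to reach f; then with f fixed, as measures in C, to reach g.\<close>

lemma markov_nn_integral: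
  assumes x: "x \<in> space S" and s: "0 \<le> s" and t: "0 \<le> t"
    and g: "g \<in> borel_measurable S" and f: "f \<in> borel_measurable S"
  shows "(\<integral>\<^sup>+w. g (Y s w) * f (Y (s + t) w) \<partial>P x) =
    (\<integral>\<^sup>+w. g (Y s w) * (\<integral>\<^sup>+w'. f (Y t w') \<partial>P (Y s w)) \<partial>P x)"
proof -
  note Ys [measurable] = measurable_Y_P[OF x s]
  have Yst [measurable]: "Y (s + t) \<in> P x \<rightarrow>\<^sub>M S" using s t by (intro measurable_Y_P[OF x]) auto
  have YsS: "w \<in> space (P x) \<Longrightarrow> Y s w \<in> space S" for w
    using measurable_space[OF Ys] .
  note [measurable] = measurable_trans_kernel[OF t] f g
  have K [measurable]: "(\<lambda>w. trans_kernel t (Y s w)) \<in> P x \<rightarrow>\<^sub>M subprob_algebra S" by measurable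
  have kf: "(\<integral>\<^sup>+w'. f (Y t w') \<partial>P (Y s w)) = (\<integral>\<^sup>+y. f y \<partial>trans_kernel t (Y s w))" if "w \<in> space (P x)" for w
    unfolding trans_kernel_def using measurable_Y_P[OF YsS[OF that] t] f
    by (subst nn_integral_distr) auto
  have kf_meas [measurable]: "(\<lambda>w. \<integral>\<^sup>+y. f y \<partial>trans_kernel t (Y s w)) \<in> borel_measurable (P x)" by measurable
  have ne: "space (P x) \<noteq> {}" using prob_space.not_empty[OF prob[OF x]] .
  have step: "(\<integral>\<^sup>+w. indicator C (Y s w) * f (Y (s + t) w) \<partial>P x) =
    (\<integral>\<^sup>+w. indicator C (Y s w) * (\<integral>\<^sup>+y. f y \<partial>trans_kernel t (Y s w)) \<partial>P x)"
    if C [measurable]: "C \<in> sets S" for C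
  proof -
    \<comment> \<open>Weighting by the event \<open>Y s \<in> C\<close> turns
      \<open>markov_sets\<close> into the statement that the law of \<open>Y (s + t)\<close> is a
      mixture of transition kernels.\<close>
    define D where "D = density (P x) (\<lambda>w. indicator C (Y s w))"
    have [measurable_cong]: "sets D = sets (P x)" by (simp add: D_def)
    have neD: "space D \<noteq> {}" using ne by (simp add: D_def)
    have KD: "(\<lambda>w. trans_kernel t (Y s w)) \<in> D \<rightarrow>\<^sub>M subprob_algebra S" using K by (simp add: D_def)
    have "distr D S (Y (s + t)) = D \<bind> (\<lambda>w. trans_kernel t (Y s w))"
    proof (rule measure_eqI)
      show "sets (distr D S (Y (s + t))) = sets (D \<bind> (\<lambda>w. trans_kernel t (Y s w)))"
        using neD by (simp add: trans_kernel_def)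
      fix B assume "B \<in> sets (distr D S (Y (s + t)))"
      then have B [measurable]: "B \<in> sets S" by simp
      have "emeasure (distr D S (Y (s + t))) B = (\<integral>\<^sup>+w. indicator B (Y (s + t) w) \<partial>D)"
      proof -
        have "emeasure (distr D S (Y (s + t))) B = (\<integral>\<^sup>+y. indicator B y \<partial>distr D S (Y (s + t)))" by simp
        also have "\<dots> = (\<integral>\<^sup>+w. indicator B (Y (s + t) w) \<partial>D)" by (rule nn_integral_distr) auto
        finally show ?thesis .
      qed
      also have "\<dots> = (\<integral>\<^sup>+w. indicator C (Y s w) * indicator B (Y (s + t) w) \<partial>P x)"
        unfolding D_def by (subst nn_integral_density) auto
      also have "\<dots> = (\<integral>\<^sup>+w. indicator C (Y s w) * emeasure (trans_kernel t (Y s w)) B \<partial>P x)"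
        by (rule markov_sets[OF x s t B C])
      also have "\<dots> = (\<integral>\<^sup>+w. emeasure (trans_kernel t (Y s w)) B \<partial>D)"
        unfolding D_def by (subst nn_integral_density) auto
      also have "\<dots> = emeasure (D \<bind> (\<lambda>w. trans_kernel t (Y s w))) B"
        by (rule emeasure_bind[OF neD KD B, symmetric])
      finally show "emeasure (distr D S (Y (s + t))) B = emeasure (D \<bind> (\<lambda>w. trans_kernel t (Y s w))) B" .
    qed
    then have "(\<integral>\<^sup>+y. f y \<partial>distr D S (Y (s + t))) = (\<integral>\<^sup>+y. f y \<partial>(D \<bind> (\<lambda>w. trans_kernel t (Y s w))))"
      by simp
    also have "\<dots> = (\<integral>\<^sup>+w. (\<integral>\<^sup>+y. f y \<partial>trans_kernel t (Y s w)) \<partial>D)"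
      by (rule nn_integral_bind[where B = S]) auto
    also have "(\<integral>\<^sup>+y. f y \<partial>distr D S (Y (s + t))) = (\<integral>\<^sup>+w. f (Y (s + t) w) \<partial>D)"
      by (rule nn_integral_distr) auto
    finally show ?thesis
      unfolding D_def by (simp add: nn_integral_density)
  qed
  \<comment> \<open>Now f is fixed: both weights, pushed forward by \<open>Y s\<close>, give the
    same mass to every C by \<open>step\<close>.\<close>
  have "distr (density (P x) (\<lambda>w. f (Y (s + t) w))) S (Y s) =
      distr (density (P x) (\<lambda>w. \<integral>\<^sup>+y. f y \<partial>trans_kernel t (Y s w))) S (Y s)" (is "?D1 = ?D2")
  proof (rule measure_eqI)
    fix C assume "C \<in> sets ?D1"
    then have C [measurable]: "C \<in> sets S" by simp
    have ind: "(\<integral>\<^sup>+w. h w * indicator (Y s -` C \<inter> space (P x)) w \<partial>P x) = (\<integral>\<^sup>+w. indicator C (Y s w) * h w \<partial>P x)" for h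
      by (intro nn_integral_cong) (auto split: split_indicator)
    have "emeasure ?D1 C = (\<integral>\<^sup>+w. indicator C (Y s w) * f (Y (s + t) w) \<partial>P x)"
      by (subst emeasure_distr) (auto simp: emeasure_density ind)
    also have "\<dots> = (\<integral>\<^sup>+w. indicator C (Y s w) * (\<integral>\<^sup>+y. f y \<partial>trans_kernel t (Y s w)) \<partial>P x)"
      by (rule step[OF C])
    also have "\<dots> = emeasure ?D2 C"
      by (subst emeasure_distr) (auto simp: emeasure_density ind)
    finally show "emeasure ?D1 C = emeasure ?D2 C" .
  qed simp
  then have "(\<integral>\<^sup>+y. g y \<partial>?D1) = (\<integral>\<^sup>+y. g y \<partial>?D2)" by simp
  then have "(\<integral>\<^sup>+w. g (Y s w) * f (Y (s + t) w) \<partial>P x) = (\<integral>\<^sup>+w. g (Y s w) * (\<integral>\<^sup>+y. f y \<partial>trans_kernel t (Y s w)) \<partial>P x)"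
    by (simp add: nn_integral_distr nn_integral_density mult.commute)
  also have "\<dots> = (\<integral>\<^sup>+w. g (Y s w) * (\<integral>\<^sup>+w'. f (Y t w') \<partial>P (Y s w)) \<partial>P x)"
    by (intro nn_integral_cong) (simp add: kf)
  finally show ?thesis .
qed

text \<open>Adding the bound C makes f nonnegative and reduces the claim to
  \<open>markov_nn_integral\<close>.\<close>

lemma markov_integral:
  fixes f :: "'s \<Rightarrow> real"
  assumes x: "x \<in> space S" and s: "0 \<le> s" and t: "0 \<le> t"
    and f: "f \<in> borel_measurable S" and bd: "\<And>y. \<bar>f y\<bar> \<le> C"
  shows "(\<integral>w. f (Y (s + t) w) \<partial>P x) = (\<integral>w. (\<integral>w'. f (Y t w') \<partial>P (Y s w)) \<partial>P x)"
proof -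
  interpret prob_space "P x" by (rule prob[OF x])
  note Ys [measurable] = measurable_Y_P[OF x s]
  have Yst [measurable]: "Y (s + t) \<in> P x \<rightarrow>\<^sub>M S" using s t by (intro measurable_Y_P[OF x]) auto
  have YsS: "w \<in> space (P x) \<Longrightarrow> Y s w \<in> space S" for w
    using measurable_space[OF Ys] .
  note [measurable] = measurable_trans_kernel[OF t] f
  have C0: "0 \<le> C" using bd[of undefined] by linarith
  define h where "h y = f y + C" for y
  have h: "0 \<le> h y" "h y \<le> 2 * C" for y using bd[of y] by (auto simp: h_def)
  have [measurable]: "h \<in> borel_measurable S" unfolding h_def by measurable
  have inth: "integrable (P x) (\<lambda>w. h (Y (s + t) w))" "integrable (P x) (\<lambda>w. f (Y (s + t) w))"
    using h bd by (intro integrable_const_bound[where B="2 * C"], auto, intro integrable_const_bound[where B=C], auto)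
  have kern: "prob_space (P (Y s w))" "Y t \<in> P (Y s w) \<rightarrow>\<^sub>M S" if "w \<in> space (P x)" for w
    using prob[OF YsS[OF that]] measurable_Y_P[OF YsS[OF that] t] by auto
  have inner: "integrable (P (Y s w)) (\<lambda>w'. f (Y t w'))" if w: "w \<in> space (P x)" for w
  proof -
    interpret Q: prob_space "P (Y s w)" by (rule kern(1)[OF w])
    note [measurable] = kern(2)[OF w]
    show ?thesis using bd by (intro Q.integrable_const_bound[where B=C]) auto
  qed
  have innerh: "(\<integral>w'. h (Y t w') \<partial>P (Y s w)) = (\<integral>w'. f (Y t w') \<partial>P (Y s w)) + C"
      "(\<integral>\<^sup>+w'. ennreal (h (Y t w')) \<partial>P (Y s w)) = ennreal (\<integral>w'. h (Y t w') \<partial>P (Y s w))"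
      "\<bar>\<integral>w'. f (Y t w') \<partial>P (Y s w)\<bar> \<le> C" if w: "w \<in> space (P x)" for w
  proof -
    interpret Q: prob_space "P (Y s w)" by (rule kern(1)[OF w])
    note [measurable] = kern(2)[OF w]
    show "(\<integral>w'. h (Y t w') \<partial>P (Y s w)) = (\<integral>w'. f (Y t w') \<partial>P (Y s w)) + C"
      unfolding h_def using inner[OF w] by (simp add: Q.prob_space)
    show "(\<integral>\<^sup>+w'. ennreal (h (Y t w')) \<partial>P (Y s w)) = ennreal (\<integral>w'. h (Y t w') \<partial>P (Y s w))"
      using h inner[OF w] by (intro nn_integral_eq_integral) (auto simp: h_def)
    have "\<bar>\<integral>w'. f (Y t w') \<partial>P (Y s w)\<bar> \<le> (\<integral>w'. \<bar>f (Y t w')\<bar> \<partial>P (Y s w))"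
      by (rule integral_abs_bound)
    also have "\<dots> \<le> (\<integral>w'. C \<partial>P (Y s w))"
      using inner[OF w] bd by (intro Bochner_Integration.integral_mono) auto
    finally show "\<bar>\<integral>w'. f (Y t w') \<partial>P (Y s w)\<bar> \<le> C" by (simp add: Q.prob_space)
  qed
  have innernn: "0 \<le> (\<integral>w'. f (Y t w') \<partial>P (Y s w)) + C" if "w \<in> space (P x)" for w
    using innerh(3)[OF that] by linarith
  have meas: "(\<lambda>w. \<integral>w'. f (Y t w') \<partial>P (Y s w)) \<in> borel_measurable (P x)"
  proof -
    have "(\<lambda>w. \<integral>y. f y \<partial>trans_kernel t (Y s w)) \<in> borel_measurable (P x)" by measurable
    then show ?thesis
    proof (rule measurable_cong[THEN iffD1, rotated])
      fix w assume w: "w \<in> space (P x)"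
      show "(\<integral>y. f y \<partial>trans_kernel t (Y s w)) = (\<integral>w'. f (Y t w') \<partial>P (Y s w))"
        unfolding trans_kernel_def by (rule integral_distr[OF kern(2)[OF w] f])
    qed
  qed
  have int2: "integrable (P x) (\<lambda>w. \<integral>w'. f (Y t w') \<partial>P (Y s w))"
    using meas innerh(3) by (intro integrable_const_bound[where B=C]) auto
  have "ennreal (\<integral>w. h (Y (s + t) w) \<partial>P x) = (\<integral>\<^sup>+w. 1 * ennreal (h (Y (s + t) w)) \<partial>P x)"
    using inth h by (subst nn_integral_eq_integral[symmetric]) auto
  also have "\<dots> = (\<integral>\<^sup>+w. 1 * (\<integral>\<^sup>+w'. ennreal (h (Y t w')) \<partial>P (Y s w)) \<partial>P x)"
    by (rule markov_nn_integral[OF x s t, where g="\<lambda>_. 1"]) auto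
  also have "\<dots> = (\<integral>\<^sup>+w. ennreal ((\<integral>w'. f (Y t w') \<partial>P (Y s w)) + C) \<partial>P x)"
    by (intro nn_integral_cong) (simp add: innerh(1,2))
  also have "\<dots> = ennreal (\<integral>w. (\<integral>w'. f (Y t w') \<partial>P (Y s w)) + C \<partial>P x)"
    using int2 innernn by (intro nn_integral_eq_integral) (auto intro!: AE_I2)
  finally have "(\<integral>w. h (Y (s + t) w) \<partial>P x) = (\<integral>w. (\<integral>w'. f (Y t w') \<partial>P (Y s w)) + C \<partial>P x)"
    using h innernn by (subst (asm) ennreal_inj) (auto intro!: integral_nonneg_AE AE_I2)
  then show ?thesis
    unfolding h_def using inth(2) int2 by (simp add: prob_space)
qed

end

section \<open>Test functions\<close>

lemma DERIV_pos_part_sq: "((\<lambda>z::real. (max 0 z)\<^sup>2) has_real_derivative 2 * max 0 z) (at z)"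
proof (cases "z = 0")
  case True
  have "(\<lambda>h::real. ((max 0 (0 + h))\<^sup>2 - (max 0 0)\<^sup>2) / h) \<midarrow>0\<rightarrow> 0"
  proof (rule Lim_null_comparison)
    show "\<forall>\<^sub>F h::real in at 0. norm (((max 0 (0 + h))\<^sup>2 - (max 0 0)\<^sup>2) / h) \<le> \<bar>h\<bar>"
      by (intro always_eventually) (auto simp: max_def power2_eq_square)
    show "((\<lambda>h::real. \<bar>h\<bar>) \<longlongrightarrow> 0) (at 0)"
      by (rule tendsto_rabs_zero) (rule tendsto_ident_at)
  qed
  then show ?thesis using True by (simp add: DERIV_def)
next
  case False
  then consider "z > 0" | "z < 0" by linarith
  then show ?thesis
  proof cases
    case 1
    have "((\<lambda>z::real. z\<^sup>2) has_real_derivative 2 * max 0 z) (at z)"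
      using 1 by (auto intro!: derivative_eq_intros)
    then show ?thesis
      by (rule has_field_derivative_transform_within_open[of _ _ _ "{0<..}"]) (use 1 in auto)
  next
    case 2
    have "((\<lambda>z::real. 0) has_real_derivative 2 * max 0 z) (at z)"
      using 2 by (auto intro!: derivative_eq_intros)
    then show ?thesis
      by (rule has_field_derivative_transform_within_open[of _ _ _ "{..<0}"]) (use 2 in auto)
  qed
qed

lemma DERIV_pos_part_cube: "((\<lambda>z::real. (max 0 z) ^ 3) has_real_derivative 3 * (max 0 z)\<^sup>2) (at z)"
proof -
  have "((\<lambda>z::real. z * (max 0 z)\<^sup>2) has_real_derivative (1 * (max 0 z)\<^sup>2 + 2 * max 0 z * z)) (at z)"
    by (intro DERIV_mult DERIV_pos_part_sq DERIV_ident)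
  moreover have "(\<lambda>z::real. z * (max 0 z)\<^sup>2) = (\<lambda>z. (max 0 z) ^ 3)"
    by (auto simp: max_def power3_eq_cube power2_eq_square)
  moreover have "1 * (max 0 z)\<^sup>2 + 2 * max 0 z * z = 3 * (max 0 z)\<^sup>2"
    by (auto simp: max_def power2_eq_square)
  ultimately show ?thesis by (simp only:)
qed

text \<open>The scale w is kept apart from p because the Mehler semigroup sends a bump in y to a
  bump in \<open>exp (- b * r) *\<^sub>R y\<close> with the same centre m.\<close>

definition bump :: "real \<Rightarrow> real \<Rightarrow> real^'d::finite \<Rightarrow> real^'d \<Rightarrow> real" where
  "bump p w m x = exp (- p * ((w *\<^sub>R x - m) \<bullet> (w *\<^sub>R x - m)))"

definition cutoff :: "real \<Rightarrow> real^'d::finite \<Rightarrow> real" where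
  "cutoff R x = max 0 (1 - (x \<bullet> x) / R\<^sup>2)"

lemma bump_has_derivative:
  "(bump p w m has_derivative (\<lambda>y. bump p w m x * (- 2 * p * w * ((w *\<^sub>R x - m) \<bullet> y)))) (at x)"
  unfolding bump_def
  by (rule derivative_eq_intros refl)+ (simp add: fun_eq_iff inner_commute algebra_simps)

lemma inner_self_has_derivative:
  "((\<lambda>x::real^'d::finite. 1 - (x \<bullet> x) / R\<^sup>2) has_derivative (\<lambda>y. - 2 * (x \<bullet> y) / R\<^sup>2)) (at x)"
proof -
  have "((\<lambda>x. 1 - (1 / R\<^sup>2) * (x \<bullet> x)) has_derivative (\<lambda>y. 0 - (1 / R\<^sup>2) * (x \<bullet> y + y \<bullet> x))) (at x)"
    by (intro has_derivative_diff has_derivative_const has_derivative_mult_right has_derivative_inner has_derivative_ident)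
  then show ?thesis by (simp add: inner_commute)
qed

lemma cutoff_sq_has_derivative:
  "((\<lambda>x::real^'d::finite. (cutoff R x)\<^sup>2) has_derivative (\<lambda>y. 2 * cutoff R x * (- 2 * (x \<bullet> y) / R\<^sup>2))) (at x)"
  using has_derivative_compose[OF inner_self_has_derivative has_field_derivative_imp_has_derivative[OF DERIV_pos_part_sq]]
  unfolding cutoff_def by simp

lemma cutoff_cube_has_derivative:
  "((\<lambda>x::real^'d::finite. (cutoff R x) ^ 3) has_derivative (\<lambda>y. 3 * (cutoff R x)\<^sup>2 * (- 2 * (x \<bullet> y) / R\<^sup>2))) (at x)"
  using has_derivative_compose[OF inner_self_has_derivative has_field_derivative_imp_has_derivative[OF DERIV_pos_part_cube]]
  unfolding cutoff_def by simp

lemma component_has_derivative: "((\<lambda>x::real^'d::finite. x $ i) has_derivative (\<lambda>y. y $ i)) (at x)"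
  by (rule bounded_linear_imp_has_derivative[OF bounded_linear_vec_nth])

text \<open>The cube of a positive part is twice continuously differentiable, so the cut bump lies
  in the class on which the generator is prescribed.\<close>

definition cut_bump :: "real \<Rightarrow> real \<Rightarrow> real^'d::finite \<Rightarrow> real \<Rightarrow> real^'d \<Rightarrow> real" where
  "cut_bump p w m R x = bump p w m x * (cutoff R x) ^ 3"

definition cut_bump' :: "real \<Rightarrow> real \<Rightarrow> real^'d::finite \<Rightarrow> real \<Rightarrow> 'd \<Rightarrow> real^'d \<Rightarrow> real" where
  "cut_bump' p w m R i x = bump p w m x *
     (- 2 * p * w * (w * x $ i - m $ i) * (cutoff R x) ^ 3 - 6 / R\<^sup>2 * x $ i * (cutoff R x)\<^sup>2)"

text \<open>The differential of \<open>cut_bump' p w m R i\<close> at x in direction y; second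
  partial derivatives are its values at \<open>y = axis j 1\<close>.\<close>

definition cut_bump'' :: "real \<Rightarrow> real \<Rightarrow> real^'d::finite \<Rightarrow> real \<Rightarrow> 'd \<Rightarrow> real^'d \<Rightarrow> real^'d \<Rightarrow> real" where
  "cut_bump'' p w m R i x y = bump p w m x *
     ((- 2 * p * w * ((w *\<^sub>R x - m) \<bullet> y)) * (- 2 * p * w * (w * x $ i - m $ i) * (cutoff R x) ^ 3 - 6 / R\<^sup>2 * x $ i * (cutoff R x)\<^sup>2)
      + (- 2 * p * w * (w * y $ i * (cutoff R x) ^ 3 + (w * x $ i - m $ i) * (3 * (cutoff R x)\<^sup>2 * (- 2 * (x \<bullet> y) / R\<^sup>2)))
         - 6 / R\<^sup>2 * (y $ i * (cutoff R x)\<^sup>2 + x $ i * (2 * cutoff R x * (- 2 * (x \<bullet> y) / R\<^sup>2)))))"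

lemma cut_bump_has_derivative:
  "(cut_bump p w m R has_derivative (\<lambda>y. \<Sum>i\<in>UNIV. cut_bump' p w m R i x * y $ i)) (at x)"
proof -
  have "(cut_bump p w m R has_derivative (\<lambda>y. bump p w m x * (3 * (cutoff R x)\<^sup>2 * (- 2 * (x \<bullet> y) / R\<^sup>2))
      + bump p w m x * (- 2 * p * w * ((w *\<^sub>R x - m) \<bullet> y)) * (cutoff R x) ^ 3)) (at x)"
    unfolding cut_bump_def by (intro has_derivative_mult bump_has_derivative cutoff_cube_has_derivative)
  moreover have "bump p w m x * (3 * (cutoff R x)\<^sup>2 * (- 2 * (x \<bullet> y) / R\<^sup>2))
      + bump p w m x * (- 2 * p * w * ((w *\<^sub>R x - m) \<bullet> y)) * (cutoff R x) ^ 3 = (\<Sum>i\<in>UNIV. cut_bump' p w m R i x * y $ i)" for y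
  proof -
    have e1: "(\<Sum>i\<in>UNIV. cut_bump' p w m R i x * y $ i) =
      bump p w m x * ((- 2 * p * w * (cutoff R x) ^ 3) * (\<Sum>i\<in>UNIV. (w * x $ i - m $ i) * y $ i) - 6 / R\<^sup>2 * (cutoff R x)\<^sup>2 * (\<Sum>i\<in>UNIV. x $ i * y $ i))"
      unfolding cut_bump'_def sum_distrib_left sum_subtractf[symmetric]
      by (intro sum.cong refl) (simp add: algebra_simps)
    have e2: "(\<Sum>i\<in>UNIV. (w * x $ i - m $ i) * y $ i) = (w *\<^sub>R x - m) \<bullet> y" "(\<Sum>i\<in>UNIV. x $ i * y $ i) = x \<bullet> y"
      by (simp_all add: inner_vec_def)
    show ?thesis unfolding e1 e2 by (simp add: algebra_simps)
  qed
  ultimately show ?thesis by simp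
qed

lemma cut_bump'_has_derivative:
  "(cut_bump' p w m R i has_derivative cut_bump'' p w m R i x) (at x)"
proof -
  have "((\<lambda>x. w * x $ i - m $ i) has_derivative (\<lambda>y. w * y $ i - 0)) (at x)"
    by (intro has_derivative_diff has_derivative_mult_right component_has_derivative has_derivative_const)
  then have 1: "((\<lambda>x. w * x $ i - m $ i) has_derivative (\<lambda>y. w * y $ i)) (at x)" by simp
  have "((\<lambda>x. bump p w m x *
     (- 2 * p * w * ((w * x $ i - m $ i) * (cutoff R x) ^ 3) - 6 / R\<^sup>2 * (x $ i * (cutoff R x)\<^sup>2))) has_derivative
     (\<lambda>y. bump p w m x *
        (- 2 * p * w * ((w * x $ i - m $ i) * (3 * (cutoff R x)\<^sup>2 * (- 2 * (x \<bullet> y) / R\<^sup>2)) + w * y $ i * (cutoff R x) ^ 3)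
          - 6 / R\<^sup>2 * (x $ i * (2 * cutoff R x * (- 2 * (x \<bullet> y) / R\<^sup>2)) + y $ i * (cutoff R x)\<^sup>2))
      + bump p w m x * (- 2 * p * w * ((w *\<^sub>R x - m) \<bullet> y)) *
          (- 2 * p * w * ((w * x $ i - m $ i) * (cutoff R x) ^ 3) - 6 / R\<^sup>2 * (x $ i * (cutoff R x)\<^sup>2)))) (at x)"
    by (intro has_derivative_mult has_derivative_diff has_derivative_mult_right 1 component_has_derivative
        bump_has_derivative cutoff_cube_has_derivative cutoff_sq_has_derivative)
  moreover have "(\<lambda>x. bump p w m x *
     (- 2 * p * w * ((w * x $ i - m $ i) * (cutoff R x) ^ 3) - 6 / R\<^sup>2 * (x $ i * (cutoff R x)\<^sup>2))) = cut_bump' p w m R i"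
    by (simp add: fun_eq_iff cut_bump'_def mult.assoc)
  moreover have "(\<lambda>y. bump p w m x *
        (- 2 * p * w * ((w * x $ i - m $ i) * (3 * (cutoff R x)\<^sup>2 * (- 2 * (x \<bullet> y) / R\<^sup>2)) + w * y $ i * (cutoff R x) ^ 3)
          - 6 / R\<^sup>2 * (x $ i * (2 * cutoff R x * (- 2 * (x \<bullet> y) / R\<^sup>2)) + y $ i * (cutoff R x)\<^sup>2))
      + bump p w m x * (- 2 * p * w * ((w *\<^sub>R x - m) \<bullet> y)) *
          (- 2 * p * w * ((w * x $ i - m $ i) * (cutoff R x) ^ 3) - 6 / R\<^sup>2 * (x $ i * (cutoff R x)\<^sup>2))) = cut_bump'' p w m R i x"
    unfolding cut_bump''_def by (rule ext) (simp only: distrib_left mult.assoc add_ac)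
  ultimately show ?thesis by simp
qed

lemma partial_eq:
  assumes "(f has_derivative f') (at x)"
  shows "partial i f x = f' (axis i 1)"
  unfolding partial_def frechet_derivative_at[OF assms, symmetric] ..

lemma partial_cut_bump: "partial i (cut_bump p w m R) = cut_bump' p w m R i"
proof
  fix x
  have "partial i (cut_bump p w m R) x = (\<Sum>j\<in>UNIV. cut_bump' p w m R j x * axis i 1 $ j)"
    by (rule partial_eq[OF cut_bump_has_derivative])
  also have "\<dots> = (\<Sum>j\<in>UNIV. if j = i then cut_bump' p w m R j x else 0)"
    by (intro sum.cong) (auto simp: axis_def)
  finally show "partial i (cut_bump p w m R) x = cut_bump' p w m R i x" by simp
qed

lemma partial_cut_bump': "partial j (cut_bump' p w m R i) = (\<lambda>x. cut_bump'' p w m R i x (axis j 1))"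
  by (rule ext) (rule partial_eq[OF cut_bump'_has_derivative])

lemma continuous_bump: "continuous_on S (bump p w m)"
  unfolding bump_def by (intro continuous_intros)

lemma continuous_cutoff: "R > 0 \<Longrightarrow> continuous_on S (cutoff R)"
  unfolding cutoff_def by (intro continuous_intros) auto

lemma cutoff_bounds: "0 \<le> cutoff R x" "cutoff R x \<le> 1"
  by (auto simp: cutoff_def)

lemma C2_cut_bump:
  fixes m :: "real^'d::finite"
  assumes R: "R > 0"
  shows "C2_compact_support (cut_bump p w m R)"
proof -
  have "{x. cut_bump p w m R x \<noteq> 0} \<subseteq> cball 0 R"
  proof
    fix x :: "real^'d" assume "x \<in> {x. cut_bump p w m R x \<noteq> 0}"
    then have "cutoff R x \<noteq> 0" by (auto simp: cut_bump_def)
    then have "(x \<bullet> x) / R\<^sup>2 < 1"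
      unfolding cutoff_def by (metis diff_gt_0_iff_gt max.absorb1 not_le)
    then have "(norm x)\<^sup>2 < R\<^sup>2" using R by (simp add: power2_norm_eq_inner)
    then show "x \<in> cball 0 R" using R by (simp add: power_less_imp_less_base less_imp_le)
  qed
  then have "bounded {x. cut_bump p w m R x \<noteq> 0}"
    using bounded_cball bounded_subset by blast
  then have "compact (closure {x. cut_bump p w m R x \<noteq> 0})" by (simp add: compact_closure)
  moreover have "continuous_on UNIV (\<lambda>x. cut_bump'' p w m R i x (axis j 1))" for i j
    unfolding cut_bump''_def by (intro continuous_intros continuous_bump continuous_cutoff R) (use R in auto)
  moreover have "cut_bump p w m R differentiable_on UNIV" "cut_bump' p w m R i differentiable_on UNIV" for i
    unfolding differentiable_on_def differentiable_def
    by (blast intro: has_derivative_at_withinI cut_bump_has_derivative cut_bump'_has_derivative)+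
  ultimately show ?thesis
    unfolding C2_compact_support_def partial_cut_bump partial_cut_bump' by blast
qed

text \<open>The Ornstein-Uhlenbeck operator applied to the bump without cutoff.\<close>

definition bump_gen :: "real \<Rightarrow> real \<Rightarrow> real \<Rightarrow> real \<Rightarrow> real^'d::finite \<Rightarrow> real^'d \<Rightarrow> real" where
  "bump_gen b \<sigma> p w m x = bump p w m x *
     (1 / 2 * \<sigma>\<^sup>2 * (4 * p\<^sup>2 * w\<^sup>2 * ((w *\<^sub>R x - m) \<bullet> (w *\<^sub>R x - m)) - 2 * p * w\<^sup>2 * real CARD('d)) + 2 * b * p * w * ((w *\<^sub>R x - m) \<bullet> x))"

text \<open>All terms caused by derivatives of the cutoff carry a factor
  \<open>1 / R\<^sup>2\<close>: for fixed x they vanish as R grows, and for R \<ge> 1 they are at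
  most quadratic in x before the bump is multiplied in.\<close>

lemma OU_operator_cut_bump:
  fixes m x :: "real^'d::finite" and w R :: real
  defines "u \<equiv> w *\<^sub>R x - m" and "P \<equiv> cutoff R x"
  shows "OU_operator b \<sigma> (cut_bump p w m R) x = bump p w m x *
    (1 / 2 * \<sigma>\<^sup>2 * (4 * p\<^sup>2 * w\<^sup>2 * (u \<bullet> u) * P ^ 3 + 24 * p * w / R\<^sup>2 * (u \<bullet> x) * P\<^sup>2 - 2 * p * w\<^sup>2 * real CARD('d) * P ^ 3
        - 6 * real CARD('d) / R\<^sup>2 * P\<^sup>2 + 24 / R\<^sup>2 * ((x \<bullet> x) / R\<^sup>2) * P)
     + b * (2 * p * w * (u \<bullet> x) * P ^ 3 + 6 / R\<^sup>2 * (x \<bullet> x) * P\<^sup>2))"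
proof -
  define G where "G = bump p w m x"
  have ax: "v \<bullet> axis i 1 = v $ i" for v :: "real^'d" and i by (simp add: inner_axis)
  have u: "w * x $ i - m $ i = u $ i" for i by (simp add: u_def)
  have s: "(\<Sum>i\<in>UNIV. v $ i * z $ i) = v \<bullet> z" for v z :: "real^'d" by (simp add: inner_vec_def)
  have F: "cut_bump'' p w m R i x (axis i 1) = G * (4 * p\<^sup>2 * w\<^sup>2 * P ^ 3 * (u $ i * u $ i) + 24 * p * w / R\<^sup>2 * P\<^sup>2 * (u $ i * x $ i)
     - (2 * p * w\<^sup>2 * P ^ 3 + 6 / R\<^sup>2 * P\<^sup>2) + 24 / R\<^sup>2 * P / R\<^sup>2 * (x $ i * x $ i))" for i
    unfolding cut_bump''_def u_def[symmetric] P_def[symmetric] G_def[symmetric] ax u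
    by (simp add: algebra_simps power2_eq_square)
  have 1: "(\<Sum>i\<in>UNIV. cut_bump'' p w m R i x (axis i 1)) =
    G * (4 * p\<^sup>2 * w\<^sup>2 * P ^ 3 * (u \<bullet> u) + 24 * p * w / R\<^sup>2 * P\<^sup>2 * (u \<bullet> x)
     - real CARD('d) * (2 * p * w\<^sup>2 * P ^ 3 + 6 / R\<^sup>2 * P\<^sup>2) + 24 / R\<^sup>2 * P / R\<^sup>2 * (x \<bullet> x))"
    by (simp only: F sum_distrib_left[symmetric] sum.distrib sum_subtractf s sum_constant) (simp add: algebra_simps)
  have "x $ i * cut_bump' p w m R i x = G * (- 2 * p * w * P ^ 3 * (u $ i * x $ i) - 6 / R\<^sup>2 * P\<^sup>2 * (x $ i * x $ i))" for i
    unfolding cut_bump'_def P_def[symmetric] G_def[symmetric] u by (simp add: algebra_simps)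
  then have 2: "(\<Sum>i\<in>UNIV. x $ i * cut_bump' p w m R i x) = G * (- 2 * p * w * P ^ 3 * (u \<bullet> x) - 6 / R\<^sup>2 * P\<^sup>2 * (x \<bullet> x))"
    by (simp only: sum_distrib_left[symmetric] sum_subtractf s)
  show ?thesis
    unfolding OU_operator_def partial_cut_bump partial_cut_bump' 1 2 G_def[symmetric]
    by (simp add: algebra_simps)
qed

text \<open>The Gaussian beats quadratic growth: with q = |w x - m|^2, the product
  \<open>q * exp (- p * q)\<close> is at most 1 / p, and |x|^2 is controlled by q and m because w is
  nonzero.\<close>

lemma bump_poly_bounded:
  fixes m :: "real^'d::finite"
  assumes p: "p > 0" and w: "w \<noteq> 0"
  obtains C where "C \<ge> 0" "\<And>x. bump p w m x * (1 + x \<bullet> x) \<le> C"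
proof -
  define C where "C = 1 + (2 / p + 2 * (m \<bullet> m)) / w\<^sup>2"
  show thesis
  proof (rule that)
    show "C \<ge> 0" using p by (simp add: C_def)
    fix x :: "real^'d"
    define u where "u = w *\<^sub>R x - m"
    define q where "q = u \<bullet> u"
    have q: "0 \<le> q" by (simp add: q_def)
    have "w\<^sup>2 * (x \<bullet> x) = (u + m) \<bullet> (u + m)" by (simp add: u_def power2_eq_square)
    also have "\<dots> \<le> 2 * q + 2 * (m \<bullet> m)"
    proof -
      have "0 \<le> (u - m) \<bullet> (u - m)" by simp
      then show ?thesis by (simp add: q_def inner_add_left inner_add_right inner_diff_left inner_diff_right inner_commute)
    qed
    finally have x: "x \<bullet> x \<le> (2 * q + 2 * (m \<bullet> m)) / w\<^sup>2" using w by (simp add: field_simps)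
    have e: "exp (- p * q) \<le> 1" using p q by simp
    have "p * q \<le> exp (p * q)" using exp_ge_add_one_self[of "p * q"] by linarith
    then have "q * exp (- p * q) \<le> 1 / p" using p by (simp add: exp_minus field_simps)
    then have eq: "exp (- p * q) * (2 * q) \<le> 2 / p" by (simp add: field_simps)
    have "bump p w m x * (1 + x \<bullet> x) \<le> exp (- p * q) * (1 + (2 * q + 2 * (m \<bullet> m)) / w\<^sup>2)"
      using x unfolding bump_def u_def[symmetric] q_def[symmetric] by (intro mult_left_mono) auto
    also have "\<dots> = exp (- p * q) + (exp (- p * q) * (2 * q) + exp (- p * q) * (2 * (m \<bullet> m))) / w\<^sup>2"
      by (simp add: distrib_left add_divide_distrib)
    also have "\<dots> \<le> 1 + (2 / p + 1 * (2 * (m \<bullet> m))) / w\<^sup>2"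
      by (intro add_mono divide_right_mono mult_right_mono e eq) auto
    finally show "bump p w m x * (1 + x \<bullet> x) \<le> C" by (simp add: C_def)
  qed
qed

text \<open>A bound uniform in the radius, so that a constant can serve as dominating function when
  the cutoff is removed.\<close>

lemma OU_operator_cut_bump_bounded:
  fixes m :: "real^'d::finite"
  assumes p: "p > 0" and w: "w \<noteq> 0"
  obtains C where "\<And>R x. R \<ge> 1 \<Longrightarrow> \<bar>OU_operator b \<sigma> (cut_bump p w m R) x\<bar> \<le> C"
proof -
  obtain C0 where C0: "C0 \<ge> 0" "\<And>x. bump p w m x * (1 + x \<bullet> x) \<le> C0"
    using bump_poly_bounded[OF p w] by metis
  \<comment> \<open>Chosen so that \<open>u \<bullet> u\<close> and
    \<open>\<bar>u \<bullet> x\<bar>\<close> are both at most k (1 + |x|^2).\<close>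
  define k where "k = 2 * w\<^sup>2 + 2 * (m \<bullet> m) + 1"
  have k: "k \<ge> 1" by (simp add: k_def)
  define K where "K = 1 / 2 * \<sigma>\<^sup>2 * (4 * p\<^sup>2 * w\<^sup>2 * k + 24 * \<bar>p * w\<bar> * k + 2 * p * w\<^sup>2 * real CARD('d) + 6 * real CARD('d) + 24) + \<bar>b\<bar> * (2 * \<bar>p * w\<bar> * k + 6)"
  show thesis
  proof (rule that)
    fix R :: real and x :: "real^'d" assume R: "R \<ge> 1"
    define u where "u = w *\<^sub>R x - m"
    define P where "P = cutoff R x"
    define X where "X = 1 + x \<bullet> x"
    have X: "X \<ge> 1" by (simp add: X_def)
    have P: "0 \<le> P" "P \<le> 1" "0 \<le> P ^ 3" "P ^ 3 \<le> 1" "0 \<le> P\<^sup>2" "P\<^sup>2 \<le> 1"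
      using cutoff_bounds[of R x] by (auto simp: P_def power_le_one)
    have xR: "x \<bullet> x / R\<^sup>2 \<le> X" "0 \<le> x \<bullet> x / R\<^sup>2" "x \<bullet> x \<le> X"
    proof -
      have "1 \<le> R\<^sup>2" using R by simp
      then have "x \<bullet> x / R\<^sup>2 \<le> x \<bullet> x / 1" by (intro divide_left_mono) auto
      then show "x \<bullet> x / R\<^sup>2 \<le> X" by (simp add: X_def)
    qed (auto simp: X_def)
    have r: "\<bar>1 / R\<^sup>2\<bar> \<le> 1" using R by simp
    have uu: "\<bar>u \<bullet> u\<bar> \<le> k * X"
    proof -
      have "0 \<le> (w *\<^sub>R x + m) \<bullet> (w *\<^sub>R x + m)" by simp
      then have "u \<bullet> u \<le> 2 * w\<^sup>2 * (x \<bullet> x) + 2 * (m \<bullet> m)"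
        by (simp add: u_def inner_add_left inner_add_right inner_diff_left inner_diff_right inner_commute power2_eq_square)
      also have "\<dots> \<le> k * X"
        unfolding k_def X_def by (simp add: algebra_simps)
      finally show ?thesis by simp
    qed
    have ux: "\<bar>u \<bullet> x\<bar> \<le> k * X"
    proof -
      have "\<bar>u \<bullet> x\<bar> \<le> norm u * norm x" by (rule Cauchy_Schwarz_ineq2)
      also have "\<dots> \<le> (u \<bullet> u + x \<bullet> x) / 2"
        using sum_squares_bound[of "norm u" "norm x"] by (simp add: power2_norm_eq_inner)
      also have "\<dots> \<le> (k * X + k * X) / 2"
      proof -
        have "1 * X \<le> k * X" using k X by (intro mult_right_mono) auto
        then show ?thesis using uu xR(3) by (intro divide_right_mono add_mono) linarith+
      qed
      finally show ?thesis by (simp add: mult.commute)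
    qed
    have m1: "\<bar>c * y * z\<bar> \<le> c' * k * X" if "\<bar>c\<bar> \<le> c'" "\<bar>y\<bar> \<le> k * X" "0 \<le> z" "z \<le> 1" for c c' y z
    proof -
      have "\<bar>c * y * z\<bar> \<le> c' * (k * X) * 1"
        unfolding abs_mult using that X k by (intro mult_mono) auto
      then show ?thesis by (simp add: mult.assoc)
    qed
    have m2: "\<bar>c * z\<bar> \<le> c' * X" if "\<bar>c\<bar> \<le> c'" "0 \<le> z" "z \<le> 1" for c c' z
    proof -
      have "\<bar>c * z\<bar> \<le> c' * X"
        unfolding abs_mult using that X by (intro mult_mono) auto
      then show ?thesis .
    qed
    have m3: "\<bar>c * y * z\<bar> \<le> c' * X" if "\<bar>c\<bar> \<le> c'" "\<bar>y\<bar> \<le> X" "0 \<le> z" "z \<le> 1" for c c' y z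
    proof -
      have "\<bar>c * y * z\<bar> \<le> c' * X * 1"
        unfolding abs_mult using that X by (intro mult_mono) auto
      then show ?thesis by simp
    qed
    have dR: "\<bar>c / R\<^sup>2\<bar> \<le> \<bar>c\<bar>" for c
      using mult_left_mono[OF r, of "\<bar>c\<bar>"] by simp
    have t1: "\<bar>4 * p\<^sup>2 * w\<^sup>2 * (u \<bullet> u) * P ^ 3\<bar> \<le> 4 * p\<^sup>2 * w\<^sup>2 * k * X" by (rule m1) (use uu P in auto)
    have t2: "\<bar>24 * p * w / R\<^sup>2 * (u \<bullet> x) * P\<^sup>2\<bar> \<le> (24 * \<bar>p * w\<bar>) * k * X"
      by (rule m1) (use ux P dR[of "24 * p * w"] in \<open>auto simp: abs_mult mult.assoc\<close>)
    have t3: "\<bar>2 * p * w\<^sup>2 * real CARD('d) * P ^ 3\<bar> \<le> 2 * p * w\<^sup>2 * real CARD('d) * X"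
      by (rule m2) (use p P in \<open>auto simp: abs_mult\<close>)
    have t4: "\<bar>6 * real CARD('d) / R\<^sup>2 * P\<^sup>2\<bar> \<le> 6 * real CARD('d) * X"
      by (rule m2) (use P dR[of "6 * real CARD('d)"] in auto)
    have t5: "\<bar>24 / R\<^sup>2 * ((x \<bullet> x) / R\<^sup>2) * P\<bar> \<le> 24 * X"
      by (rule m3) (use P xR dR[of 24] in auto)
    have t6: "\<bar>2 * p * w * (u \<bullet> x) * P ^ 3\<bar> \<le> (2 * \<bar>p * w\<bar>) * k * X"
      by (rule m1) (use ux P in \<open>auto simp: abs_mult\<close>)
    have t7: "\<bar>6 / R\<^sup>2 * (x \<bullet> x) * P\<^sup>2\<bar> \<le> 6 * X"
      by (rule m3) (use P xR dR[of 6] in auto)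
    define A where "A = 4 * p\<^sup>2 * w\<^sup>2 * (u \<bullet> u) * P ^ 3 + 24 * p * w / R\<^sup>2 * (u \<bullet> x) * P\<^sup>2 - 2 * p * w\<^sup>2 * real CARD('d) * P ^ 3
        - 6 * real CARD('d) / R\<^sup>2 * P\<^sup>2 + 24 / R\<^sup>2 * ((x \<bullet> x) / R\<^sup>2) * P"
    define B where "B = 2 * p * w * (u \<bullet> x) * P ^ 3 + 6 / R\<^sup>2 * (x \<bullet> x) * P\<^sup>2"
    have A: "\<bar>A\<bar> \<le> (4 * p\<^sup>2 * w\<^sup>2 * k + 24 * \<bar>p * w\<bar> * k + 2 * p * w\<^sup>2 * real CARD('d) + 6 * real CARD('d) + 24) * X"
      unfolding A_def distrib_right using t1 t2 t3 t4 t5 by linarith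
    have B: "\<bar>B\<bar> \<le> (2 * \<bar>p * w\<bar> * k + 6) * X"
      unfolding B_def distrib_right using t6 t7 by linarith
    have "\<bar>1 / 2 * \<sigma>\<^sup>2 * A + b * B\<bar> \<le> \<bar>1 / 2 * \<sigma>\<^sup>2 * A\<bar> + \<bar>b * B\<bar>" by (rule abs_triangle_ineq)
    also have "\<dots> = 1 / 2 * \<sigma>\<^sup>2 * \<bar>A\<bar> + \<bar>b\<bar> * \<bar>B\<bar>" by (simp add: abs_mult)
    also have "\<dots> \<le> 1 / 2 * \<sigma>\<^sup>2 * ((4 * p\<^sup>2 * w\<^sup>2 * k + 24 * \<bar>p * w\<bar> * k + 2 * p * w\<^sup>2 * real CARD('d) + 6 * real CARD('d) + 24) * X)
        + \<bar>b\<bar> * ((2 * \<bar>p * w\<bar> * k + 6) * X)"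
      by (intro add_mono mult_left_mono A B) auto
    also have "\<dots> = K * X" by (simp add: K_def algebra_simps)
    finally have AB: "\<bar>1 / 2 * \<sigma>\<^sup>2 * A + b * B\<bar> \<le> K * X" .
    have K: "0 \<le> K" using k p by (auto simp: K_def intro!: mult_nonneg_nonneg add_nonneg_nonneg)
    have "\<bar>OU_operator b \<sigma> (cut_bump p w m R) x\<bar> = bump p w m x * \<bar>1 / 2 * \<sigma>\<^sup>2 * A + b * B\<bar>"
      unfolding OU_operator_cut_bump u_def[symmetric] P_def[symmetric] A_def[symmetric] B_def[symmetric]
      by (simp add: abs_mult bump_def)
    also have "\<dots> \<le> bump p w m x * (K * X)"
      by (intro mult_left_mono AB) (simp add: bump_def)
    also have "\<dots> = K * (bump p w m x * X)" by simp
    also have "\<dots> \<le> K * C0" unfolding X_def by (intro mult_left_mono C0 K)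
    finally show "\<bar>OU_operator b \<sigma> (cut_bump p w m R) x\<bar> \<le> K * C0" .
  qed
qed

lemma cutoff_tendsto: "(\<lambda>n. cutoff (real (Suc n)) x) \<longlonglongrightarrow> 1"
proof -
  have "(\<lambda>n. 1 / real (Suc n)) \<longlonglongrightarrow> 0" using LIMSEQ_inverse_real_of_nat by (simp add: inverse_eq_divide)
  then have "(\<lambda>n. max 0 (1 - (x \<bullet> x) * (1 / real (Suc n))\<^sup>2)) \<longlonglongrightarrow> max 0 (1 - (x \<bullet> x) * 0\<^sup>2)"
    by (intro tendsto_intros)
  then show ?thesis unfolding cutoff_def by (simp add: power_divide)
qed

lemma cut_bump_tendsto: "(\<lambda>n. cut_bump p w m (real (Suc n)) x) \<longlonglongrightarrow> bump p w m x"
  unfolding cut_bump_def using tendsto_mult[OF tendsto_const tendsto_power[OF cutoff_tendsto], of "bump p w m x" x 3] by simp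

lemma OU_operator_cut_bump_tendsto:
  "(\<lambda>n. OU_operator b \<sigma> (cut_bump p w m (real (Suc n))) x) \<longlonglongrightarrow> bump_gen b \<sigma> p w m x"
proof -
  have z: "(\<lambda>n. c / (real (Suc n))\<^sup>2) \<longlonglongrightarrow> 0" for c
  proof -
    have "(\<lambda>n. c * (inverse (real (Suc n)))\<^sup>2) \<longlonglongrightarrow> c * 0\<^sup>2"
      by (intro tendsto_intros LIMSEQ_inverse_real_of_nat)
    then show ?thesis by (simp add: divide_inverse power_inverse)
  qed
  have "(\<lambda>n. OU_operator b \<sigma> (cut_bump p w m (real (Suc n))) x) \<longlonglongrightarrow> bump p w m x *
    (1 / 2 * \<sigma>\<^sup>2 * (4 * p\<^sup>2 * w\<^sup>2 * ((w *\<^sub>R x - m) \<bullet> (w *\<^sub>R x - m)) * 1 ^ 3 + 0 * ((w *\<^sub>R x - m) \<bullet> x) * 1\<^sup>2 - 2 * p * w\<^sup>2 * real CARD('a) * 1 ^ 3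
        - 0 * 1\<^sup>2 + 0 * 0 * 1)
     + b * (2 * p * w * ((w *\<^sub>R x - m) \<bullet> x) * 1 ^ 3 + 0 * (x \<bullet> x) * 1\<^sup>2))"
    unfolding OU_operator_cut_bump by (intro tendsto_intros cutoff_tendsto z)
  then show ?thesis by (simp add: bump_gen_def algebra_simps)
qed

section \<open>The law of the Ornstein--Uhlenbeck process\<close>

text \<open>Closed sets are stable under intersection and generate the Borel sets, and the indicator
  of a closed set F is the limit of the continuous functions
  \<open>max 0 (1 - real k * infdist x F)\<close>.\<close>

lemma measure_eqI_continuous:
  fixes M N :: "'a::metric_space measure"
  assumes M: "prob_space M" "sets M = sets borel" and N: "prob_space N" "sets N = sets borel"
    and eq: "\<And>h :: 'a \<Rightarrow> real. continuous_on UNIV h \<Longrightarrow> (\<And>x. 0 \<le> h x \<and> h x \<le> 1) \<Longrightarrow> (\<integral>x. h x \<partial>M) = (\<integral>x. h x \<partial>N)"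
  shows "M = N"
proof -
  interpret M: prob_space M by fact
  interpret N: prob_space N by fact
  have spM: "space M = UNIV" using sets_eq_imp_space_eq[OF M(2)] by simp
  have spN: "space N = UNIV" using sets_eq_imp_space_eq[OF N(2)] by simp
  have closed: "emeasure M F = emeasure N F" if F: "closed F" for F
  \<comment> \<open>The distance to the empty set is 0 by convention, so the approximation would
    fail for it.\<close>
  proof (cases "F = {}")
    case False
    define h where "h k x = max 0 (1 - real k * infdist x F)" for k x
    have hc: "continuous_on UNIV (h k)" for k
      unfolding h_def by (intro continuous_intros)
    have h01: "0 \<le> h k x \<and> h k x \<le> 1" for k x
      by (auto simp: h_def infdist_nonneg)
    have lim: "(\<lambda>k. h k x) \<longlonglongrightarrow> indicat_real F x" for x
    proof (cases "x \<in> F")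
      case True
      then show ?thesis by (simp add: h_def)
    next
      case x: False
      then have "infdist x F > 0"
        using F False in_closed_iff_infdist_zero infdist_nonneg[of x F] by (metis less_eq_real_def)
      then have "\<forall>\<^sub>F k in sequentially. 1 / infdist x F \<le> real k"
        by (intro eventually_mono[OF eventually_ge_at_top[of "nat \<lceil>1 / infdist x F\<rceil>"]]) linarith
      then have "\<forall>\<^sub>F k in sequentially. h k x = indicat_real F x"
        by (rule eventually_mono) (use x \<open>infdist x F > 0\<close> in \<open>auto simp: h_def field_simps\<close>)
      then show ?thesis by (rule tendsto_eventually)
    qed
    have meas: "h k \<in> borel_measurable borel" for k by (intro borel_measurable_continuous_onI hc)
    have Fb: "F \<in> sets borel" using F by simp
    have l1: "(\<lambda>k. \<integral>x. h k x \<partial>M) \<longlonglongrightarrow> (\<integral>x. indicat_real F x \<partial>M)"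
      using meas Fb h01 lim by (intro integral_dominated_convergence[where w = "\<lambda>_. 1"])
        (auto simp: M(2) cong: measurable_cong_sets)
    have l2: "(\<lambda>k. \<integral>x. h k x \<partial>N) \<longlonglongrightarrow> (\<integral>x. indicat_real F x \<partial>N)"
      using meas Fb h01 lim by (intro integral_dominated_convergence[where w = "\<lambda>_. 1"])
        (auto simp: N(2) cong: measurable_cong_sets)
    have e: "(\<lambda>k. \<integral>x. h k x \<partial>M) = (\<lambda>k. \<integral>x. h k x \<partial>N)"
      using eq[OF hc h01] by simp
    have "(\<integral>x. indicat_real F x \<partial>M) = (\<integral>x. indicat_real F x \<partial>N)"
      by (rule LIMSEQ_unique[OF l1[unfolded e] l2])
    then show ?thesis
      by (simp add: M.emeasure_eq_measure N.emeasure_eq_measure M(2) N(2) Fb spM spN)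
  qed simp
  show ?thesis
  proof (rule measure_eqI_generator_eq[where E = "Collect closed" and \<Omega> = UNIV and A = "\<lambda>_. UNIV"])
    show "Int_stable (Collect closed)" by (auto simp: Int_stable_def)
    show "sets M = sigma_sets UNIV (Collect closed)" "sets N = sigma_sets UNIV (Collect closed)"
      unfolding M(2) N(2) borel_eq_closed by (auto intro!: sets_measure_of)
  qed (use closed in auto)
qed

section \<open>Continuity of expectations along paths, and Dynkin's formula\<close>

context OU_process
begin

lemma OU_space: "x \<in> space (borel :: (real^'d) measure)"
  by simp

lemmas OU_prob = prob[OF OU_space] and OU_meas = measurable_Y_P[OF OU_space]

text \<open>Path continuity and dominated convergence. Continuity is joint because the
  backward-equation argument moves the time of the path and the time of the function
  together.\<close>

lemma OU_expectation_continuous: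
  fixes G :: "real \<Rightarrow> real^'d \<Rightarrow> real"
  assumes G: "continuous_on ({0..} \<times> UNIV) (\<lambda>(r, y). G r y)" and bd: "\<And>r y. 0 \<le> r \<Longrightarrow> \<bar>G r y\<bar> \<le> C"
  shows "continuous_on ({0..} \<times> {0..}) (\<lambda>(s, r). \<integral>\<omega>. G r (\<xi> s \<omega>) \<partial>Pr x)"
proof -
  interpret prob_space "Pr x" by (rule OU_prob)
  have Gm: "G r \<in> borel_measurable borel" if "0 \<le> r" for r
  proof -
    have "continuous_on UNIV (\<lambda>y. (\<lambda>(r, y). G r y) (r, y))"
      by (rule continuous_on_compose2[OF G]) (use that in \<open>auto intro!: continuous_intros\<close>)
    then show ?thesis by (intro borel_measurable_continuous_onI) simp
  qed
  show ?thesis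
    unfolding continuous_on_sequentially
  proof (intro ballI allI impI)
    fix z :: "nat \<Rightarrow> real \<times> real" and c :: "real \<times> real"
    assume c: "c \<in> {0..} \<times> {0..}" and z: "(\<forall>n. z n \<in> {0..} \<times> {0..}) \<and> z \<longlonglongrightarrow> c"
    define s where "s n = fst (z n)" for n
    define r where "r n = snd (z n)" for n
    obtain s0 r0 where c0: "c = (s0, r0)" by fastforce
    have s: "\<And>n. 0 \<le> s n" "s \<longlonglongrightarrow> s0" and r: "\<And>n. 0 \<le> r n" "r \<longlonglongrightarrow> r0" and 0: "0 \<le> s0" "0 \<le> r0"
      using z c tendsto_fst[of z c sequentially] tendsto_snd[of z c sequentially] unfolding s_def r_def c0
      by (auto simp: mem_Times_iff)
    have "(\<lambda>n. \<integral>\<omega>. G (r n) (\<xi> (s n) \<omega>) \<partial>Pr x) \<longlonglongrightarrow> (\<integral>\<omega>. G r0 (\<xi> s0 \<omega>) \<partial>Pr x)"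
    proof (rule integral_dominated_convergence[where w = "\<lambda>_. C"])
      show "(\<lambda>\<omega>. G r0 (\<xi> s0 \<omega>)) \<in> borel_measurable (Pr x)"
        by (rule measurable_compose[OF OU_meas Gm]) (use 0 in auto)
      show "(\<lambda>\<omega>. G (r n) (\<xi> (s n) \<omega>)) \<in> borel_measurable (Pr x)" for n
        by (rule measurable_compose[OF OU_meas Gm]) (use s r in auto)
      show "AE \<omega> in Pr x. norm (G (r n) (\<xi> (s n) \<omega>)) \<le> C" for n
        using bd r by auto
      show "AE \<omega> in Pr x. (\<lambda>n. G (r n) (\<xi> (s n) \<omega>)) \<longlonglongrightarrow> G r0 (\<xi> s0 \<omega>)"
      proof (rule AE_I2)
        fix \<omega> assume "\<omega> \<in> space (Pr x)"
        then have "continuous_on {0..} (\<lambda>t. \<xi> t \<omega>)" using continuous_paths by (simp add: space_P)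
        then have "(\<lambda>n. \<xi> (s n) \<omega>) \<longlonglongrightarrow> \<xi> s0 \<omega>"
          using s 0 by (intro continuous_on_tendsto_compose[where f = "\<lambda>t. \<xi> t \<omega>" and s = "{0..}"]) auto
        then have "(\<lambda>n. (r n, \<xi> (s n) \<omega>)) \<longlonglongrightarrow> (r0, \<xi> s0 \<omega>)" by (intro tendsto_Pair r)
        then show "(\<lambda>n. G (r n) (\<xi> (s n) \<omega>)) \<longlonglongrightarrow> G r0 (\<xi> s0 \<omega>)"
          using continuous_on_tendsto_compose[OF G, of "\<lambda>n. (r n, \<xi> (s n) \<omega>)" "(r0, \<xi> s0 \<omega>)" sequentially] r 0 by auto
      qed
    qed auto
    then show "((\<lambda>(s, r). \<integral>\<omega>. G r (\<xi> s \<omega>) \<partial>Pr x) \<circ> z) \<longlonglongrightarrow> (\<lambda>(s, r). \<integral>\<omega>. G r (\<xi> s \<omega>) \<partial>Pr x) c"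
      by (simp add: o_def case_prod_beta s_def r_def c0)
  qed
qed

lemma OU_expectation_continuous1:
  fixes G :: "real^'d \<Rightarrow> real"
  assumes G: "continuous_on UNIV G" and bd: "\<And>y. \<bar>G y\<bar> \<le> C"
  shows "continuous_on {0..} (\<lambda>s. \<integral>w. G (\<xi> s w) \<partial>Pr x)"
proof -
  have "continuous_on ({0..} \<times> {0..}) (\<lambda>(s, r::real). \<integral>w. G (\<xi> s w) \<partial>Pr x)"
  proof (rule OU_expectation_continuous[where G = "\<lambda>r. G"])
    have "continuous_on ({0::real..} \<times> UNIV) (\<lambda>z. G (snd z))"
      by (rule continuous_on_compose2[OF G]) (auto intro!: continuous_intros)
    then show "continuous_on ({0::real..} \<times> UNIV) (\<lambda>(r, y). G y)" by (simp add: case_prod_beta)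
  qed (rule bd)
  then have "continuous_on {0..} (\<lambda>s. (\<lambda>(s, r::real). \<integral>w. G (\<xi> s w) \<partial>Pr x) (s, 0))"
    by (rule continuous_on_compose2) (auto intro!: continuous_intros)
  then show ?thesis by simp
qed

lemma OU_expectation_bound:
  fixes G :: "real^'d \<Rightarrow> real"
  assumes [measurable]: "G \<in> borel_measurable borel" and bd: "\<And>y. \<bar>G y\<bar> \<le> C" and s: "0 \<le> s"
  shows "integrable (Pr x) (\<lambda>w. G (\<xi> s w))" "\<bar>\<integral>w. G (\<xi> s w) \<partial>Pr x\<bar> \<le> C"
proof -
  interpret prob_space "Pr x" by (rule OU_prob)
  note [measurable] = OU_meas[OF s]
  show int: "integrable (Pr x) (\<lambda>w. G (\<xi> s w))"
    using bd by (intro integrable_const_bound[where B = C]) auto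
  have "\<bar>\<integral>w. G (\<xi> s w) \<partial>Pr x\<bar> \<le> (\<integral>w. \<bar>G (\<xi> s w)\<bar> \<partial>Pr x)" by (rule integral_abs_bound)
  also have "\<dots> \<le> (\<integral>w. C \<partial>Pr x)"
    using int bd by (intro Bochner_Integration.integral_mono) auto
  finally show "\<bar>\<integral>w. G (\<xi> s w) \<partial>Pr x\<bar> \<le> C" by (simp add: prob_space)
qed

lemma OU_start:
  fixes f :: "real^'d \<Rightarrow> real"
  assumes [measurable]: "f \<in> borel_measurable borel"
  shows "(\<integral>w. f (\<xi> 0 w) \<partial>Pr x) = f x"
proof -
  interpret prob_space "Pr x" by (rule OU_prob)
  note [measurable] = OU_meas[OF order_refl]
  have "(\<integral>w. f (\<xi> 0 w) \<partial>Pr x) = (\<integral>w. f x \<partial>Pr x)"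
    using start[OF OU_space, of x] by (intro integral_cong_AE) auto
  then show ?thesis by (simp add: prob_space)
qed

text \<open>The Markov property turns the uniform convergence of the difference quotients into a
  derivative of \<Phi> at every time, and the fundamental theorem of calculus integrates it.\<close>

lemma dynkin_C2:
  fixes f :: "real^'d \<Rightarrow> real"
  assumes f: "C2_compact_support f" and t: "0 \<le> t"
  shows "((\<lambda>s. \<integral>w. OU_operator b \<sigma> f (\<xi> s w) \<partial>Pr x) has_integral ((\<integral>w. f (\<xi> t w) \<partial>Pr x) - f x)) {0..t}"
proof -
  define L where "L = OU_operator b \<sigma> f"
  define \<Phi> where "\<Phi> s = (\<integral>w. f (\<xi> s w) \<partial>Pr x)" for s
  define K where "K s = (\<integral>w. L (\<xi> s w) \<partial>Pr x)" for s
  have fd: "f differentiable_on UNIV" "\<And>i. partial i f differentiable_on UNIV" "\<And>i j. continuous_on UNIV (partial j (partial i f))"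
      "compact (closure {x. f x \<noteq> 0})"
    using f by (auto simp: C2_compact_support_def)
  have fc: "continuous_on UNIV f" by (rule differentiable_imp_continuous_on[OF fd(1)])
  have pc: "continuous_on UNIV (partial i f)" for i by (rule differentiable_imp_continuous_on[OF fd(2)])
  have [measurable]: "f \<in> borel_measurable borel" by (rule borel_measurable_continuous_onI[OF fc])
  have Lc: "continuous_on UNIV L"
    unfolding L_def OU_operator_def by (intro continuous_intros pc fd(3))
  have [measurable]: "L \<in> borel_measurable borel" by (rule borel_measurable_continuous_onI[OF Lc])
  obtain C where C: "\<And>y. \<bar>f y\<bar> \<le> C"
  proof -
    have "bounded (f ` closure {x. f x \<noteq> 0})"
      by (intro compact_imp_bounded compact_continuous_image continuous_on_subset[OF fc] fd(4)) auto
    then obtain C where C: "\<And>y. y \<in> closure {x. f x \<noteq> 0} \<Longrightarrow> \<bar>f y\<bar> \<le> C"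
      by (auto simp: bounded_iff)
    show thesis
    proof (rule that[of "max C 0"])
      fix y show "\<bar>f y\<bar> \<le> max C 0"
        using C[of y] closure_subset[of "{x. f x \<noteq> 0}"] by (cases "f y = 0") (auto simp: le_max_iff_disj)
    qed
  qed
  have unif: "\<exists>\<delta>>0. \<forall>h y. 0 < h \<longrightarrow> h < \<delta> \<longrightarrow> \<bar>((\<integral>w. f (\<xi> h w) \<partial>Pr y) - f y) / h - L y\<bar> < e" if "e > 0" for e
  proof -
    have "\<forall>\<^sub>F t in at_right 0. \<forall>y\<in>UNIV. dist ((semigroup_of \<xi> Pr t f y - f y) / t) (OU_operator b \<sigma> f y) < e"
      using generator[OF f] that by (auto dest: uniform_limitD)
    then obtain \<delta> where "\<delta> > 0" "\<And>h. 0 < h \<Longrightarrow> h < \<delta> \<Longrightarrow> \<forall>y\<in>UNIV. dist ((semigroup_of \<xi> Pr h f y - f y) / h) (OU_operator b \<sigma> f y) < e"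
      unfolding eventually_at_right_field by auto
    then show ?thesis by (auto simp: dist_real_def semigroup_of_def L_def)
  qed
  \<comment> \<open>Boundedness of L is read off the generator limit: at one small h it differs by
    less than 1 from a difference quotient, which is at most 2 C / h.\<close>
  obtain C' where C': "\<And>y. \<bar>L y\<bar> \<le> C'"
  proof -
    obtain \<delta> where \<delta>: "\<delta> > 0" "\<And>h y. 0 < h \<Longrightarrow> h < \<delta> \<Longrightarrow> \<bar>((\<integral>w. f (\<xi> h w) \<partial>Pr y) - f y) / h - L y\<bar> < 1"
      using unif[of 1] by auto
    define h where "h = \<delta> / 2"
    have h: "0 < h" "h < \<delta>" using \<delta> by (auto simp: h_def)
    show thesis
    proof (rule that)
      fix y
      have "\<bar>(\<integral>w. f (\<xi> h w) \<partial>Pr y) - f y\<bar> \<le> 2 * C"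
      proof -
        have "\<bar>\<integral>w. f (\<xi> h w) \<partial>Pr y\<bar> \<le> C" using C h by (intro OU_expectation_bound(2)) auto
        then show ?thesis using C[of y] by linarith
      qed
      then have "\<bar>((\<integral>w. f (\<xi> h w) \<partial>Pr y) - f y) / h\<bar> \<le> 2 * C / h"
        using h by (simp add: divide_right_mono)
      then show "\<bar>L y\<bar> \<le> 2 * C / h + 1" using \<delta>(2)[OF h, of y] by linarith
    qed
  qed
  have Kc: "continuous_on {0..} K" unfolding K_def by (rule OU_expectation_continuous1[OF Lc C'])
  \<comment> \<open>Increments to the right, with an error uniform in the starting time s; this
    uniformity also gives access to increments to the left.\<close>
  have incr: "\<exists>\<delta>>0. \<forall>s h. 0 \<le> s \<longrightarrow> 0 < h \<longrightarrow> h < \<delta> \<longrightarrow> \<bar>\<Phi> (s + h) - \<Phi> s - h * K s\<bar> \<le> h * e" if e: "e > 0" for e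
  proof -
    obtain \<delta> where \<delta>: "\<delta> > 0" "\<And>h y. 0 < h \<Longrightarrow> h < \<delta> \<Longrightarrow> \<bar>((\<integral>w. f (\<xi> h w) \<partial>Pr y) - f y) / h - L y\<bar> < e"
      using unif[OF e] by auto
    have "\<bar>\<Phi> (s + h) - \<Phi> s - h * K s\<bar> \<le> h * e" if s: "0 \<le> s" and h: "0 < h" "h < \<delta>" for s h
    proof -
      interpret prob_space "Pr x" by (rule OU_prob)
      define D where "D y = (\<integral>w. f (\<xi> h w) \<partial>Pr y) - f y - h * L y" for y
      have D: "\<bar>D y\<bar> \<le> h * e" for y
      proof -
        have "((\<integral>w. f (\<xi> h w) \<partial>Pr y) - f y) / h - L y = D y / h" using h by (simp add: D_def field_simps)
        then show ?thesis using \<delta>(2)[OF h, of y] h by (simp add: field_simps)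
      qed
      note [measurable] = OU_meas[OF s]
      have Tm: "(\<lambda>y. \<integral>w. f (\<xi> h w) \<partial>Pr y) \<in> borel_measurable borel"
      proof -
        have h0: "0 \<le> h" using h by simp
        note [measurable] = measurable_trans_kernel[OF h0]
        have "(\<lambda>y. \<integral>z. f z \<partial>trans_kernel h y) \<in> borel_measurable borel" by measurable
        moreover have "(\<integral>z. f z \<partial>trans_kernel h y) = (\<integral>w. f (\<xi> h w) \<partial>Pr y)" for y
          unfolding trans_kernel_def by (rule integral_distr[OF OU_meas[OF h0]]) simp
        ultimately show ?thesis by simp
      qed
      have Tb: "\<bar>\<integral>w. f (\<xi> h w) \<partial>Pr y\<bar> \<le> C" for y
        using OU_expectation_bound(2)[of f C h y] C h by simp
      have i1: "integrable (Pr x) (\<lambda>w. \<integral>w'. f (\<xi> h w') \<partial>Pr (\<xi> s w))"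
        using OU_expectation_bound(1)[OF Tm Tb s] .
      have i2: "integrable (Pr x) (\<lambda>w. f (\<xi> s w))" "integrable (Pr x) (\<lambda>w. L (\<xi> s w))"
        by (rule OU_expectation_bound(1)[OF _ C s], simp) (rule OU_expectation_bound(1)[OF _ C' s], simp)
      have "\<Phi> (s + h) = (\<integral>w. (\<integral>w'. f (\<xi> h w') \<partial>Pr (\<xi> s w)) \<partial>Pr x)"
        unfolding \<Phi>_def using h by (intro markov_integral[OF OU_space s _ _ C]) auto
      then have "\<Phi> (s + h) - \<Phi> s - h * K s = (\<integral>w. D (\<xi> s w) \<partial>Pr x)"
        unfolding D_def \<Phi>_def K_def using i1 i2 by simp
      moreover have "D \<in> borel_measurable borel" unfolding D_def using Tm by measurable
      ultimately show ?thesis using OU_expectation_bound(2)[of D "h * e" s x] D s by simp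
    qed
    then show ?thesis using \<delta>(1) by blast
  qed
  have deriv: "(\<Phi> has_vector_derivative K s) (at s within {0..t})" if s: "s \<in> {0..t}" for s
    unfolding has_vector_derivative_def has_derivative_within_alt
  proof (intro conjI allI impI)
    show "bounded_linear (\<lambda>x. x *\<^sub>R K s)" by (rule bounded_linear_scaleR_left)
    fix e :: real assume e: "e > 0"
    obtain \<delta>1 where \<delta>1: "\<delta>1 > 0" "\<And>s h. 0 \<le> s \<Longrightarrow> 0 < h \<Longrightarrow> h < \<delta>1 \<Longrightarrow> \<bar>\<Phi> (s + h) - \<Phi> s - h * K s\<bar> \<le> h * (e / 2)"
      using incr[of "e / 2"] e by auto
    obtain \<delta>2 where \<delta>2: "\<delta>2 > 0" "\<And>r. 0 \<le> r \<Longrightarrow> \<bar>r - s\<bar> < \<delta>2 \<Longrightarrow> \<bar>K r - K s\<bar> < e / 2"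
      using Kc[unfolded continuous_on_iff, rule_format, of s "e / 2"] s e by (auto simp: dist_real_def)
    show "\<exists>d>0. \<forall>y\<in>{0..t}. norm (y - s) < d \<longrightarrow> norm (\<Phi> y - \<Phi> s - (y - s) *\<^sub>R K s) \<le> e * norm (y - s)"
    proof (intro exI[of _ "min \<delta>1 \<delta>2"] conjI ballI impI)
      show "min \<delta>1 \<delta>2 > 0" using \<delta>1 \<delta>2 by simp
      fix y assume y: "y \<in> {0..t}" and ys: "norm (y - s) < min \<delta>1 \<delta>2"
      consider "y = s" | "s < y" | "y < s" by linarith
      then show "norm (\<Phi> y - \<Phi> s - (y - s) *\<^sub>R K s) \<le> e * norm (y - s)"
      proof cases
        case 2
        have "\<bar>\<Phi> y - \<Phi> s - (y - s) * K s\<bar> \<le> (y - s) * (e / 2)"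
          using \<delta>1(2)[of s "y - s"] s 2 ys by auto
        also have "\<dots> \<le> (y - s) * e" using 2 e by (intro mult_left_mono) auto
        finally show ?thesis using 2 by (simp add: mult.commute)
      next
        \<comment> \<open>A left increment at s is a right increment at the earlier time y;
          continuity of K then replaces \<open>K y\<close> by \<open>K s\<close>.\<close>
        case 3
        have 1: "\<bar>\<Phi> s - \<Phi> y - (s - y) * K y\<bar> \<le> (s - y) * (e / 2)"
          using \<delta>1(2)[of y "s - y"] y 3 ys by auto
        have "\<bar>K y - K s\<bar> \<le> e / 2" using \<delta>2(2)[of y] y ys by auto
        then have "\<bar>(s - y) * (K y - K s)\<bar> \<le> (s - y) * (e / 2)"
          unfolding abs_mult using 3 by (simp add: mult_left_mono)
        moreover have "\<Phi> y - \<Phi> s - (y - s) * K s = - (\<Phi> s - \<Phi> y - (s - y) * K y) - (s - y) * (K y - K s)"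
          by (simp add: algebra_simps)
        ultimately have "\<bar>\<Phi> y - \<Phi> s - (y - s) * K s\<bar> \<le> (s - y) * (e / 2) + (s - y) * (e / 2)"
          using 1 by linarith
        then show ?thesis using 3 by (simp add: mult.commute)
      qed simp
    qed
  qed
  have "(K has_integral (\<Phi> t - \<Phi> 0)) {0..t}"
    by (rule fundamental_theorem_of_calculus[OF t deriv])
  then show ?thesis
    unfolding \<Phi>_def OU_start[OF \<open>f \<in> borel_measurable borel\<close>] unfolding K_def L_def .
qed

text \<open>The cutoff radius n + 1 tends to infinity; dominated convergence is applied under the
  expectation and then in the time integral.\<close>

lemma dynkin_bump:
  fixes m :: "real^'d"
  assumes p: "p > 0" and w: "w \<noteq> 0" and t: "0 \<le> t"
  shows "((\<lambda>s. \<integral>\<omega>. bump_gen b \<sigma> p w m (\<xi> s \<omega>) \<partial>Pr x) has_integral ((\<integral>\<omega>. bump p w m (\<xi> t \<omega>) \<partial>Pr x) - bump p w m x)) {0..t}"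
proof -
  interpret prob_space "Pr x" by (rule OU_prob)
  define F where "F n = cut_bump p w m (real (Suc n))" for n
  define L where "L n = OU_operator b \<sigma> (F n)" for n
  obtain C where C: "\<And>R x. R \<ge> 1 \<Longrightarrow> \<bar>OU_operator b \<sigma> (cut_bump p w m R) x\<bar> \<le> C"
    using OU_operator_cut_bump_bounded[OF p w] by metis
  have LC: "\<bar>L n y\<bar> \<le> C" for n y unfolding L_def F_def by (rule C) simp
  have C2: "C2_compact_support (F n)" for n unfolding F_def by (rule C2_cut_bump) simp
  have Fc: "F n \<in> borel_measurable borel" for n
    using C2[of n] by (auto simp: C2_compact_support_def intro!: borel_measurable_continuous_onI differentiable_imp_continuous_on)
  have Lm: "L n \<in> borel_measurable borel" for n
  proof -
    have "continuous_on UNIV (L n)"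
      using C2[of n] unfolding C2_compact_support_def L_def OU_operator_def
      by (intro continuous_intros) (auto intro: differentiable_imp_continuous_on)
    then show ?thesis by (rule borel_measurable_continuous_onI)
  qed
  have Ll: "(\<lambda>n. L n y) \<longlonglongrightarrow> bump_gen b \<sigma> p w m y" for y
    unfolding L_def F_def by (rule OU_operator_cut_bump_tendsto)
  have gm: "bump_gen b \<sigma> p w m \<in> borel_measurable borel"
    by (rule borel_measurable_LIMSEQ_real[OF Ll Lm])
  have bm: "bump p w m \<in> borel_measurable borel" by (rule borel_measurable_continuous_onI[OF continuous_bump])
  have F1: "\<bar>F n y\<bar> \<le> 1" for n y
    using cutoff_bounds[of "real (Suc n)" y] p unfolding F_def cut_bump_def bump_def abs_mult
    by (intro mult_le_one) (auto simp: power_le_one)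
  have Fl: "(\<lambda>n. F n y) \<longlonglongrightarrow> bump p w m y" for y
    unfolding F_def by (rule cut_bump_tendsto)
  have dyn: "((\<lambda>s. \<integral>\<omega>. L n (\<xi> s \<omega>) \<partial>Pr x) has_integral ((\<integral>\<omega>. F n (\<xi> t \<omega>) \<partial>Pr x) - F n x)) {0..t}" for n
    unfolding L_def by (rule dynkin_C2[OF C2 t])
  have conv: "(\<lambda>n. \<integral>\<omega>. L n (\<xi> s \<omega>) \<partial>Pr x) \<longlonglongrightarrow> (\<integral>\<omega>. bump_gen b \<sigma> p w m (\<xi> s \<omega>) \<partial>Pr x)" if s: "0 \<le> s" for s
    using LC Ll by (intro integral_dominated_convergence[where w = "\<lambda>_. C"])
      (auto intro!: measurable_compose[OF OU_meas[OF s]] gm Lm)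
  have conv2: "(\<lambda>n. (\<integral>\<omega>. F n (\<xi> t \<omega>) \<partial>Pr x) - F n x) \<longlonglongrightarrow> (\<integral>\<omega>. bump p w m (\<xi> t \<omega>) \<partial>Pr x) - bump p w m x"
    using F1 Fl by (intro tendsto_diff integral_dominated_convergence[where w = "\<lambda>_. 1"] Fl)
      (auto intro!: measurable_compose[OF OU_meas[OF t]] bm Fc)
  have i1: "(\<lambda>s. \<integral>\<omega>. bump_gen b \<sigma> p w m (\<xi> s \<omega>) \<partial>Pr x) integrable_on {0..t}"
   and i2: "(\<lambda>n. integral {0..t} (\<lambda>s. \<integral>\<omega>. L n (\<xi> s \<omega>) \<partial>Pr x)) \<longlonglongrightarrow> integral {0..t} (\<lambda>s. \<integral>\<omega>. bump_gen b \<sigma> p w m (\<xi> s \<omega>) \<partial>Pr x)"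
  proof -
    have 1: "(\<lambda>s. \<integral>\<omega>. L n (\<xi> s \<omega>) \<partial>Pr x) integrable_on {0..t}" for n
      using dyn by blast
    have 2: "(\<lambda>s::real. C) integrable_on {0..t}" by (rule integrable_const_ivl)
    have 3: "norm (\<integral>\<omega>. L n (\<xi> s \<omega>) \<partial>Pr x) \<le> C" if "s \<in> {0..t}" for n s
      using OU_expectation_bound(2)[OF Lm LC] that by simp
    have 4: "(\<lambda>n. \<integral>\<omega>. L n (\<xi> s \<omega>) \<partial>Pr x) \<longlonglongrightarrow> (\<integral>\<omega>. bump_gen b \<sigma> p w m (\<xi> s \<omega>) \<partial>Pr x)" if "s \<in> {0..t}" for s
      using conv that by simp
    show "(\<lambda>s. \<integral>\<omega>. bump_gen b \<sigma> p w m (\<xi> s \<omega>) \<partial>Pr x) integrable_on {0..t}"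
      by (rule dominated_convergence(1)[OF 1 2 3 4])
    show "(\<lambda>n. integral {0..t} (\<lambda>s. \<integral>\<omega>. L n (\<xi> s \<omega>) \<partial>Pr x)) \<longlonglongrightarrow> integral {0..t} (\<lambda>s. \<integral>\<omega>. bump_gen b \<sigma> p w m (\<xi> s \<omega>) \<partial>Pr x)"
      by (rule dominated_convergence(2)[OF 1 2 3 4])
  qed
  have "integral {0..t} (\<lambda>s. \<integral>\<omega>. bump_gen b \<sigma> p w m (\<xi> s \<omega>) \<partial>Pr x) = (\<integral>\<omega>. bump p w m (\<xi> t \<omega>) \<partial>Pr x) - bump p w m x"
    using LIMSEQ_unique[OF i2] conv2 by (simp add: integral_unique[OF dyn])
  then show ?thesis using i1 by (metis integrable_integral)
qed

end

text \<open>Variance, in units of the stationary one, of the process after time r with independent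
  Gaussian noise of width \<epsilon> added. The summand \<open>\<epsilon>\<^sup>2\<close> keeps it
  away from 0 at r = 0.\<close>

definition heat_var :: "real \<Rightarrow> real \<Rightarrow> real \<Rightarrow> real" where
  "heat_var b \<epsilon> r = \<epsilon>\<^sup>2 + 1 - (exp (- b * r))\<^sup>2"

text \<open>The image of the Gaussian bump \<open>exp (- a |y - m|\<^sup>2 / \<epsilon>\<^sup>2)\<close> (up to a constant) under the
  Mehler semigroup; it solves the Kolmogorov backward equation.\<close>

definition heat_bump :: "real \<Rightarrow> real \<Rightarrow> real \<Rightarrow> real^'d::finite \<Rightarrow> real \<Rightarrow> real^'d \<Rightarrow> real" where
  "heat_bump b \<sigma> \<epsilon> m r y = exp (- (real CARD('d) / 2) * ln (heat_var b \<epsilon> r)) *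
     bump (b / \<sigma>\<^sup>2 / heat_var b \<epsilon> r) (exp (- b * r)) m y"

definition heat_gen :: "real \<Rightarrow> real \<Rightarrow> real \<Rightarrow> real^'d::finite \<Rightarrow> real \<Rightarrow> real^'d \<Rightarrow> real" where
  "heat_gen b \<sigma> \<epsilon> m r y = exp (- (real CARD('d) / 2) * ln (heat_var b \<epsilon> r)) *
     bump_gen b \<sigma> (b / \<sigma>\<^sup>2 / heat_var b \<epsilon> r) (exp (- b * r)) m y"

context
  fixes b \<sigma> \<epsilon> :: real
  assumes b: "b > 0" and \<sigma>: "\<sigma> > 0" and \<epsilon>: "\<epsilon> > 0"
begin

lemma heat_var_bounds:
  assumes "0 \<le> r"
  shows "\<epsilon>\<^sup>2 \<le> heat_var b \<epsilon> r" "heat_var b \<epsilon> r \<le> \<epsilon>\<^sup>2 + 1" "0 < heat_var b \<epsilon> r"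
proof -
  have "(exp (- b * r))\<^sup>2 \<le> 1" using b assms by (simp add: power_le_one)
  then show 1: "\<epsilon>\<^sup>2 \<le> heat_var b \<epsilon> r" "heat_var b \<epsilon> r \<le> \<epsilon>\<^sup>2 + 1" by (auto simp: heat_var_def)
  show "0 < heat_var b \<epsilon> r" using 1(1) \<epsilon> by (meson less_le_trans zero_less_power)
qed

text \<open>The Kolmogorov backward equation. With the prefactor written as the exponential of a
  logarithm, a single exponent has to be differentiated.\<close>

lemma heat_bump_deriv:
  fixes m y :: "real^'d::finite"
  assumes r: "0 \<le> r"
  shows "((\<lambda>r. heat_bump b \<sigma> \<epsilon> m r y) has_real_derivative heat_gen b \<sigma> \<epsilon> m r y) (at r)"
proof -
  define a where "a = b / \<sigma>\<^sup>2"
  have a: "a > 0" using b \<sigma> by (simp add: a_def)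
  have \<sigma>2: "\<sigma>\<^sup>2 = b / a" using b \<sigma> by (simp add: a_def)
  define d where "d = real CARD('d)"
  define w where "w r = exp (- b * r)" for r
  define V where "V r = \<epsilon>\<^sup>2 + 1 - (w r)\<^sup>2" for r
  define N where "N r = (w r)\<^sup>2 * (y \<bullet> y) - 2 * w r * (y \<bullet> m) + m \<bullet> m" for r
  have V: "V r > 0" using heat_var_bounds(3)[OF r] by (simp add: V_def w_def heat_var_def)
  have N: "(w r *\<^sub>R y - m) \<bullet> (w r *\<^sub>R y - m) = N r" for r
    by (simp add: N_def inner_diff_left inner_diff_right inner_commute power2_eq_square algebra_simps)
  have dw: "(w has_real_derivative - b * w r) (at r)"
    unfolding w_def by (auto intro!: derivative_eq_intros)
  have dV: "(V has_real_derivative 2 * b * (w r)\<^sup>2) (at r)"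
    unfolding V_def by (auto intro!: derivative_eq_intros dw simp: power2_eq_square)
  have dN: "(N has_real_derivative - 2 * b * w r * ((w r *\<^sub>R y - m) \<bullet> y)) (at r)"
    unfolding N_def by (auto intro!: derivative_eq_intros dw simp: power2_eq_square inner_diff_left inner_commute algebra_simps)
  have dE: "((\<lambda>r. - (d / 2) * ln (V r) + - (a / V r) * N r) has_real_derivative
      (- (d / 2) * (2 * b * (w r)\<^sup>2 / V r) + (a / V r) * (2 * b * w r * ((w r *\<^sub>R y - m) \<bullet> y)) + a * (2 * b * (w r)\<^sup>2) / (V r)\<^sup>2 * N r)) (at r)"
    using V by (auto intro!: derivative_eq_intros dV dN simp: power2_eq_square field_simps)
  have dexp: "((\<lambda>r. exp (- (d / 2) * ln (V r) + - (a / V r) * N r)) has_real_derivative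
      exp (- (d / 2) * ln (V r) + - (a / V r) * N r) *
      (- (d / 2) * (2 * b * (w r)\<^sup>2 / V r) + (a / V r) * (2 * b * w r * ((w r *\<^sub>R y - m) \<bullet> y)) + a * (2 * b * (w r)\<^sup>2) / (V r)\<^sup>2 * N r)) (at r)"
    by (rule DERIV_fun_exp[OF dE])
  have f: "heat_bump b \<sigma> \<epsilon> m r y = exp (- (d / 2) * ln (V r) + - (a / V r) * N r)" for r
    unfolding heat_bump_def bump_def heat_var_def w_def[symmetric] V_def[symmetric] N a_def[symmetric] d_def[symmetric] exp_add ..
  have e: "1 / 2 * \<sigma>\<^sup>2 * (4 * (a / V r)\<^sup>2 * (w r)\<^sup>2 * N r - 2 * (a / V r) * (w r)\<^sup>2 * d) + 2 * b * (a / V r) * w r * ((w r *\<^sub>R y - m) \<bullet> y)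
     = (- (d / 2) * (2 * b * (w r)\<^sup>2 / V r) + (a / V r) * (2 * b * w r * ((w r *\<^sub>R y - m) \<bullet> y)) + a * (2 * b * (w r)\<^sup>2) / (V r)\<^sup>2 * N r)"
    unfolding \<sigma>2 using a V by (simp add: field_simps power2_eq_square)
  have "heat_gen b \<sigma> \<epsilon> m r y = exp (- (d / 2) * ln (V r) + - (a / V r) * N r) *
      (1 / 2 * \<sigma>\<^sup>2 * (4 * (a / V r)\<^sup>2 * (w r)\<^sup>2 * N r - 2 * (a / V r) * (w r)\<^sup>2 * d) + 2 * b * (a / V r) * w r * ((w r *\<^sub>R y - m) \<bullet> y))"
    unfolding heat_gen_def bump_gen_def bump_def heat_var_def w_def[symmetric] V_def[symmetric] N a_def[symmetric] d_def[symmetric] exp_add mult.assoc ..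
  then show ?thesis unfolding f e using dexp by simp
qed

lemma heat_gen_continuous:
  fixes m :: "real^'d::finite"
  shows "continuous_on ({0..} \<times> UNIV) (\<lambda>(r, y). heat_gen b \<sigma> \<epsilon> m r y)"
proof -
  have V: "heat_var b \<epsilon> (fst z) > 0" if "z \<in> {0..} \<times> (UNIV :: (real^'d) set)" for z
    using that heat_var_bounds(3)[of "fst z"] by auto
  have cV: "continuous_on ({0..} \<times> (UNIV :: (real^'d) set)) (\<lambda>z. heat_var b \<epsilon> (fst z))"
    unfolding heat_var_def by (intro continuous_intros)
  show ?thesis
    unfolding heat_gen_def bump_gen_def bump_def case_prod_beta
    by (intro continuous_intros cV) (use V in \<open>auto simp: less_imp_neq[symmetric]\<close>)
qed

text \<open>Uniform in r as well as in y, as required for dominated convergence in both time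
  variables.\<close>

lemma heat_gen_bounded:
  fixes m :: "real^'d::finite"
  obtains C where "\<And>r y. 0 \<le> r \<Longrightarrow> \<bar>heat_gen b \<sigma> \<epsilon> m r y\<bar> \<le> C"
proof -
  define a where "a = b / \<sigma>\<^sup>2"
  have a: "a > 0" using b \<sigma> by (simp add: a_def)
  have \<sigma>2: "\<sigma>\<^sup>2 = b / a" using b \<sigma> by (simp add: a_def)
  define d where "d = real CARD('d)"
  have d: "d \<ge> 0" by (simp add: d_def)
  define M where "M = m \<bullet> m"
  have M: "M \<ge> 0" by (simp add: M_def)
  define e where "e = \<epsilon>\<^sup>2"
  have e: "e > 0" using \<epsilon> by (simp add: e_def)
  \<comment> \<open>The slowest Gaussian rate that occurs, since the variance never exceeds e +
    1.\<close>
  define k where "k = a / (e + 1)"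
  have k: "k > 0" using a e by (simp add: k_def)
  define K where "K = 2 * a * b / e\<^sup>2 + b * d / e + 3 * a * b / e + a * b * M / e"
  have K: "K \<ge> 0" using a b d e M by (simp add: K_def)
  show thesis
  proof (rule that)
    fix r :: real and y :: "real^'d" assume r: "0 \<le> r"
    define w where "w = exp (- b * r)"
    have w: "0 < w" "w\<^sup>2 \<le> 1" "w \<le> 1" using b r by (auto simp: w_def power_le_one)
    define V where "V = heat_var b \<epsilon> r"
    have V: "e \<le> V" "V \<le> e + 1" "0 < V" using heat_var_bounds[OF r] by (auto simp: V_def e_def)
    define u where "u = w *\<^sub>R y - m"
    define N where "N = u \<bullet> u"
    have N: "N \<ge> 0" by (simp add: N_def)
    have um: "\<bar>u \<bullet> m\<bar> \<le> (N + M) / 2"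
    proof -
      have "\<bar>u \<bullet> m\<bar> \<le> norm u * norm m" by (rule Cauchy_Schwarz_ineq2)
      also have "\<dots> \<le> (N + M) / 2"
        using sum_squares_bound[of "norm u" "norm m"] by (simp add: power2_norm_eq_inner N_def M_def)
      finally show ?thesis .
    qed
    \<comment> \<open>Since w y = u + m, the drift term is expressed through u and m; bounding y
      itself would cost a factor 1 / w, which is unbounded in r.\<close>
    have wuy: "w * (u \<bullet> y) = N + u \<bullet> m"
      by (simp add: N_def u_def inner_diff_left inner_diff_right inner_commute algebra_simps)
    have iV: "1 / V \<le> 1 / e" "1 / V\<^sup>2 \<le> 1 / e\<^sup>2" "0 < 1 / V"
      using V e by (auto simp: frac_le power_mono)
    define Q where "Q = 1 / 2 * \<sigma>\<^sup>2 * (4 * (a / V)\<^sup>2 * w\<^sup>2 * N - 2 * (a / V) * w\<^sup>2 * d) + 2 * b * (a / V) * (w * (u \<bullet> y))"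
    have Qeq: "Q = 2 * a * b * N * (w\<^sup>2 * (1 / V\<^sup>2)) - b * d * (w\<^sup>2 * (1 / V)) + 2 * a * b * (1 / V) * (N + u \<bullet> m)"
      unfolding Q_def \<sigma>2 wuy using a V by (simp add: field_simps power2_eq_square)
    have q1: "w\<^sup>2 * (1 / V\<^sup>2) \<le> 1 * (1 / e\<^sup>2)" "w\<^sup>2 * (1 / V) \<le> 1 * (1 / e)"
      by (rule mult_mono[OF w(2) iV(2)], use V e in auto)[1] (rule mult_mono[OF w(2) iV(1)], use V e in auto)[1]
    have "\<bar>2 * a * b * N * (w\<^sup>2 * (1 / V\<^sup>2))\<bar> \<le> 2 * a * b * N * (1 / e\<^sup>2)"
      using q1 a b N by (simp add: abs_mult del: times_divide_eq_right) (intro mult_left_mono, auto)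
    moreover have "\<bar>b * d * (w\<^sup>2 * (1 / V))\<bar> \<le> b * d * (1 / e)"
      using q1 b d V w by (simp add: abs_mult del: times_divide_eq_right) (intro mult_left_mono, auto)
    moreover have "\<bar>2 * a * b * (1 / V) * (N + u \<bullet> m)\<bar> \<le> 2 * a * b * (1 / e) * (N + (N + M) / 2)"
    proof -
      have "\<bar>N + u \<bullet> m\<bar> \<le> N + (N + M) / 2" using um N by linarith
      then show ?thesis
        unfolding abs_mult using iV a b N V e by (intro mult_mono) auto
    qed
    ultimately have "\<bar>Q\<bar> \<le> 2 * a * b * N * (1 / e\<^sup>2) + b * d * (1 / e) + 2 * a * b * (1 / e) * (N + (N + M) / 2)"
      unfolding Qeq by linarith
    also have "\<dots> = (2 * a * b / e\<^sup>2 + 3 * a * b / e) * N + (b * d / e + a * b * M / e)"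
      using e by (simp add: field_simps)
    also have "\<dots> \<le> K * N + K * 1"
      using a b d e M N by (intro add_mono mult_right_mono) (auto simp: K_def)
    finally have Q: "\<bar>Q\<bar> \<le> K * (1 + N)" by (simp add: algebra_simps)
    have E: "exp (- (a / V) * N) \<le> exp (- k * N)"
    proof -
      have "a / (e + 1) \<le> a / V" using a V by (intro divide_left_mono mult_pos_pos) auto
      then have "a / (e + 1) * N \<le> a / V * N" using N by (rule mult_right_mono)
      then show ?thesis by (simp add: k_def)
    qed
    have kN: "exp (- k * N) * (1 + N) \<le> 1 + 1 / k"
    proof -
      have "k * N \<le> exp (k * N)" using exp_ge_add_one_self[of "k * N"] by linarith
      then have "exp (- k * N) * N \<le> 1 / k" using k by (simp add: exp_minus field_simps)
      moreover have "exp (- k * N) \<le> 1" using k N by simp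
      ultimately show ?thesis unfolding distrib_left mult_1_right by linarith
    qed
    have c: "exp (- (d / 2) * ln V) \<le> exp (- (d / 2) * ln e)"
      using V e d by (simp add: mult_left_mono)
    have "\<bar>heat_gen b \<sigma> \<epsilon> m r y\<bar> = exp (- (d / 2) * ln V) * (exp (- (a / V) * N) * \<bar>Q\<bar>)"
      unfolding heat_gen_def bump_gen_def bump_def V_def[symmetric] w_def[symmetric] u_def[symmetric] N_def[symmetric]
        a_def[symmetric] d_def[symmetric] Q_def by (simp add: abs_mult mult.assoc)
    also have "\<dots> \<le> exp (- (d / 2) * ln e) * (exp (- k * N) * (K * (1 + N)))"
      using Q K N by (intro mult_mono c E) auto
    also have "\<dots> = exp (- (d / 2) * ln e) * (K * (exp (- k * N) * (1 + N)))" by (simp add: mult_ac)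
    also have "\<dots> \<le> exp (- (d / 2) * ln e) * (K * (1 + 1 / k))"
      by (intro mult_left_mono kN K) auto
    finally show "\<bar>heat_gen b \<sigma> \<epsilon> m r y\<bar> \<le> exp (- (d / 2) * ln e) * (K * (1 + 1 / k))" .
  qed
qed

lemma heat_bump_bounds:
  fixes m y :: "real^'d::finite"
  assumes "0 \<le> r"
  shows "\<bar>heat_bump b \<sigma> \<epsilon> m r y\<bar> \<le> exp (- (real CARD('d) / 2) * ln (heat_var b \<epsilon> r))"
proof -
  have "bump (b / \<sigma>\<^sup>2 / heat_var b \<epsilon> r) (exp (- b * r)) m y \<le> 1"
    using b heat_var_bounds(3)[OF assms] by (simp add: bump_def)
  then show ?thesis unfolding heat_bump_def abs_mult by (simp add: bump_def)
qed

end

section \<open>Identification of the law of the process\<close>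

context OU_process
begin

text \<open>The expectation of the bump with remaining time t - s, evaluated at
  \<open>\<xi> s\<close>, does not depend on s: Dynkin's formula in s and the backward equation in r
  contribute opposite derivatives. The cases s = t and s = 0 give the two sides.\<close>

lemma heat_bump_expectation:
  fixes m :: "real^'d"
  assumes \<epsilon>: "\<epsilon> > 0" and t: "0 \<le> t"
  shows "(\<integral>\<omega>. heat_bump b \<sigma> \<epsilon> m 0 (\<xi> t \<omega>) \<partial>Pr x) = heat_bump b \<sigma> \<epsilon> m t x"
proof -
  interpret prob_space "Pr x" by (rule OU_prob)
  define g where "g = heat_bump b \<sigma> \<epsilon> m"
  define L where "L = heat_gen b \<sigma> \<epsilon> m"
  define \<Phi> where "\<Phi> s r = (\<integral>\<omega>. g r (\<xi> s \<omega>) \<partial>Pr x)" for s r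
  define K where "K s r = (\<integral>\<omega>. L r (\<xi> s \<omega>) \<partial>Pr x)" for s r
  note V = heat_var_bounds[OF b_pos \<sigma>_pos \<epsilon>]
  obtain C where C: "\<And>r y. 0 \<le> r \<Longrightarrow> \<bar>L r y\<bar> \<le> C"
    using heat_gen_bounded[OF b_pos \<sigma>_pos \<epsilon>, of m] unfolding L_def by blast
  have gm: "g r \<in> borel_measurable borel" for r
    unfolding g_def heat_bump_def by (intro borel_measurable_continuous_onI continuous_intros continuous_bump)
  have gb: "\<bar>g r y\<bar> \<le> exp (- (real CARD('d) / 2) * ln (heat_var b \<epsilon> r))" if "0 \<le> r" for r y
    unfolding g_def by (rule heat_bump_bounds[OF b_pos \<sigma>_pos \<epsilon> that])
  have Lc: "continuous_on ({0..} \<times> UNIV) (\<lambda>(r, y). L r y)"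
    unfolding L_def by (rule heat_gen_continuous[OF b_pos \<sigma>_pos \<epsilon>])
  have Lm: "L r \<in> borel_measurable borel" for r
    unfolding L_def heat_gen_def bump_gen_def bump_def
    by (intro borel_measurable_continuous_onI continuous_intros)
  have gint: "integrable (Pr x) (\<lambda>\<omega>. g r (\<xi> s \<omega>))" if "0 \<le> s" "0 \<le> r" for s r
    by (rule OU_expectation_bound(1)[OF gm gb[OF that(2)] that(1)])
  have Kc: "continuous_on ({0..} \<times> {0..}) (\<lambda>(s, r). K s r)"
    unfolding K_def by (rule OU_expectation_continuous[OF Lc C])
  \<comment> \<open>Dynkin's formula with the time r of the bump frozen.\<close>
  have \<Phi>s: "\<Phi> s r = g r x + integral {0..s} (\<lambda>v. K v r)" if s: "0 \<le> s" and r: "0 \<le> r" for s r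
  proof -
    define c where "c = exp (- (real CARD('d) / 2) * ln (heat_var b \<epsilon> r))"
    define p where "p = b / \<sigma>\<^sup>2 / heat_var b \<epsilon> r"
    have p: "p > 0" using b_pos \<sigma>_pos V(3)[OF r] by (simp add: p_def)
    have "((\<lambda>v. c * (\<integral>\<omega>. bump_gen b \<sigma> p (exp (- b * r)) m (\<xi> v \<omega>) \<partial>Pr x)) has_integral
       c * ((\<integral>\<omega>. bump p (exp (- b * r)) m (\<xi> s \<omega>) \<partial>Pr x) - bump p (exp (- b * r)) m x)) {0..s}"
      by (intro has_integral_mult_right dynkin_bump[OF p _ s]) simp
    then have "((\<lambda>v. K v r) has_integral (\<Phi> s r - g r x)) {0..s}"
      unfolding K_def L_def \<Phi>_def g_def heat_gen_def heat_bump_def c_def[symmetric] p_def[symmetric]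
      by (simp add: right_diff_distrib)
    then show ?thesis by (simp add: integral_unique)
  qed
  have Kc1: "continuous_on {0..} (\<lambda>v. K v r)" if "0 \<le> r" for r
  proof -
    have "continuous_on {0..} (\<lambda>v. (\<lambda>(s, r). K s r) (v, r))"
      by (rule continuous_on_compose2[OF Kc]) (use that in \<open>auto intro!: continuous_intros\<close>)
    then show ?thesis by simp
  qed
  have ds: "((\<lambda>s. \<Phi> s r) has_real_derivative K s r) (at s within {0..t})" if s: "s \<in> {0..t}" and r: "0 \<le> r" for s r
  proof -
    have "((\<lambda>s. integral {0..s} (\<lambda>v. K v r)) has_real_derivative K s r) (at s within {0..t})"
      by (rule integral_has_real_derivative[OF continuous_on_subset[OF Kc1[OF r]] s]) auto
    then have "((\<lambda>s. g r x + integral {0..s} (\<lambda>v. K v r)) has_real_derivative 0 + K s r) (at s within {0..t})"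
      by (intro DERIV_add DERIV_const)
    then have "((\<lambda>s. g r x + integral {0..s} (\<lambda>v. K v r)) has_real_derivative K s r) (at s within {0..t})"
      by simp
    then show ?thesis
      by (rule has_field_derivative_transform_within[where d = 1]) (use \<Phi>s r s in auto)
  qed
  \<comment> \<open>Differentiation under the expectation; the mean value theorem bounds the
    difference quotients by the constant C.\<close>
  have dr: "((\<lambda>r. \<Phi> s r) has_real_derivative K s r) (at r within {0..t})" if s: "0 \<le> s" and r: "r \<in> {0..t}" for s r
    unfolding has_field_derivative_iff tendsto_at_iff_sequentially
  proof (intro allI impI)
    fix X :: "nat \<Rightarrow> real" assume X: "\<forall>i. X i \<in> {0..t} - {r}" and Xl: "X \<longlonglongrightarrow> r"
    have X0: "0 \<le> X n" "X n \<noteq> r" "X n \<in> {0..t}" for n using X by auto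
    have r0: "0 \<le> r" using r by simp
    have gd: "((\<lambda>r. g r y) has_real_derivative L r y) (at r within A)" if "0 \<le> r" for r y A
      using heat_bump_deriv[OF b_pos \<sigma>_pos \<epsilon> that, of m y] unfolding g_def L_def by (rule has_field_derivative_at_within)
    have "(\<lambda>n. \<integral>\<omega>. (g (X n) (\<xi> s \<omega>) - g r (\<xi> s \<omega>)) / (X n - r) \<partial>Pr x) \<longlonglongrightarrow> (\<integral>\<omega>. L r (\<xi> s \<omega>) \<partial>Pr x)"
    proof (rule integral_dominated_convergence[where w = "\<lambda>_. C"])
      show "(\<lambda>\<omega>. L r (\<xi> s \<omega>)) \<in> borel_measurable (Pr x)"
        by (rule measurable_compose[OF OU_meas[OF s] Lm])
      show "(\<lambda>\<omega>. (g (X n) (\<xi> s \<omega>) - g r (\<xi> s \<omega>)) / (X n - r)) \<in> borel_measurable (Pr x)" for n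
        by (intro borel_measurable_divide borel_measurable_diff measurable_compose[OF OU_meas[OF s] gm] borel_measurable_const)
      show "AE \<omega> in Pr x. (\<lambda>n. (g (X n) (\<xi> s \<omega>) - g r (\<xi> s \<omega>)) / (X n - r)) \<longlonglongrightarrow> L r (\<xi> s \<omega>)"
      proof (rule AE_I2)
        fix \<omega>
        show "(\<lambda>n. (g (X n) (\<xi> s \<omega>) - g r (\<xi> s \<omega>)) / (X n - r)) \<longlonglongrightarrow> L r (\<xi> s \<omega>)"
          using gd[OF r0, of "\<xi> s \<omega>" UNIV] X0 Xl
          unfolding has_field_derivative_iff tendsto_at_iff_sequentially by (auto simp: o_def)
      qed
      show "AE \<omega> in Pr x. norm ((g (X n) (\<xi> s \<omega>) - g r (\<xi> s \<omega>)) / (X n - r)) \<le> C" for n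
      proof (rule AE_I2)
        fix \<omega>
        have "norm (g (X n) (\<xi> s \<omega>) - g r (\<xi> s \<omega>)) \<le> C * norm (X n - r)"
          by (rule field_differentiable_bound[where S = "{0..t}" and f = "\<lambda>r. g r (\<xi> s \<omega>)" and f' = "\<lambda>r. L r (\<xi> s \<omega>)"])
            (use X0 r C gd in auto)
        then show "norm ((g (X n) (\<xi> s \<omega>) - g r (\<xi> s \<omega>)) / (X n - r)) \<le> C"
          using X0(2)[of n] by (simp add: norm_divide pos_divide_le_eq)
      qed
    qed auto
    moreover have "(\<integral>\<omega>. (g (X n) (\<xi> s \<omega>) - g r (\<xi> s \<omega>)) / (X n - r) \<partial>Pr x) = (\<Phi> s (X n) - \<Phi> s r) / (X n - r)" for n
      unfolding \<Phi>_def using gint[OF s r0] gint[OF s X0(1)] by simp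
    ultimately show "((\<lambda>y. (\<Phi> s y - \<Phi> s r) / (y - r)) \<circ> X) \<longlonglongrightarrow> K s r"
      unfolding o_def K_def by (simp only:)
  qed
  define F where "F s = \<Phi> s (t - s)" for s
  \<comment> \<open>One argument is moved at a time. After subtraction of a linear term with slope
    k, the mean value theorem and the joint continuity of K bound each error by e / 2 times the
    step, and the two slopes cancel in the sum.\<close>
  have dF: "(F has_derivative (\<lambda>h. 0)) (at s within {0..t})" if s: "s \<in> {0..t}" for s
    unfolding has_derivative_within_alt
  proof (intro conjI allI impI)
    show "bounded_linear (\<lambda>h::real. 0::real)" by (rule bounded_linear_zero)
    fix e :: real assume e: "e > 0"
    have ts: "(s, t - s) \<in> {0..} \<times> {0..}" using s by auto
    obtain \<delta> where \<delta>: "\<delta> > 0" "\<And>z. z \<in> {0..} \<times> {0..} \<Longrightarrow> dist z (s, t - s) < \<delta> \<Longrightarrow> \<bar>K (fst z) (snd z) - K s (t - s)\<bar> < e / 2"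
      using Kc[unfolded continuous_on_iff, rule_format, OF ts, of "e / 2"] e by (auto simp: dist_real_def case_prod_beta)
    have near: "\<bar>K v r - K s (t - s)\<bar> \<le> e / 2" if "0 \<le> v" "0 \<le> r" "\<bar>v - s\<bar> < \<delta> / 2" "\<bar>r - (t - s)\<bar> < \<delta> / 2" for v r
    proof -
      have "dist (v, r) (s, t - s) \<le> \<bar>v - s\<bar> + \<bar>r - (t - s)\<bar>"
        unfolding dist_Pair_Pair dist_real_def using sqrt_sum_squares_le_sum_abs[of "v - s" "r - (t - s)"] by simp
      then show ?thesis using \<delta>(2)[of "(v, r)"] that by simp
    qed
    show "\<exists>d>0. \<forall>y\<in>{0..t}. norm (y - s) < d \<longrightarrow> norm (F y - F s - 0) \<le> e * norm (y - s)"
    proof (intro exI[of _ "\<delta> / 2"] conjI ballI impI)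
      show "\<delta> / 2 > 0" using \<delta> by simp
      fix y assume y: "y \<in> {0..t}" and ys: "norm (y - s) < \<delta> / 2"
      define k where "k = K s (t - s)"
      define S where "S = {0..t} \<inter> ball s (\<delta> / 2)"
      have S: "convex S" "s \<in> S" "y \<in> S" unfolding S_def using s y ys \<delta>(1) by (auto simp: dist_real_def convex_Int abs_minus_commute)
      have 1: "norm ((\<Phi> y (t - y) - y * k) - (\<Phi> s (t - y) - s * k)) \<le> e / 2 * norm (y - s)"
      proof (rule field_differentiable_bound[where S = S and f = "\<lambda>v. \<Phi> v (t - y) - v * k" and f' = "\<lambda>v. K v (t - y) - k"])
        fix v assume v: "v \<in> S"
        have "((\<lambda>v. \<Phi> v (t - y)) has_real_derivative K v (t - y)) (at v within S)"
          by (rule has_field_derivative_subset[OF ds]) (use v y in \<open>auto simp: S_def\<close>)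
        moreover have "((\<lambda>v. v * k) has_real_derivative k) (at v within S)"
          by (auto intro!: derivative_eq_intros)
        ultimately show "((\<lambda>v. \<Phi> v (t - y) - v * k) has_real_derivative K v (t - y) - k) (at v within S)"
          by (rule DERIV_diff)
        show "norm (K v (t - y) - k) \<le> e / 2"
          unfolding k_def using near[of v "t - y"] v y ys by (auto simp: S_def dist_real_def abs_minus_commute)
      qed (use S in auto)
      define S' where "S' = {0..t} \<inter> ball (t - s) (\<delta> / 2)"
      have S': "convex S'" "t - s \<in> S'" "t - y \<in> S'" unfolding S'_def using s y ys \<delta>(1) by (auto simp: dist_real_def convex_Int abs_minus_commute)
      have 2: "norm ((\<Phi> s (t - y) - (t - y) * k) - (\<Phi> s (t - s) - (t - s) * k)) \<le> e / 2 * norm ((t - y) - (t - s))"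
      proof (rule field_differentiable_bound[where S = S' and f = "\<lambda>v. \<Phi> s v - v * k" and f' = "\<lambda>v. K s v - k"])
        fix v assume v: "v \<in> S'"
        have "((\<lambda>v. \<Phi> s v) has_real_derivative K s v) (at v within S')"
          by (rule has_field_derivative_subset[OF dr]) (use v s in \<open>auto simp: S'_def\<close>)
        moreover have "((\<lambda>v. v * k) has_real_derivative k) (at v within S')"
          by (auto intro!: derivative_eq_intros)
        ultimately show "((\<lambda>v. \<Phi> s v - v * k) has_real_derivative K s v - k) (at v within S')"
          by (rule DERIV_diff)
        show "norm (K s v - k) \<le> e / 2"
          unfolding k_def using near[of s v] v s \<delta>(1) by (auto simp: S'_def dist_real_def abs_minus_commute)
      qed (use S' in auto)
      have "F y - F s = ((\<Phi> y (t - y) - y * k) - (\<Phi> s (t - y) - s * k)) + ((\<Phi> s (t - y) - (t - y) * k) - (\<Phi> s (t - s) - (t - s) * k))"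
        by (simp add: F_def algebra_simps)
      then have "norm (F y - F s) \<le> e / 2 * norm (y - s) + e / 2 * norm ((t - y) - (t - s))"
        using 1 2 norm_triangle_mono by metis
      also have "\<dots> = e * norm (y - s)"
        by (simp add: abs_minus_commute[of s y])
      finally show "norm (F y - F s - 0) \<le> e * norm (y - s)" by simp
    qed
  qed
  obtain c where c: "\<And>s. s \<in> {0..t} \<Longrightarrow> F s = c"
    using has_derivative_zero_constant[of "{0..t}" F] dF by auto
  have "\<Phi> t 0 = \<Phi> 0 t" using c[of t] c[of 0] t by (simp add: F_def)
  then show ?thesis unfolding \<Phi>_def OU_start[OF gm] unfolding g_def .
qed

text \<open>Integrating the known expectations of bumps against h over all centres m identifies the
  law of \<open>\<xi> t\<close> convolved with a Gaussian of width \<epsilon>. Letting \<epsilon>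
  tend to 0 then determines the integral of every continuous h with values in [0, 1].\<close>

lemma OU_law:
  assumes t: "0 \<le> t"
  shows "distr (Pr x) borel (\<xi> t) = ou_law (b / \<sigma>\<^sup>2) (exp (- b * t)) x"
proof (rule measure_eqI_continuous)
  interpret prob_space "Pr x" by (rule OU_prob)
  define a where "a = b / \<sigma>\<^sup>2"
  have a: "a > 0" using b_pos \<sigma>_pos by (simp add: a_def)
  define w where "w = exp (- b * t)"
  have w: "0 < w" "w\<^sup>2 \<le> 1" using b_pos t by (auto simp: w_def power_le_one)
  define \<nu> where "\<nu> = distr (Pr x) borel (\<xi> t)"
  show p: "prob_space (distr (Pr x) borel (\<xi> t))" by (rule prob_space_distr[OF OU_meas[OF t]])
  then interpret \<nu>: prob_space \<nu> by (simp add: \<nu>_def)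
  have [measurable_cong]: "sets \<nu> = sets borel" by (simp add: \<nu>_def)
  show "prob_space (ou_law (b / \<sigma>\<^sup>2) (exp (- b * t)) x)" by (rule prob_space_ou_law[OF a[unfolded a_def]])
  show "sets (distr (Pr x) borel (\<xi> t)) = sets borel" "sets (ou_law (b / \<sigma>\<^sup>2) (exp (- b * t)) x) = sets borel" by auto
  fix h :: "real^'d \<Rightarrow> real" assume hc: "continuous_on UNIV h" and h: "\<And>x. 0 \<le> h x \<and> h x \<le> 1"
  have [measurable]: "h \<in> borel_measurable borel" by (rule borel_measurable_continuous_onI[OF hc])
  \<comment> \<open>The Lebesgue density at m of y + c Z, where Z has law \<open>gauss a\<close>; as
    a function of y it is a multiple of a bump centred at m.\<close>
  define D where "D c y m = (sqrt (a / pi) / c) ^ CARD('d) * exp (- a * (norm (m - y))\<^sup>2 / c\<^sup>2)" for c and y m :: "real^'d"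
  have aff: "(\<integral>\<^sup>+z. ennreal (h (y + c *\<^sub>R z)) \<partial>gauss a) = (\<integral>\<^sup>+m. ennreal (h m) * ennreal (D c y m) \<partial>lborel)" if c: "c > 0" for c y
  proof -
    have "(\<integral>\<^sup>+z. ennreal (h (y + c *\<^sub>R z)) \<partial>gauss a) = (\<integral>\<^sup>+m. ennreal (h m) \<partial>distr (gauss a) borel (\<lambda>z. y + c *\<^sub>R z))"
      by (subst nn_integral_distr) auto
    also have "\<dots> = (\<integral>\<^sup>+m. ennreal (D c y m) * ennreal (h m) \<partial>lborel)"
      unfolding gauss_affine[OF a c] D_def by (rule nn_integral_density) auto
    finally show ?thesis by (simp add: mult.commute)
  qed
  interpret G: prob_space "gauss a :: (real^'d) measure" by (rule prob_space_gauss[OF a])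
  have key: "(\<integral>y. (\<integral>z. h (y + \<epsilon> *\<^sub>R z) \<partial>gauss a) \<partial>\<nu>) = (\<integral>z. h (w *\<^sub>R x + sqrt (\<epsilon>\<^sup>2 + 1 - w\<^sup>2) *\<^sub>R z) \<partial>gauss a)"
    if \<epsilon>: "\<epsilon> > 0" for \<epsilon>
  proof -
    define V where "V = \<epsilon>\<^sup>2 + 1 - w\<^sup>2"
    have V: "V > 0" using w \<epsilon> by (simp add: V_def add_pos_nonneg add.assoc add_diff_eq[symmetric])
    have pw: "(1 / c) ^ CARD('d) = exp (- (real CARD('d) / 2) * ln (c\<^sup>2))" if "c > 0" for c :: real
    proof -
      have "exp (- (real CARD('d) / 2) * ln (c\<^sup>2)) = exp (real CARD('d) * - ln c)"
        using that by (simp add: ln_realpow)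
      also have "\<dots> = (exp (- ln c)) ^ CARD('d)" by (rule exp_of_nat_mult)
      also have "exp (- ln c) = 1 / c" using that by (simp add: exp_minus inverse_eq_divide)
      finally show ?thesis by simp
    qed
    \<comment> \<open>\<open>heat_bump_expectation\<close> in terms of densities: averaging the
      density of width \<epsilon> over \<open>\<xi> t\<close> gives the density of width sqrt V
      around w x.\<close>
    have Dint: "(\<integral>\<^sup>+y. ennreal (D \<epsilon> y m) \<partial>\<nu>) = ennreal (D (sqrt V) (w *\<^sub>R x) m)" for m
    proof -
      define B where "B y = exp (- a * (norm (m - y))\<^sup>2 / \<epsilon>\<^sup>2)" for y
      have [measurable]: "B \<in> borel_measurable borel" unfolding B_def by measurable
      have intB: "integrable \<nu> B" using a by (intro \<nu>.integrable_const_bound[where B = 1]) (auto simp: B_def)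
      have hb0: "heat_bump b \<sigma> \<epsilon> m 0 y = (1 / \<epsilon>) ^ CARD('d) * B y" for y
      proof -
        have "(norm (m - y))\<^sup>2 = (y - m) \<bullet> (y - m)"
          by (metis norm_minus_commute power2_norm_eq_inner)
        then show ?thesis
          unfolding heat_bump_def bump_def heat_var_def B_def pw[OF \<epsilon>] by (simp add: a_def)
      qed
      have hbt: "heat_bump b \<sigma> \<epsilon> m t x = (1 / sqrt V) ^ CARD('d) * exp (- a * (norm (m - w *\<^sub>R x))\<^sup>2 / (sqrt V)\<^sup>2)"
      proof -
        have "(norm (m - w *\<^sub>R x))\<^sup>2 = (w *\<^sub>R x - m) \<bullet> (w *\<^sub>R x - m)"
          by (metis norm_minus_commute power2_norm_eq_inner)
        moreover have "heat_var b \<epsilon> t = V" by (simp add: heat_var_def V_def w_def)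
        ultimately show ?thesis
          unfolding heat_bump_def bump_def using V by (simp add: pw a_def w_def)
      qed
      have "(\<integral>y. heat_bump b \<sigma> \<epsilon> m 0 y \<partial>\<nu>) = heat_bump b \<sigma> \<epsilon> m t x"
        unfolding \<nu>_def heat_bump_expectation[OF \<epsilon> t, symmetric]
        by (rule integral_distr[OF OU_meas[OF t]]) (simp add: hb0)
      then have e: "(1 / \<epsilon>) ^ CARD('d) * (\<integral>y. B y \<partial>\<nu>) = (1 / sqrt V) ^ CARD('d) * exp (- a * (norm (m - w *\<^sub>R x))\<^sup>2 / (sqrt V)\<^sup>2)"
        unfolding hb0 hbt by simp
      have D0: "D \<epsilon> y m \<ge> 0" for y using a \<epsilon> by (simp add: D_def)
      have DB: "D \<epsilon> y m = sqrt (a / pi) ^ CARD('d) * ((1 / \<epsilon>) ^ CARD('d) * B y)" for y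
        by (simp add: D_def B_def power_divide)
      have "(\<integral>\<^sup>+y. ennreal (D \<epsilon> y m) \<partial>\<nu>) = ennreal (\<integral>y. D \<epsilon> y m \<partial>\<nu>)"
        using D0 intB by (intro nn_integral_eq_integral) (auto simp: DB)
      also have "(\<integral>y. D \<epsilon> y m \<partial>\<nu>) = sqrt (a / pi) ^ CARD('d) * ((1 / \<epsilon>) ^ CARD('d) * (\<integral>y. B y \<partial>\<nu>))"
        unfolding DB by simp
      also have "\<dots> = D (sqrt V) (w *\<^sub>R x) m" unfolding e by (simp add: D_def power_divide)
      finally show ?thesis .
    qed
    have [measurable]: "(\<lambda>z. D \<epsilon> (fst z) (snd z)) \<in> borel_measurable (borel \<Otimes>\<^sub>M borel)" unfolding D_def by measurable
    have inn: "(\<integral>\<^sup>+z. ennreal (h (y + c *\<^sub>R z)) \<partial>gauss a) = ennreal (\<integral>z. h (y + c *\<^sub>R z) \<partial>gauss a)" for y c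
      using h by (intro nn_integral_eq_integral G.integrable_const_bound[where B = 1]) auto
    have i01: "0 \<le> (\<integral>z. h (y + c *\<^sub>R z) \<partial>gauss a)" "(\<integral>z. h (y + c *\<^sub>R z) \<partial>gauss a) \<le> 1" for y c
      using h by (auto intro!: integral_nonneg_AE AE_I2 G.integral_le_const G.integrable_const_bound[where B = 1])
    have pair: "pair_sigma_finite \<nu> lborel" ..
    have "ennreal (\<integral>y. (\<integral>z. h (y + \<epsilon> *\<^sub>R z) \<partial>gauss a) \<partial>\<nu>) = (\<integral>\<^sup>+y. ennreal (\<integral>z. h (y + \<epsilon> *\<^sub>R z) \<partial>gauss a) \<partial>\<nu>)"
      using i01 by (intro nn_integral_eq_integral[symmetric] \<nu>.integrable_const_bound[where B = 1]) auto
    also have "\<dots> = (\<integral>\<^sup>+y. (\<integral>\<^sup>+m. ennreal (h m) * ennreal (D \<epsilon> y m) \<partial>lborel) \<partial>\<nu>)"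
      unfolding inn[symmetric] aff[OF \<epsilon>] ..
    also have "\<dots> = (\<integral>\<^sup>+m. (\<integral>\<^sup>+y. ennreal (h m) * ennreal (D \<epsilon> y m) \<partial>\<nu>) \<partial>lborel)"
      by (rule pair_sigma_finite.Fubini'[OF pair, symmetric]) (simp add: case_prod_beta)
    also have "\<dots> = (\<integral>\<^sup>+m. ennreal (h m) * (\<integral>\<^sup>+y. ennreal (D \<epsilon> y m) \<partial>\<nu>) \<partial>lborel)"
      by (intro nn_integral_cong nn_integral_cmult) (simp add: D_def)
    also have "\<dots> = (\<integral>\<^sup>+z. ennreal (h (w *\<^sub>R x + sqrt V *\<^sub>R z)) \<partial>gauss a)"
      unfolding Dint using V by (intro aff[symmetric]) simp
    also have "\<dots> = ennreal (\<integral>z. h (w *\<^sub>R x + sqrt V *\<^sub>R z) \<partial>gauss a)" by (rule inn)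
    finally show ?thesis
      using i01 by (subst (asm) ennreal_inj) (auto simp: V_def intro!: integral_nonneg_AE AE_I2)
  qed
  have hlim: "(\<lambda>n. h (z n)) \<longlonglongrightarrow> h z0" if "z \<longlonglongrightarrow> z0" for z z0
    by (rule continuous_on_tendsto_compose[OF hc that]) auto
  define e where "e n = inverse (real (Suc n))" for n
  have e: "e n > 0" "e \<longlonglongrightarrow> 0" for n unfolding e_def by simp (rule LIMSEQ_inverse_real_of_nat)
  have l1: "(\<lambda>n. \<integral>z. h (y + e n *\<^sub>R z) \<partial>gauss a) \<longlonglongrightarrow> (\<integral>z. h y \<partial>(gauss a :: (real^'d) measure))" for y
  proof (rule integral_dominated_convergence[where w = "\<lambda>_. 1"])
    show "AE z in gauss a. (\<lambda>n. h (y + e n *\<^sub>R z)) \<longlonglongrightarrow> h y"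
    proof (intro AE_I2 hlim)
      fix z
      show "(\<lambda>n. y + e n *\<^sub>R z) \<longlonglongrightarrow> y"
        using tendsto_add[OF tendsto_const tendsto_scaleR[OF e(2) tendsto_const], of y z] by simp
    qed
  qed (use h in auto)
  have l2: "(\<lambda>n. \<integral>y. (\<integral>z. h (y + e n *\<^sub>R z) \<partial>gauss a) \<partial>\<nu>) \<longlonglongrightarrow> (\<integral>y. h y \<partial>\<nu>)"
  proof (rule integral_dominated_convergence[where w = "\<lambda>_. 1"])
    show "AE y in \<nu>. (\<lambda>n. \<integral>z. h (y + e n *\<^sub>R z) \<partial>gauss a) \<longlonglongrightarrow> h y"
      using l1 by (simp add: G.prob_space[simplified])
    show "AE y in \<nu>. norm (\<integral>z. h (y + e n *\<^sub>R z) \<partial>gauss a) \<le> 1" for n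
    proof (rule AE_I2)
      fix y
      have "0 \<le> (\<integral>z. h (y + e n *\<^sub>R z) \<partial>gauss a)" "(\<integral>z. h (y + e n *\<^sub>R z) \<partial>gauss a) \<le> 1"
        using h by (auto intro!: integral_nonneg_AE AE_I2 G.integral_le_const G.integrable_const_bound[where B = 1])
      then show "norm (\<integral>z. h (y + e n *\<^sub>R z) \<partial>gauss a) \<le> 1" by simp
    qed
  qed auto
  have l3: "(\<lambda>n. \<integral>z. h (w *\<^sub>R x + sqrt ((e n)\<^sup>2 + 1 - w\<^sup>2) *\<^sub>R z) \<partial>gauss a) \<longlonglongrightarrow> (\<integral>z. h (w *\<^sub>R x + sqrt (1 - w\<^sup>2) *\<^sub>R z) \<partial>gauss a)"
  proof (rule integral_dominated_convergence[where w = "\<lambda>_. 1"])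
    show "AE z in gauss a. (\<lambda>n. h (w *\<^sub>R x + sqrt ((e n)\<^sup>2 + 1 - w\<^sup>2) *\<^sub>R z)) \<longlonglongrightarrow> h (w *\<^sub>R x + sqrt (1 - w\<^sup>2) *\<^sub>R z)"
    proof (intro AE_I2 hlim)
      fix z
      have "(\<lambda>n. w *\<^sub>R x + sqrt ((e n)\<^sup>2 + 1 - w\<^sup>2) *\<^sub>R z) \<longlonglongrightarrow> w *\<^sub>R x + sqrt (0\<^sup>2 + 1 - w\<^sup>2) *\<^sub>R z"
        by (intro tendsto_intros e(2))
      then show "(\<lambda>n. w *\<^sub>R x + sqrt ((e n)\<^sup>2 + 1 - w\<^sup>2) *\<^sub>R z) \<longlonglongrightarrow> w *\<^sub>R x + sqrt (1 - w\<^sup>2) *\<^sub>R z" by simp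
    qed
  qed (use h in auto)
  have "(\<integral>y. h y \<partial>\<nu>) = (\<integral>z. h (w *\<^sub>R x + sqrt (1 - w\<^sup>2) *\<^sub>R z) \<partial>gauss a)"
    by (rule LIMSEQ_unique[OF l2]) (unfold key[OF e(1)], rule l3)
  then show "(\<integral>y. h y \<partial>distr (Pr x) borel (\<xi> t)) = (\<integral>y. h y \<partial>ou_law (b / \<sigma>\<^sup>2) (exp (- b * t)) x)"
    unfolding \<nu>_def[symmetric] a_def[symmetric] w_def[symmetric] by (simp add: integral_ou_law ou_map_def)
qed

lemma nn_integral_OU:
  assumes "0 \<le> t" "f \<in> borel_measurable borel"
  shows "(\<integral>\<^sup>+w. f (\<xi> t w) \<partial>Pr x) = (\<integral>\<^sup>+y. f y \<partial>ou_law (b / \<sigma>\<^sup>2) (exp (- b * t)) x)"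
  unfolding OU_law[OF assms(1), symmetric] using assms by (subst nn_integral_distr[OF OU_meas]) auto

text \<open>Read off from the Markov property of \<xi>, whose law is now known, instead of composing
  Gaussian kernels.\<close>

lemma ou_law_semigroup:
  assumes s: "0 \<le> s" and t: "0 \<le> t" and f [measurable]: "f \<in> borel_measurable borel"
  shows "(\<integral>\<^sup>+y. (\<integral>\<^sup>+z. f z \<partial>ou_law (b / \<sigma>\<^sup>2) (exp (- b * t)) y) \<partial>ou_law (b / \<sigma>\<^sup>2) (exp (- b * s)) x)
    = (\<integral>\<^sup>+z. f z \<partial>ou_law (b / \<sigma>\<^sup>2) (exp (- b * (s + t))) (x :: real^'d))"
proof -
  have a: "b / \<sigma>\<^sup>2 > 0" using b_pos \<sigma>_pos by simp
  note [measurable] = ou_law_measurable[OF _ _ a]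
  have m: "(\<lambda>y. \<integral>\<^sup>+z. f z \<partial>ou_law (b / \<sigma>\<^sup>2) (exp (- b * t)) y) \<in> borel_measurable borel" by measurable
  have "(\<integral>\<^sup>+z. f z \<partial>ou_law (b / \<sigma>\<^sup>2) (exp (- b * (s + t))) x) = (\<integral>\<^sup>+w. 1 * f (\<xi> (s + t) w) \<partial>Pr x)"
    using s t by (simp add: nn_integral_OU)
  also have "\<dots> = (\<integral>\<^sup>+w. 1 * (\<integral>\<^sup>+w'. f (\<xi> t w') \<partial>Pr (\<xi> s w)) \<partial>Pr x)"
    by (rule markov_nn_integral[OF OU_space s t, where g = "\<lambda>_. 1"]) auto
  also have "\<dots> = (\<integral>\<^sup>+w. (\<integral>\<^sup>+z. f z \<partial>ou_law (b / \<sigma>\<^sup>2) (exp (- b * t)) (\<xi> s w)) \<partial>Pr x)"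
    using t by (simp add: nn_integral_OU)
  also have "\<dots> = (\<integral>\<^sup>+y. (\<integral>\<^sup>+z. f z \<partial>ou_law (b / \<sigma>\<^sup>2) (exp (- b * t)) y) \<partial>ou_law (b / \<sigma>\<^sup>2) (exp (- b * s)) x)"
    by (rule nn_integral_OU[OF s m])
  finally show ?thesis by simp
qed

end

section \<open>The branching mechanism\<close>

lemma exp_second_order: "((\<lambda>u::real. (exp u - 1 - u) / u\<^sup>2) \<longlongrightarrow> 1 / 2) (at 0)"
proof (rule lhopital[where f' = "\<lambda>u. exp u - 1" and g' = "\<lambda>u. 2 * u"])
  have "((\<lambda>u::real. exp u - 1 - u) \<longlongrightarrow> exp 0 - 1 - 0) (at 0)" by (intro tendsto_intros)
  then show "((\<lambda>u::real. exp u - 1 - u) \<longlongrightarrow> 0) (at 0)" by simp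
  have "((\<lambda>u::real. u\<^sup>2) \<longlongrightarrow> 0\<^sup>2) (at 0)" by (intro tendsto_intros)
  then show "((\<lambda>u::real. u\<^sup>2) \<longlongrightarrow> 0) (at 0)" by simp
  have ne: "\<forall>\<^sub>F u::real in at 0. u \<noteq> 0" by (rule eventually_neq_at_within)
  show "\<forall>\<^sub>F u::real in at 0. u\<^sup>2 \<noteq> 0" "\<forall>\<^sub>F u::real in at 0. 2 * u \<noteq> 0" using ne by auto
  show "\<forall>\<^sub>F u::real in at 0. ((\<lambda>u. exp u - 1 - u) has_real_derivative exp u - 1) (at u)"
    by (intro always_eventually allI) (auto intro!: derivative_eq_intros)
  show "\<forall>\<^sub>F u::real in at 0. ((\<lambda>u. u\<^sup>2) has_real_derivative 2 * u) (at u)"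
    by (intro always_eventually allI) (auto intro!: derivative_eq_intros)
  have "((\<lambda>h::real. (exp (0 + h) - exp 0) / h) \<longlongrightarrow> exp 0) (at 0)"
    using DERIV_exp[of 0] unfolding DERIV_def .
  then have "((\<lambda>h::real. (exp h - 1) / h * (1 / 2)) \<longlongrightarrow> 1 * (1 / 2)) (at 0)"
    by (intro tendsto_mult tendsto_const) simp
  then show "((\<lambda>u::real. (exp u - 1) / (2 * u)) \<longlongrightarrow> 1 / 2) (at 0)" by (simp add: mult.commute)
qed

text \<open>The remainder factor is delivered as a sequence h with no division left, so indices with
  \<open>u n = 0\<close> are covered.\<close>

lemma exp_second_order_seq:
  fixes u :: "nat \<Rightarrow> real"
  assumes "u \<longlonglongrightarrow> 0"
  shows "\<exists>h. h \<longlonglongrightarrow> 1 / 2 \<and> (\<forall>n. exp (u n) = 1 + u n + (u n)\<^sup>2 * h n)"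
proof -
  define H where "H v = (if v = 0 then 1 / 2 else (exp v - 1 - v) / v\<^sup>2)" for v :: real
  have "(H \<longlongrightarrow> 1 / 2) (at 0)"
    by (rule Lim_transform_eventually[OF exp_second_order]) (auto simp: H_def eventually_at_filter)
  then have "isCont H 0" by (simp add: isCont_def H_def)
  then have "(\<lambda>n. H (u n)) \<longlonglongrightarrow> H 0" using assms by (rule isCont_tendsto_compose)
  moreover have "exp v = 1 + v + v\<^sup>2 * H v" for v by (simp add: H_def)
  ultimately show ?thesis by (intro exI[of _ "\<lambda>n. H (u n)"]) (auto simp: H_def)
qed

text \<open>The upper bound follows from \<open>exp (- y) \<le> 1 / (1 + y)\<close> and
  \<open>(1 - y + y\<^sup>2) * (1 + y) = 1 + y ^ 3\<close>.\<close>

lemma exp_neg_bounds: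
  fixes y :: real assumes "0 \<le> y"
  shows "0 \<le> exp (- y) - 1 + y" "exp (- y) - 1 + y \<le> y\<^sup>2"
proof -
  show "0 \<le> exp (- y) - 1 + y" using exp_ge_add_one_self[of "- y"] by simp
  have "exp (- y) \<le> 1 / (1 + y)"
    using exp_ge_add_one_self[of y] assms unfolding exp_minus inverse_eq_divide by (intro divide_left_mono) (auto intro: add_pos_nonneg)
  also have "\<dots> \<le> 1 - y + y\<^sup>2"
  proof -
    have "1 \<le> 1 + y ^ 3" using assms by simp
    also have "\<dots> = (1 - y + y\<^sup>2) * (1 + y)" by (simp add: algebra_simps power2_eq_square power3_eq_cube)
    finally show ?thesis using assms by (simp add: divide_le_eq add_pos_nonneg)
  qed
  finally show "exp (- y) - 1 + y \<le> y\<^sup>2" by simp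
qed

context branching_mechanism
begin

text \<open>The branching mechanism without its linear part: nonnegative and nondecreasing on the
  half-line, so its integrals can be taken in \<open>ennreal\<close>.\<close>

definition psi0 :: "real \<Rightarrow> real" where
  "psi0 z = \<beta> * z\<^sup>2 + (\<integral>x. (exp (- z * x) - 1 + z * x) \<partial>n)"

text \<open>Half of the second derivative of the branching mechanism at 0.\<close>

definition kap :: real where
  "kap = \<beta> + (\<integral>x. x\<^sup>2 \<partial>n) / 2"

lemma branching_psi_eq: "branching_psi \<alpha> \<beta> n z = - \<alpha> * z + psi0 z"
  by (simp add: branching_psi_def psi0_def)

lemma space_n: "space n = {0<..}"
  using sets_eq_imp_space_eq[OF sets_n] by (simp add: space_restrict_space)

lemma n_measurable: "f \<in> borel_measurable borel \<Longrightarrow> f \<in> borel_measurable n" for f :: "real \<Rightarrow> real"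
  by (subst measurable_cong_sets[OF sets_n refl]) (rule measurable_restrict_space1)

lemma integrable_sq_n: "integrable n (\<lambda>x. x\<^sup>2)"
proof (rule integrableI_nonneg)
  show "(\<lambda>x. x\<^sup>2) \<in> borel_measurable n" by (rule n_measurable) measurable
qed (use second_moment_n in auto)

lemma integrable_rho:
  assumes z: "0 \<le> z" shows "integrable n (\<lambda>x. exp (- z * x) - 1 + z * x)"
proof (rule Bochner_Integration.integrable_bound)
  show "integrable n (\<lambda>x. z\<^sup>2 * x\<^sup>2)" using integrable_sq_n by simp
  show "(\<lambda>x. exp (- z * x) - 1 + z * x) \<in> borel_measurable n" by (rule n_measurable) measurable
  show "AE x in n. norm (exp (- z * x) - 1 + z * x) \<le> norm (z\<^sup>2 * x\<^sup>2)"
  proof (rule AE_I2)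
    fix x assume "x \<in> space n"
    then have "0 \<le> z * x" using z by (simp add: space_n)
    from exp_neg_bounds[OF this] show "norm (exp (- z * x) - 1 + z * x) \<le> norm (z\<^sup>2 * x\<^sup>2)"
      by (simp add: power_mult_distrib)
  qed
qed

lemma psi0_nonneg:
  assumes z: "0 \<le> z" shows "0 \<le> psi0 z"
  unfolding psi0_def
proof (rule add_nonneg_nonneg)
  show "0 \<le> (\<integral>x. (exp (- z * x) - 1 + z * x) \<partial>n)"
  proof (rule Bochner_Integration.integral_nonneg)
  fix x assume "x \<in> space n"
  then have "0 \<le> z * x" using z by (simp add: space_n)
    from exp_neg_bounds(1)[OF this] show "0 \<le> exp (- z * x) - 1 + z * x" by simp
  qed
qed (use \<beta>_nonneg in auto)

lemma kap_nonneg: "0 \<le> kap"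
  using \<beta>_nonneg by (simp add: kap_def)

text \<open>The factor 2 is there because \<open>exp_neg_bounds\<close> has \<open>y\<^sup>2\<close>
  in place of \<open>y\<^sup>2 / 2\<close>; the bound serves domination only.\<close>

lemma psi0_le:
  assumes z: "0 \<le> z" shows "psi0 z \<le> 2 * kap * z\<^sup>2"
proof -
  have "(\<integral>x. (exp (- z * x) - 1 + z * x) \<partial>n) \<le> (\<integral>x. z\<^sup>2 * x\<^sup>2 \<partial>n)"
  proof (rule integral_mono)
    fix x assume "x \<in> space n"
    then have "0 \<le> z * x" using z by (simp add: space_n)
    from exp_neg_bounds[OF this] show "exp (- z * x) - 1 + z * x \<le> z\<^sup>2 * x\<^sup>2"
      by (simp add: power_mult_distrib)
  qed (use integrable_rho[OF z] integrable_sq_n in auto)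
  moreover have "0 \<le> \<beta> * z\<^sup>2" using \<beta>_nonneg by simp
  ultimately show ?thesis by (simp add: psi0_def kap_def algebra_simps)
qed

lemma psi0_mono:
  assumes z: "0 \<le> z" "z \<le> z'" shows "psi0 z \<le> psi0 z'"
  unfolding psi0_def
proof (rule add_mono)
  show "\<beta> * z\<^sup>2 \<le> \<beta> * z'\<^sup>2" using z \<beta>_nonneg by (intro mult_left_mono power_mono) auto
  show "(\<integral>x. (exp (- z * x) - 1 + z * x) \<partial>n) \<le> (\<integral>x. (exp (- z' * x) - 1 + z' * x) \<partial>n)"
  proof (rule integral_mono)
    fix x assume "x \<in> space n"
    then have x: "0 < x" by (simp add: space_n)
    have e: "exp (- z' * x) = exp (- z * x) * exp (- (z' - z) * x)"
      by (simp add: exp_add[symmetric] algebra_simps)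
    have "1 - exp (- (z' - z) * x) \<le> (z' - z) * x"
      using exp_ge_add_one_self[of "- (z' - z) * x"] by (simp add: algebra_simps)
    moreover have "0 \<le> 1 - exp (- (z' - z) * x)"
      using mult_nonneg_nonneg[of "z' - z" x] z x by (simp add: algebra_simps)
    ultimately have "exp (- z * x) * (1 - exp (- (z' - z) * x)) \<le> 1 * ((z' - z) * x)"
      using z x by (intro mult_mono) auto
    then show "exp (- z * x) - 1 + z * x \<le> exp (- z' * x) - 1 + z' * x"
      unfolding e by (simp add: algebra_simps)
  qed (use z integrable_rho in auto)
qed

text \<open>Monotone functions are Borel; the truncation at 0 reflects that monotonicity is
  established on the half-line only.\<close>

lemma psi0_measurable [measurable]: "(\<lambda>z. psi0 (max 0 z)) \<in> borel_measurable borel"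
  by (rule borel_measurable_mono) (auto simp: mono_def intro!: psi0_mono)

lemma psi0_0: "psi0 0 = 0"
  by (simp add: psi0_def)

text \<open>After division by z^2 the integrand tends to x^2 / 2 and is dominated by x^2, which is
  integrable under n.\<close>

lemma psi0_limit:
  assumes z: "\<And>k. 0 < z k" "z \<longlonglongrightarrow> 0"
  shows "(\<lambda>k. psi0 (z k) / (z k)\<^sup>2) \<longlonglongrightarrow> kap"
proof -
  have "(\<lambda>k. \<integral>x. (exp (- z k * x) - 1 + z k * x) / (z k)\<^sup>2 \<partial>n) \<longlonglongrightarrow> (\<integral>x. x\<^sup>2 / 2 \<partial>n)"
  proof (rule integral_dominated_convergence[where w = "\<lambda>x. x\<^sup>2"])
    show "AE x in n. (\<lambda>k. (exp (- z k * x) - 1 + z k * x) / (z k)\<^sup>2) \<longlonglongrightarrow> x\<^sup>2 / 2"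
    proof (rule AE_I2)
      fix x
      have "(\<lambda>k. - z k * x) \<longlonglongrightarrow> - 0 * x" by (intro tendsto_intros z)
      then obtain h where h: "h \<longlonglongrightarrow> 1 / 2" "\<And>k. exp (- z k * x) = 1 + (- z k * x) + (- z k * x)\<^sup>2 * h k"
        using exp_second_order_seq[of "\<lambda>k. - z k * x"] by auto
      have "(exp (- z k * x) - 1 + z k * x) / (z k)\<^sup>2 = x\<^sup>2 * h k" for k
        unfolding h(2) using z(1)[of k] by (simp add: power_mult_distrib)
      then show "(\<lambda>k. (exp (- z k * x) - 1 + z k * x) / (z k)\<^sup>2) \<longlonglongrightarrow> x\<^sup>2 / 2"
        using tendsto_mult[OF tendsto_const h(1), of "x\<^sup>2"] by simp
    qed
    show "AE x in n. norm ((exp (- z k * x) - 1 + z k * x) / (z k)\<^sup>2) \<le> x\<^sup>2" for k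
    proof (rule AE_I2)
      fix x assume "x \<in> space n"
      then have "0 \<le> z k * x" using z(1)[of k] by (simp add: space_n)
      from exp_neg_bounds[OF this] show "norm ((exp (- z k * x) - 1 + z k * x) / (z k)\<^sup>2) \<le> x\<^sup>2"
        using z(1)[of k] by (simp add: power_mult_distrib divide_le_eq mult.commute)
    qed
    show "(\<lambda>x. x\<^sup>2 / 2) \<in> borel_measurable n" by (rule n_measurable) measurable
    show "(\<lambda>x. (exp (- z k * x) - 1 + z k * x) / (z k)\<^sup>2) \<in> borel_measurable n" for k by (rule n_measurable) measurable
  qed (rule integrable_sq_n)
  then have "(\<lambda>k. \<beta> + (\<integral>x. (exp (- z k * x) - 1 + z k * x) / (z k)\<^sup>2 \<partial>n)) \<longlonglongrightarrow> \<beta> + (\<integral>x. x\<^sup>2 / 2 \<partial>n)"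
    by (intro tendsto_add tendsto_const)
  moreover have "psi0 (z k) / (z k)\<^sup>2 = \<beta> + (\<integral>x. (exp (- z k * x) - 1 + z k * x) / (z k)\<^sup>2 \<partial>n)" for k
    unfolding integral_divide_zero psi0_def using z(1)[of k] by (simp add: add_divide_distrib)
  ultimately show ?thesis by (simp add: kap_def)
qed

lemma psi0_second_order:
  assumes z: "\<And>k. 0 \<le> z k" "z \<longlonglongrightarrow> 0"
  shows "\<exists>h. h \<longlonglongrightarrow> kap \<and> (\<forall>k. psi0 (z k) = (z k)\<^sup>2 * h k)"
proof -
  \<comment> \<open>Zeros of z are replaced by 1 / (k + 1) to make \<open>psi0_limit\<close>
    applicable; at such k both sides of the claim are 0.\<close>
  define z' where "z' k = (if z k = 0 then inverse (real (Suc k)) else z k)" for k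
  have "(\<lambda>k. z k + inverse (real (Suc k))) \<longlonglongrightarrow> 0 + 0"
    by (intro tendsto_add z LIMSEQ_inverse_real_of_nat)
  then have up: "(\<lambda>k. z k + inverse (real (Suc k))) \<longlonglongrightarrow> 0" by simp
  have pos: "0 < z' k" for k using z(1)[of k] by (auto simp: z'_def le_less)
  have "z' \<longlonglongrightarrow> 0"
  proof (rule tendsto_sandwich[OF _ _ tendsto_const up])
    show "\<forall>\<^sub>F k in sequentially. 0 \<le> z' k" using pos by (auto intro!: always_eventually less_imp_le)
    show "\<forall>\<^sub>F k in sequentially. z' k \<le> z k + inverse (real (Suc k))"
      using z(1) by (auto intro!: always_eventually simp: z'_def)
  qed
  from psi0_limit[OF pos this] show ?thesis
    by (intro exI[of _ "\<lambda>k. psi0 (z' k) / (z' k)\<^sup>2"]) (auto simp: z'_def psi0_0)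
qed

text \<open>The mechanism is convex and vanishes at 0, so once it is at least 1 at z0 it stays above
  z / z0 from there on. This lets the integrability of \<psi>(u), part of the notion of solution,
  control u itself.\<close>

lemma psi_coercive:
  obtains c z0 where "c > 0" "z0 > 0" "\<And>z. 0 \<le> z \<Longrightarrow> z \<le> z0 + c * \<bar>branching_psi \<alpha> \<beta> n z\<bar>"
proof -
  have "\<forall>\<^sub>F z in at_top. 1 \<le> branching_psi \<alpha> \<beta> n z"
    using psi_at_top by (simp add: filterlim_at_top)
  then obtain z1 where z1: "\<And>z. z1 \<le> z \<Longrightarrow> 1 \<le> branching_psi \<alpha> \<beta> n z"
    by (auto simp: eventually_at_top_linorder)
  define z0 where "z0 = max z1 1"
  have z0: "z0 > 0" "1 \<le> branching_psi \<alpha> \<beta> n z0" using z1 by (auto simp: z0_def)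
  \<comment> \<open>Convexity on the segment from 0 to z, on which z0 sits at the fraction l = z0 /
    z.\<close>
  have ray: "z / z0 * branching_psi \<alpha> \<beta> n z0 \<le> branching_psi \<alpha> \<beta> n z" if z: "z0 \<le> z" for z
  proof -
    define l where "l = z0 / z"
    have zp: "z > 0" using z z0 by simp
    have l: "0 < l" "l \<le> 1" "z0 = l * z" using z z0 zp by (auto simp: l_def)
    have "(\<integral>x. (exp (- z0 * x) - 1 + z0 * x) \<partial>n) \<le> (\<integral>x. l * (exp (- z * x) - 1 + z * x) \<partial>n)"
    proof (rule integral_mono)
      fix x
      have "exp ((1 - l) *\<^sub>R 0 + l *\<^sub>R (- z * x)) \<le> (1 - l) * exp 0 + l * exp (- z * x)"
        using l by (intro convex_onD[OF exp_convex]) auto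
      then have "exp (- z0 * x) \<le> (1 - l) + l * exp (- z * x)" by (simp add: l(3) mult.assoc)
      then show "exp (- z0 * x) - 1 + z0 * x \<le> l * (exp (- z * x) - 1 + z * x)"
        by (simp add: l(3) algebra_simps)
    qed (use integrable_rho z0 zp in auto)
    then have 1: "(\<integral>x. (exp (- z0 * x) - 1 + z0 * x) \<partial>n) \<le> l * (\<integral>x. (exp (- z * x) - 1 + z * x) \<partial>n)" by simp
    have 2: "\<beta> * z0\<^sup>2 \<le> l * (\<beta> * z\<^sup>2)"
    proof -
      have "l * l * (\<beta> * z\<^sup>2) \<le> l * 1 * (\<beta> * z\<^sup>2)" using l \<beta>_nonneg by (intro mult_right_mono mult_left_mono) auto
      then show ?thesis by (simp add: l(3) power2_eq_square mult_ac)
    qed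
    have "branching_psi \<alpha> \<beta> n z0 \<le> l * branching_psi \<alpha> \<beta> n z"
      using 1 2 unfolding branching_psi_def by (simp add: l(3) algebra_simps)
    then show ?thesis using z0 zp by (simp add: l_def field_simps)
  qed
  show thesis
  proof (rule that)
    fix z :: real assume z: "0 \<le> z"
    show "z \<le> z0 + z0 * \<bar>branching_psi \<alpha> \<beta> n z\<bar>"
    proof (cases "z \<le> z0")
      case True
      then show ?thesis using z0 by (simp add: add_increasing2)
    next
      case False
      have "z / z0 * 1 \<le> z / z0 * branching_psi \<alpha> \<beta> n z0" using z z0 by (intro mult_left_mono) auto
      also have "\<dots> \<le> branching_psi \<alpha> \<beta> n z" using ray False by simp
      finally have "z \<le> z0 * branching_psi \<alpha> \<beta> n z" using z0 by (simp add: field_simps)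
      also have "\<dots> \<le> z0 * \<bar>branching_psi \<alpha> \<beta> n z\<bar>" using z0 by (intro mult_left_mono) auto
      finally have "z \<le> z0 * \<bar>branching_psi \<alpha> \<beta> n z\<bar>" .
      then show ?thesis using z0 by simp
    qed
  qed (use z0 in auto)
qed

end

section \<open>Moments from the Laplace transform\<close>

text \<open>Expansion of the Laplace transform at 0 along a sequence: m is the mean and c0 half the
  variance. Fatou's lemma first yields integrability, after which Z, respectively its square, can
  serve as its own dominating function.\<close>

lemma laplace_moments:
  fixes Z :: "'a \<Rightarrow> real" and \<theta> c :: "nat \<Rightarrow> real"
  assumes Q: "prob_space Q" and Zm [measurable]: "Z \<in> borel_measurable Q" and Z0: "\<And>\<omega>. 0 \<le> Z \<omega>"
    and \<theta>: "\<And>k. 0 < \<theta> k" "\<theta> \<longlonglongrightarrow> 0" and c: "c \<longlonglongrightarrow> c0"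
    and L: "\<And>k. (\<integral>\<omega>. exp (- \<theta> k * Z \<omega>) \<partial>Q) = exp (- \<theta> k * m + (\<theta> k)\<^sup>2 * c k)"
  shows "integrable Q Z" "(\<integral>\<omega>. Z \<omega> \<partial>Q) = m"
    "integrable Q (\<lambda>\<omega>. (Z \<omega>)\<^sup>2)" "(\<integral>\<omega>. (Z \<omega>)\<^sup>2 \<partial>Q) = m\<^sup>2 + 2 * c0"
proof -
  interpret prob_space Q by fact
  define u where "u k = - \<theta> k * m + (\<theta> k)\<^sup>2 * c k" for k
  have "u \<longlonglongrightarrow> - 0 * m + 0\<^sup>2 * c0" unfolding u_def by (intro tendsto_intros \<theta> c)
  then have "u \<longlonglongrightarrow> 0" by simp
  then obtain h where h: "h \<longlonglongrightarrow> 1 / 2" "\<And>k. exp (u k) = 1 + u k + (u k)\<^sup>2 * h k"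
    using exp_second_order_seq by blast
  have ut: "u k / \<theta> k = - m + \<theta> k * c k" for k
    using \<theta>(1)[of k] by (simp add: u_def field_simps power2_eq_square)
  have int_e: "integrable Q (\<lambda>\<omega>. exp (- \<theta> k * Z \<omega>))" for k
    using Z0 \<theta>(1)[of k] by (intro integrable_const_bound[where B = 1]) (auto simp: less_imp_le)
  have Zlim: "\<exists>g. g \<longlonglongrightarrow> 1 / 2 \<and> (\<forall>k. exp (- \<theta> k * z) = 1 + (- \<theta> k * z) + (- \<theta> k * z)\<^sup>2 * g k)" for z
  proof -
    have "(\<lambda>k. - \<theta> k * z) \<longlonglongrightarrow> - 0 * z" by (intro tendsto_intros \<theta>)
    then show ?thesis using exp_second_order_seq[of "\<lambda>k. - \<theta> k * z"] by simp
  qed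
  define f1 where "f1 k \<omega> = (1 - exp (- \<theta> k * Z \<omega>)) / \<theta> k" for k \<omega>
  have f1_lim: "(\<lambda>k. f1 k \<omega>) \<longlonglongrightarrow> Z \<omega>" for \<omega>
  proof -
    obtain g where g: "g \<longlonglongrightarrow> 1 / 2" "\<And>k. exp (- \<theta> k * Z \<omega>) = 1 + (- \<theta> k * Z \<omega>) + (- \<theta> k * Z \<omega>)\<^sup>2 * g k"
      using Zlim by blast
    have "(\<lambda>k. Z \<omega> - \<theta> k * (Z \<omega>)\<^sup>2 * g k) \<longlonglongrightarrow> Z \<omega> - 0 * (Z \<omega>)\<^sup>2 * (1 / 2)"
      by (intro tendsto_intros \<theta> g(1))
    moreover have "f1 k \<omega> = Z \<omega> - \<theta> k * (Z \<omega>)\<^sup>2 * g k" for k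
      unfolding f1_def g(2) using \<theta>(1)[of k] by (simp add: field_simps power2_eq_square)
    ultimately show ?thesis by simp
  qed
  have f1_bounds: "0 \<le> f1 k \<omega>" "f1 k \<omega> \<le> Z \<omega>" for k \<omega>
    using Z0[of \<omega>] \<theta>(1)[of k] exp_ge_add_one_self[of "- \<theta> k * Z \<omega>"]
    by (auto simp: f1_def divide_le_eq mult.commute)
  have f1_int: "integrable Q (f1 k)" for k unfolding f1_def using int_e by simp
  have E1: "(\<lambda>k. \<integral>\<omega>. f1 k \<omega> \<partial>Q) \<longlonglongrightarrow> m"
  proof -
    have "(\<integral>\<omega>. f1 k \<omega> \<partial>Q) = - (u k / \<theta> k) - (u k / \<theta> k) * u k * h k" for k
    proof -
      have "(\<integral>\<omega>. f1 k \<omega> \<partial>Q) = (1 - exp (u k)) / \<theta> k"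
        unfolding f1_def u_def L[symmetric] using int_e by (simp add: prob_space)
      then show ?thesis unfolding h(2) using \<theta>(1)[of k] by (simp add: field_simps power2_eq_square)
    qed
    moreover have "(\<lambda>k. - (- m + \<theta> k * c k) - (- m + \<theta> k * c k) * u k * h k) \<longlonglongrightarrow> - (- m + 0 * c0) - (- m + 0 * c0) * 0 * (1 / 2)"
      by (intro tendsto_intros \<theta> c h \<open>u \<longlonglongrightarrow> 0\<close>)
    ultimately show ?thesis by (simp add: ut)
  qed
  have nnZ: "(\<integral>\<^sup>+\<omega>. ennreal (Z \<omega>) \<partial>Q) \<le> ennreal m"
  proof -
    have "(\<integral>\<^sup>+\<omega>. ennreal (Z \<omega>) \<partial>Q) = (\<integral>\<^sup>+\<omega>. liminf (\<lambda>k. ennreal (f1 k \<omega>)) \<partial>Q)"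
      by (intro nn_integral_cong lim_imp_Liminf[symmetric] tendsto_ennrealI f1_lim) simp
    also have "\<dots> \<le> liminf (\<lambda>k. \<integral>\<^sup>+\<omega>. ennreal (f1 k \<omega>) \<partial>Q)"
      by (rule nn_integral_liminf) (simp add: f1_def)
    also have "(\<lambda>k. \<integral>\<^sup>+\<omega>. ennreal (f1 k \<omega>) \<partial>Q) = (\<lambda>k. ennreal (\<integral>\<omega>. f1 k \<omega> \<partial>Q))"
      using f1_int f1_bounds by (auto intro!: ext nn_integral_eq_integral)
    also have "liminf \<dots> = ennreal m"
      by (intro lim_imp_Liminf tendsto_ennrealI E1) simp
    finally show ?thesis .
  qed
  show intZ: "integrable Q Z"
    using nnZ Z0 by (intro integrableI_nonneg) (auto simp: le_less_trans)
  have "(\<lambda>k. \<integral>\<omega>. f1 k \<omega> \<partial>Q) \<longlonglongrightarrow> (\<integral>\<omega>. Z \<omega> \<partial>Q)"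
    using f1_bounds f1_lim by (intro integral_dominated_convergence[where w = Z] intZ) (auto intro: borel_measurable_integrable[OF f1_int])
  then show EZ: "(\<integral>\<omega>. Z \<omega> \<partial>Q) = m" using E1 LIMSEQ_unique by blast
  \<comment> \<open>The second-order quotient, which tends to half the square of Z; its expectation
    can be computed because the mean is already known to be m.\<close>
  define f2 where "f2 k \<omega> = (exp (- \<theta> k * Z \<omega>) - 1 + \<theta> k * Z \<omega>) / (\<theta> k)\<^sup>2" for k \<omega>
  have f2_lim: "(\<lambda>k. f2 k \<omega>) \<longlonglongrightarrow> (Z \<omega>)\<^sup>2 / 2" for \<omega>
  proof -
    obtain g where g: "g \<longlonglongrightarrow> 1 / 2" "\<And>k. exp (- \<theta> k * Z \<omega>) = 1 + (- \<theta> k * Z \<omega>) + (- \<theta> k * Z \<omega>)\<^sup>2 * g k"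
      using Zlim by blast
    have "(\<lambda>k. (Z \<omega>)\<^sup>2 * g k) \<longlonglongrightarrow> (Z \<omega>)\<^sup>2 * (1 / 2)"
      by (intro tendsto_intros g(1))
    moreover have "f2 k \<omega> = (Z \<omega>)\<^sup>2 * g k" for k
      unfolding f2_def g(2) using \<theta>(1)[of k] by (simp add: power_mult_distrib)
    ultimately show ?thesis by simp
  qed
  have f2_bounds: "0 \<le> f2 k \<omega>" "f2 k \<omega> \<le> (Z \<omega>)\<^sup>2" for k \<omega>
  proof -
    have "0 \<le> \<theta> k * Z \<omega>" using Z0 \<theta>(1)[of k] by simp
    from exp_neg_bounds[OF this] show "0 \<le> f2 k \<omega>" "f2 k \<omega> \<le> (Z \<omega>)\<^sup>2"
      using \<theta>(1)[of k] by (auto simp: f2_def power_mult_distrib divide_le_eq mult.commute)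
  qed
  have f2_int: "integrable Q (f2 k)" for k unfolding f2_def using int_e intZ by simp
  have E2: "(\<lambda>k. \<integral>\<omega>. f2 k \<omega> \<partial>Q) \<longlonglongrightarrow> m\<^sup>2 / 2 + c0"
  proof -
    have "(\<integral>\<omega>. f2 k \<omega> \<partial>Q) = c k + (u k / \<theta> k)\<^sup>2 * h k" for k
    proof -
      have "(\<integral>\<omega>. f2 k \<omega> \<partial>Q) = (exp (u k) - 1 + \<theta> k * m) / (\<theta> k)\<^sup>2"
        unfolding f2_def u_def L[symmetric] using int_e intZ by (simp add: prob_space EZ)
      also have "exp (u k) - 1 + \<theta> k * m = (\<theta> k)\<^sup>2 * c k + (u k)\<^sup>2 * h k"
        unfolding h(2) by (simp add: u_def)
      finally show ?thesis using \<theta>(1)[of k] by (simp add: add_divide_distrib power_divide)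
    qed
    moreover have "(\<lambda>k. c k + (- m + \<theta> k * c k)\<^sup>2 * h k) \<longlonglongrightarrow> c0 + (- m + 0 * c0)\<^sup>2 * (1 / 2)"
      by (intro tendsto_intros \<theta> c h)
    ultimately show ?thesis by (simp add: ut add.commute)
  qed
  have nnZ2: "(\<integral>\<^sup>+\<omega>. ennreal ((Z \<omega>)\<^sup>2 / 2) \<partial>Q) \<le> ennreal (m\<^sup>2 / 2 + c0)"
  proof -
    have "(\<integral>\<^sup>+\<omega>. ennreal ((Z \<omega>)\<^sup>2 / 2) \<partial>Q) = (\<integral>\<^sup>+\<omega>. liminf (\<lambda>k. ennreal (f2 k \<omega>)) \<partial>Q)"
      by (intro nn_integral_cong lim_imp_Liminf[symmetric] tendsto_ennrealI f2_lim) simp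
    also have "\<dots> \<le> liminf (\<lambda>k. \<integral>\<^sup>+\<omega>. ennreal (f2 k \<omega>) \<partial>Q)"
      by (rule nn_integral_liminf) (simp add: f2_def)
    also have "(\<lambda>k. \<integral>\<^sup>+\<omega>. ennreal (f2 k \<omega>) \<partial>Q) = (\<lambda>k. ennreal (\<integral>\<omega>. f2 k \<omega> \<partial>Q))"
      using f2_int f2_bounds by (auto intro!: ext nn_integral_eq_integral)
    also have "liminf \<dots> = ennreal (m\<^sup>2 / 2 + c0)"
      by (intro lim_imp_Liminf tendsto_ennrealI E2) simp
    finally show ?thesis .
  qed
  have "integrable Q (\<lambda>\<omega>. (Z \<omega>)\<^sup>2 / 2)"
    using nnZ2 Z0 by (intro integrableI_nonneg) (auto simp: le_less_trans)
  then have "integrable Q (\<lambda>\<omega>. 2 * ((Z \<omega>)\<^sup>2 / 2))" by (rule integrable_mult_right)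
  then show intZ2: "integrable Q (\<lambda>\<omega>. (Z \<omega>)\<^sup>2)" by simp
  have "(\<lambda>k. \<integral>\<omega>. f2 k \<omega> \<partial>Q) \<longlonglongrightarrow> (\<integral>\<omega>. (Z \<omega>)\<^sup>2 / 2 \<partial>Q)"
    using f2_bounds f2_lim by (intro integral_dominated_convergence[where w = "\<lambda>\<omega>. (Z \<omega>)\<^sup>2"] intZ2) (auto intro: borel_measurable_integrable[OF f2_int])
  then have "(\<integral>\<omega>. (Z \<omega>)\<^sup>2 / 2 \<partial>Q) = m\<^sup>2 / 2 + c0" using E2 LIMSEQ_unique by blast
  then show "(\<integral>\<omega>. (Z \<omega>)\<^sup>2 \<partial>Q) = m\<^sup>2 + 2 * c0" by simp
qed

section \<open>The mild equation with nonnegative terms\<close>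

lemma integrable_enn2real:
  assumes [measurable]: "F \<in> borel_measurable M" and fin: "(\<integral>\<^sup>+x. F x \<partial>M) < \<infinity>"
  shows "integrable M (\<lambda>x. enn2real (F x))" "(\<integral>x. enn2real (F x) \<partial>M) = enn2real (\<integral>\<^sup>+x. F x \<partial>M)"
proof -
  have "AE x in M. F x \<noteq> \<infinity>" using fin by (intro nn_integral_noteq_infinite) auto
  then have ae: "AE x in M. ennreal (enn2real (F x)) = F x" by (auto simp: less_top)
  then have e: "(\<integral>\<^sup>+x. ennreal (enn2real (F x)) \<partial>M) = (\<integral>\<^sup>+x. F x \<partial>M)" by (rule nn_integral_cong_AE)
  show "integrable M (\<lambda>x. enn2real (F x))"
    using fin e by (intro integrableI_nonneg) auto
  show "(\<integral>x. enn2real (F x) \<partial>M) = enn2real (\<integral>\<^sup>+x. F x \<partial>M)"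
    unfolding e[symmetric] by (rule integral_eq_nn_integral) auto
qed

text \<open>Tonelli on the triangle s \<le> r; integrating
  \<open>\<alpha> * exp (\<alpha> * s)\<close> over \<open>{0..r}\<close> leaves
  \<open>exp (\<alpha> * r) - 1\<close>.\<close>

lemma nn_integral_exp_swap:
  fixes h :: "real \<Rightarrow> ennreal"
  assumes [measurable]: "h \<in> borel_measurable borel" and \<alpha>: "0 < \<alpha>"
  shows "(\<integral>\<^sup>+s\<in>{0..t}. ennreal (\<alpha> * exp (\<alpha> * s)) * (\<integral>\<^sup>+r\<in>{s..t}. h r \<partial>lborel) \<partial>lborel) =
    (\<integral>\<^sup>+r\<in>{0..t}. ennreal (exp (\<alpha> * r) - 1) * h r \<partial>lborel)"
proof -
  have pair: "pair_sigma_finite (lborel :: real measure) (lborel :: real measure)" ..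
  have "(\<integral>\<^sup>+s\<in>{0..t}. ennreal (\<alpha> * exp (\<alpha> * s)) * (\<integral>\<^sup>+r\<in>{s..t}. h r \<partial>lborel) \<partial>lborel) =
    (\<integral>\<^sup>+s. (\<integral>\<^sup>+r. ennreal (\<alpha> * exp (\<alpha> * s)) * (h r * indicator {s..t} r) * indicator {0..t} s \<partial>lborel) \<partial>lborel)"
    by (simp add: nn_integral_cmult nn_integral_multc)
  also have "\<dots> = (\<integral>\<^sup>+s. (\<integral>\<^sup>+r. (if 0 \<le> s \<and> s \<le> r \<and> r \<le> t then ennreal (\<alpha> * exp (\<alpha> * s)) * h r else 0) \<partial>lborel) \<partial>lborel)"
    by (intro nn_integral_cong) (auto split: split_indicator)
  also have "\<dots> = (\<integral>\<^sup>+r. (\<integral>\<^sup>+s. (if 0 \<le> s \<and> s \<le> r \<and> r \<le> t then ennreal (\<alpha> * exp (\<alpha> * s)) * h r else 0) \<partial>lborel) \<partial>lborel)"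
    by (rule pair_sigma_finite.Fubini'[OF pair, symmetric]) measurable
  also have "\<dots> = (\<integral>\<^sup>+r. (\<integral>\<^sup>+s. (h r * indicator {0..t} r) * (ennreal (\<alpha> * exp (\<alpha> * s)) * indicator {0..r} s) \<partial>lborel) \<partial>lborel)"
    by (intro nn_integral_cong) (auto split: split_indicator simp: mult_ac)
  also have "\<dots> = (\<integral>\<^sup>+r. (h r * indicator {0..t} r) * (\<integral>\<^sup>+s. ennreal (\<alpha> * exp (\<alpha> * s)) * indicator {0..r} s \<partial>lborel) \<partial>lborel)"
    by (intro nn_integral_cong nn_integral_cmult) measurable
  also have "\<dots> = (\<integral>\<^sup>+r\<in>{0..t}. ennreal (exp (\<alpha> * r) - 1) * h r \<partial>lborel)"
  proof (intro nn_integral_cong)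
    fix r :: real
    show "(h r * indicator {0..t} r) * (\<integral>\<^sup>+s. ennreal (\<alpha> * exp (\<alpha> * s)) * indicator {0..r} s \<partial>lborel) =
      ennreal (exp (\<alpha> * r) - 1) * h r * indicator {0..t} r"
    proof (cases "0 \<le> r")
      case True
      have "(\<integral>\<^sup>+s. ennreal (\<alpha> * exp (\<alpha> * s)) * indicator {0..r} s \<partial>lborel) = ennreal (exp (\<alpha> * r) - exp (\<alpha> * 0))"
        using True \<alpha> by (intro nn_integral_FTC_Icc) (auto intro!: derivative_eq_intros)
      then show ?thesis by (simp add: mult_ac)
    qed auto
  qed
  finally show ?thesis .
qed

lemma tail_integral_measurable:
  fixes h :: "real \<Rightarrow> ennreal"
  assumes [measurable]: "h \<in> borel_measurable borel"
  shows "(\<lambda>s. \<integral>\<^sup>+r\<in>{s..t}. h r \<partial>lborel) \<in> borel_measurable borel"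
proof -
  have "(\<lambda>s. \<integral>\<^sup>+r. (if s \<le> r \<and> r \<le> t then h r else 0) \<partial>lborel) \<in> borel_measurable borel" by measurable
  moreover have "(\<integral>\<^sup>+r. (if s \<le> r \<and> r \<le> t then h r else 0) \<partial>lborel) = (\<integral>\<^sup>+r\<in>{s..t}. h r \<partial>lborel)" for s
    by (intro nn_integral_cong) (auto split: split_indicator)
  ultimately show ?thesis by simp
qed

text \<open>Gronwall's argument with equalities: the equation is integrated against
  \<open>\<alpha> * exp (\<alpha> * s)\<close>, and the integrals of m then cancel against the
  equation at s = 0. The finiteness assumptions permit this cancellation.\<close>

lemma linear_volterra:
  fixes m k :: "real \<Rightarrow> ennreal"
  assumes [measurable]: "m \<in> borel_measurable borel" "k \<in> borel_measurable borel"
    and \<alpha>: "0 < \<alpha>" and t: "0 \<le> t" and c: "c < \<infinity>"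
    and eq: "\<And>s. 0 \<le> s \<Longrightarrow> s \<le> t \<Longrightarrow>
      m s + (\<integral>\<^sup>+r\<in>{s..t}. k r \<partial>lborel) = c + ennreal \<alpha> * (\<integral>\<^sup>+r\<in>{s..t}. m r \<partial>lborel)"
    and fin: "(\<integral>\<^sup>+r\<in>{0..t}. m r \<partial>lborel) < \<infinity>" "(\<integral>\<^sup>+r\<in>{0..t}. k r \<partial>lborel) < \<infinity>"
  shows "m 0 + (\<integral>\<^sup>+r\<in>{0..t}. ennreal (exp (\<alpha> * r)) * k r \<partial>lborel) = ennreal (exp (\<alpha> * t)) * c"
proof -
  let ?e = "\<lambda>s. ennreal (\<alpha> * exp (\<alpha> * s))"
  note [measurable] = tail_integral_measurable[OF assms(1)] tail_integral_measurable[OF assms(2)]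
  \<comment> \<open>E, D and J integrate h with weights \<open>exp (\<alpha> * r)\<close>,
    \<open>exp (\<alpha> * r) - 1\<close> and 1, so that E = D + J.\<close>
  define E where "E h = (\<integral>\<^sup>+r\<in>{0..t}. ennreal (exp (\<alpha> * r)) * h r \<partial>lborel)" for h
  define D where "D h = (\<integral>\<^sup>+r\<in>{0..t}. ennreal (exp (\<alpha> * r) - 1) * h r \<partial>lborel)" for h
  define J where "J h = (\<integral>\<^sup>+r\<in>{0..t}. h r \<partial>lborel)" for h :: "real \<Rightarrow> ennreal"
  have ED: "E h = D h + J h" if [measurable]: "h \<in> borel_measurable borel" for h
  proof -
    have "E h = (\<integral>\<^sup>+r. ennreal (exp (\<alpha> * r) - 1) * h r * indicator {0..t} r + h r * indicator {0..t} r \<partial>lborel)"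
      unfolding E_def
    proof (intro nn_integral_cong)
      fix r :: real
      have "ennreal (exp (\<alpha> * r)) = ennreal (exp (\<alpha> * r) - 1) + 1" if "0 \<le> r"
        using \<alpha> that by (simp add: ennreal_plus[symmetric] del: ennreal_plus flip: ennreal_1)
      then show "ennreal (exp (\<alpha> * r)) * h r * indicator {0..t} r = ennreal (exp (\<alpha> * r) - 1) * h r * indicator {0..t} r + h r * indicator {0..t} r"
        by (auto split: split_indicator simp: distrib_right)
    qed
    also have "\<dots> = D h + J h" unfolding D_def J_def by (rule nn_integral_add) auto
    finally show ?thesis .
  qed
  have Efin: "E h < \<infinity>" if [measurable]: "h \<in> borel_measurable borel" and "J h < \<infinity>" for h
  proof -
    have "E h \<le> (\<integral>\<^sup>+r. ennreal (exp (\<alpha> * t)) * (h r * indicator {0..t} r) \<partial>lborel)"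
      unfolding E_def mult.assoc using \<alpha>
      by (intro nn_integral_mono) (auto split: split_indicator intro!: mult_right_mono ennreal_leI)
    also have "\<dots> = ennreal (exp (\<alpha> * t)) * J h" unfolding J_def by (rule nn_integral_cmult) auto
    also have "\<dots> < \<infinity>" using that by (simp add: ennreal_mult_less_top)
    finally show ?thesis .
  qed
  have expc: "(\<integral>\<^sup>+s\<in>{0..t}. ?e s \<partial>lborel) = ennreal (exp (\<alpha> * t) - exp (\<alpha> * 0))"
    using t \<alpha> by (intro nn_integral_FTC_Icc) (auto intro!: derivative_eq_intros)
  have lhs: "(\<integral>\<^sup>+s\<in>{0..t}. ?e s * (m s + (\<integral>\<^sup>+r\<in>{s..t}. k r \<partial>lborel)) \<partial>lborel) = ennreal \<alpha> * E m + D k"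
  proof -
    have "(\<integral>\<^sup>+s\<in>{0..t}. ?e s * (m s + (\<integral>\<^sup>+r\<in>{s..t}. k r \<partial>lborel)) \<partial>lborel) =
      (\<integral>\<^sup>+s. ?e s * m s * indicator {0..t} s + ?e s * (\<integral>\<^sup>+r\<in>{s..t}. k r \<partial>lborel) * indicator {0..t} s \<partial>lborel)"
      by (simp add: distrib_left distrib_right)
    also have "\<dots> = (\<integral>\<^sup>+s. ?e s * m s * indicator {0..t} s \<partial>lborel) + (\<integral>\<^sup>+s. ?e s * (\<integral>\<^sup>+r\<in>{s..t}. k r \<partial>lborel) * indicator {0..t} s \<partial>lborel)"
      by (rule nn_integral_add) measurable
    also have "(\<integral>\<^sup>+s. ?e s * m s * indicator {0..t} s \<partial>lborel) = (\<integral>\<^sup>+s. ennreal \<alpha> * (ennreal (exp (\<alpha> * s)) * m s * indicator {0..t} s) \<partial>lborel)"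
      using \<alpha> by (intro nn_integral_cong) (simp add: ennreal_mult mult.assoc)
    also have "\<dots> = ennreal \<alpha> * E m" unfolding E_def by (rule nn_integral_cmult) measurable
    finally show ?thesis unfolding D_def nn_integral_exp_swap[OF assms(2) \<alpha>, symmetric] .
  qed
  have rhs: "(\<integral>\<^sup>+s\<in>{0..t}. ?e s * (c + ennreal \<alpha> * (\<integral>\<^sup>+r\<in>{s..t}. m r \<partial>lborel)) \<partial>lborel) = ennreal (exp (\<alpha> * t) - 1) * c + ennreal \<alpha> * D m"
  proof -
    have "(\<integral>\<^sup>+s\<in>{0..t}. ?e s * (c + ennreal \<alpha> * (\<integral>\<^sup>+r\<in>{s..t}. m r \<partial>lborel)) \<partial>lborel) =
      (\<integral>\<^sup>+s. (?e s * indicator {0..t} s) * c + ennreal \<alpha> * (?e s * (\<integral>\<^sup>+r\<in>{s..t}. m r \<partial>lborel) * indicator {0..t} s) \<partial>lborel)"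
      by (intro nn_integral_cong) (simp add: distrib_left distrib_right mult_ac)
    also have "\<dots> = (\<integral>\<^sup>+s. (?e s * indicator {0..t} s) * c \<partial>lborel) + (\<integral>\<^sup>+s. ennreal \<alpha> * (?e s * (\<integral>\<^sup>+r\<in>{s..t}. m r \<partial>lborel) * indicator {0..t} s) \<partial>lborel)"
      by (rule nn_integral_add) measurable
    also have "(\<integral>\<^sup>+s. ennreal \<alpha> * (?e s * (\<integral>\<^sup>+r\<in>{s..t}. m r \<partial>lborel) * indicator {0..t} s) \<partial>lborel) = ennreal \<alpha> * D m"
      unfolding D_def nn_integral_exp_swap[OF assms(1) \<alpha>, symmetric] by (rule nn_integral_cmult) measurable
    also have "(\<integral>\<^sup>+s. (?e s * indicator {0..t} s) * c \<partial>lborel) = ennreal (exp (\<alpha> * t) - 1) * c"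
      using expc by (subst nn_integral_multc) auto
    finally show ?thesis .
  qed
  have main: "ennreal \<alpha> * E m + D k = ennreal (exp (\<alpha> * t) - 1) * c + ennreal \<alpha> * D m"
    unfolding lhs[symmetric] rhs[symmetric] using eq by (intro nn_integral_cong) (auto split: split_indicator)
  have eq0: "m 0 + J k = c + ennreal \<alpha> * J m" using eq[of 0] t by (simp add: J_def)
  have Jf: "J m < \<infinity>" "J k < \<infinity>" using fin by (auto simp: J_def)
  have Ef: "E m < \<infinity>" "E k < \<infinity>" using Efin[OF assms(1) Jf(1)] Efin[OF assms(2) Jf(2)] by auto
  have Df: "D m < \<infinity>" "D k < \<infinity>" using Ef ED[OF assms(1)] ED[OF assms(2)] by (auto simp: ennreal_add_eq_top less_top)
  have mf: "m 0 < \<infinity>"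
  proof -
    have "c + ennreal \<alpha> * J m < \<infinity>" using c Jf by (simp add: ennreal_mult_less_top)
    moreover have "m 0 \<le> m 0 + J k" by simp
    ultimately show ?thesis unfolding eq0 by (rule le_less_trans[rotated])
  qed
  \<comment> \<open>All eight quantities involved are finite, so the cancellation is carried out in
    the reals.\<close>
  have fin_real: thesis if "v < \<infinity>" "\<And>z. v = ennreal z \<Longrightarrow> 0 \<le> z \<Longrightarrow> thesis" for v thesis
    using that by (cases v) auto
  obtain Em where r1: "E m = ennreal Em" "0 \<le> Em" using fin_real[OF Ef(1)] .
  obtain Ek where r2: "E k = ennreal Ek" "0 \<le> Ek" using fin_real[OF Ef(2)] .
  obtain Dm where r3: "D m = ennreal Dm" "0 \<le> Dm" using fin_real[OF Df(1)] .
  obtain Dk where r4: "D k = ennreal Dk" "0 \<le> Dk" using fin_real[OF Df(2)] .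
  obtain Jm where r5: "J m = ennreal Jm" "0 \<le> Jm" using fin_real[OF Jf(1)] .
  obtain Jk where r6: "J k = ennreal Jk" "0 \<le> Jk" using fin_real[OF Jf(2)] .
  obtain m0 where r7: "m 0 = ennreal m0" "0 \<le> m0" using fin_real[OF mf] .
  obtain c' where r8: "c = ennreal c'" "0 \<le> c'" using fin_real[OF c] .
  note r = r1(1) r2(1) r3(1) r4(1) r5(1) r6(1) r7(1) r8(1)
  note nn = r1(2) r2(2) r3(2) r4(2) r5(2) r6(2) r7(2) r8(2)
  have et: "0 \<le> exp (\<alpha> * t) - 1" using \<alpha> t by simp
  have 1: "Em = Dm + Jm" "Ek = Dk + Jk"
    using ED[OF assms(1)] ED[OF assms(2)] nn unfolding r by (simp_all add: ennreal_plus[symmetric] del: ennreal_plus)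
  have 2: "m0 + Jk = c' + \<alpha> * Jm"
    using eq0 nn \<alpha> unfolding r by (simp add: ennreal_plus[symmetric] ennreal_mult[symmetric] del: ennreal_plus)
  have 3: "\<alpha> * Em + Dk = (exp (\<alpha> * t) - 1) * c' + \<alpha> * Dm"
    using main nn \<alpha> et unfolding r by (simp add: ennreal_plus[symmetric] ennreal_mult[symmetric] del: ennreal_plus)
  have "m0 + Ek = exp (\<alpha> * t) * c'" using 1 2 3 by (simp add: algebra_simps)
  then have "m 0 + E k = ennreal (exp (\<alpha> * t)) * c"
    unfolding r using nn by (simp add: ennreal_plus[symmetric] ennreal_mult[symmetric] del: ennreal_plus)
  then show ?thesis by (simp add: E_def)
qed

section \<open>The mild equation in terms of the Mehler kernels\<close>

context super_OU_process
begin

abbreviation Q :: "real \<Rightarrow> real^'d \<Rightarrow> (real^'d) measure" where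
  "Q t x \<equiv> ou_law (b / \<sigma>\<^sup>2) (exp (- b * t)) x"

lemma a_pos: "0 < b / \<sigma>\<^sup>2"
  using b_pos \<sigma>_pos by simp

lemma Q_kernel [measurable]:
  assumes [measurable]: "f \<in> borel_measurable M'" "g \<in> borel_measurable M'"
  shows "(\<lambda>z. Q (f z) (g z)) \<in> M' \<rightarrow>\<^sub>M subprob_algebra borel"
  by (rule ou_law_measurable[OF _ _ a_pos]) measurable

lemma Q_prob: "prob_space (Q t x)"
  by (rule prob_space_ou_law[OF a_pos])

lemma ou_law_UNIV [simp]: "emeasure (ou_law (b / \<sigma>\<^sup>2) w x) UNIV = 1"
  using prob_space.emeasure_space_1[OF prob_space_ou_law[OF a_pos, of w x]] by simp

lemma Q_0: "f \<in> borel_measurable borel \<Longrightarrow> (\<integral>\<^sup>+y. f y \<partial>Q 0 x) = f x"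
  using ou_law_1[OF a_pos, of x] by (simp add: nn_integral_return)

lemma Q_integral_measurable [measurable]:
  assumes [measurable]: "(\<lambda>(z, y). F z y) \<in> borel_measurable (M' \<Otimes>\<^sub>M borel)" "f \<in> borel_measurable M'" "g \<in> borel_measurable M'"
  shows "(\<lambda>z. \<integral>\<^sup>+y. F z y \<partial>Q (f z) (g z)) \<in> borel_measurable M'"
  by (rule nn_integral_measurable_subprob_algebra2[where N = borel]) measurable

lemma mild_nonneg: "mild_solution \<psi> \<xi> Pr f u \<Longrightarrow> 0 \<le> t \<Longrightarrow> 0 \<le> u x t"
  by (simp add: mild_solution_def)

lemma mild_measurable:
  assumes "mild_solution \<psi> \<xi> Pr f u"
  shows "(\<lambda>(x, t). u x (max 0 t)) \<in> borel_measurable (borel \<Otimes>\<^sub>M borel)"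
proof -
  have 1: "(\<lambda>(x, t). u x t) \<in> borel_measurable (borel \<Otimes>\<^sub>M restrict_space borel {0..})"
    using assms by (simp add: mild_solution_def)
  have 2: "(\<lambda>z. (fst z, max 0 (snd z))) \<in> (borel \<Otimes>\<^sub>M borel) \<rightarrow>\<^sub>M (borel \<Otimes>\<^sub>M restrict_space borel {0::real..})"
    by (intro measurable_Pair measurable_restrict_space2) auto
  show ?thesis using measurable_compose[OF 2 1] by (simp add: case_prod_beta)
qed

text \<open>The linear part of \<psi> is moved to the right-hand side, so that every term is
  nonnegative. Finiteness starts from the integrability of \<psi>(u) in
  \<open>mild_solution\<close>, passes to u by \<open>psi_coercive\<close>, and from there to
  \<open>psi0\<close>. The argument \<open>max 0 (t - s)\<close> keeps to the nonnegative times on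
  which u is controlled.\<close>

lemma mild_nn_integral:
  assumes mild: "mild_solution (branching_psi \<alpha> \<beta> n) \<xi> Pr f u"
    and f [measurable]: "f \<in> borel_measurable borel" and f0: "\<And>y. 0 \<le> f y" and fC: "\<And>y. f y \<le> C"
    and t: "0 \<le> t"
  shows "(\<integral>\<^sup>+s\<in>{0..t}. (\<integral>\<^sup>+y. ennreal (u y (max 0 (t - s))) \<partial>Q s x) \<partial>lborel) < \<infinity>" (is ?fin1)
    and "(\<integral>\<^sup>+s\<in>{0..t}. (\<integral>\<^sup>+y. ennreal (psi0 (u y (max 0 (t - s)))) \<partial>Q s x) \<partial>lborel) < \<infinity>" (is ?fin2)
    and "ennreal (u x t) + (\<integral>\<^sup>+s\<in>{0..t}. (\<integral>\<^sup>+y. ennreal (psi0 (u y (max 0 (t - s)))) \<partial>Q s x) \<partial>lborel) =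
      (\<integral>\<^sup>+y. ennreal (f y) \<partial>Q t x) + ennreal \<alpha> * (\<integral>\<^sup>+s\<in>{0..t}. (\<integral>\<^sup>+y. ennreal (u y (max 0 (t - s))) \<partial>Q s x) \<partial>lborel)" (is ?eq)
proof -
  define \<psi> where "\<psi> = branching_psi \<alpha> \<beta> n"
  define U where "U s y = u y (max 0 (t - s))" for s y
  note mm [measurable] = mild_measurable[OF mild]
  have Um [measurable]: "(\<lambda>(s, y). U s y) \<in> borel_measurable (borel \<Otimes>\<^sub>M borel)"
  proof -
    have "(\<lambda>z. (snd z, t - fst z)) \<in> (borel :: real measure) \<Otimes>\<^sub>M (borel :: (real^'d) measure) \<rightarrow>\<^sub>M borel \<Otimes>\<^sub>M borel" by measurable
    from measurable_compose[OF this mm] show ?thesis by (simp add: U_def case_prod_beta)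
  qed
  have U0: "0 \<le> U s y" for s y unfolding U_def by (rule mild_nonneg[OF mild]) simp
  have psU [measurable]: "(\<lambda>(s, y). psi0 (U s y)) \<in> borel_measurable (borel \<Otimes>\<^sub>M borel)"
  proof -
    have "(\<lambda>z. psi0 (max 0 (case_prod U z))) \<in> borel_measurable (borel \<Otimes>\<^sub>M borel)"
      by (rule measurable_compose[OF Um psi0_measurable])
    then show ?thesis using U0 by (simp add: case_prod_beta max_def)
  qed
  have \<psi>U: "\<psi> (U s y) = - \<alpha> * U s y + psi0 (U s y)" for s y by (simp add: \<psi>_def branching_psi_eq)
  have \<psi>Um [measurable]: "(\<lambda>(s, y). \<psi> (U s y)) \<in> borel_measurable (borel \<Otimes>\<^sub>M borel)"
    unfolding \<psi>U by measurable
  have Us [measurable]: "U s \<in> borel_measurable borel" "(\<lambda>y. psi0 (U s y)) \<in> borel_measurable borel" "(\<lambda>y. \<psi> (U s y)) \<in> borel_measurable borel" for s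
    using measurable_compose[OF _ Um, of "\<lambda>y. (s, y)" borel] measurable_compose[OF _ psU, of "\<lambda>y. (s, y)" borel]
      measurable_compose[OF _ \<psi>Um, of "\<lambda>y. (s, y)" borel] by simp_all
  have ps0: "0 \<le> psi0 (U s y)" for s y by (rule psi0_nonneg[OF U0])
  interpret prob_space "Pr x" by (rule OU_prob)
  interpret pair_sigma_finite "Pr x" lborel ..
  define H where "H = (\<lambda>(w, s). indicat_real (space (Pr x) \<times> {0..t}) (w, s) * \<psi> (u (\<xi> s w) (t - s)))"
  have Hint: "integrable (Pr x \<Otimes>\<^sub>M lborel) H"
    and Heq: "u x t + (\<integral>w. (LINT s:{0..t}|lborel. \<psi> (u (\<xi> s w) (t - s))) \<partial>Pr x) = (\<integral>w. f (\<xi> t w) \<partial>Pr x)"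
    using mild t unfolding mild_solution_def set_integrable_def H_def \<psi>_def by (auto simp: split_def)
  have Hs: "H (w, s) = indicat_real {0..t} s * \<psi> (U s (\<xi> s w))" if "w \<in> space (Pr x)" for w s
    using that by (auto simp: H_def U_def split: split_indicator)
  have law_nn: "(\<integral>\<^sup>+w. g (\<xi> s w) \<partial>Pr x) = (\<integral>\<^sup>+y. g y \<partial>Q s x)" if "0 \<le> s" "g \<in> borel_measurable borel" for s g
    by (rule nn_integral_OU[OF that])
  have law_int: "(\<integral>w. g (\<xi> s w) \<partial>Pr x) = (\<integral>y. g y \<partial>Q s x)" if "0 \<le> s" "g \<in> borel_measurable borel" for s and g :: "real^'d \<Rightarrow> real"
    unfolding OU_law[OF that(1), symmetric] using that by (subst integral_distr[OF OU_meas]) auto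
  define I where "I s = (\<integral>\<^sup>+y. ennreal \<bar>\<psi> (U s y)\<bar> \<partial>Q s x)" for s
  define A where "A s = (\<integral>\<^sup>+y. ennreal (psi0 (U s y)) \<partial>Q s x)" for s
  define B where "B s = (\<integral>\<^sup>+y. ennreal (U s y) \<partial>Q s x)" for s
  have [measurable]: "I \<in> borel_measurable borel" "A \<in> borel_measurable borel" "B \<in> borel_measurable borel"
    unfolding I_def A_def B_def by measurable
  have Ifin: "(\<integral>\<^sup>+s\<in>{0..t}. I s \<partial>lborel) < \<infinity>"
  proof -
    have "(\<integral>\<^sup>+z. ennreal (norm (H z)) \<partial>(Pr x \<Otimes>\<^sub>M lborel)) < \<infinity>"
      using Hint by (simp add: integrable_iff_bounded)
    also have "(\<integral>\<^sup>+z. ennreal (norm (H z)) \<partial>(Pr x \<Otimes>\<^sub>M lborel)) = (\<integral>\<^sup>+s. (\<integral>\<^sup>+w. ennreal (norm (H (w, s))) \<partial>Pr x) \<partial>lborel)"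
      using Hint by (intro nn_integral_snd[symmetric]) auto
    also have "\<dots> = (\<integral>\<^sup>+s\<in>{0..t}. I s \<partial>lborel)"
    proof (intro nn_integral_cong)
      fix s :: real
      have "(\<integral>\<^sup>+w. ennreal (norm (H (w, s))) \<partial>Pr x) = (\<integral>\<^sup>+w. ennreal \<bar>indicat_real {0..t} s * \<psi> (U s (\<xi> s w))\<bar> \<partial>Pr x)"
        by (intro nn_integral_cong) (simp add: Hs)
      also have "\<dots> = I s * indicator {0..t} s"
        using law_nn[of s "\<lambda>y. ennreal \<bar>\<psi> (U s y)\<bar>"] by (auto simp: I_def split: split_indicator)
      finally show "(\<integral>\<^sup>+w. ennreal (norm (H (w, s))) \<partial>Pr x) = I s * indicator {0..t} s" .
    qed
    finally show ?thesis .
  qed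
  obtain c z0 where cz: "c > 0" "z0 > 0" "\<And>z. 0 \<le> z \<Longrightarrow> z \<le> z0 + c * \<bar>\<psi> z\<bar>"
    using psi_coercive unfolding \<psi>_def by metis
  have Bfin: "(\<integral>\<^sup>+s\<in>{0..t}. B s \<partial>lborel) < \<infinity>"
  proof -
    have "B s \<le> ennreal z0 + ennreal c * I s" for s
    proof -
      have "B s \<le> (\<integral>\<^sup>+y. ennreal z0 + ennreal c * ennreal \<bar>\<psi> (U s y)\<bar> \<partial>Q s x)"
        unfolding B_def using cz U0
        by (intro nn_integral_mono) (simp add: ennreal_mult[symmetric] ennreal_plus[symmetric] del: ennreal_plus)
      also have "\<dots> = ennreal z0 + ennreal c * I s"
        unfolding I_def by (subst nn_integral_add) (simp_all add: nn_integral_cmult)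
      finally show ?thesis .
    qed
    then have "(\<integral>\<^sup>+s\<in>{0..t}. B s \<partial>lborel) \<le> (\<integral>\<^sup>+s. ennreal z0 * indicator {0..t} s + ennreal c * (I s * indicator {0..t} s) \<partial>lborel)"
      by (intro nn_integral_mono) (auto split: split_indicator)
    also have "\<dots> = (\<integral>\<^sup>+s. ennreal z0 * indicator {0..t} s \<partial>lborel) + (\<integral>\<^sup>+s. ennreal c * (I s * indicator {0..t} s) \<partial>lborel)"
      by (rule nn_integral_add) measurable
    also have "\<dots> = ennreal z0 * ennreal t + ennreal c * (\<integral>\<^sup>+s\<in>{0..t}. I s \<partial>lborel)"
      using t by (simp add: nn_integral_cmult nn_integral_cmult_indicator)
    also have "\<dots> < \<infinity>" using Ifin by (simp add: ennreal_mult_less_top)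
    finally show ?thesis .
  qed
  have Afin: "(\<integral>\<^sup>+s\<in>{0..t}. A s \<partial>lborel) < \<infinity>"
  proof -
    have "A s \<le> I s + ennreal \<alpha> * B s" for s
    proof -
      have "A s \<le> (\<integral>\<^sup>+y. ennreal \<bar>\<psi> (U s y)\<bar> + ennreal \<alpha> * ennreal (U s y) \<partial>Q s x)"
        unfolding A_def using \<alpha>_pos U0
        by (intro nn_integral_mono) (auto simp: ennreal_mult[symmetric] ennreal_plus[symmetric] \<psi>U simp del: ennreal_plus intro!: ennreal_leI)
      also have "\<dots> = I s + ennreal \<alpha> * B s"
        unfolding I_def B_def by (subst nn_integral_add) (simp_all add: nn_integral_cmult)
      finally show ?thesis .
    qed
    then have "(\<integral>\<^sup>+s\<in>{0..t}. A s \<partial>lborel) \<le> (\<integral>\<^sup>+s. I s * indicator {0..t} s + ennreal \<alpha> * (B s * indicator {0..t} s) \<partial>lborel)"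
      by (intro nn_integral_mono) (auto split: split_indicator)
    also have "\<dots> = (\<integral>\<^sup>+s\<in>{0..t}. I s \<partial>lborel) + ennreal \<alpha> * (\<integral>\<^sup>+s\<in>{0..t}. B s \<partial>lborel)"
      by (subst nn_integral_add) (simp_all add: nn_integral_cmult)
    also have "\<dots> < \<infinity>" using Ifin Bfin by (simp add: ennreal_mult_less_top)
    finally show ?thesis .
  qed
  show ?fin1 ?fin2 using Bfin Afin by (simp_all add: A_def B_def U_def)
  \<comment> \<open>\<open>enn2real\<close> sends infinity to 0, so A' and B' represent A and B only
    where these are finite, which is almost everywhere.\<close>
  define A' where "A' s = enn2real (A s * indicator {0..t} s)" for s
  define B' where "B' s = enn2real (B s * indicator {0..t} s)" for s
  have A': "integrable lborel A'" "(\<integral>s. A' s \<partial>lborel) = enn2real (\<integral>\<^sup>+s\<in>{0..t}. A s \<partial>lborel)"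
    unfolding A'_def using integrable_enn2real[OF _ Afin] by auto
  have B': "integrable lborel B'" "(\<integral>s. B' s \<partial>lborel) = enn2real (\<integral>\<^sup>+s\<in>{0..t}. B s \<partial>lborel)"
    unfolding B'_def using integrable_enn2real[OF _ Bfin] by auto
  \<comment> \<open>At a fixed time s the expectation over paths depends only on the law
    \<open>Q s x\<close>, which is where the Mehler kernel enters the equation.\<close>
  have inner: "AE s in lborel. (\<integral>w. H (w, s) \<partial>Pr x) = A' s - \<alpha> * B' s"
  proof -
    have "AE s in lborel. A s * indicator {0..t} s \<noteq> \<infinity>" "AE s in lborel. B s * indicator {0..t} s \<noteq> \<infinity>"
      using nn_integral_noteq_infinite[of "\<lambda>s. A s * indicator {0..t} s" lborel]
        nn_integral_noteq_infinite[of "\<lambda>s. B s * indicator {0..t} s" lborel] Afin Bfin by auto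
    then show ?thesis
    proof eventually_elim
      case (elim s)
      show ?case
      proof (cases "s \<in> {0..t}")
        case True
        then have AB: "A s < \<infinity>" "B s < \<infinity>" using elim by (auto simp: less_top)
        have iA: "integrable (Q s x) (\<lambda>y. psi0 (U s y))"
          using AB ps0 unfolding A_def by (intro integrableI_nonneg) auto
        have iB: "integrable (Q s x) (U s)"
          using AB U0 unfolding B_def by (intro integrableI_nonneg) auto
        have "(\<integral>w. H (w, s) \<partial>Pr x) = (\<integral>w. \<psi> (U s (\<xi> s w)) \<partial>Pr x)"
          using True by (intro Bochner_Integration.integral_cong) (auto simp: Hs)
        also have "\<dots> = (\<integral>y. \<psi> (U s y) \<partial>Q s x)" using True by (intro law_int) auto
        also have "\<dots> = (\<integral>y. psi0 (U s y) \<partial>Q s x) - \<alpha> * (\<integral>y. U s y \<partial>Q s x)"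
          unfolding \<psi>U using iA iB by simp
        also have "(\<integral>y. psi0 (U s y) \<partial>Q s x) = A' s"
          unfolding A'_def A_def using True ps0 by (subst integral_eq_nn_integral) auto
        also have "(\<integral>y. U s y \<partial>Q s x) = B' s"
          unfolding B'_def B_def using True U0 by (subst integral_eq_nn_integral) auto
        finally show ?thesis .
      next
        case False
        then have "(\<integral>w. H (w, s) \<partial>Pr x) = (\<integral>w. 0 \<partial>Pr x)"
          by (intro Bochner_Integration.integral_cong) (auto simp: Hs)
        then show ?thesis using False by (auto simp: A'_def B'_def)
      qed
    qed
  qed
  have "(\<integral>w. (LINT s:{0..t}|lborel. \<psi> (u (\<xi> s w) (t - s))) \<partial>Pr x) = (\<integral>w. (\<integral>s. H (w, s) \<partial>lborel) \<partial>Pr x)"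
    unfolding set_lebesgue_integral_def H_def
    by (intro Bochner_Integration.integral_cong refl) (auto split: split_indicator)
  also have "\<dots> = (\<integral>s. (\<integral>w. H (w, s) \<partial>Pr x) \<partial>lborel)"
    by (rule Fubini_integral[of "\<lambda>w s. H (w, s)", symmetric]) (simp add: Hint)
  also have "\<dots> = (\<integral>s. A' s - \<alpha> * B' s \<partial>lborel)"
  proof (rule integral_cong_AE[OF _ _ inner])
    show "(\<lambda>s. \<integral>w. H (w, s) \<partial>Pr x) \<in> borel_measurable lborel"
      using integrable_snd[of "\<lambda>w s. H (w, s)"] Hint by simp
  qed (use A' B' in auto)
  also have "\<dots> = enn2real (\<integral>\<^sup>+s\<in>{0..t}. A s \<partial>lborel) - \<alpha> * enn2real (\<integral>\<^sup>+s\<in>{0..t}. B s \<partial>lborel)"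
    using A' B' by simp
  finally have real_eq: "u x t + enn2real (\<integral>\<^sup>+s\<in>{0..t}. A s \<partial>lborel) = (\<integral>y. f y \<partial>Q t x) + \<alpha> * enn2real (\<integral>\<^sup>+s\<in>{0..t}. B s \<partial>lborel)"
    using Heq law_int[OF t f] by simp
  have Tf: "(\<integral>\<^sup>+y. ennreal (f y) \<partial>Q t x) = ennreal (\<integral>y. f y \<partial>Q t x)"
  proof -
    interpret q: prob_space "Q t x" by (rule Q_prob)
    have C0: "0 \<le> C" using f0[of undefined] fC[of undefined] by linarith
    show ?thesis
      using f0 fC C0 by (intro nn_integral_eq_integral q.integrable_const_bound[where B = C]) auto
  qed
  have ennA: "ennreal (enn2real (\<integral>\<^sup>+s\<in>{0..t}. A s \<partial>lborel)) = (\<integral>\<^sup>+s\<in>{0..t}. A s \<partial>lborel)"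
    "ennreal (enn2real (\<integral>\<^sup>+s\<in>{0..t}. B s \<partial>lborel)) = (\<integral>\<^sup>+s\<in>{0..t}. B s \<partial>lborel)"
    using Afin Bfin by simp_all
  have "ennreal (u x t) + ennreal (enn2real (\<integral>\<^sup>+s\<in>{0..t}. A s \<partial>lborel)) =
     ennreal (\<integral>y. f y \<partial>Q t x) + ennreal \<alpha> * ennreal (enn2real (\<integral>\<^sup>+s\<in>{0..t}. B s \<partial>lborel))"
    using real_eq mild_nonneg[OF mild t, of x] \<alpha>_pos f0
    by (simp add: ennreal_plus[symmetric] ennreal_mult[symmetric] del: ennreal_plus)
  then show ?eq unfolding ennA Tf[symmetric] by (simp add: A_def B_def U_def)
qed

end

section \<open>Finite measures as a measurable space\<close>

lemma space_finite_measure_algebra: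
  "space (finite_measure_algebra K) = {\<mu>. finite_measure \<mu> \<and> sets \<mu> = sets K}"
  by (auto simp: finite_measure_algebra_def space_Sup_eq_UN)

lemma measurable_emeasure_finite_measure_algebra:
  "A \<in> sets K \<Longrightarrow> (\<lambda>\<mu>. emeasure \<mu> A) \<in> borel_measurable (finite_measure_algebra K)"
  by (auto intro!: measurable_Sup1 measurable_vimage_algebra1 simp: finite_measure_algebra_def)

lemma nn_integral_measurable_finite_measure_algebra:
  assumes "f \<in> borel_measurable K"
  shows "(\<lambda>\<mu>. \<integral>\<^sup>+x. f x \<partial>\<mu>) \<in> borel_measurable (finite_measure_algebra K)"
  using assms
proof (induction f rule: borel_measurable_induct)
  case (cong f g)
  have "(\<integral>\<^sup>+x. f x \<partial>\<mu>) = (\<integral>\<^sup>+x. g x \<partial>\<mu>)" if "\<mu> \<in> space (finite_measure_algebra K)" for \<mu>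
    using that cong(3) sets_eq_imp_space_eq[of \<mu> K] by (intro nn_integral_cong) (auto simp: space_finite_measure_algebra)
  then show ?case using cong(4) by (subst measurable_cong[where g = "\<lambda>\<mu>. \<integral>\<^sup>+x. g x \<partial>\<mu>"]) auto
next
  case (set A)
  have "(\<integral>\<^sup>+x. indicator A x \<partial>\<mu>) = emeasure \<mu> A" if "\<mu> \<in> space (finite_measure_algebra K)" for \<mu>
    using that set by (intro nn_integral_indicator) (auto simp: space_finite_measure_algebra)
  then show ?case
    using measurable_emeasure_finite_measure_algebra[OF set] by (subst measurable_cong[where g = "\<lambda>\<mu>. emeasure \<mu> A"]) auto
next
  case (mult u c)
  have "(\<integral>\<^sup>+x. c * u x \<partial>\<mu>) = c * (\<integral>\<^sup>+x. u x \<partial>\<mu>)" if "\<mu> \<in> space (finite_measure_algebra K)" for \<mu>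
    using that mult(2) by (intro nn_integral_cmult) (auto simp: space_finite_measure_algebra cong: measurable_cong_sets)
  then show ?case
    using mult(4) by (subst measurable_cong[where g = "\<lambda>\<mu>. c * (\<integral>\<^sup>+x. u x \<partial>\<mu>)"]) auto
next
  case (add u v)
  have "(\<integral>\<^sup>+x. v x + u x \<partial>\<mu>) = (\<integral>\<^sup>+x. v x \<partial>\<mu>) + (\<integral>\<^sup>+x. u x \<partial>\<mu>)" if "\<mu> \<in> space (finite_measure_algebra K)" for \<mu>
    using that add(1,3) by (intro nn_integral_add) (auto simp: space_finite_measure_algebra cong: measurable_cong_sets)
  then show ?case
    using add(6,7) by (subst measurable_cong[where g = "\<lambda>\<mu>. (\<integral>\<^sup>+x. v x \<partial>\<mu>) + (\<integral>\<^sup>+x. u x \<partial>\<mu>)"]) auto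
next
  case (seq U)
  have SU: "(SUP i. U i) = (\<lambda>x. SUP i. U i x)" by (auto simp: fun_eq_iff image_comp)
  have e: "integral\<^sup>N \<mu> (SUP i. U i) = (SUP i. \<integral>\<^sup>+x. U i x \<partial>\<mu>)" if "\<mu> \<in> space (finite_measure_algebra K)" for \<mu>
    unfolding SU using that seq
    by (intro nn_integral_monotone_convergence_SUP) (auto simp: space_finite_measure_algebra cong: measurable_cong_sets)
  then show ?case
    using seq by (subst measurable_cong[OF e]) auto
qed

context super_OU_process
begin

section \<open>Solutions of the mild equation\<close>

text \<open>Tonelli, the semigroup property and the substitution of s + r by r.\<close>

lemma Q_semigroup_time:
  fixes G :: "real \<Rightarrow> real^'d \<Rightarrow> ennreal"
  assumes G [measurable]: "(\<lambda>(r, z). G r z) \<in> borel_measurable (borel \<Otimes>\<^sub>M borel)" and s: "0 \<le> s"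
  shows "(\<integral>\<^sup>+y. (\<integral>\<^sup>+r\<in>{0..t - s}. (\<integral>\<^sup>+z. G (s + r) z \<partial>Q r y) \<partial>lborel) \<partial>Q s x) =
    (\<integral>\<^sup>+r\<in>{s..t}. (\<integral>\<^sup>+z. G r z \<partial>Q r x) \<partial>lborel)"
proof -
  interpret q: prob_space "Q s x" by (rule Q_prob)
  have pair: "pair_sigma_finite (Q s x) (lborel :: real measure)" ..
  have [measurable]: "G r \<in> borel_measurable borel" for r
    using measurable_compose[OF _ G, of "\<lambda>y. (r, y)" borel] by simp
  have "(\<integral>\<^sup>+y. (\<integral>\<^sup>+r\<in>{0..t - s}. (\<integral>\<^sup>+z. G (s + r) z \<partial>Q r y) \<partial>lborel) \<partial>Q s x) =
    (\<integral>\<^sup>+r. (\<integral>\<^sup>+y. (\<integral>\<^sup>+z. G (s + r) z \<partial>Q r y) * indicator {0..t - s} r \<partial>Q s x) \<partial>lborel)"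
    by (rule pair_sigma_finite.Fubini'[OF pair, symmetric]) measurable
  also have "\<dots> = (\<integral>\<^sup>+r. (\<integral>\<^sup>+z. G (s + r) z \<partial>Q (s + r) x) * indicator {0..t - s} r \<partial>lborel)"
  proof (intro nn_integral_cong)
    fix r :: real
    have "(\<integral>\<^sup>+y. (\<integral>\<^sup>+z. G (s + r) z \<partial>Q r y) * indicator {0..t - s} r \<partial>Q s x) =
       (\<integral>\<^sup>+y. (\<integral>\<^sup>+z. G (s + r) z \<partial>Q r y) \<partial>Q s x) * indicator {0..t - s} r"
      by (rule nn_integral_multc) measurable
    also have "\<dots> = (\<integral>\<^sup>+z. G (s + r) z \<partial>Q (s + r) x) * indicator {0..t - s} r"
      using ou_law_semigroup[OF s, of r "G (s + r)" x] by (auto split: split_indicator)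
    finally show "(\<integral>\<^sup>+y. (\<integral>\<^sup>+z. G (s + r) z \<partial>Q r y) * indicator {0..t - s} r \<partial>Q s x) =
       (\<integral>\<^sup>+z. G (s + r) z \<partial>Q (s + r) x) * indicator {0..t - s} r" .
  qed
  also have "\<dots> = (\<integral>\<^sup>+r. (\<integral>\<^sup>+z. G (s + 1 * r) z \<partial>Q (s + 1 * r) x) * indicator {s..t} (s + 1 * r) \<partial>lborel)"
    by (intro nn_integral_cong) (auto split: split_indicator)
  also have "\<dots> = (\<integral>\<^sup>+r\<in>{s..t}. (\<integral>\<^sup>+z. G r z \<partial>Q r x) \<partial>lborel)"
  proof -
    have m: "(\<lambda>r. (\<integral>\<^sup>+z. G r z \<partial>Q r x) * indicator {s..t} r) \<in> borel_measurable borel" by measurable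
    show ?thesis using nn_integral_real_affine[OF m, of 1 s] by simp
  qed
  finally show ?thesis .
qed

lemma mild_U_measurable:
  assumes mild: "mild_solution \<psi> \<xi> Pr f u"
  shows "(\<lambda>(s, y). u y (max 0 (t - s))) \<in> borel_measurable (borel \<Otimes>\<^sub>M borel)"
    and "(\<lambda>(s, y). psi0 (u y (max 0 (t - s)))) \<in> borel_measurable (borel \<Otimes>\<^sub>M borel)"
proof -
  note mm = mild_measurable[OF mild]
  have "(\<lambda>z. (snd z, t - fst z)) \<in> (borel :: real measure) \<Otimes>\<^sub>M (borel :: (real^'d) measure) \<rightarrow>\<^sub>M borel \<Otimes>\<^sub>M borel" by measurable
  from measurable_compose[OF this mm] show 1: "(\<lambda>(s, y). u y (max 0 (t - s))) \<in> borel_measurable (borel \<Otimes>\<^sub>M borel)"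
    by (simp add: case_prod_beta)
  have "(\<lambda>z. psi0 (max 0 (case z of (s, y) \<Rightarrow> u y (max 0 (t - s))))) \<in> borel_measurable (borel \<Otimes>\<^sub>M borel)"
    by (rule measurable_compose[OF 1 psi0_measurable])
  then show "(\<lambda>(s, y). psi0 (u y (max 0 (t - s)))) \<in> borel_measurable (borel \<Otimes>\<^sub>M borel)"
    using mild_nonneg[OF mild] by (simp add: case_prod_beta max_def)
qed

text \<open>Variation of constants. Averaging the mild equation at time t - s over
  \<open>Q s x\<close> shows that m, the average of u at time t - s, solves the equation of
  \<open>linear_volterra\<close>; the linear branching then turns into the factors
  \<open>exp (\<alpha> * s)\<close>.\<close>

lemma mild_formula:
  assumes mild: "mild_solution (branching_psi \<alpha> \<beta> n) \<xi> Pr f u"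
    and f [measurable]: "f \<in> borel_measurable borel" and f0: "\<And>y. 0 \<le> f y" and fC: "\<And>y. f y \<le> C"
    and t: "0 \<le> t"
  shows "ennreal (u x t) + (\<integral>\<^sup>+s\<in>{0..t}. ennreal (exp (\<alpha> * s)) * (\<integral>\<^sup>+y. ennreal (psi0 (u y (max 0 (t - s)))) \<partial>Q s x) \<partial>lborel) =
      ennreal (exp (\<alpha> * t)) * (\<integral>\<^sup>+y. ennreal (f y) \<partial>Q t x)"
proof -
  note U [measurable] = mild_U_measurable[OF mild, of t]
  define m where "m s = (\<integral>\<^sup>+y. ennreal (u y (max 0 (t - s))) \<partial>Q s x)" for s
  define k where "k s = (\<integral>\<^sup>+y. ennreal (psi0 (u y (max 0 (t - s)))) \<partial>Q s x)" for s
  define c where "c = (\<integral>\<^sup>+y. ennreal (f y) \<partial>Q t x)"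
  have mk [measurable]: "m \<in> borel_measurable borel" "k \<in> borel_measurable borel"
    unfolding m_def k_def by measurable
  have c: "c < \<infinity>"
  proof -
    have "c \<le> (\<integral>\<^sup>+y. ennreal C \<partial>Q t x)" unfolding c_def using fC by (intro nn_integral_mono ennreal_leI) auto
    also have "\<dots> < \<infinity>" by simp
    finally show ?thesis .
  qed
  have eq: "m s + (\<integral>\<^sup>+r\<in>{s..t}. k r \<partial>lborel) = c + ennreal \<alpha> * (\<integral>\<^sup>+r\<in>{s..t}. m r \<partial>lborel)" if s: "0 \<le> s" "s \<le> t" for s
  proof -
    have ts: "0 \<le> t - s" using s by simp
    have A: "(\<integral>\<^sup>+y. (\<integral>\<^sup>+r\<in>{0..t - s}. (\<integral>\<^sup>+z. ennreal (psi0 (u z (max 0 (t - (s + r))))) \<partial>Q r y) \<partial>lborel) \<partial>Q s x) = (\<integral>\<^sup>+r\<in>{s..t}. k r \<partial>lborel)"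
      unfolding k_def by (rule Q_semigroup_time[OF _ s(1), where G = "\<lambda>r z. ennreal (psi0 (u z (max 0 (t - r))))"]) measurable
    have B: "(\<integral>\<^sup>+y. (\<integral>\<^sup>+r\<in>{0..t - s}. (\<integral>\<^sup>+z. ennreal (u z (max 0 (t - (s + r)))) \<partial>Q r y) \<partial>lborel) \<partial>Q s x) = (\<integral>\<^sup>+r\<in>{s..t}. m r \<partial>lborel)"
      unfolding m_def by (rule Q_semigroup_time[OF _ s(1), where G = "\<lambda>r z. ennreal (u z (max 0 (t - r)))"]) measurable
    have us [measurable]: "(\<lambda>y. u y (t - s)) \<in> borel_measurable borel"
      using measurable_compose[OF _ U(1), of "\<lambda>y. (s, y)" borel] ts by (simp add: max_def)
    have meas [measurable]: "(\<lambda>y. \<integral>\<^sup>+r\<in>{0..t - s}. (\<integral>\<^sup>+z. ennreal (psi0 (u z (max 0 (t - (s + r))))) \<partial>Q r y) \<partial>lborel) \<in> borel_measurable borel"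
      "(\<lambda>y. \<integral>\<^sup>+r\<in>{0..t - s}. (\<integral>\<^sup>+z. ennreal (u z (max 0 (t - (s + r)))) \<partial>Q r y) \<partial>lborel) \<in> borel_measurable borel"
    proof -
      have m1: "(\<lambda>w. (s + snd (fst w), snd w)) \<in> ((borel :: (real^'d) measure) \<Otimes>\<^sub>M (borel :: real measure)) \<Otimes>\<^sub>M (borel :: (real^'d) measure) \<rightarrow>\<^sub>M borel \<Otimes>\<^sub>M borel"
        by measurable
      note [measurable] = measurable_compose[OF m1 U(1), unfolded case_prod_beta fst_conv snd_conv] measurable_compose[OF m1 U(2), unfolded case_prod_beta fst_conv snd_conv]
      have [measurable]: "(\<lambda>p. \<integral>\<^sup>+z. ennreal (psi0 (u z (max 0 (t - (s + snd p))))) \<partial>Q (snd p) (fst p)) \<in> borel_measurable ((borel :: (real^'d) measure) \<Otimes>\<^sub>M (borel :: real measure))"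
        "(\<lambda>p. \<integral>\<^sup>+z. ennreal (u z (max 0 (t - (s + snd p)))) \<partial>Q (snd p) (fst p)) \<in> borel_measurable ((borel :: (real^'d) measure) \<Otimes>\<^sub>M (borel :: real measure))"
        by (rule Q_integral_measurable; simp add: case_prod_beta; measurable)+
      have "(\<lambda>y. \<integral>\<^sup>+r. (\<integral>\<^sup>+z. ennreal (psi0 (u z (max 0 (t - (s + snd (y, r)))))) \<partial>Q (snd (y, r)) (fst (y, r))) * indicator {0..t - s} r \<partial>lborel) \<in> borel_measurable borel"
        by measurable
      then show "(\<lambda>y. \<integral>\<^sup>+r\<in>{0..t - s}. (\<integral>\<^sup>+z. ennreal (psi0 (u z (max 0 (t - (s + r))))) \<partial>Q r y) \<partial>lborel) \<in> borel_measurable borel" by simp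
      have "(\<lambda>y. \<integral>\<^sup>+r. (\<integral>\<^sup>+z. ennreal (u z (max 0 (t - (s + snd (y, r))))) \<partial>Q (snd (y, r)) (fst (y, r))) * indicator {0..t - s} r \<partial>lborel) \<in> borel_measurable borel"
        by measurable
      then show "(\<lambda>y. \<integral>\<^sup>+r\<in>{0..t - s}. (\<integral>\<^sup>+z. ennreal (u z (max 0 (t - (s + r)))) \<partial>Q r y) \<partial>lborel) \<in> borel_measurable borel" by simp
    qed
    have um: "m s = (\<integral>\<^sup>+y. ennreal (u y (t - s)) \<partial>Q s x)"
      using ts by (simp add: m_def)
    have "m s + (\<integral>\<^sup>+r\<in>{s..t}. k r \<partial>lborel) =
      (\<integral>\<^sup>+y. ennreal (u y (t - s)) + (\<integral>\<^sup>+r\<in>{0..t - s}. (\<integral>\<^sup>+z. ennreal (psi0 (u z (max 0 (t - (s + r))))) \<partial>Q r y) \<partial>lborel) \<partial>Q s x)"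
      unfolding A[symmetric] um by (rule nn_integral_add[symmetric]) measurable
    also have "\<dots> = (\<integral>\<^sup>+y. (\<integral>\<^sup>+z. ennreal (f z) \<partial>Q (t - s) y) + ennreal \<alpha> * (\<integral>\<^sup>+r\<in>{0..t - s}. (\<integral>\<^sup>+z. ennreal (u z (max 0 (t - (s + r)))) \<partial>Q r y) \<partial>lborel) \<partial>Q s x)"
      using mild_nn_integral(3)[OF mild f f0 fC ts] by (intro nn_integral_cong) (simp add: diff_diff_eq)
    also have "\<dots> = (\<integral>\<^sup>+y. (\<integral>\<^sup>+z. ennreal (f z) \<partial>Q (t - s) y) \<partial>Q s x) + (\<integral>\<^sup>+y. ennreal \<alpha> * (\<integral>\<^sup>+r\<in>{0..t - s}. (\<integral>\<^sup>+z. ennreal (u z (max 0 (t - (s + r)))) \<partial>Q r y) \<partial>lborel) \<partial>Q s x)"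
      by (rule nn_integral_add) measurable
    also have "(\<integral>\<^sup>+y. ennreal \<alpha> * (\<integral>\<^sup>+r\<in>{0..t - s}. (\<integral>\<^sup>+z. ennreal (u z (max 0 (t - (s + r)))) \<partial>Q r y) \<partial>lborel) \<partial>Q s x) = ennreal \<alpha> * (\<integral>\<^sup>+r\<in>{s..t}. m r \<partial>lborel)"
      unfolding B[symmetric] by (rule nn_integral_cmult) measurable
    also have "(\<integral>\<^sup>+y. (\<integral>\<^sup>+z. ennreal (f z) \<partial>Q (t - s) y) \<partial>Q s x) = c"
      unfolding c_def by (subst ou_law_semigroup[OF s(1) ts]) auto
    finally show ?thesis .
  qed
  have m0: "m 0 = ennreal (u x t)"
  proof -
    have "(\<lambda>y. u y (max 0 (t - 0))) \<in> borel_measurable borel"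
      using measurable_compose[OF _ U(1), of "\<lambda>y. (0, y)" borel] by simp
    then show ?thesis unfolding m_def using t by (subst Q_0) auto
  qed
  have "m 0 + (\<integral>\<^sup>+r\<in>{0..t}. ennreal (exp (\<alpha> * r)) * k r \<partial>lborel) = ennreal (exp (\<alpha> * t)) * c"
    by (rule linear_volterra[OF mk \<alpha>_pos t c eq])
      (use mild_nn_integral(1,2)[OF mild f f0 fC t, of x] in \<open>auto simp: m_def k_def\<close>)
  then show ?thesis unfolding m0 by (simp add: k_def c_def)
qed

text \<open>The integral term in \<open>mild_formula\<close> is nonnegative and is dropped.\<close>

lemma mild_le:
  assumes mild: "mild_solution (branching_psi \<alpha> \<beta> n) \<xi> Pr f u"
    and f: "f \<in> borel_measurable borel" and f0: "\<And>y. 0 \<le> f y" and fC: "\<And>y. f y \<le> C"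
    and t: "0 \<le> t"
  shows "u x t \<le> exp (\<alpha> * t) * C"
proof -
  have C0: "0 \<le> C" using f0[of undefined] fC[of undefined] by linarith
  have "ennreal (u x t) \<le> ennreal (exp (\<alpha> * t)) * (\<integral>\<^sup>+y. ennreal (f y) \<partial>Q t x)"
    unfolding mild_formula[OF mild f f0 fC t, symmetric] by simp
  also have "\<dots> \<le> ennreal (exp (\<alpha> * t)) * (\<integral>\<^sup>+y. ennreal C \<partial>Q t x)"
    using fC by (intro mult_left_mono nn_integral_mono ennreal_leI) auto
  also have "\<dots> = ennreal (exp (\<alpha> * t) * C)" using C0 by (simp add: ennreal_mult)
  finally show ?thesis using C0 by (simp add: ennreal_le_iff)
qed

end

lemma finite_measure_less_top: "finite_measure N \<Longrightarrow> emeasure N A < \<top>"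
  using finite_measure.emeasure_finite[of N A] by (simp only: infinity_ennreal_def top.not_eq_extremum)

context super_OU_process
begin

section \<open>Moments of the superprocess\<close>

definition mean_op :: "(real^'d \<Rightarrow> ennreal) \<Rightarrow> real \<Rightarrow> real^'d \<Rightarrow> ennreal" where
  "mean_op f r y = ennreal (exp (\<alpha> * r)) * (\<integral>\<^sup>+z. f z \<partial>Q r y)"

text \<open>The variance of the integral of f under \<open>X t\<close>, started from the unit mass
  at x, up to the factor \<open>2 * kap\<close>, which is the second derivative of \<psi> at
  0.\<close>

definition var_op :: "(real^'d \<Rightarrow> ennreal) \<Rightarrow> real \<Rightarrow> real^'d \<Rightarrow> ennreal" where
  "var_op f t x = (\<integral>\<^sup>+s\<in>{0..t}. ennreal (exp (\<alpha> * s)) * (\<integral>\<^sup>+y. (mean_op f (t - s) y)\<^sup>2 \<partial>Q s x) \<partial>lborel)"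

lemma mean_op_measurable [measurable]:
  assumes [measurable]: "F \<in> borel_measurable borel" "f \<in> borel_measurable M'" "g \<in> borel_measurable M'"
  shows "(\<lambda>z. mean_op F (f z) (g z)) \<in> borel_measurable M'"
  unfolding mean_op_def by measurable

lemma var_op_measurable [measurable]:
  assumes [measurable]: "F \<in> borel_measurable borel"
  shows "var_op F t \<in> borel_measurable borel"
  unfolding var_op_def by measurable

lemma MF_D: "\<mu> \<in> space MF \<Longrightarrow> finite_measure \<mu>" "\<mu> \<in> space MF \<Longrightarrow> sets \<mu> = sets borel"
  by (auto simp: space_finite_measure_algebra)

lemma X_space: "\<mu> \<in> space MF \<Longrightarrow> 0 \<le> t \<Longrightarrow> w \<in> space (P \<mu>) \<Longrightarrow> X t w \<in> space MF"
  using measurable_space[OF X.measurable_Y] by (simp add: X.space_P)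

lemma X_nn_measurable:
  assumes "\<mu> \<in> space MF" "0 \<le> t" "f \<in> borel_measurable borel"
  shows "(\<lambda>w. \<integral>\<^sup>+x. f x \<partial>X t w) \<in> borel_measurable (P \<mu>)"
  by (rule measurable_compose[OF X.measurable_Y_P[OF assms(1,2)] nn_integral_measurable_finite_measure_algebra[OF assms(3)]])

lemma X_integral_eq:
  fixes f :: "real^'d \<Rightarrow> real"
  assumes "\<mu> \<in> space MF" "0 \<le> t" "w \<in> space (P \<mu>)" "f \<in> borel_measurable borel" "\<And>x. 0 \<le> f x"
  shows "(\<integral>x. f x \<partial>X t w) = enn2real (\<integral>\<^sup>+x. ennreal (f x) \<partial>X t w)"
  using assms MF_D(2)[OF X_space[OF assms(1-3)]]
  by (intro integral_eq_nn_integral) (auto cong: measurable_cong_sets)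

text \<open>By \<open>mild_formula\<close> the solution with initial value \<theta> f is \<theta>
  times the mean minus \<theta>^2 times a term converging to \<open>kap * var_op\<close>. This is
  the expansion from which \<open>laplace_moments\<close> extracts both moments.\<close>

lemma bounded_moments:
  assumes f [measurable]: "f \<in> borel_measurable borel" and f0: "\<And>y. 0 \<le> f y" and fC: "\<And>y. f y \<le> C"
    and \<mu>: "\<mu> \<in> space MF" and t: "0 \<le> t"
  shows "(\<integral>\<^sup>+\<omega>. (\<integral>\<^sup>+x. ennreal (f x) \<partial>X t \<omega>) \<partial>P \<mu>) = (\<integral>\<^sup>+x. mean_op (\<lambda>x. ennreal (f x)) t x \<partial>\<mu>)"
    and "(\<integral>\<^sup>+\<omega>. (\<integral>\<^sup>+x. ennreal (f x) \<partial>X t \<omega>)\<^sup>2 \<partial>P \<mu>) =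
      (\<integral>\<^sup>+x. mean_op (\<lambda>x. ennreal (f x)) t x \<partial>\<mu>)\<^sup>2 + ennreal (2 * kap) * (\<integral>\<^sup>+x. var_op (\<lambda>x. ennreal (f x)) t x \<partial>\<mu>)"
proof -
  have C0: "0 \<le> C" using f0[of undefined] fC[of undefined] by linarith
  define F where "F = (\<lambda>x. ennreal (f x))"
  have [measurable]: "F \<in> borel_measurable borel" unfolding F_def by measurable
  define \<theta> where "\<theta> k = inverse (real (Suc k))" for k
  have \<theta>: "\<theta> k > 0" "\<theta> k \<le> 1" "\<theta> \<longlonglongrightarrow> 0" for k
    unfolding \<theta>_def by (simp, simp add: inverse_eq_divide, rule LIMSEQ_inverse_real_of_nat)
  have bnd: "bounded (range (\<lambda>x. \<theta> k * f x))" for k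
    by (rule boundedI[of _ "\<theta> k * C"]) (use f0 fC \<theta>(1)[of k] in \<open>auto simp: abs_mult\<close>)
  have "\<exists>u. mild_solution (branching_psi \<alpha> \<beta> n) \<xi> Pr (\<lambda>x. \<theta> k * f x) u \<and>
     (\<forall>\<mu>\<in>space MF. \<forall>t\<ge>0. - ln (\<integral>\<omega>. exp (- (\<integral>x. \<theta> k * f x \<partial>X t \<omega>)) \<partial>P \<mu>) = (\<integral>x. u x t \<partial>\<mu>))" for k
  proof -
    have "(\<lambda>x. \<theta> k * f x) \<in> borel_measurable borel" "\<And>x. 0 \<le> \<theta> k * f x" using f0 \<theta>(1)[of k] by auto
    from log_Laplace[OF this(1) bnd this(2)] show ?thesis by (elim exE conjE) (intro exI conjI)
  qed
  then obtain u where mild: "\<And>k. mild_solution (branching_psi \<alpha> \<beta> n) \<xi> Pr (\<lambda>x. \<theta> k * f x) (u k)"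
    and lap: "\<And>k. - ln (\<integral>\<omega>. exp (- (\<integral>x. \<theta> k * f x \<partial>X t \<omega>)) \<partial>P \<mu>) = (\<integral>x. u k x t \<partial>\<mu>)"
    using \<mu> t by metis
  have fk: "(\<lambda>x. \<theta> k * f x) \<in> borel_measurable borel" "0 \<le> \<theta> k * f x" "\<theta> k * f x \<le> \<theta> k * C" for k x
    using f0 fC \<theta>(1)[of k] by auto
  note form = mild_formula[OF mild fk]
  have u0: "0 \<le> u k x r" if "0 \<le> r" for k x r by (rule mild_nonneg[OF mild that])
  have u_le: "u k x r \<le> exp (\<alpha> * r) * (\<theta> k * C)" if "0 \<le> r" for k x r by (rule mild_le[OF mild fk that])
  \<comment> \<open>u is of order \<theta> by \<open>mild_le\<close> and \<open>psi0\<close> is at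
    most quadratic; Bt is the resulting constant, the same for all k.\<close>
  define Bt where "Bt r = 2 * kap * (exp (\<alpha> * r) * C)\<^sup>2" for r
  have Bt0: "0 \<le> Bt r" for r using kap_nonneg by (simp add: Bt_def)
  have psi_le: "psi0 (u k y (max 0 (r - s))) \<le> (\<theta> k)\<^sup>2 * Bt r" if s: "0 \<le> s" "s \<le> r" for k y r s
  proof -
    have "u k y (max 0 (r - s)) \<le> exp (\<alpha> * (r - s)) * (\<theta> k * C)" using u_le[of "r - s"] s by simp
    also have "\<dots> \<le> exp (\<alpha> * r) * (\<theta> k * C)"
      using s \<alpha>_pos C0 \<theta>(1)[of k] by (intro mult_right_mono) auto
    finally have "(u k y (max 0 (r - s)))\<^sup>2 \<le> (exp (\<alpha> * r) * (\<theta> k * C))\<^sup>2"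
      by (intro power_mono u0) auto
    then have "2 * kap * (u k y (max 0 (r - s)))\<^sup>2 \<le> 2 * kap * (exp (\<alpha> * r) * (\<theta> k * C))\<^sup>2"
      using kap_nonneg by (intro mult_left_mono) auto
    then show ?thesis
      using psi0_le[OF u0, of "max 0 (r - s)" k y] by (simp add: Bt_def power_mult_distrib mult_ac)
  qed
  define mr where "mr r x = exp (\<alpha> * r) * (\<integral>y. f y \<partial>Q r x)" for r x
  have mr0: "0 \<le> mr r x" for r x using f0 by (simp add: mr_def)
  have Qf: "(\<integral>\<^sup>+y. F y \<partial>Q r x) = ennreal (\<integral>y. f y \<partial>Q r x)" for r x
  proof -
    interpret q: prob_space "Q r x" by (rule Q_prob)
    show ?thesis unfolding F_def using f0 fC C0
      by (intro nn_integral_eq_integral q.integrable_const_bound[where B = C]) auto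
  qed
  have mean: "mean_op F r x = ennreal (mr r x)" for r x
    unfolding mean_op_def mr_def Qf using f0 by (simp add: ennreal_mult)
  have mr_meas [measurable]: "(\<lambda>(r, y). mr r y) \<in> borel_measurable (borel \<Otimes>\<^sub>M borel)"
  proof -
    have "(\<lambda>z. enn2real (mean_op F (fst z) (snd z))) \<in> borel_measurable (borel \<Otimes>\<^sub>M borel)" by measurable
    then show ?thesis using mr0 by (simp add: mean case_prod_beta)
  qed
  \<comment> \<open>The nonlinear loss in \<open>mild_formula\<close>. It is of order \<theta>^2, so
    that u divided by \<theta> converges to the mean \<open>mr\<close>.\<close>
  define R where "R k r x = (\<integral>\<^sup>+s\<in>{0..r}. ennreal (exp (\<alpha> * s)) * (\<integral>\<^sup>+y. ennreal (psi0 (u k y (max 0 (r - s)))) \<partial>Q s x) \<partial>lborel)" for k r x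
  have uR: "ennreal (u k x r) + R k r x = ennreal (\<theta> k * mr r x)" if "0 \<le> r" for k r x
  proof -
    have "(\<integral>\<^sup>+y. ennreal (\<theta> k * f y) \<partial>Q r x) = ennreal (\<theta> k) * (\<integral>\<^sup>+y. F y \<partial>Q r x)"
      unfolding F_def using \<theta>(1)[of k] f0
      by (subst nn_integral_cmult[symmetric]) (auto simp: ennreal_mult)
    then show ?thesis
      unfolding R_def form[OF that] Qf mr_def using \<theta>(1)[of k] f0
      by (simp add: ennreal_mult[symmetric] mult_ac)
  qed
  define D where "D r = r * (exp (\<alpha> * r) * Bt r)" for r
  have R_le: "R k r x \<le> ennreal ((\<theta> k)\<^sup>2 * D r)" if r: "0 \<le> r" for k r x
  proof -
    have "R k r x \<le> (\<integral>\<^sup>+s. ennreal (exp (\<alpha> * r) * ((\<theta> k)\<^sup>2 * Bt r)) * indicator {0..r} s \<partial>lborel)"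
      unfolding R_def
    proof (intro nn_integral_mono)
      fix s :: real
      show "ennreal (exp (\<alpha> * s)) * (\<integral>\<^sup>+y. ennreal (psi0 (u k y (max 0 (r - s)))) \<partial>Q s x) * indicator {0..r} s
        \<le> ennreal (exp (\<alpha> * r) * ((\<theta> k)\<^sup>2 * Bt r)) * indicator {0..r} s"
      proof (cases "s \<in> {0..r}")
        case True
        have "(\<integral>\<^sup>+y. ennreal (psi0 (u k y (max 0 (r - s)))) \<partial>Q s x) \<le> (\<integral>\<^sup>+y. ennreal ((\<theta> k)\<^sup>2 * Bt r) \<partial>Q s x)"
          using psi_le True by (intro nn_integral_mono ennreal_leI) auto
        then have "(\<integral>\<^sup>+y. ennreal (psi0 (u k y (max 0 (r - s)))) \<partial>Q s x) \<le> ennreal ((\<theta> k)\<^sup>2 * Bt r)" by simp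
        moreover have "ennreal (exp (\<alpha> * s)) \<le> ennreal (exp (\<alpha> * r))" using True \<alpha>_pos by (intro ennreal_leI) auto
        ultimately have "ennreal (exp (\<alpha> * s)) * (\<integral>\<^sup>+y. ennreal (psi0 (u k y (max 0 (r - s)))) \<partial>Q s x) \<le> ennreal (exp (\<alpha> * r)) * ennreal ((\<theta> k)\<^sup>2 * Bt r)"
          by (intro mult_mono) auto
        then show ?thesis using True Bt0[of r] by (simp add: ennreal_mult)
      qed simp
    qed
    also have "\<dots> = ennreal (exp (\<alpha> * r) * ((\<theta> k)\<^sup>2 * Bt r)) * ennreal r"
      using r by (simp add: nn_integral_cmult_indicator)
    also have "\<dots> = ennreal ((\<theta> k)\<^sup>2 * D r)"
      using r Bt0[of r] by (simp add: ennreal_mult[symmetric] D_def mult_ac)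
    finally show ?thesis .
  qed
  have D0: "0 \<le> D r" if "0 \<le> r" for r using that Bt0[of r] by (simp add: D_def)
  have u_lim: "(\<lambda>k. u k x r / \<theta> k) \<longlonglongrightarrow> mr r x" if r: "0 \<le> r" for x r
  proof (rule tendsto_sandwich)
    have bounds: "\<theta> k * mr r x - (\<theta> k)\<^sup>2 * D r \<le> u k x r" "u k x r \<le> \<theta> k * mr r x" for k
    proof -
      have "ennreal (u k x r) \<le> ennreal (\<theta> k * mr r x)" unfolding uR[OF r, symmetric] by simp
      then show "u k x r \<le> \<theta> k * mr r x" using mr0 \<theta>(1)[of k] by (simp add: ennreal_le_iff)
      have "ennreal (\<theta> k * mr r x) \<le> ennreal (u k x r) + ennreal ((\<theta> k)\<^sup>2 * D r)"
        unfolding uR[OF r, symmetric] by (intro add_left_mono R_le r)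
      also have "\<dots> = ennreal (u k x r + (\<theta> k)\<^sup>2 * D r)" using u0[OF r] D0[OF r] by (intro ennreal_plus[symmetric]) auto
      finally show "\<theta> k * mr r x - (\<theta> k)\<^sup>2 * D r \<le> u k x r"
        using u0[OF r, of k x] D0[OF r] by (subst (asm) ennreal_le_iff) auto
    qed
    show "\<forall>\<^sub>F k in sequentially. mr r x - \<theta> k * D r \<le> u k x r / \<theta> k"
      using bounds(1) \<theta>(1) by (intro always_eventually allI) (simp add: le_divide_eq algebra_simps power2_eq_square)
    show "\<forall>\<^sub>F k in sequentially. u k x r / \<theta> k \<le> mr r x"
      using bounds(2) \<theta>(1) by (intro always_eventually allI) (simp add: divide_le_eq mult.commute)
    have "(\<lambda>k. mr r x - \<theta> k * D r) \<longlonglongrightarrow> mr r x - 0 * D r" by (intro tendsto_intros \<theta>(3))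
    then show "(\<lambda>k. mr r x - \<theta> k * D r) \<longlonglongrightarrow> mr r x" by simp
  qed (rule tendsto_const)
  \<comment> \<open>The integrand of R divided by \<theta>^2. For s in \<open>{0..t}\<close> it is
    bounded by \<open>Bt t\<close> and tends to kap times the squared mean, so dominated convergence
    applies in y, in s and over \<mu>.\<close>
  define G where "G k s y = psi0 (u k y (max 0 (t - s))) / (\<theta> k)\<^sup>2" for k s y
  have G_meas [measurable]: "(\<lambda>(s, y). G k s y) \<in> borel_measurable (borel \<Otimes>\<^sub>M borel)" for k
    unfolding G_def using mild_U_measurable(2)[OF mild, of k t] by (simp add: case_prod_beta)
  have G0: "0 \<le> G k s y" for k s y unfolding G_def by (intro divide_nonneg_nonneg psi0_nonneg u0) auto
  have G_le: "G k s y \<le> Bt t" if "s \<in> {0..t}" for k s y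
    using psi_le[of s t k y] that \<theta>(1)[of k] by (simp add: G_def divide_le_eq mult.commute)
  have G_lim: "(\<lambda>k. G k s y) \<longlonglongrightarrow> kap * (mr (t - s) y)\<^sup>2" if s: "s \<in> {0..t}" for s y
  proof -
    have ts: "0 \<le> t - s" using s by simp
    have "(\<lambda>k. u k y (t - s)) \<longlonglongrightarrow> 0"
    proof (rule tendsto_sandwich[OF _ _ tendsto_const])
      show "\<forall>\<^sub>F k in sequentially. 0 \<le> u k y (t - s)" using u0[OF ts] by simp
      show "\<forall>\<^sub>F k in sequentially. u k y (t - s) \<le> exp (\<alpha> * (t - s)) * (\<theta> k * C)" using u_le[OF ts] by simp
      have "(\<lambda>k. exp (\<alpha> * (t - s)) * (\<theta> k * C)) \<longlonglongrightarrow> exp (\<alpha> * (t - s)) * (0 * C)" by (intro tendsto_intros \<theta>(3))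
      then show "(\<lambda>k. exp (\<alpha> * (t - s)) * (\<theta> k * C)) \<longlonglongrightarrow> 0" by simp
    qed
    then obtain h where h: "h \<longlonglongrightarrow> kap" "\<And>k. psi0 (u k y (t - s)) = (u k y (t - s))\<^sup>2 * h k"
      using psi0_second_order[of "\<lambda>k. u k y (t - s)"] u0[OF ts] by blast
    have "(\<lambda>k. h k * (u k y (t - s) / \<theta> k)\<^sup>2) \<longlonglongrightarrow> kap * (mr (t - s) y)\<^sup>2"
      by (intro tendsto_intros h(1) u_lim ts)
    then show ?thesis using ts by (simp add: G_def h(2) power_divide mult.commute)
  qed
  define V where "V k x = (\<integral>\<^sup>+s\<in>{0..t}. ennreal (exp (\<alpha> * s)) * (\<integral>\<^sup>+y. ennreal (G k s y) \<partial>Q s x) \<partial>lborel)" for k x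
  define V0 where "V0 x = (\<integral>\<^sup>+s\<in>{0..t}. ennreal (exp (\<alpha> * s)) * (\<integral>\<^sup>+y. ennreal (kap * (mr (t - s) y)\<^sup>2) \<partial>Q s x) \<partial>lborel)" for x
  have V_meas [measurable]: "V k \<in> borel_measurable borel" "V0 \<in> borel_measurable borel" for k
    unfolding V_def V0_def by measurable
  have RV: "R k t x = ennreal ((\<theta> k)\<^sup>2) * V k x" for k x
  proof -
    have "R k t x = (\<integral>\<^sup>+s. ennreal ((\<theta> k)\<^sup>2) * (ennreal (exp (\<alpha> * s)) * (\<integral>\<^sup>+y. ennreal (G k s y) \<partial>Q s x) * indicator {0..t} s) \<partial>lborel)"
      unfolding R_def
    proof (intro nn_integral_cong)
      fix s :: real
      have [measurable]: "G k s \<in> borel_measurable borel"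
        using measurable_compose[OF _ G_meas[of k], of "\<lambda>y. (s, y)" borel] by simp
      have "(\<integral>\<^sup>+y. ennreal (psi0 (u k y (max 0 (t - s)))) \<partial>Q s x) = (\<integral>\<^sup>+y. ennreal ((\<theta> k)\<^sup>2) * ennreal (G k s y) \<partial>Q s x)"
        using \<theta>(1)[of k] G0 by (intro nn_integral_cong) (simp add: ennreal_mult[symmetric], simp add: G_def)
      also have "\<dots> = ennreal ((\<theta> k)\<^sup>2) * (\<integral>\<^sup>+y. ennreal (G k s y) \<partial>Q s x)"
        by (rule nn_integral_cmult) measurable
      finally show "ennreal (exp (\<alpha> * s)) * (\<integral>\<^sup>+y. ennreal (psi0 (u k y (max 0 (t - s)))) \<partial>Q s x) * indicator {0..t} s =
        ennreal ((\<theta> k)\<^sup>2) * (ennreal (exp (\<alpha> * s)) * (\<integral>\<^sup>+y. ennreal (G k s y) \<partial>Q s x) * indicator {0..t} s)"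
        by (simp add: mult_ac)
    qed
    also have "\<dots> = ennreal ((\<theta> k)\<^sup>2) * V k x"
      unfolding V_def by (rule nn_integral_cmult) measurable
    finally show ?thesis .
  qed
  have V_int_le: "ennreal (exp (\<alpha> * s)) * (\<integral>\<^sup>+y. ennreal (G k s y) \<partial>Q s x) * indicator {0..t} s \<le> ennreal (exp (\<alpha> * t) * Bt t) * indicator {0..t} s" for k s x
  proof (cases "s \<in> {0..t}")
    case True
    have "(\<integral>\<^sup>+y. ennreal (G k s y) \<partial>Q s x) \<le> (\<integral>\<^sup>+y. ennreal (Bt t) \<partial>Q s x)"
      using G_le True by (intro nn_integral_mono ennreal_leI) auto
    then have "(\<integral>\<^sup>+y. ennreal (G k s y) \<partial>Q s x) \<le> ennreal (Bt t)" by simp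
    moreover have "ennreal (exp (\<alpha> * s)) \<le> ennreal (exp (\<alpha> * t))" using True \<alpha>_pos by (intro ennreal_leI) auto
    ultimately have "ennreal (exp (\<alpha> * s)) * (\<integral>\<^sup>+y. ennreal (G k s y) \<partial>Q s x) \<le> ennreal (exp (\<alpha> * t)) * ennreal (Bt t)"
      by (intro mult_mono) auto
    then show ?thesis using True Bt0[of t] by (simp add: ennreal_mult)
  qed simp
  have const_int: "(\<integral>\<^sup>+s. ennreal (exp (\<alpha> * t) * Bt t) * indicator {0..t} s \<partial>lborel) = ennreal (D t)"
  proof -
    have "(\<integral>\<^sup>+s. ennreal (exp (\<alpha> * t) * Bt t) * indicator {0..t} s \<partial>lborel) = ennreal (exp (\<alpha> * t) * Bt t) * emeasure lborel {0..t}"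
      by (rule nn_integral_cmult_indicator) simp
    also have "\<dots> = ennreal (D t)" using t Bt0[of t] by (simp add: ennreal_mult[symmetric] D_def mult_ac)
    finally show ?thesis .
  qed
  have V_le: "V k x \<le> ennreal (D t)" for k x
    unfolding V_def const_int[symmetric] by (intro nn_integral_mono V_int_le)
  have V_lim: "(\<lambda>k. V k x) \<longlonglongrightarrow> V0 x" for x
    unfolding V_def V0_def
  proof (rule nn_integral_dominated_convergence[where w = "\<lambda>s. ennreal (exp (\<alpha> * t) * Bt t) * indicator {0..t} s"])
    show "(\<integral>\<^sup>+s. ennreal (exp (\<alpha> * t) * Bt t) * indicator {0..t} s \<partial>lborel) < \<infinity>" unfolding const_int by simp
    show "AE s in lborel. (\<lambda>k. ennreal (exp (\<alpha> * s)) * (\<integral>\<^sup>+y. ennreal (G k s y) \<partial>Q s x) * indicator {0..t} s)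
      \<longlonglongrightarrow> ennreal (exp (\<alpha> * s)) * (\<integral>\<^sup>+y. ennreal (kap * (mr (t - s) y)\<^sup>2) \<partial>Q s x) * indicator {0..t} s"
    proof (rule AE_I2)
      fix s :: real
      show "(\<lambda>k. ennreal (exp (\<alpha> * s)) * (\<integral>\<^sup>+y. ennreal (G k s y) \<partial>Q s x) * indicator {0..t} s)
        \<longlonglongrightarrow> ennreal (exp (\<alpha> * s)) * (\<integral>\<^sup>+y. ennreal (kap * (mr (t - s) y)\<^sup>2) \<partial>Q s x) * indicator {0..t} s"
      proof (cases "s \<in> {0..t}")
        case True
        have [measurable]: "G k s \<in> borel_measurable borel" for k
          using measurable_compose[OF _ G_meas[of k], of "\<lambda>y. (s, y)" borel] by simp
        have [measurable]: "mr (t - s) \<in> borel_measurable borel"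
          using measurable_compose[OF _ mr_meas, of "\<lambda>y. (t - s, y)" borel] by simp
        have "(\<lambda>k. \<integral>\<^sup>+y. ennreal (G k s y) \<partial>Q s x) \<longlonglongrightarrow> (\<integral>\<^sup>+y. ennreal (kap * (mr (t - s) y)\<^sup>2) \<partial>Q s x)"
          by (rule nn_integral_dominated_convergence[where w = "\<lambda>_. ennreal (Bt t)"])
            (use G_le[OF True] G_lim[OF True] in \<open>auto intro!: tendsto_ennrealI ennreal_leI AE_I2\<close>)
        then show ?thesis using True by (simp add: ennreal_tendsto_cmult)
      qed simp
    qed
    show "AE s in lborel. ennreal (exp (\<alpha> * s)) * (\<integral>\<^sup>+y. ennreal (G k s y) \<partial>Q s x) * indicator {0..t} s
      \<le> ennreal (exp (\<alpha> * t) * Bt t) * indicator {0..t} s" for k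
      by (intro AE_I2 V_int_le)
  qed measurable
  have V0_eq: "V0 x = ennreal kap * var_op F t x" for x
  proof -
    have "V0 x = (\<integral>\<^sup>+s. ennreal kap * (ennreal (exp (\<alpha> * s)) * (\<integral>\<^sup>+y. (mean_op F (t - s) y)\<^sup>2 \<partial>Q s x) * indicator {0..t} s) \<partial>lborel)"
      unfolding V0_def
    proof (intro nn_integral_cong)
      fix s :: real
      have "(\<integral>\<^sup>+y. ennreal (kap * (mr (t - s) y)\<^sup>2) \<partial>Q s x) = (\<integral>\<^sup>+y. ennreal kap * (mean_op F (t - s) y)\<^sup>2 \<partial>Q s x)"
        unfolding mean using kap_nonneg mr0 by (intro nn_integral_cong) (simp add: ennreal_mult ennreal_power)
      also have "\<dots> = ennreal kap * (\<integral>\<^sup>+y. (mean_op F (t - s) y)\<^sup>2 \<partial>Q s x)" by (rule nn_integral_cmult) measurable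
      finally show "ennreal (exp (\<alpha> * s)) * (\<integral>\<^sup>+y. ennreal (kap * (mr (t - s) y)\<^sup>2) \<partial>Q s x) * indicator {0..t} s =
        ennreal kap * (ennreal (exp (\<alpha> * s)) * (\<integral>\<^sup>+y. (mean_op F (t - s) y)\<^sup>2 \<partial>Q s x) * indicator {0..t} s)"
        by (simp add: mult_ac)
    qed
    also have "\<dots> = ennreal kap * var_op F t x" unfolding var_op_def by (rule nn_integral_cmult) measurable
    finally show ?thesis .
  qed
  interpret \<mu>: finite_measure \<mu> by (rule MF_D(1)[OF \<mu>])
  have s\<mu> [measurable_cong]: "sets \<mu> = sets borel" by (rule MF_D(2)[OF \<mu>])
  define cc where "cc k = enn2real (\<integral>\<^sup>+x. V k x \<partial>\<mu>)" for k
  define c0 where "c0 = enn2real (\<integral>\<^sup>+x. V0 x \<partial>\<mu>)"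
  have Dint: "(\<integral>\<^sup>+x. ennreal (D t) \<partial>\<mu>) < \<infinity>" by (simp add: ennreal_mult_less_top finite_measure_less_top[OF \<mu>.finite_measure_axioms])
  have V\<mu>_lim: "(\<lambda>k. \<integral>\<^sup>+x. V k x \<partial>\<mu>) \<longlonglongrightarrow> (\<integral>\<^sup>+x. V0 x \<partial>\<mu>)"
    by (rule nn_integral_dominated_convergence[where w = "\<lambda>_. ennreal (D t)"]) (use V_le V_lim Dint in auto)
  have V\<mu>_le: "(\<integral>\<^sup>+x. V k x \<partial>\<mu>) \<le> (\<integral>\<^sup>+x. ennreal (D t) \<partial>\<mu>)" for k by (intro nn_integral_mono V_le)
  have V\<mu>_fin: "(\<integral>\<^sup>+x. V k x \<partial>\<mu>) < \<infinity>" for k using V\<mu>_le Dint by (rule le_less_trans)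
  have V0_fin: "(\<integral>\<^sup>+x. V0 x \<partial>\<mu>) < \<infinity>"
    using LIMSEQ_le_const2[OF V\<mu>_lim, of "\<integral>\<^sup>+x. ennreal (D t) \<partial>\<mu>"] V\<mu>_le Dint by (auto intro: le_less_trans)
  have cc_lim: "cc \<longlonglongrightarrow> c0"
    unfolding cc_def c0_def using V\<mu>_lim V0_fin by (intro tendsto_enn2real) (auto simp: less_top)
  have cc: "ennreal (cc k) = (\<integral>\<^sup>+x. V k x \<partial>\<mu>)" "0 \<le> cc k" for k
    unfolding cc_def using V\<mu>_fin[of k] by simp_all
  have c0: "ennreal c0 = (\<integral>\<^sup>+x. V0 x \<partial>\<mu>)" "0 \<le> c0"
    unfolding c0_def using V0_fin by simp_all
  define m where "m = (\<integral>x. mr t x \<partial>\<mu>)"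
  have mrt [measurable]: "mr t \<in> borel_measurable borel"
    using measurable_compose[OF _ mr_meas, of "\<lambda>y. (t, y)" borel] by simp
  have mr_le: "mr t x \<le> exp (\<alpha> * t) * C" for x
  proof -
    interpret q: prob_space "Q t x" by (rule Q_prob)
    have "(\<integral>y. f y \<partial>Q t x) \<le> C" using f0 fC C0 by (intro q.integral_le_const q.integrable_const_bound[where B = C]) auto
    then show ?thesis by (simp add: mr_def)
  qed
  have mr_int: "integrable \<mu> (mr t)"
    using mr0 mr_le by (intro \<mu>.integrable_const_bound[where B = "exp (\<alpha> * t) * C"]) auto
  have m: "ennreal m = (\<integral>\<^sup>+x. mean_op F t x \<partial>\<mu>)" "0 \<le> m"
    unfolding m_def mean using mr0 mr_int by (auto simp: nn_integral_eq_integral)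
  have ut [measurable]: "(\<lambda>x. u k x t) \<in> borel_measurable borel" for k
    using measurable_compose[OF _ mild_measurable[OF mild, of k], of "\<lambda>x. (x, t)" borel] t by simp
  have u_int: "integrable \<mu> (\<lambda>x. u k x t)" for k
    using u0[OF t] u_le[OF t] by (intro \<mu>.integrable_const_bound[where B = "exp (\<alpha> * t) * (\<theta> k * C)"]) auto
  \<comment> \<open>This is the exponent in the form required by \<open>laplace_moments\<close>,
    with \<open>cc k\<close> converging to \<open>c0\<close>.\<close>
  have u\<mu>: "(\<integral>x. u k x t \<partial>\<mu>) = \<theta> k * m - (\<theta> k)\<^sup>2 * cc k" for k
  proof -
    have "(\<integral>\<^sup>+x. ennreal (u k x t) + ennreal ((\<theta> k)\<^sup>2) * V k x \<partial>\<mu>) = (\<integral>\<^sup>+x. ennreal (\<theta> k * mr t x) \<partial>\<mu>)"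
      unfolding RV[symmetric] by (simp add: uR[OF t])
    also have "\<dots> = ennreal (\<theta> k * m)"
      unfolding m_def using mr0 mr_int \<theta>(1)[of k] by (subst nn_integral_eq_integral) auto
    also have "(\<integral>\<^sup>+x. ennreal (u k x t) + ennreal ((\<theta> k)\<^sup>2) * V k x \<partial>\<mu>) = (\<integral>\<^sup>+x. ennreal (u k x t) \<partial>\<mu>) + ennreal ((\<theta> k)\<^sup>2) * (\<integral>\<^sup>+x. V k x \<partial>\<mu>)"
      by (subst nn_integral_add) (simp_all add: nn_integral_cmult)
    also have "(\<integral>\<^sup>+x. ennreal (u k x t) \<partial>\<mu>) = ennreal (\<integral>x. u k x t \<partial>\<mu>)"
      using u0[OF t] u_int by (intro nn_integral_eq_integral) auto
    finally have "ennreal ((\<integral>x. u k x t \<partial>\<mu>) + (\<theta> k)\<^sup>2 * cc k) = ennreal (\<theta> k * m)"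
      using u0[OF t] cc by (simp add: ennreal_mult)
    then show ?thesis
      using m(2) \<theta>(1)[of k] cc(2)[of k] u0[OF t] by (subst (asm) ennreal_inj) (auto intro!: add_nonneg_nonneg integral_nonneg_AE)
  qed
  interpret P: prob_space "P \<mu>" by (rule X.prob[OF \<mu>])
  define Z where "Z \<omega> = enn2real (\<integral>\<^sup>+x. F x \<partial>X t \<omega>)" for \<omega>
  have Zm [measurable]: "Z \<in> borel_measurable (P \<mu>)"
    unfolding Z_def using X_nn_measurable[OF \<mu> t, of F] by measurable
  have Z0: "0 \<le> Z \<omega>" for \<omega> by (simp add: Z_def)
  have ZX: "(\<integral>x. c * f x \<partial>X t \<omega>) = c * Z \<omega>" if "\<omega> \<in> space (P \<mu>)" for c \<omega>
    using X_integral_eq[OF \<mu> t that f f0] by (simp add: Z_def F_def)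
  have Zfin: "ennreal (Z \<omega>) = (\<integral>\<^sup>+x. F x \<partial>X t \<omega>)" if \<omega>: "\<omega> \<in> space (P \<mu>)" for \<omega>
  proof -
    interpret x: finite_measure "X t \<omega>" by (rule MF_D(1)[OF X_space[OF \<mu> t \<omega>]])
    have "(\<integral>\<^sup>+x. F x \<partial>X t \<omega>) \<le> (\<integral>\<^sup>+x. ennreal C \<partial>X t \<omega>)" unfolding F_def using fC by (intro nn_integral_mono ennreal_leI) auto
    also have "\<dots> < \<infinity>" by (simp add: ennreal_mult_less_top finite_measure_less_top[OF x.finite_measure_axioms])
    finally show ?thesis by (simp add: Z_def)
  qed
  have L: "(\<integral>\<omega>. exp (- \<theta> k * Z \<omega>) \<partial>P \<mu>) = exp (- \<theta> k * m + (\<theta> k)\<^sup>2 * cc k)" for k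
  proof -
    have "(\<integral>\<omega>. exp (- (\<integral>x. \<theta> k * f x \<partial>X t \<omega>)) \<partial>P \<mu>) = (\<integral>\<omega>. exp (- \<theta> k * Z \<omega>) \<partial>P \<mu>)"
      by (intro Bochner_Integration.integral_cong refl) (simp only: ZX, simp)
    then have ln: "ln (\<integral>\<omega>. exp (- \<theta> k * Z \<omega>) \<partial>P \<mu>) = - \<theta> k * m + (\<theta> k)\<^sup>2 * cc k"
      using lap[of k] u\<mu>[of k] by simp
    have int: "integrable (P \<mu>) (\<lambda>\<omega>. exp (- \<theta> k * Z \<omega>))"
      using Z0 \<theta>(1)[of k] by (intro P.integrable_const_bound[where B = 1]) (auto simp: less_imp_le)
    \<comment> \<open>Positivity is needed to invert the logarithm: as \<open>ln 0 = 0\<close>, the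
      Laplace identity by itself does not exclude a vanishing expectation.\<close>
    have "(\<integral>\<omega>. exp (- \<theta> k * Z \<omega>) \<partial>P \<mu>) \<noteq> 0"
    proof
      assume "(\<integral>\<omega>. exp (- \<theta> k * Z \<omega>) \<partial>P \<mu>) = 0"
      then have "AE \<omega> in P \<mu>. exp (- \<theta> k * Z \<omega>) = 0"
        by (subst (asm) integral_nonneg_eq_0_iff_AE[OF int]) auto
      then show False using P.not_empty by (auto simp: P.AE_False)
    qed
    moreover have "0 \<le> (\<integral>\<omega>. exp (- \<theta> k * Z \<omega>) \<partial>P \<mu>)" by (intro integral_nonneg_AE AE_I2) auto
    ultimately have "0 < (\<integral>\<omega>. exp (- \<theta> k * Z \<omega>) \<partial>P \<mu>)" by linarith
    then show ?thesis unfolding ln[symmetric] by (rule exp_ln[symmetric])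
  qed
  note lm = laplace_moments[OF P.prob_space_axioms Zm Z0 \<theta>(1) \<theta>(3) cc_lim L]
  have "(\<integral>\<^sup>+\<omega>. (\<integral>\<^sup>+x. F x \<partial>X t \<omega>) \<partial>P \<mu>) = (\<integral>\<^sup>+\<omega>. ennreal (Z \<omega>) \<partial>P \<mu>)"
    by (intro nn_integral_cong) (simp add: Zfin)
  also have "\<dots> = ennreal m" using lm(1,2) Z0 by (subst nn_integral_eq_integral) auto
  finally show "(\<integral>\<^sup>+\<omega>. (\<integral>\<^sup>+x. ennreal (f x) \<partial>X t \<omega>) \<partial>P \<mu>) = (\<integral>\<^sup>+x. mean_op (\<lambda>x. ennreal (f x)) t x \<partial>\<mu>)"
    unfolding m F_def .
  have "(\<integral>\<^sup>+\<omega>. (\<integral>\<^sup>+x. F x \<partial>X t \<omega>)\<^sup>2 \<partial>P \<mu>) = (\<integral>\<^sup>+\<omega>. ennreal ((Z \<omega>)\<^sup>2) \<partial>P \<mu>)"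
    by (intro nn_integral_cong) (simp add: Zfin[symmetric] ennreal_power Z0)
  also have "\<dots> = ennreal (m\<^sup>2 + 2 * c0)" using lm(3,4) by (subst nn_integral_eq_integral) auto
  also have "\<dots> = (ennreal m)\<^sup>2 + 2 * ennreal c0"
    using m(2) c0(2) by (simp add: ennreal_power ennreal_mult)
  also have "ennreal c0 = ennreal kap * (\<integral>\<^sup>+x. var_op F t x \<partial>\<mu>)"
    unfolding c0 V0_eq by (rule nn_integral_cmult) measurable
  finally show "(\<integral>\<^sup>+\<omega>. (\<integral>\<^sup>+x. ennreal (f x) \<partial>X t \<omega>)\<^sup>2 \<partial>P \<mu>) =
      (\<integral>\<^sup>+x. mean_op (\<lambda>x. ennreal (f x)) t x \<partial>\<mu>)\<^sup>2 + ennreal (2 * kap) * (\<integral>\<^sup>+x. var_op (\<lambda>x. ennreal (f x)) t x \<partial>\<mu>)"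
    unfolding m F_def using kap_nonneg by (simp add: ennreal_mult mult.assoc)
qed

end

lemma nn_integral_LIMSEQ_space:
  assumes [measurable]: "\<And>i. f i \<in> borel_measurable M"
    and mono: "\<And>i x. x \<in> space M \<Longrightarrow> f i x \<le> f (Suc i) x"
    and lim: "\<And>x. x \<in> space M \<Longrightarrow> (\<lambda>i. f i x) \<longlonglongrightarrow> u x"
  shows "(\<lambda>i. \<integral>\<^sup>+x. f i x \<partial>M) \<longlonglongrightarrow> (\<integral>\<^sup>+x. u x \<partial>M)"
proof -
  define g where "g i x = (if x \<in> space M then f i x else 0)" for i x
  define v where "v x = (if x \<in> space M then u x else 0)" for x
  have "(\<lambda>i. \<integral>\<^sup>+x. g i x \<partial>M) \<longlonglongrightarrow> (\<integral>\<^sup>+x. v x \<partial>M)"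
  proof (rule nn_integral_LIMSEQ)
    show "incseq g" using mono by (intro incseq_SucI) (auto simp: g_def le_fun_def)
    show "g i \<in> borel_measurable M" for i unfolding g_def
      by (subst measurable_cong[where g = "f i"]) auto
    show "(\<lambda>i. g i x) \<longlonglongrightarrow> v x" for x using lim by (auto simp: g_def v_def)
  qed
  moreover have "(\<integral>\<^sup>+x. g i x \<partial>M) = (\<integral>\<^sup>+x. f i x \<partial>M)" for i by (intro nn_integral_cong) (simp add: g_def)
  moreover have "(\<integral>\<^sup>+x. v x \<partial>M) = (\<integral>\<^sup>+x. u x \<partial>M)" by (intro nn_integral_cong) (simp add: v_def)
  ultimately show ?thesis by simp
qed

lemma tendsto_power2_ennreal:
  fixes l :: ennreal
  shows "(f \<longlongrightarrow> l) F \<Longrightarrow> ((\<lambda>x. (f x)\<^sup>2) \<longlongrightarrow> l\<^sup>2) F"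
  unfolding power2_eq_square by (rule tendsto_mult_ennreal) auto

lemma power2_mono_ennreal: "(a :: ennreal) \<le> b \<Longrightarrow> a\<^sup>2 \<le> b\<^sup>2"
  unfolding power2_eq_square by (rule mult_mono) auto

section \<open>From bounded to unbounded nonnegative functions\<close>

context super_OU_process
begin

lemma mean_op_mono: "(\<And>x. F x \<le> G x) \<Longrightarrow> mean_op F r y \<le> mean_op G r y"
  unfolding mean_op_def by (intro mult_left_mono nn_integral_mono) auto

lemma var_op_mono: "(\<And>x. F x \<le> G x) \<Longrightarrow> var_op F t x \<le> var_op G t x"
  unfolding var_op_def
  by (intro nn_integral_mono mult_right_mono mult_left_mono power2_mono_ennreal mean_op_mono) auto

lemma mean_op_LIMSEQ:
  assumes "\<And>k. F k \<in> borel_measurable borel" "\<And>k x. F k x \<le> F (Suc k) x" "\<And>x. (\<lambda>k. F k x) \<longlonglongrightarrow> G x"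
  shows "(\<lambda>k. mean_op (F k) r y) \<longlonglongrightarrow> mean_op G r y"
  unfolding mean_op_def using assms
  by (intro ennreal_tendsto_cmult nn_integral_LIMSEQ_space) (auto cong: measurable_cong_sets)

lemma var_op_LIMSEQ:
  assumes F [measurable]: "\<And>k. F k \<in> borel_measurable borel" and mono: "\<And>k x. F k x \<le> F (Suc k) x"
    and lim: "\<And>x. (\<lambda>k. F k x) \<longlonglongrightarrow> G x"
  shows "(\<lambda>k. var_op (F k) t x) \<longlonglongrightarrow> var_op G t x"
  unfolding var_op_def
proof (rule nn_integral_LIMSEQ_space)
  have inner: "(\<lambda>k. \<integral>\<^sup>+y. (mean_op (F k) (t - s) y)\<^sup>2 \<partial>Q s x) \<longlonglongrightarrow> (\<integral>\<^sup>+y. (mean_op G (t - s) y)\<^sup>2 \<partial>Q s x)" for s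
    by (intro nn_integral_LIMSEQ_space tendsto_power2_ennreal mean_op_LIMSEQ F mono lim power2_mono_ennreal mean_op_mono) measurable
  show "(\<lambda>k. ennreal (exp (\<alpha> * s)) * (\<integral>\<^sup>+y. (mean_op (F k) (t - s) y)\<^sup>2 \<partial>Q s x) * indicator {0..t} s)
      \<longlonglongrightarrow> ennreal (exp (\<alpha> * s)) * (\<integral>\<^sup>+y. (mean_op G (t - s) y)\<^sup>2 \<partial>Q s x) * indicator {0..t} s" for s
    using ennreal_tendsto_cmult[OF _ inner, of "ennreal (exp (\<alpha> * s))"] by (cases "s \<in> {0..t}") auto
  show "ennreal (exp (\<alpha> * s)) * (\<integral>\<^sup>+y. (mean_op (F k) (t - s) y)\<^sup>2 \<partial>Q s x) * indicator {0..t} s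
      \<le> ennreal (exp (\<alpha> * s)) * (\<integral>\<^sup>+y. (mean_op (F (Suc k)) (t - s) y)\<^sup>2 \<partial>Q s x) * indicator {0..t} s" for k s
    by (intro nn_integral_mono mult_right_mono mult_left_mono power2_mono_ennreal mean_op_mono mono) auto
qed measurable

text \<open>Truncation at level k and monotone convergence; the values may be infinite.\<close>

lemma moments_nn:
  assumes f [measurable]: "f \<in> borel_measurable borel" and f0: "\<And>y. 0 \<le> f y"
    and \<mu>: "\<mu> \<in> space MF" and t: "0 \<le> t"
  shows "(\<integral>\<^sup>+w. (\<integral>\<^sup>+x. ennreal (f x) \<partial>X t w) \<partial>P \<mu>) = (\<integral>\<^sup>+x. mean_op (\<lambda>x. ennreal (f x)) t x \<partial>\<mu>)"
    and "(\<integral>\<^sup>+w. (\<integral>\<^sup>+x. ennreal (f x) \<partial>X t w)\<^sup>2 \<partial>P \<mu>) =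
      (\<integral>\<^sup>+x. mean_op (\<lambda>x. ennreal (f x)) t x \<partial>\<mu>)\<^sup>2 + ennreal (2 * kap) * (\<integral>\<^sup>+x. var_op (\<lambda>x. ennreal (f x)) t x \<partial>\<mu>)"
proof -
  define g where "g k x = min (f x) (real k)" for k x
  define F where "F k x = ennreal (g k x)" for k x
  define G where "G x = ennreal (f x)" for x
  have g: "g k \<in> borel_measurable borel" "0 \<le> g k x" "g k x \<le> real k" for k x
    unfolding g_def using f0 by (measurable, auto)
  have Fm [measurable]: "F k \<in> borel_measurable borel" for k unfolding F_def using g by measurable
  have mono: "F k x \<le> F (Suc k) x" for k x unfolding F_def g_def by (intro ennreal_leI) auto
  have lim: "(\<lambda>k. F k x) \<longlonglongrightarrow> G x" for x
  proof (rule tendsto_eventually)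
    show "\<forall>\<^sub>F k in sequentially. F k x = G x"
      using eventually_ge_at_top[of "nat \<lceil>f x\<rceil>"]
    proof (rule eventually_mono)
      fix k assume "nat \<lceil>f x\<rceil> \<le> k"
      then have "f x \<le> real k" by linarith
      then show "F k x = G x" by (simp add: F_def G_def g_def)
    qed
  qed
  have s\<mu> [measurable_cong]: "sets \<mu> = sets borel" by (rule MF_D(2)[OF \<mu>])
  have bm: "(\<integral>\<^sup>+w. (\<integral>\<^sup>+x. F k x \<partial>X t w) \<partial>P \<mu>) = (\<integral>\<^sup>+x. mean_op (F k) t x \<partial>\<mu>)"
    "(\<integral>\<^sup>+w. (\<integral>\<^sup>+x. F k x \<partial>X t w)\<^sup>2 \<partial>P \<mu>) = (\<integral>\<^sup>+x. mean_op (F k) t x \<partial>\<mu>)\<^sup>2 + ennreal (2 * kap) * (\<integral>\<^sup>+x. var_op (F k) t x \<partial>\<mu>)" for k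
    using bounded_moments[OF g \<mu> t, of k] by (simp_all add: F_def[abs_def])
  have Xlim: "(\<lambda>k. \<integral>\<^sup>+x. F k x \<partial>X t w) \<longlonglongrightarrow> (\<integral>\<^sup>+x. G x \<partial>X t w)" if "w \<in> space (P \<mu>)" for w
    using MF_D(2)[OF X_space[OF \<mu> t that]] Fm
    by (intro nn_integral_LIMSEQ_space mono lim) (auto cong: measurable_cong_sets)
  have Xm [measurable]: "(\<lambda>w. \<integral>\<^sup>+x. F k x \<partial>X t w) \<in> borel_measurable (P \<mu>)" for k
    by (rule X_nn_measurable[OF \<mu> t Fm])
  have m_lim: "(\<lambda>k. \<integral>\<^sup>+x. mean_op (F k) t x \<partial>\<mu>) \<longlonglongrightarrow> (\<integral>\<^sup>+x. mean_op G t x \<partial>\<mu>)"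
    by (intro nn_integral_LIMSEQ_space mean_op_LIMSEQ Fm mono lim mean_op_mono) measurable
  have v_lim: "(\<lambda>k. \<integral>\<^sup>+x. var_op (F k) t x \<partial>\<mu>) \<longlonglongrightarrow> (\<integral>\<^sup>+x. var_op G t x \<partial>\<mu>)"
    by (intro nn_integral_LIMSEQ_space var_op_LIMSEQ Fm mono lim var_op_mono) measurable
  have "(\<lambda>k. \<integral>\<^sup>+w. (\<integral>\<^sup>+x. F k x \<partial>X t w) \<partial>P \<mu>) \<longlonglongrightarrow> (\<integral>\<^sup>+w. (\<integral>\<^sup>+x. G x \<partial>X t w) \<partial>P \<mu>)"
    by (intro nn_integral_LIMSEQ_space Xlim nn_integral_mono mono) measurable
  from LIMSEQ_unique[OF this m_lim[unfolded bm(1)[symmetric]]]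
  show "(\<integral>\<^sup>+w. (\<integral>\<^sup>+x. ennreal (f x) \<partial>X t w) \<partial>P \<mu>) = (\<integral>\<^sup>+x. mean_op (\<lambda>x. ennreal (f x)) t x \<partial>\<mu>)"
    by (simp add: G_def[abs_def])
  have 1: "(\<lambda>k. \<integral>\<^sup>+w. (\<integral>\<^sup>+x. F k x \<partial>X t w)\<^sup>2 \<partial>P \<mu>) \<longlonglongrightarrow> (\<integral>\<^sup>+w. (\<integral>\<^sup>+x. G x \<partial>X t w)\<^sup>2 \<partial>P \<mu>)"
    by (intro nn_integral_LIMSEQ_space tendsto_power2_ennreal Xlim power2_mono_ennreal nn_integral_mono mono) measurable
  have 2: "(\<lambda>k. (\<integral>\<^sup>+x. mean_op (F k) t x \<partial>\<mu>)\<^sup>2 + ennreal (2 * kap) * (\<integral>\<^sup>+x. var_op (F k) t x \<partial>\<mu>))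
     \<longlonglongrightarrow> (\<integral>\<^sup>+x. mean_op G t x \<partial>\<mu>)\<^sup>2 + ennreal (2 * kap) * (\<integral>\<^sup>+x. var_op G t x \<partial>\<mu>)"
    by (intro tendsto_add tendsto_power2_ennreal m_lim ennreal_tendsto_cmult v_lim) simp
  show "(\<integral>\<^sup>+w. (\<integral>\<^sup>+x. ennreal (f x) \<partial>X t w)\<^sup>2 \<partial>P \<mu>) =
      (\<integral>\<^sup>+x. mean_op (\<lambda>x. ennreal (f x)) t x \<partial>\<mu>)\<^sup>2 + ennreal (2 * kap) * (\<integral>\<^sup>+x. var_op (\<lambda>x. ennreal (f x)) t x \<partial>\<mu>)"
    using LIMSEQ_unique[OF 1 2[unfolded bm(2)[symmetric]]] by (simp add: G_def[abs_def])
qed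

section \<open>Second moments for functions of polynomial growth\<close>

definition sg :: "(real^'d \<Rightarrow> real) \<Rightarrow> real \<Rightarrow> real^'d \<Rightarrow> real" where
  "sg f r y = (\<integral>z. f z \<partial>Q r y)"

text \<open>The counterpart of \<open>var_op\<close> for functions of either sign: squaring the
  real-valued mean keeps it in \<open>ennreal\<close>.\<close>

definition sg_var :: "(real^'d \<Rightarrow> real) \<Rightarrow> real \<Rightarrow> real^'d \<Rightarrow> ennreal" where
  "sg_var f t x = (\<integral>\<^sup>+s\<in>{0..t}. ennreal (exp (\<alpha> * s)) * (\<integral>\<^sup>+y. ennreal ((exp (\<alpha> * (t - s)) * sg f (t - s) y)\<^sup>2) \<partial>Q s x) \<partial>lborel)"

lemma w_bounds: "0 \<le> t \<Longrightarrow> 0 \<le> exp (- b * t)" "0 \<le> t \<Longrightarrow> exp (- b * t) \<le> 1"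
  using b_pos by auto

lemma Q_integrable: "poly_bdd f \<Longrightarrow> 0 \<le> t \<Longrightarrow> integrable (Q t x) f"
  by (intro poly_bdd_integrable_ou_law a_pos w_bounds)

lemma sg_measurable [measurable]:
  assumes [measurable]: "f \<in> borel_measurable borel" "g \<in> borel_measurable M'" "h \<in> borel_measurable M'"
  shows "(\<lambda>z. sg f (g z) (h z)) \<in> borel_measurable M'"
proof -
  have "(\<lambda>z. integral\<^sup>L (Q (g z) (h z)) f) \<in> borel_measurable M'"
    by (rule measurable_compose[OF Q_kernel integral_measurable_subprob_algebra]) measurable
  then show ?thesis by (simp add: sg_def)
qed

lemma poly_bdd_sg: "poly_bdd f \<Longrightarrow> 0 \<le> t \<Longrightarrow> poly_bdd (sg f t)"
  unfolding sg_def by (intro poly_bdd_mehler a_pos w_bounds)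

lemma sg_poly_bound:
  assumes f: "poly_bdd f"
  obtains g where "poly_bdd g" "\<And>y. 0 \<le> g y" "\<And>r y. 0 \<le> r \<Longrightarrow> \<bar>sg f r y\<bar> \<le> g y"
proof -
  obtain C m where C: "C \<ge> 0"
    "\<And>w x. 0 \<le> w \<Longrightarrow> w \<le> 1 \<Longrightarrow> (\<integral>z. \<bar>f z\<bar> \<partial>ou_law (b / \<sigma>\<^sup>2) w x) \<le> C * (1 + norm x ^ m)"
    using ou_law_poly_bound[OF a_pos f] by metis
  show thesis
  proof (rule that)
    show "poly_bdd (\<lambda>y::real^'d. C * (1 + norm y ^ m))"
      by (intro poly_bdd_cmult poly_bdd_add poly_bdd_const poly_bdd_power poly_bdd_norm)
    show "0 \<le> C * (1 + norm y ^ m)" for y :: "real^'d" using C by simp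
    show "\<bar>sg f r y\<bar> \<le> C * (1 + norm y ^ m)" if "0 \<le> r" for r y
      unfolding sg_def using integral_abs_bound[of "Q r y" f] C(2)[OF w_bounds[OF that], of y] by linarith
  qed
qed

text \<open>\<open>sg_poly_bound\<close> is used twice, for f and for the square of its majorant,
  which gives a bound free of both times.\<close>

lemma Q_sq_bound:
  assumes f: "poly_bdd f"
  obtains g where "poly_bdd g" "\<And>y. 0 \<le> g y"
    "\<And>r s x. 0 \<le> r \<Longrightarrow> 0 \<le> s \<Longrightarrow> (\<integral>\<^sup>+y. ennreal ((sg f r y)\<^sup>2) \<partial>Q s x) \<le> ennreal (g x)"
proof -
  obtain g1 where g1: "poly_bdd g1" "\<And>y. 0 \<le> g1 y" "\<And>r y. 0 \<le> r \<Longrightarrow> \<bar>sg f r y\<bar> \<le> g1 y"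
    using sg_poly_bound[OF f] by metis
  have p2: "poly_bdd (\<lambda>y. (g1 y)\<^sup>2)" by (intro poly_bdd_power g1)
  obtain g2 where g2: "poly_bdd g2" "\<And>y. 0 \<le> g2 y" "\<And>r y. 0 \<le> r \<Longrightarrow> \<bar>sg (\<lambda>y. (g1 y)\<^sup>2) r y\<bar> \<le> g2 y"
    using sg_poly_bound[OF p2] by metis
  show thesis
  proof (rule that[OF g2(1,2)])
    fix r s :: real and x assume r: "0 \<le> r" "0 \<le> s"
    have "(\<integral>\<^sup>+y. ennreal ((sg f r y)\<^sup>2) \<partial>Q s x) \<le> (\<integral>\<^sup>+y. ennreal ((g1 y)\<^sup>2) \<partial>Q s x)"
      using g1(3)[OF r(1)] g1(2) by (intro nn_integral_mono ennreal_leI) (metis abs_le_square_iff abs_of_nonneg)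
    also have "\<dots> = ennreal (sg (\<lambda>y. (g1 y)\<^sup>2) s x)"
      unfolding sg_def by (intro nn_integral_eq_integral Q_integrable p2 r) auto
    also have "\<dots> \<le> ennreal (g2 x)" using g2(3)[OF r(2), of x] by (intro ennreal_leI) simp
    finally show "(\<integral>\<^sup>+y. ennreal ((sg f r y)\<^sup>2) \<partial>Q s x) \<le> ennreal (g2 x)" .
  qed
qed

text \<open>A crude bound that grows with t and serves finiteness only.\<close>

lemma sg_var_bound:
  assumes f: "poly_bdd f" and t: "0 \<le> t"
  obtains g where "poly_bdd g" "\<And>y. 0 \<le> g y" "\<And>x. sg_var f t x \<le> ennreal (g x)"
proof -
  note [measurable] = poly_bdd_measurable[OF f]
  obtain g where g: "poly_bdd g" "\<And>y. 0 \<le> g y"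
    "\<And>r s x. 0 \<le> r \<Longrightarrow> 0 \<le> s \<Longrightarrow> (\<integral>\<^sup>+y. ennreal ((sg f r y)\<^sup>2) \<partial>Q s x) \<le> ennreal (g x)"
    using Q_sq_bound[OF f] by metis
  define c where "c = exp (\<alpha> * t) * (exp (\<alpha> * t))\<^sup>2"
  show thesis
  proof (rule that)
    show "poly_bdd (\<lambda>x. (t * c) * g x)" by (intro poly_bdd_cmult g)
    show "0 \<le> (t * c) * g y" for y using t g by (simp add: c_def)
    fix x
    have "sg_var f t x \<le> (\<integral>\<^sup>+s. ennreal (c * g x) * indicator {0..t} s \<partial>lborel)"
      unfolding sg_var_def
    proof (intro nn_integral_mono)
      fix s :: real
      show "ennreal (exp (\<alpha> * s)) * (\<integral>\<^sup>+y. ennreal ((exp (\<alpha> * (t - s)) * sg f (t - s) y)\<^sup>2) \<partial>Q s x) * indicator {0..t} s \<le> ennreal (c * g x) * indicator {0..t} s"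
      proof (cases "s \<in> {0..t}")
        case True
        have e: "exp (\<alpha> * (t - s)) \<le> exp (\<alpha> * t)" "exp (\<alpha> * s) \<le> exp (\<alpha> * t)" using True \<alpha>_pos by auto
        have "(\<integral>\<^sup>+y. ennreal ((exp (\<alpha> * (t - s)) * sg f (t - s) y)\<^sup>2) \<partial>Q s x) \<le> (\<integral>\<^sup>+y. ennreal ((exp (\<alpha> * t))\<^sup>2) * ennreal ((sg f (t - s) y)\<^sup>2) \<partial>Q s x)"
          using e(1) by (intro nn_integral_mono)
            (auto simp: ennreal_mult[symmetric] power_mult_distrib intro!: ennreal_leI mult_right_mono power_mono)
        also have "\<dots> = ennreal ((exp (\<alpha> * t))\<^sup>2) * (\<integral>\<^sup>+y. ennreal ((sg f (t - s) y)\<^sup>2) \<partial>Q s x)"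
          by (rule nn_integral_cmult) measurable
        also have "\<dots> \<le> ennreal ((exp (\<alpha> * t))\<^sup>2) * ennreal (g x)"
          using True by (intro mult_left_mono g(3)) auto
        finally have "ennreal (exp (\<alpha> * s)) * (\<integral>\<^sup>+y. ennreal ((exp (\<alpha> * (t - s)) * sg f (t - s) y)\<^sup>2) \<partial>Q s x)
           \<le> ennreal (exp (\<alpha> * t)) * (ennreal ((exp (\<alpha> * t))\<^sup>2) * ennreal (g x))"
          using e(2) by (intro mult_mono ennreal_leI) auto
        then show ?thesis using True g(2)[of x] by (simp add: c_def ennreal_mult mult.assoc)
      qed simp
    qed
    also have "\<dots> = ennreal (c * g x) * emeasure lborel {0..t}" by (rule nn_integral_cmult_indicator) simp
    also have "\<dots> = ennreal ((t * c) * g x)" using t g(2)[of x] by (simp add: c_def ennreal_mult[symmetric] mult_ac)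
    finally show "sg_var f t x \<le> ennreal ((t * c) * g x)" .
  qed
qed

lemma sg_var_measurable [measurable]:
  assumes [measurable]: "f \<in> borel_measurable borel"
  shows "sg_var f t \<in> borel_measurable borel"
  unfolding sg_var_def by measurable

lemma mean_op_eq_sg:
  assumes f: "poly_bdd f" "\<And>x. 0 \<le> f x" and r: "0 \<le> r"
  shows "mean_op (\<lambda>x. ennreal (f x)) r y = ennreal (exp (\<alpha> * r) * sg f r y)"
proof -
  have "(\<integral>\<^sup>+z. ennreal (f z) \<partial>Q r y) = ennreal (sg f r y)"
    unfolding sg_def using f(2) by (intro nn_integral_eq_integral Q_integrable f(1) r) auto
  then show ?thesis unfolding mean_op_def using f(2) by (simp add: ennreal_mult sg_def)
qed

lemma var_op_eq_sg_var:
  assumes f: "poly_bdd f" "\<And>x. 0 \<le> f x"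
  shows "var_op (\<lambda>x. ennreal (f x)) t x = sg_var f t x"
  unfolding var_op_def sg_var_def
proof (intro nn_integral_cong)
  fix s :: real
  have nn: "0 \<le> sg f r y" for r y unfolding sg_def using f(2) by simp
  show "ennreal (exp (\<alpha> * s)) * (\<integral>\<^sup>+y. (mean_op (\<lambda>x. ennreal (f x)) (t - s) y)\<^sup>2 \<partial>Q s x) * indicator {0..t} s =
    ennreal (exp (\<alpha> * s)) * (\<integral>\<^sup>+y. ennreal ((exp (\<alpha> * (t - s)) * sg f (t - s) y)\<^sup>2) \<partial>Q s x) * indicator {0..t} s"
    using nn by (cases "s \<in> {0..t}") (auto simp: mean_op_eq_sg[OF f] ennreal_power)
qed

lemma sg_linear:
  assumes "poly_bdd f" "poly_bdd g" "0 \<le> r"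
  shows "sg (\<lambda>x. f x + g x) r y = sg f r y + sg g r y" "sg (\<lambda>x. f x - g x) r y = sg f r y - sg g r y"
  unfolding sg_def using Q_integrable[OF assms(1,3)] Q_integrable[OF assms(2,3)] by auto

text \<open>\<open>sg_var\<close> is a quadratic form in f. The parallelogram law expresses this
  through nonnegative terms alone, so the argument can stay in \<open>ennreal\<close>.\<close>

lemma sg_var_parallelogram:
  assumes f: "poly_bdd f" and g: "poly_bdd g"
  shows "sg_var (\<lambda>x. f x - g x) t x + sg_var (\<lambda>x. f x + g x) t x = 2 * sg_var f t x + 2 * sg_var g t x"
proof -
  note [measurable] = poly_bdd_measurable[OF f] poly_bdd_measurable[OF g]
  define I where "I h s = (\<integral>\<^sup>+y. ennreal ((exp (\<alpha> * (t - s)) * sg h (t - s) y)\<^sup>2) \<partial>Q s x)" for h s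
  define J where "J h s = ennreal (exp (\<alpha> * s)) * I h s * indicator {0..t} s" for h s
  have [measurable]: "J h \<in> borel_measurable borel" if [measurable]: "h \<in> borel_measurable borel" for h
    unfolding J_def I_def by measurable
  have Jeq: "sg_var h t x = (\<integral>\<^sup>+s. J h s \<partial>lborel)" for h by (simp add: sg_var_def J_def I_def)
  have I: "I (\<lambda>x. f x - g x) s + I (\<lambda>x. f x + g x) s = 2 * I f s + 2 * I g s" if s: "s \<in> {0..t}" for s
  proof -
    have ts: "0 \<le> t - s" using s by simp
    let ?e = "exp (\<alpha> * (t - s))"
    have "I (\<lambda>x. f x - g x) s + I (\<lambda>x. f x + g x) s =
      (\<integral>\<^sup>+y. ennreal ((?e * sg (\<lambda>x. f x - g x) (t - s) y)\<^sup>2) + ennreal ((?e * sg (\<lambda>x. f x + g x) (t - s) y)\<^sup>2) \<partial>Q s x)"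
      unfolding I_def by (rule nn_integral_add[symmetric]) measurable
    also have "\<dots> = (\<integral>\<^sup>+y. 2 * ennreal ((?e * sg f (t - s) y)\<^sup>2) + 2 * ennreal ((?e * sg g (t - s) y)\<^sup>2) \<partial>Q s x)"
    proof (intro nn_integral_cong)
      fix y
      have "ennreal ((?e * (sg f (t - s) y - sg g (t - s) y))\<^sup>2) + ennreal ((?e * (sg f (t - s) y + sg g (t - s) y))\<^sup>2)
        = ennreal (2 * (?e * sg f (t - s) y)\<^sup>2 + 2 * (?e * sg g (t - s) y)\<^sup>2)"
      proof -
        have "(?e * (sg f (t - s) y - sg g (t - s) y))\<^sup>2 + (?e * (sg f (t - s) y + sg g (t - s) y))\<^sup>2
          = 2 * (?e * sg f (t - s) y)\<^sup>2 + 2 * (?e * sg g (t - s) y)\<^sup>2"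
          by (simp add: power2_eq_square algebra_simps)
        then show ?thesis by (simp only: ennreal_plus[OF zero_le_power2 zero_le_power2, symmetric])
      qed
      also have "\<dots> = 2 * ennreal ((?e * sg f (t - s) y)\<^sup>2) + 2 * ennreal ((?e * sg g (t - s) y)\<^sup>2)"
        by (simp add: ennreal_mult)
      finally show "ennreal ((?e * sg (\<lambda>x. f x - g x) (t - s) y)\<^sup>2) + ennreal ((?e * sg (\<lambda>x. f x + g x) (t - s) y)\<^sup>2)
        = 2 * ennreal ((?e * sg f (t - s) y)\<^sup>2) + 2 * ennreal ((?e * sg g (t - s) y)\<^sup>2)"
        unfolding sg_linear[OF f g ts] .
    qed
    also have "\<dots> = 2 * I f s + 2 * I g s"
      unfolding I_def by (subst nn_integral_add) (simp_all add: nn_integral_cmult)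
    finally show ?thesis .
  qed
  have "sg_var (\<lambda>x. f x - g x) t x + sg_var (\<lambda>x. f x + g x) t x = (\<integral>\<^sup>+s. J (\<lambda>x. f x - g x) s + J (\<lambda>x. f x + g x) s \<partial>lborel)"
    unfolding Jeq by (rule nn_integral_add[symmetric]) measurable
  also have "\<dots> = (\<integral>\<^sup>+s. 2 * J f s + 2 * J g s \<partial>lborel)"
  proof (intro nn_integral_cong)
    fix s :: real
    have "J (\<lambda>x. f x - g x) s + J (\<lambda>x. f x + g x) s = ennreal (exp (\<alpha> * s)) * (I (\<lambda>x. f x - g x) s + I (\<lambda>x. f x + g x) s) * indicator {0..t} s"
      by (simp add: J_def algebra_simps)
    also have "\<dots> = ennreal (exp (\<alpha> * s)) * (2 * I f s + 2 * I g s) * indicator {0..t} s"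
      using I by (cases "s \<in> {0..t}") auto
    also have "\<dots> = 2 * J f s + 2 * J g s" by (simp add: J_def algebra_simps)
    finally show "J (\<lambda>x. f x - g x) s + J (\<lambda>x. f x + g x) s = 2 * J f s + 2 * J g s" .
  qed
  also have "\<dots> = 2 * sg_var f t x + 2 * sg_var g t x"
    unfolding Jeq by (subst nn_integral_add) (simp_all add: nn_integral_cmult)
  finally show ?thesis .
qed

end

context super_OU_process
begin

definition xint :: "(real^'d \<Rightarrow> real) \<Rightarrow> real \<Rightarrow> 'w \<Rightarrow> real" where
  "xint f t \<omega> = (\<integral>x. f x \<partial>X t \<omega>)"

end

section \<open>Moments for signed functions under a fixed compactly supported initial
  measure\<close>

locale super_OU_process_start = super_OU_process b \<sigma> N \<xi> Pr \<alpha> \<beta> n M X P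
  for b \<sigma> :: real and N :: "'v measure"
    and \<xi> :: "real \<Rightarrow> 'v \<Rightarrow> real^'d::finite" and Pr :: "real^'d \<Rightarrow> 'v measure"
    and \<alpha> \<beta> :: real and n :: "real measure"
    and M :: "'w measure" and X :: "real \<Rightarrow> 'w \<Rightarrow> (real^'d) measure"
    and P :: "(real^'d) measure \<Rightarrow> 'w measure" +
  fixes \<mu> :: "(real^'d) measure"
  assumes \<mu>: "\<mu> \<in> space MF" and cs: "compactly_supported \<mu>"
begin

text \<open>Compactness of the support makes f bounded almost everywhere.\<close>

lemma poly_bdd_integrable_init:
  assumes f: "poly_bdd f" shows "integrable \<mu> f"
proof -
  interpret finite_measure \<mu> by (rule MF_D(1)[OF \<mu>])
  have [measurable_cong]: "sets \<mu> = sets borel" by (rule MF_D(2)[OF \<mu>])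
  note [measurable] = poly_bdd_measurable[OF f]
  obtain K where K: "compact K" "emeasure \<mu> (- K) = 0" using cs by (auto simp: compactly_supported_def)
  obtain B where B: "\<And>x. x \<in> K \<Longrightarrow> norm x \<le> B" using compact_imp_bounded[OF K(1)] by (auto simp: bounded_iff)
  obtain C m where C: "C \<ge> 0" "\<And>x. \<bar>f x\<bar> \<le> C * (1 + (norm x) ^ m)" using poly_bddE[OF f] by metis
  have Kb: "- K \<in> sets \<mu>" using compact_imp_closed[OF K(1)] by (simp add: MF_D(2)[OF \<mu>])
  have AE: "AE x in \<mu>. x \<in> K" by (rule AE_I[of _ _ "- K"]) (use K Kb in auto)
  show ?thesis
  proof (rule integrable_const_bound[where B = "C * (1 + B ^ m)"])
    show "AE x in \<mu>. norm (f x) \<le> C * (1 + B ^ m)"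
      using AE
    proof eventually_elim
      case (elim x)
      have "\<bar>f x\<bar> \<le> C * (1 + (norm x) ^ m)" by (rule C)
      also have "\<dots> \<le> C * (1 + B ^ m)" using B[OF elim] C by (intro mult_left_mono add_mono power_mono) auto
      finally show ?case by simp
    qed
  qed measurable
qed

definition mm :: "(real^'d \<Rightarrow> real) \<Rightarrow> real \<Rightarrow> real" where
  "mm f t = exp (\<alpha> * t) * (\<integral>x. sg f t x \<partial>\<mu>)"

lemma sg_var_finite:
  assumes f: "poly_bdd f" and t: "0 \<le> t"
  shows "(\<integral>\<^sup>+x. sg_var f t x \<partial>\<mu>) < \<infinity>"
proof -
  obtain g where g: "poly_bdd g" "\<And>y. 0 \<le> g y" "\<And>x. sg_var f t x \<le> ennreal (g x)"
    using sg_var_bound[OF f t] by metis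
  have "(\<integral>\<^sup>+x. sg_var f t x \<partial>\<mu>) \<le> (\<integral>\<^sup>+x. ennreal (g x) \<partial>\<mu>)" by (intro nn_integral_mono g)
  also have "\<dots> = ennreal (\<integral>x. g x \<partial>\<mu>)" using g by (intro nn_integral_eq_integral poly_bdd_integrable_init) auto
  finally show ?thesis by (simp add: le_less_trans)
qed

lemma nonneg_second_moment:
  assumes f: "poly_bdd f" "\<And>x. 0 \<le> f x" and t: "0 \<le> t"
  shows "(\<integral>\<^sup>+w. (\<integral>\<^sup>+x. ennreal (f x) \<partial>X t w)\<^sup>2 \<partial>P \<mu>) = ennreal ((mm f t)\<^sup>2) + ennreal (2 * kap) * (\<integral>\<^sup>+x. sg_var f t x \<partial>\<mu>)"
    and "(\<integral>\<^sup>+w. (\<integral>\<^sup>+x. ennreal (f x) \<partial>X t w)\<^sup>2 \<partial>P \<mu>) < \<infinity>"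
    and "AE w in P \<mu>. (\<integral>\<^sup>+x. ennreal (f x) \<partial>X t w) < \<infinity>"
proof -
  note fm [measurable] = poly_bdd_measurable[OF f(1)]
  have sg0: "0 \<le> sg f t x" for x unfolding sg_def using f(2) by simp
  have "(\<integral>\<^sup>+x. mean_op (\<lambda>x. ennreal (f x)) t x \<partial>\<mu>) = (\<integral>\<^sup>+x. ennreal (exp (\<alpha> * t) * sg f t x) \<partial>\<mu>)"
    by (simp add: mean_op_eq_sg[OF f t])
  also have "\<dots> = ennreal (\<integral>x. exp (\<alpha> * t) * sg f t x \<partial>\<mu>)"
    using sg0 by (intro nn_integral_eq_integral poly_bdd_integrable_init poly_bdd_cmult poly_bdd_sg f(1) t) auto
  finally have mean: "(\<integral>\<^sup>+x. mean_op (\<lambda>x. ennreal (f x)) t x \<partial>\<mu>) = ennreal (mm f t)" by (simp add: mm_def)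
  have m0: "0 \<le> mm f t" unfolding mm_def using sg0 by simp
  show 1: "(\<integral>\<^sup>+w. (\<integral>\<^sup>+x. ennreal (f x) \<partial>X t w)\<^sup>2 \<partial>P \<mu>) = ennreal ((mm f t)\<^sup>2) + ennreal (2 * kap) * (\<integral>\<^sup>+x. sg_var f t x \<partial>\<mu>)"
    using moments_nn(2)[OF fm f(2) \<mu> t] m0 unfolding mean var_op_eq_sg_var[OF f] by (simp add: ennreal_power)
  show 2: "(\<integral>\<^sup>+w. (\<integral>\<^sup>+x. ennreal (f x) \<partial>X t w)\<^sup>2 \<partial>P \<mu>) < \<infinity>"
    unfolding 1 using sg_var_finite[OF f(1) t] by (simp add: ennreal_mult_less_top)
  have "(\<integral>\<^sup>+w. (\<integral>\<^sup>+x. ennreal (f x) \<partial>X t w) \<partial>P \<mu>) = ennreal (mm f t)"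
    using moments_nn(1)[OF fm f(2) \<mu> t] mean by simp
  then have "AE w in P \<mu>. (\<integral>\<^sup>+x. ennreal (f x) \<partial>X t w) \<noteq> \<infinity>"
    by (intro nn_integral_noteq_infinite X_nn_measurable \<mu> t) auto
  then show "AE w in P \<mu>. (\<integral>\<^sup>+x. ennreal (f x) \<partial>X t w) < \<infinity>" by (simp add: less_top)
qed

lemma X_sets: "0 \<le> t \<Longrightarrow> w \<in> space (P \<mu>) \<Longrightarrow> sets (X t w) = sets borel"
  by (rule MF_D(2)[OF X_space[OF \<mu>]])

lemma AE_integrable_X:
  assumes f: "poly_bdd f" and t: "0 \<le> t"
  shows "AE w in P \<mu>. integrable (X t w) f"
  using nonneg_second_moment(3)[OF poly_bdd_abs[OF f] abs_ge_zero t] AE_space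
proof eventually_elim
  case (elim w)
  note [measurable_cong] = X_sets[OF t elim(2)]
  show ?case using elim(1) poly_bdd_measurable[OF f] by (simp add: integrable_iff_bounded)
qed

lemma xint_nonneg_eq:
  assumes "f \<in> borel_measurable borel" "\<And>x. 0 \<le> f x" "0 \<le> t" "w \<in> space (P \<mu>)"
  shows "xint f t w = enn2real (\<integral>\<^sup>+x. ennreal (f x) \<partial>X t w)"
  unfolding xint_def by (rule X_integral_eq[OF \<mu> assms(3,4,1,2)])

lemma xint_nonneg: "(\<And>x. 0 \<le> f x) \<Longrightarrow> 0 \<le> xint f t w"
  unfolding xint_def by simp

text \<open>The Bochner integral of a non-integrable function is 0, so the difference of the
  integrals of the positive and negative parts has to be replaced by 0 unless both are
  finite.\<close>

lemma xint_measurable: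
  assumes f [measurable]: "f \<in> borel_measurable borel" and t: "0 \<le> t"
  shows "xint f t \<in> borel_measurable (P \<mu>)"
proof -
  define A where "A w = (\<integral>\<^sup>+x. ennreal (f x) \<partial>X t w)" for w
  define B where "B w = (\<integral>\<^sup>+x. ennreal (- f x) \<partial>X t w)" for w
  have [measurable]: "A \<in> borel_measurable (P \<mu>)" "B \<in> borel_measurable (P \<mu>)"
    unfolding A_def B_def by (intro X_nn_measurable \<mu> t; measurable)+
  have "(\<lambda>w. if A w < \<infinity> \<and> B w < \<infinity> then enn2real (A w) - enn2real (B w) else 0) \<in> borel_measurable (P \<mu>)"
    by measurable
  moreover have "xint f t w = (if A w < \<infinity> \<and> B w < \<infinity> then enn2real (A w) - enn2real (B w) else 0)" if w: "w \<in> space (P \<mu>)" for w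
  proof -
    note [measurable_cong] = X_sets[OF t w]
    have i: "integrable (X t w) f \<longleftrightarrow> A w < \<infinity> \<and> B w < \<infinity>"
      using real_integrable_def[of "X t w" f] by (auto simp: A_def B_def less_top)
    show ?thesis
      using i real_lebesgue_integral_def[of "X t w" f] not_integrable_integral_eq[of "X t w" f]
      by (auto simp: xint_def A_def B_def)
  qed
  ultimately show ?thesis by (subst measurable_cong) auto
qed

text \<open>Almost surely only: additivity rests on the integrability of both functions under
  \<open>X t w\<close>.\<close>

lemma AE_xint_linear:
  assumes f: "poly_bdd f" and g: "poly_bdd g" and t: "0 \<le> t"
  shows "AE w in P \<mu>. xint (\<lambda>x. f x + g x) t w = xint f t w + xint g t w \<and> xint (\<lambda>x. f x - g x) t w = xint f t w - xint g t w"
  using AE_integrable_X[OF f t] AE_integrable_X[OF g t]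
  by eventually_elim (simp add: xint_def)

lemma xint_cmult: "xint (\<lambda>x. c * f x) t w = c * xint f t w"
  by (simp add: xint_def)

lemma xint_second_moment_nonneg:
  assumes f: "poly_bdd f" "\<And>x. 0 \<le> f x" and t: "0 \<le> t"
  shows "(\<integral>\<^sup>+w. ennreal ((xint f t w)\<^sup>2) \<partial>P \<mu>) = ennreal ((mm f t)\<^sup>2) + ennreal (2 * kap) * (\<integral>\<^sup>+x. sg_var f t x \<partial>\<mu>)"
  unfolding nonneg_second_moment(1)[OF f t, symmetric]
proof (rule nn_integral_cong_AE)
  show "AE w in P \<mu>. ennreal ((xint f t w)\<^sup>2) = (\<integral>\<^sup>+x. ennreal (f x) \<partial>X t w)\<^sup>2"
    using nonneg_second_moment(3)[OF f t] AE_space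
  proof eventually_elim
    case (elim w)
    have "(\<integral>\<^sup>+x. ennreal (f x) \<partial>X t w) = ennreal (xint f t w)"
      using xint_nonneg_eq[OF poly_bdd_measurable[OF f(1)] f(2) t elim(2)] elim(1) by simp
    then show ?case using xint_nonneg[OF f(2)] by (simp add: ennreal_power)
  qed
qed

lemma mm_linear:
  assumes f: "poly_bdd f" and g: "poly_bdd g" and t: "0 \<le> t"
  shows "mm (\<lambda>x. f x + g x) t = mm f t + mm g t" "mm (\<lambda>x. f x - g x) t = mm f t - mm g t"
  unfolding mm_def sg_linear[OF f g t]
  using poly_bdd_integrable_init[OF poly_bdd_sg[OF f t]] poly_bdd_integrable_init[OF poly_bdd_sg[OF g t]]
  by (simp_all add: algebra_simps)

lemma poly_bdd_pos_neg:
  assumes "poly_bdd f" shows "poly_bdd (\<lambda>x. max (f x) 0)" "poly_bdd (\<lambda>x. max (- f x) 0)"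
  using poly_bdd_measurable[OF assms] by (auto intro!: poly_bdd_mono[OF assms] simp: max_def)

lemma pos_neg_eq: "(\<lambda>x. max (f x) 0 - max (- f x) 0) = (f :: 'x \<Rightarrow> real)"
  by (auto simp: max_def)

text \<open>Both sides obey the parallelogram law. For f = g - h with positive part g and negative
  part h, the identity is known for g, h and g + h, and the term for g + h is cancelled.\<close>

lemma xint_second_moment:
  assumes f: "poly_bdd f" and t: "0 \<le> t"
  shows "(\<integral>\<^sup>+w. ennreal ((xint f t w)\<^sup>2) \<partial>P \<mu>) = ennreal ((mm f t)\<^sup>2) + ennreal (2 * kap) * (\<integral>\<^sup>+x. sg_var f t x \<partial>\<mu>)"
proof -
  define g where "g x = max (f x) 0" for x
  define h where "h x = max (- f x) 0" for x
  have gh: "poly_bdd g" "poly_bdd h" "\<And>x. 0 \<le> g x" "\<And>x. 0 \<le> h x" "(\<lambda>x. g x - h x) = f"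
    using poly_bdd_pos_neg[OF f] pos_neg_eq[of f] by (auto simp: g_def[abs_def] h_def[abs_def])
  have p: "poly_bdd (\<lambda>x. g x + h x)" "\<And>x. 0 \<le> g x + h x" using gh by (auto intro: poly_bdd_add)
  have s\<mu> [measurable_cong]: "sets \<mu> = sets borel" by (rule MF_D(2)[OF \<mu>])
  note [measurable] = poly_bdd_measurable[OF gh(1)] poly_bdd_measurable[OF gh(2)] poly_bdd_measurable[OF f] poly_bdd_measurable[OF p(1)]
  note xm [measurable] = xint_measurable[OF _ t]
  define E where "E k = (\<integral>\<^sup>+w. ennreal ((xint k t w)\<^sup>2) \<partial>P \<mu>)" for k
  define V where "V k = (\<integral>\<^sup>+x. sg_var k t x \<partial>\<mu>)" for k
  define S where "S k = ennreal ((mm k t)\<^sup>2) + ennreal (2 * kap) * V k" for k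
  have E: "E k = S k" if "poly_bdd k" "\<And>x. 0 \<le> k x" for k
    unfolding E_def S_def V_def by (rule xint_second_moment_nonneg[OF that t])
  have Epar: "E f + E (\<lambda>x. g x + h x) = 2 * E g + 2 * E h"
  proof -
    have "E f + E (\<lambda>x. g x + h x) = (\<integral>\<^sup>+w. ennreal ((xint f t w)\<^sup>2) + ennreal ((xint (\<lambda>x. g x + h x) t w)\<^sup>2) \<partial>P \<mu>)"
      unfolding E_def by (rule nn_integral_add[symmetric]) measurable
    also have "\<dots> = (\<integral>\<^sup>+w. 2 * ennreal ((xint g t w)\<^sup>2) + 2 * ennreal ((xint h t w)\<^sup>2) \<partial>P \<mu>)"
    proof (rule nn_integral_cong_AE)
      show "AE w in P \<mu>. ennreal ((xint f t w)\<^sup>2) + ennreal ((xint (\<lambda>x. g x + h x) t w)\<^sup>2) = 2 * ennreal ((xint g t w)\<^sup>2) + 2 * ennreal ((xint h t w)\<^sup>2)"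
        using AE_xint_linear[OF gh(1,2) t]
      proof eventually_elim
        case (elim w)
        have "(xint f t w)\<^sup>2 + (xint (\<lambda>x. g x + h x) t w)\<^sup>2 = 2 * (xint g t w)\<^sup>2 + 2 * (xint h t w)\<^sup>2"
        proof -
          have e: "xint (\<lambda>x. g x + h x) t w = xint g t w + xint h t w" "xint f t w = xint g t w - xint h t w"
            using elim unfolding gh(5) by auto
          show ?thesis unfolding e by (simp add: power2_eq_square algebra_simps)
        qed
        then have "ennreal ((xint f t w)\<^sup>2) + ennreal ((xint (\<lambda>x. g x + h x) t w)\<^sup>2) = ennreal (2 * (xint g t w)\<^sup>2 + 2 * (xint h t w)\<^sup>2)"
          by (simp only: ennreal_plus[OF zero_le_power2 zero_le_power2, symmetric])
        then show ?case by (simp add: ennreal_mult)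
      qed
    qed
    also have "\<dots> = 2 * E g + 2 * E h"
      unfolding E_def by (subst nn_integral_add) (simp_all add: nn_integral_cmult)
    finally show ?thesis .
  qed
  have Vpar: "V f + V (\<lambda>x. g x + h x) = 2 * V g + 2 * V h"
  proof -
    have "V f + V (\<lambda>x. g x + h x) = (\<integral>\<^sup>+x. sg_var f t x + sg_var (\<lambda>x. g x + h x) t x \<partial>\<mu>)"
      unfolding V_def by (rule nn_integral_add[symmetric]) measurable
    also have "\<dots> = (\<integral>\<^sup>+x. 2 * sg_var g t x + 2 * sg_var h t x \<partial>\<mu>)"
      using sg_var_parallelogram[OF gh(1,2)] unfolding gh(5) by simp
    also have "\<dots> = 2 * V g + 2 * V h" unfolding V_def by (subst nn_integral_add) (simp_all add: nn_integral_cmult)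
    finally show ?thesis .
  qed
  have mpar: "ennreal ((mm f t)\<^sup>2) + ennreal ((mm (\<lambda>x. g x + h x) t)\<^sup>2) = 2 * ennreal ((mm g t)\<^sup>2) + 2 * ennreal ((mm h t)\<^sup>2)"
  proof -
    have "(mm f t)\<^sup>2 + (mm (\<lambda>x. g x + h x) t)\<^sup>2 = 2 * (mm g t)\<^sup>2 + 2 * (mm h t)\<^sup>2"
      using mm_linear[OF gh(1,2) t] unfolding gh(5) by (simp add: power2_eq_square ring_distribs)
    then have "ennreal ((mm f t)\<^sup>2) + ennreal ((mm (\<lambda>x. g x + h x) t)\<^sup>2) = ennreal (2 * (mm g t)\<^sup>2 + 2 * (mm h t)\<^sup>2)"
      by (simp only: ennreal_plus[OF zero_le_power2 zero_le_power2, symmetric])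
    then show ?thesis by (simp add: ennreal_mult)
  qed
  have Spar: "S f + S (\<lambda>x. g x + h x) = 2 * S g + 2 * S h"
  proof -
    have "S f + S (\<lambda>x. g x + h x) = (ennreal ((mm f t)\<^sup>2) + ennreal ((mm (\<lambda>x. g x + h x) t)\<^sup>2)) + ennreal (2 * kap) * (V f + V (\<lambda>x. g x + h x))"
      unfolding S_def by (simp add: distrib_left add_ac)
    also have "\<dots> = 2 * S g + 2 * S h" unfolding mpar Vpar S_def by (simp add: distrib_left algebra_simps)
    finally show ?thesis .
  qed
  \<comment> \<open>Cancellation in \<open>ennreal\<close> requires the common summand to be
    finite.\<close>
  have fin: "S (\<lambda>x. g x + h x) < \<infinity>"
    unfolding S_def V_def using sg_var_finite[OF p(1) t] by (simp add: ennreal_mult_less_top)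
  have "E f + S (\<lambda>x. g x + h x) = S f + S (\<lambda>x. g x + h x)"
    using Epar Spar E[OF gh(1,3)] E[OF gh(2,4)] E[OF p] by simp
  then have "E f = S f" using fin by (auto simp: less_top add.commute[of _ "S (\<lambda>x. g x + h x)"] ennreal_add_left_cancel)
  then show ?thesis by (simp add: E_def S_def V_def)
qed

lemma xint_sq_integrable:
  assumes f: "poly_bdd f" and t: "0 \<le> t"
  shows "integrable (P \<mu>) (\<lambda>w. (xint f t w)\<^sup>2)"
proof (rule integrableI_nonneg)
  show "(\<lambda>w. (xint f t w)\<^sup>2) \<in> borel_measurable (P \<mu>)"
    using xint_measurable[OF poly_bdd_measurable[OF f] t] by measurable
  show "(\<integral>\<^sup>+w. ennreal ((xint f t w)\<^sup>2) \<partial>P \<mu>) < \<infinity>"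
    unfolding xint_second_moment[OF f t] using sg_var_finite[OF f t] by (simp add: ennreal_mult_less_top)
qed simp

lemma xint_mult_integrable:
  assumes f: "poly_bdd f" and g: "poly_bdd g" and t: "0 \<le> t" and s: "0 \<le> s"
  shows "integrable (P \<mu>) (\<lambda>w. xint f s w * xint g t w)"
  by (intro integral_Cauchy_Schwarz(1) xint_measurable poly_bdd_measurable f g s t xint_sq_integrable)

text \<open>The Markov property at time s, followed by the first-moment formula started from
  \<open>X s w\<close>. That is an arbitrary finite measure, which is why \<open>moments_nn\<close>
  is stated for all of \<open>space MF\<close>.\<close>

lemma cross_moment_nonneg:
  assumes f: "poly_bdd f" "\<And>x. 0 \<le> f x" and g: "poly_bdd g" "\<And>x. 0 \<le> g x" and s: "0 \<le> s" and t: "0 \<le> t"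
  shows "(\<integral>w. xint f s w * xint g (s + t) w \<partial>P \<mu>) = exp (\<alpha> * t) * (\<integral>w. xint f s w * xint (sg g t) s w \<partial>P \<mu>)"
proof -
  have st: "0 \<le> s + t" using s t by simp
  note fm [measurable] = poly_bdd_measurable[OF f(1)]
  note gm [measurable] = poly_bdd_measurable[OF g(1)]
  have sgp: "poly_bdd (sg g t)" by (rule poly_bdd_sg[OF g(1) t])
  have sg0: "0 \<le> sg g t x" for x unfolding sg_def using g(2) by simp
  note sgm [measurable] = poly_bdd_measurable[OF sgp]
  define \<Phi> where "\<Phi> \<nu> = (\<integral>\<^sup>+x. ennreal (f x) \<partial>\<nu>)" for \<nu> :: "(real^'d) measure"
  define \<Psi> where "\<Psi> \<nu> = (\<integral>\<^sup>+x. ennreal (g x) \<partial>\<nu>)" for \<nu> :: "(real^'d) measure"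
  have [measurable]: "\<Phi> \<in> borel_measurable MF" "\<Psi> \<in> borel_measurable MF"
    unfolding \<Phi>_def \<Psi>_def by (intro nn_integral_measurable_finite_measure_algebra; measurable)+
  have mk: "(\<integral>\<^sup>+w. \<Phi> (X s w) * \<Psi> (X (s + t) w) \<partial>P \<mu>) = (\<integral>\<^sup>+w. \<Phi> (X s w) * (\<integral>\<^sup>+w'. \<Psi> (X t w') \<partial>P (X s w)) \<partial>P \<mu>)"
    by (rule X.markov_nn_integral[OF \<mu> s t]) measurable
  have L: "(\<integral>\<^sup>+w. \<Phi> (X s w) * \<Psi> (X (s + t) w) \<partial>P \<mu>) = ennreal (\<integral>w. xint f s w * xint g (s + t) w \<partial>P \<mu>)"
  proof -
    have "(\<integral>\<^sup>+w. \<Phi> (X s w) * \<Psi> (X (s + t) w) \<partial>P \<mu>) = (\<integral>\<^sup>+w. ennreal (xint f s w * xint g (s + t) w) \<partial>P \<mu>)"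
    proof (rule nn_integral_cong_AE)
      show "AE w in P \<mu>. \<Phi> (X s w) * \<Psi> (X (s + t) w) = ennreal (xint f s w * xint g (s + t) w)"
        using nonneg_second_moment(3)[OF f s] nonneg_second_moment(3)[OF g st] AE_space
      proof eventually_elim
        case (elim w)
        then show ?case
          using xint_nonneg_eq[OF fm f(2) s elim(3)] xint_nonneg_eq[OF gm g(2) st elim(3)]
          by (simp add: \<Phi>_def \<Psi>_def ennreal_mult)
      qed
    qed
    also have "\<dots> = ennreal (\<integral>w. xint f s w * xint g (s + t) w \<partial>P \<mu>)"
      using f(2) g(2) by (intro nn_integral_eq_integral xint_mult_integrable f(1) g(1) s st) (auto intro!: AE_I2 mult_nonneg_nonneg xint_nonneg)
    finally show ?thesis .
  qed
  have R: "(\<integral>\<^sup>+w. \<Phi> (X s w) * (\<integral>\<^sup>+w'. \<Psi> (X t w') \<partial>P (X s w)) \<partial>P \<mu>) = ennreal (\<integral>w. exp (\<alpha> * t) * (xint f s w * xint (sg g t) s w) \<partial>P \<mu>)"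
  proof -
    have "(\<integral>\<^sup>+w. \<Phi> (X s w) * (\<integral>\<^sup>+w'. \<Psi> (X t w') \<partial>P (X s w)) \<partial>P \<mu>) = (\<integral>\<^sup>+w. ennreal (exp (\<alpha> * t) * (xint f s w * xint (sg g t) s w)) \<partial>P \<mu>)"
    proof (rule nn_integral_cong_AE)
      show "AE w in P \<mu>. \<Phi> (X s w) * (\<integral>\<^sup>+w'. \<Psi> (X t w') \<partial>P (X s w)) = ennreal (exp (\<alpha> * t) * (xint f s w * xint (sg g t) s w))"
        using nonneg_second_moment(3)[OF f s] nonneg_second_moment(3)[OF sgp sg0 s] AE_space
      proof eventually_elim
        case (elim w)
        note [measurable_cong] = X_sets[OF s elim(3)]
        have XsMF: "X s w \<in> space MF" by (rule X_space[OF \<mu> s elim(3)])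
        have "(\<integral>\<^sup>+w'. \<Psi> (X t w') \<partial>P (X s w)) = (\<integral>\<^sup>+x. mean_op (\<lambda>x. ennreal (g x)) t x \<partial>X s w)"
          unfolding \<Psi>_def by (rule moments_nn(1)[OF gm g(2) XsMF t])
        also have "\<dots> = (\<integral>\<^sup>+x. ennreal (exp (\<alpha> * t)) * ennreal (sg g t x) \<partial>X s w)"
          using sg0 by (simp add: mean_op_eq_sg[OF g t] ennreal_mult)
        also have "\<dots> = ennreal (exp (\<alpha> * t)) * (\<integral>\<^sup>+x. ennreal (sg g t x) \<partial>X s w)"
          by (rule nn_integral_cmult) measurable
        finally show ?case
          using xint_nonneg_eq[OF fm f(2) s elim(3)] xint_nonneg_eq[OF sgm sg0 s elim(3)] elim(1,2)
          by (simp add: \<Phi>_def ennreal_mult mult_ac)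
      qed
    qed
    also have "\<dots> = ennreal (\<integral>w. exp (\<alpha> * t) * (xint f s w * xint (sg g t) s w) \<partial>P \<mu>)"
      using f(2) sg0 by (intro nn_integral_eq_integral integrable_mult_right xint_mult_integrable f(1) sgp s) (auto intro!: AE_I2 mult_nonneg_nonneg xint_nonneg)
    finally show ?thesis .
  qed
  have "ennreal (\<integral>w. xint f s w * xint g (s + t) w \<partial>P \<mu>) = ennreal (\<integral>w. exp (\<alpha> * t) * (xint f s w * xint (sg g t) s w) \<partial>P \<mu>)"
    using mk unfolding L R .
  then have "(\<integral>w. xint f s w * xint g (s + t) w \<partial>P \<mu>) = (\<integral>w. exp (\<alpha> * t) * (xint f s w * xint (sg g t) s w) \<partial>P \<mu>)"
    using f(2) g(2) sg0 by (subst (asm) ennreal_inj) (auto intro!: integral_nonneg_AE AE_I2 mult_nonneg_nonneg xint_nonneg)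
  then show ?thesis by simp
qed

text \<open>Bilinear expansion of the nonnegative case over positive and negative parts; all
  products are integrable by Cauchy-Schwarz.\<close>

lemma cross_moment:
  assumes f: "poly_bdd f" and s: "0 \<le> s" and t: "0 \<le> t"
  shows "(\<integral>w. xint f s w * xint f (s + t) w \<partial>P \<mu>) = exp (\<alpha> * t) * (\<integral>w. xint f s w * xint (sg f t) s w \<partial>P \<mu>)"
proof -
  have st: "0 \<le> s + t" using s t by simp
  define g where "g x = max (f x) 0" for x
  define h where "h x = max (- f x) 0" for x
  have gh: "poly_bdd g" "poly_bdd h" "\<And>x. 0 \<le> g x" "\<And>x. 0 \<le> h x" "(\<lambda>x. g x - h x) = f"
    using poly_bdd_pos_neg[OF f] pos_neg_eq[of f] by (auto simp: g_def[abs_def] h_def[abs_def])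
  have sgp: "poly_bdd (sg g t)" "poly_bdd (sg h t)" by (intro poly_bdd_sg gh t)+
  have sgf: "sg f t = (\<lambda>x. sg g t x - sg h t x)"
    using sg_linear(2)[OF gh(1,2) t] unfolding gh(5) by auto
  note xm [measurable] = xint_measurable[OF poly_bdd_measurable]
  note int = xint_mult_integrable
  have f_s: "AE w in P \<mu>. xint f s w = xint g s w - xint h s w"
    using AE_xint_linear[OF gh(1,2) s] unfolding gh(5) by auto
  have f_st: "AE w in P \<mu>. xint f (s + t) w = xint g (s + t) w - xint h (s + t) w"
    using AE_xint_linear[OF gh(1,2) st] unfolding gh(5) by auto
  have sg_s: "AE w in P \<mu>. xint (sg f t) s w = xint (sg g t) s w - xint (sg h t) s w"
    using AE_xint_linear[OF sgp s] unfolding sgf by auto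
  note [measurable] = xint_measurable[OF poly_bdd_measurable[OF gh(1)] s] xint_measurable[OF poly_bdd_measurable[OF gh(1)] st]
    xint_measurable[OF poly_bdd_measurable[OF gh(2)] s] xint_measurable[OF poly_bdd_measurable[OF gh(2)] st]
    xint_measurable[OF poly_bdd_measurable[OF sgp(1)] s] xint_measurable[OF poly_bdd_measurable[OF sgp(2)] s]
    xint_measurable[OF poly_bdd_measurable[OF f] s] xint_measurable[OF poly_bdd_measurable[OF f] st]
    xint_measurable[OF poly_bdd_measurable[OF poly_bdd_sg[OF f t]] s]
  have "(\<integral>w. xint f s w * xint f (s + t) w \<partial>P \<mu>) =
     (\<integral>w. xint g s w * xint g (s + t) w - xint g s w * xint h (s + t) w - xint h s w * xint g (s + t) w + xint h s w * xint h (s + t) w \<partial>P \<mu>)"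
  proof (rule integral_cong_AE)
    show "AE w in P \<mu>. xint f s w * xint f (s + t) w =
      xint g s w * xint g (s + t) w - xint g s w * xint h (s + t) w - xint h s w * xint g (s + t) w + xint h s w * xint h (s + t) w"
      using f_s f_st by eventually_elim (simp add: ring_distribs)
  qed measurable
  also have "\<dots> = exp (\<alpha> * t) * (\<integral>w. xint g s w * xint (sg g t) s w \<partial>P \<mu>) - exp (\<alpha> * t) * (\<integral>w. xint g s w * xint (sg h t) s w \<partial>P \<mu>)
    - exp (\<alpha> * t) * (\<integral>w. xint h s w * xint (sg g t) s w \<partial>P \<mu>) + exp (\<alpha> * t) * (\<integral>w. xint h s w * xint (sg h t) s w \<partial>P \<mu>)"
    using int[OF gh(1) gh(1) st s] int[OF gh(1) gh(2) st s] int[OF gh(2) gh(1) st s] int[OF gh(2) gh(2) st s]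
    by (simp add: cross_moment_nonneg[OF gh(1,3) gh(1,3) s t] cross_moment_nonneg[OF gh(1,3) gh(2,4) s t]
        cross_moment_nonneg[OF gh(2,4) gh(1,3) s t] cross_moment_nonneg[OF gh(2,4) gh(2,4) s t])
  also have "\<dots> = exp (\<alpha> * t) * (\<integral>w. xint g s w * xint (sg g t) s w - xint g s w * xint (sg h t) s w
     - xint h s w * xint (sg g t) s w + xint h s w * xint (sg h t) s w \<partial>P \<mu>)"
    using int[OF gh(1) sgp(1) s s] int[OF gh(1) sgp(2) s s] int[OF gh(2) sgp(1) s s] int[OF gh(2) sgp(2) s s]
    by (simp add: algebra_simps)
  also have "(\<integral>w. xint g s w * xint (sg g t) s w - xint g s w * xint (sg h t) s w
     - xint h s w * xint (sg g t) s w + xint h s w * xint (sg h t) s w \<partial>P \<mu>) = (\<integral>w. xint f s w * xint (sg f t) s w \<partial>P \<mu>)"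
  proof (rule integral_cong_AE)
    show "AE w in P \<mu>. xint g s w * xint (sg g t) s w - xint g s w * xint (sg h t) s w
     - xint h s w * xint (sg g t) s w + xint h s w * xint (sg h t) s w = xint f s w * xint (sg f t) s w"
      using f_s sg_s by eventually_elim (simp add: ring_distribs)
  qed measurable
  finally show ?thesis .
qed

end

section \<open>Convergence in mean square\<close>

lemma sq_add_le: "(x + y)\<^sup>2 \<le> 2 * x\<^sup>2 + 2 * y\<^sup>2" for x y :: real
  using sum_squares_bound[of x y] by (simp add: power2_sum)

lemma square_integrable_add:
  assumes "square_integrable Q A" "square_integrable Q B"
  shows "square_integrable Q (\<lambda>w. A w + B w)"
proof -
  have [measurable]: "A \<in> borel_measurable Q" "B \<in> borel_measurable Q" using assms by (auto simp: square_integrable_def)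
  have i: "integrable Q (\<lambda>w. 2 * (A w)\<^sup>2 + 2 * (B w)\<^sup>2)" using assms by (auto simp: square_integrable_def)
  have "integrable Q (\<lambda>w. (A w + B w)\<^sup>2)"
  proof (rule Bochner_Integration.integrable_bound[OF i])
    show "AE w in Q. norm ((A w + B w)\<^sup>2) \<le> norm (2 * (A w)\<^sup>2 + 2 * (B w)\<^sup>2)"
      using sq_add_le by (auto intro!: AE_I2)
  qed measurable
  then show ?thesis by (simp add: square_integrable_def)
qed

lemma square_integrable_cmult:
  "square_integrable Q A \<Longrightarrow> square_integrable Q (\<lambda>w. c * A w)"
  by (auto simp: square_integrable_def power_mult_distrib)

lemma square_integrable_diff:
  assumes "square_integrable Q A" "square_integrable Q B"
  shows "square_integrable Q (\<lambda>w. A w - B w)"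
  using square_integrable_add[OF assms(1) square_integrable_cmult[OF assms(2), of "- 1"]] by simp

lemma integral_sq_add_le:
  assumes "square_integrable Q A" "square_integrable Q B"
  shows "(\<integral>w. (A w + B w)\<^sup>2 \<partial>Q) \<le> 2 * (\<integral>w. (A w)\<^sup>2 \<partial>Q) + 2 * (\<integral>w. (B w)\<^sup>2 \<partial>Q)"
proof -
  have "(\<integral>w. (A w + B w)\<^sup>2 \<partial>Q) \<le> (\<integral>w. 2 * (A w)\<^sup>2 + 2 * (B w)\<^sup>2 \<partial>Q)"
    using assms square_integrable_add[OF assms] sq_add_le
    by (intro integral_mono) (auto simp: square_integrable_def)
  also have "\<dots> = 2 * (\<integral>w. (A w)\<^sup>2 \<partial>Q) + 2 * (\<integral>w. (B w)\<^sup>2 \<partial>Q)"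
    using assms by (auto simp: square_integrable_def)
  finally show ?thesis .
qed

lemma tendsto_L2_add:
  assumes A: "tendsto_L2 Q A A' F" and B: "tendsto_L2 Q B B' F"
  shows "tendsto_L2 Q (\<lambda>t w. A t w + B t w) (\<lambda>w. A' w + B' w) F"
proof -
  have ev: "\<forall>\<^sub>F t in F. square_integrable Q (A t) \<and> square_integrable Q (B t)"
    using A B by (auto simp: tendsto_L2_def intro: eventually_conj)
  have lim: "square_integrable Q A'" "square_integrable Q B'" using A B by (auto simp: tendsto_L2_def)
  have "((\<lambda>t. \<integral>w. (A t w + B t w - (A' w + B' w))\<^sup>2 \<partial>Q) \<longlongrightarrow> 0) F"
  proof (rule tendsto_sandwich[OF _ _ tendsto_const])
    show "((\<lambda>t. 2 * (\<integral>w. (A t w - A' w)\<^sup>2 \<partial>Q) + 2 * (\<integral>w. (B t w - B' w)\<^sup>2 \<partial>Q)) \<longlongrightarrow> 0) F"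
      using A B by (auto simp: tendsto_L2_def intro!: tendsto_eq_intros)
    show "\<forall>\<^sub>F t in F. (\<integral>w. (A t w + B t w - (A' w + B' w))\<^sup>2 \<partial>Q)
        \<le> 2 * (\<integral>w. (A t w - A' w)\<^sup>2 \<partial>Q) + 2 * (\<integral>w. (B t w - B' w)\<^sup>2 \<partial>Q)"
      using ev
    proof eventually_elim
      case (elim t)
      show ?case
        using integral_sq_add_le[OF square_integrable_diff[of Q "A t", OF _ lim(1)] square_integrable_diff[of Q "B t", OF _ lim(2)]] elim
        by (simp add: algebra_simps)
    qed
  qed auto
  with ev lim show ?thesis
    by (auto simp: tendsto_L2_def square_integrable_add elim!: eventually_mono)
qed

lemma tendsto_L2_cmult:
  assumes A: "tendsto_L2 Q A A' F"
  shows "tendsto_L2 Q (\<lambda>t w. c * A t w) (\<lambda>w. c * A' w) F"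
proof -
  have "((\<lambda>t. \<integral>w. (c * A t w - c * A' w)\<^sup>2 \<partial>Q) \<longlongrightarrow> 0) F"
    using tendsto_mult_right_zero[of "\<lambda>t. \<integral>w. (A t w - A' w)\<^sup>2 \<partial>Q" F "c\<^sup>2"] A
    by (simp add: tendsto_L2_def right_diff_distrib[symmetric] power_mult_distrib)
  with A show ?thesis
    by (auto simp: tendsto_L2_def square_integrable_cmult elim!: eventually_mono)
qed

lemma tendsto_L2_zero: "tendsto_L2 Q (\<lambda>t w. 0) (\<lambda>w. 0) F"
  by (simp add: tendsto_L2_def square_integrable_def)

lemma tendsto_L2_sum:
  assumes "finite I" "\<And>i. i \<in> I \<Longrightarrow> tendsto_L2 Q (A i) (A' i) F"
  shows "tendsto_L2 Q (\<lambda>t w. \<Sum>i\<in>I. A i t w) (\<lambda>w. \<Sum>i\<in>I. A' i w) F"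
  using assms by (induction I rule: finite_induct) (auto intro: tendsto_L2_zero tendsto_L2_add)

lemma tendsto_L2_cong_AE:
  assumes A: "tendsto_L2 Q A Z F"
    and B: "\<forall>\<^sub>F t in F. B t \<in> borel_measurable Q \<and> (AE w in Q. A t w = B t w)"
  shows "tendsto_L2 Q B Z F"
proof -
  have Z [measurable]: "Z \<in> borel_measurable Q" using A by (simp add: tendsto_L2_def square_integrable_def)
  have sq: "\<forall>\<^sub>F t in F. square_integrable Q (A t)" using A by (simp add: tendsto_L2_def)
  have 1: "\<forall>\<^sub>F t in F. square_integrable Q (B t)"
    using sq B
  proof eventually_elim
    case (elim t)
    have [measurable]: "A t \<in> borel_measurable Q" "B t \<in> borel_measurable Q"
      using elim by (auto simp: square_integrable_def)
    have "integrable Q (\<lambda>w. (A t w)\<^sup>2) \<longleftrightarrow> integrable Q (\<lambda>w. (B t w)\<^sup>2)"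
      using elim(2) by (intro integrable_cong_AE) auto
    then show ?case using elim by (simp add: square_integrable_def)
  qed
  have 2: "\<forall>\<^sub>F t in F. (\<integral>w. (A t w - Z w)\<^sup>2 \<partial>Q) = (\<integral>w. (B t w - Z w)\<^sup>2 \<partial>Q)"
    using sq B
  proof eventually_elim
    case (elim t)
    have [measurable]: "A t \<in> borel_measurable Q" "B t \<in> borel_measurable Q"
      using elim by (auto simp: square_integrable_def)
    show ?case using elim(2) by (intro integral_cong_AE) auto
  qed
  have "((\<lambda>t. \<integral>w. (B t w - Z w)\<^sup>2 \<partial>Q) \<longlongrightarrow> 0) F"
    using A tendsto_cong[OF 2] by (simp add: tendsto_L2_def)
  with 1 A show ?thesis by (simp add: tendsto_L2_def)
qed

lemma exp_decay:
  fixes \<delta> :: real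
  assumes "0 < \<delta>" shows "((\<lambda>s. exp (- (\<delta> * s))) \<longlongrightarrow> 0) at_top"
proof -
  have "filterlim (\<lambda>s. \<delta> * s) at_top at_top"
    by (rule filterlim_tendsto_pos_mult_at_top[OF tendsto_const assms filterlim_ident])
  then have "filterlim (\<lambda>s. - (\<delta> * s)) at_bot at_top" by (simp add: filterlim_uminus_at_bot)
  then show ?thesis by (rule filterlim_compose[OF exp_at_bot])
qed

text \<open>The limit is built pathwise along integer times, where the increments are summable in L1
  because their L2 norms have a geometric bound. Fatou's lemma transfers the increment bound to the
  distance from the limit, at every real time.\<close>

lemma tendsto_L2_exp_Cauchy:
  fixes H :: "real \<Rightarrow> 'w \<Rightarrow> real"
  assumes Q: "prob_space Q" and H: "\<And>t. 0 \<le> t \<Longrightarrow> square_integrable Q (H t)"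
    and D: "\<And>s t. 0 \<le> s \<Longrightarrow> 0 \<le> t \<Longrightarrow> (\<integral>w. (H (s + t) w - H s w)\<^sup>2 \<partial>Q) \<le> K * exp (- \<delta> * s)"
    and \<delta>: "0 < \<delta>"
  shows "\<exists>Z. tendsto_L2 Q H Z at_top"
proof -
  interpret prob_space Q by fact
  have Hm: "H t \<in> borel_measurable Q" if "0 \<le> t" for t using H[OF that] by (simp add: square_integrable_def)
  define h where "h k = H (real k)" for k
  have [measurable]: "h k \<in> borel_measurable Q" for k unfolding h_def by (rule Hm) simp
  define Z where "Z w = lim (\<lambda>k. h k w)" for w
  have Zm [measurable]: "Z \<in> borel_measurable Q" unfolding Z_def by (rule borel_measurable_lim_metric) measurable
  define c where "c k = sqrt (K * exp (- \<delta> * real k))" for k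
  have dint: "(\<integral>\<^sup>+w. ennreal \<bar>h (Suc k) w - h k w\<bar> \<partial>Q) \<le> ennreal (c k)" for k
  proof -
    have sq: "square_integrable Q (\<lambda>w. h (Suc k) w - h k w)" unfolding h_def by (intro square_integrable_diff H) auto
    have i: "integrable Q (\<lambda>w. \<bar>h (Suc k) w - h k w\<bar>)"
      using square_integrable_imp_integrable[of "\<lambda>w. h (Suc k) w - h k w"] sq by (intro integrable_abs) (simp add: square_integrable_def)
    have "(\<integral>w. \<bar>h (Suc k) w - h k w\<bar> \<partial>Q)\<^sup>2 \<le> (\<integral>w. \<bar>h (Suc k) w - h k w\<bar>\<^sup>2 \<partial>Q)"
      using sq by (intro integral_sq_le_prob Q) (simp_all add: square_integrable_def)
    also have "\<dots> \<le> K * exp (- \<delta> * real k)" using D[of "real k" 1] by (simp add: h_def add.commute)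
    finally have "(\<integral>w. \<bar>h (Suc k) w - h k w\<bar> \<partial>Q) \<le> c k" unfolding c_def by (rule real_le_rsqrt)
    then show ?thesis by (subst nn_integral_eq_integral[OF i]) (auto intro: ennreal_leI)
  qed
  have K: "0 \<le> K" using D[of 0 0] by simp
  have c0: "0 \<le> c k" for k using K by (simp add: c_def)
  have "c k = sqrt K * exp (- \<delta> / 2) ^ k" for k
  proof -
    have "exp (- \<delta> * real k) = (exp (- \<delta> / 2) ^ k)\<^sup>2" by (simp add: exp_of_nat_mult[symmetric] exp_double[symmetric] power2_eq_square exp_add[symmetric] algebra_simps)
    then show ?thesis unfolding c_def by (simp add: real_sqrt_mult real_sqrt_abs)
  qed
  then have "c = (\<lambda>k. sqrt K * exp (- \<delta> / 2) ^ k)" by (rule ext)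
  then have "summable c" using \<delta> by (auto intro!: summable_mult summable_geometric)
  then have cfin: "(\<Sum>k. ennreal (c k)) \<noteq> top" using c0 by (intro ennreal_suminf_neq_top) auto
  have "(\<integral>\<^sup>+w. (\<Sum>k. ennreal \<bar>h (Suc k) w - h k w\<bar>) \<partial>Q) = (\<Sum>k. \<integral>\<^sup>+w. ennreal \<bar>h (Suc k) w - h k w\<bar> \<partial>Q)"
    by (rule nn_integral_suminf) measurable
  also have "\<dots> \<le> (\<Sum>k. ennreal (c k))" by (intro suminf_le dint) auto
  finally have "(\<integral>\<^sup>+w. (\<Sum>k. ennreal \<bar>h (Suc k) w - h k w\<bar>) \<partial>Q) \<noteq> \<infinity>"
    using cfin by (auto simp: top_unique)
  then have "AE w in Q. (\<Sum>k. ennreal \<bar>h (Suc k) w - h k w\<bar>) \<noteq> \<infinity>"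
    by (intro nn_integral_noteq_infinite) measurable
  then have lim: "AE w in Q. (\<lambda>k. h k w) \<longlonglongrightarrow> Z w"
  proof eventually_elim
    case (elim w)
    then have "summable (\<lambda>k. \<bar>h (Suc k) w - h k w\<bar>)" by (intro summable_suminf_not_top) auto
    then have "summable (\<lambda>k. h (Suc k) w - h k w)" by (rule summable_rabs_cancel)
    then have "convergent (\<lambda>k. \<Sum>i<k. h (Suc i) w - h i w)" by (simp add: summable_iff_convergent)
    then have "convergent (\<lambda>k. h k w - h 0 w)" by (simp only: sum_lessThan_telescope[of "\<lambda>i. h i w"])
    then have "convergent (\<lambda>k. (h k w - h 0 w) + h 0 w)" by (intro convergent_add convergent_const)
    then show ?case by (simp add: convergent_LIMSEQ_iff Z_def)
  qed
  \<comment> \<open>Fatou along the integers k \<ge> s, for which the increment from s to k has a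
    bound independent of k.\<close>
  have bound: "(\<integral>\<^sup>+w. ennreal ((H s w - Z w)\<^sup>2) \<partial>Q) \<le> ennreal (K * exp (- \<delta> * s))" if s: "0 \<le> s" for s
  proof -
    note [measurable] = Hm[OF s]
    have "(\<integral>\<^sup>+w. ennreal ((H s w - Z w)\<^sup>2) \<partial>Q) = (\<integral>\<^sup>+w. liminf (\<lambda>k. ennreal ((h k w - H s w)\<^sup>2)) \<partial>Q)"
    proof (rule nn_integral_cong_AE)
      show "AE w in Q. ennreal ((H s w - Z w)\<^sup>2) = liminf (\<lambda>k. ennreal ((h k w - H s w)\<^sup>2))"
        using lim
      proof eventually_elim
        case (elim w)
        have "(\<lambda>k. ennreal ((h k w - H s w)\<^sup>2)) \<longlonglongrightarrow> ennreal ((Z w - H s w)\<^sup>2)"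
          using elim by (intro tendsto_intros)
        from lim_imp_Liminf[OF _ this] show ?case by (simp add: power2_commute[of "Z w"])
      qed
    qed
    also have "\<dots> \<le> liminf (\<lambda>k. \<integral>\<^sup>+w. ennreal ((h k w - H s w)\<^sup>2) \<partial>Q)" by (rule nn_integral_liminf) measurable
    also have "\<dots> \<le> ennreal (K * exp (- \<delta> * s))"
    proof (rule Liminf_le)
      show "\<forall>\<^sub>F k in sequentially. (\<integral>\<^sup>+w. ennreal ((h k w - H s w)\<^sup>2) \<partial>Q) \<le> ennreal (K * exp (- \<delta> * s))"
        using eventually_ge_at_top[of "nat \<lceil>s\<rceil>"]
      proof eventually_elim
        case (elim k)
        then have sk: "s \<le> real k" by linarith
        have sq: "square_integrable Q (\<lambda>w. h k w - H s w)" unfolding h_def by (intro square_integrable_diff H s) auto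
        have "(\<integral>w. (h k w - H s w)\<^sup>2 \<partial>Q) \<le> K * exp (- \<delta> * s)" using D[OF s, of "real k - s"] sk by (simp add: h_def)
        then show ?case using sq by (subst nn_integral_eq_integral) (auto simp: square_integrable_def intro: ennreal_leI)
      qed
    qed auto
    finally show ?thesis .
  qed
  have diff: "square_integrable Q (\<lambda>w. H s w - Z w)" "(\<integral>w. (H s w - Z w)\<^sup>2 \<partial>Q) \<le> K * exp (- \<delta> * s)" if s: "0 \<le> s" for s
  proof -
    note [measurable] = Hm[OF s]
    have i: "integrable Q (\<lambda>w. (H s w - Z w)\<^sup>2)"
    proof (rule integrableI_bounded)
      show "(\<integral>\<^sup>+w. ennreal (norm ((H s w - Z w)\<^sup>2)) \<partial>Q) < \<infinity>"
        using bound[OF s] by (simp add: le_less_trans)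
    qed measurable
    then show "square_integrable Q (\<lambda>w. H s w - Z w)" by (simp add: square_integrable_def)
    have "ennreal (\<integral>w. (H s w - Z w)\<^sup>2 \<partial>Q) \<le> ennreal (K * exp (- \<delta> * s))"
      using bound[OF s] nn_integral_eq_integral[OF i] by simp
    then show "(\<integral>w. (H s w - Z w)\<^sup>2 \<partial>Q) \<le> K * exp (- \<delta> * s)" using K by (simp add: ennreal_le_iff)
  qed
  have "square_integrable Q Z"
    using square_integrable_diff[OF H[of 0] diff(1)[of 0]] by simp
  moreover have "((\<lambda>s. \<integral>w. (H s w - Z w)\<^sup>2 \<partial>Q) \<longlongrightarrow> 0) at_top"
  proof (rule tendsto_sandwich[OF _ _ tendsto_const])
    show "\<forall>\<^sub>F s in at_top. (\<integral>w. (H s w - Z w)\<^sup>2 \<partial>Q) \<le> K * exp (- \<delta> * s)"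
      using eventually_ge_at_top[of 0] by eventually_elim (rule diff)
    show "((\<lambda>s. K * exp (- \<delta> * s)) \<longlongrightarrow> 0) at_top"
      using tendsto_mult_right_zero[OF exp_decay[OF \<delta>]] by simp
  qed auto
  moreover have "\<forall>\<^sub>F s in at_top. square_integrable Q (H s)"
    using eventually_ge_at_top[of 0] by eventually_elim (rule H)
  ultimately show ?thesis by (auto simp: tendsto_L2_def)
qed

section \<open>The martingales and the remainder\<close>

lemma nn_integral_exp_tail:
  assumes d: "0 < \<delta>"
  shows "(\<integral>\<^sup>+r. ennreal (exp (- (\<delta> * r))) * indicator {s..} r \<partial>lborel) = ennreal (exp (- (\<delta> * s)) / \<delta>)"
proof -
  have "(\<integral>\<^sup>+r. ennreal (exp (- (\<delta> * r))) * indicator {s..} r \<partial>lborel) = ennreal (0 - (- exp (- (\<delta> * s)) / \<delta>))"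
  proof (rule nn_integral_FTC_atLeast)
    show "DERIV (\<lambda>r. - exp (- (\<delta> * r)) / \<delta>) r :> exp (- (\<delta> * r))" for r
      using d by (auto intro!: derivative_eq_intros)
    show "((\<lambda>r. - exp (- (\<delta> * r)) / \<delta>) \<longlongrightarrow> 0) at_top"
      using tendsto_divide_zero[OF tendsto_minus[OF exp_decay[OF d], simplified], of \<delta>] by simp
  qed auto
  then show ?thesis by simp
qed

context super_OU_process_start
begin

lemma square_integrable_xint: "poly_bdd f \<Longrightarrow> 0 \<le> t \<Longrightarrow> square_integrable (P \<mu>) (xint f t)"
  by (simp add: square_integrable_def xint_sq_integrable xint_measurable poly_bdd_measurable)

lemma xint_second_moment_scaled:
  assumes f: "poly_bdd f" and t: "0 \<le> t"
  shows "ennreal (\<integral>w. (exp (- l * t) * xint f t w)\<^sup>2 \<partial>P \<mu>) = ennreal (exp (- (2 * l * t)) * (mm f t)\<^sup>2) +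
    ennreal (2 * kap) * (ennreal (exp (- (2 * l * t))) * (\<integral>\<^sup>+x. sg_var f t x \<partial>\<mu>))"
proof -
  have "ennreal (\<integral>w. (exp (- l * t) * xint f t w)\<^sup>2 \<partial>P \<mu>) = (\<integral>\<^sup>+w. ennreal ((exp (- l * t) * xint f t w)\<^sup>2) \<partial>P \<mu>)"
    using square_integrable_cmult[OF square_integrable_xint[OF f t]]
    by (intro nn_integral_eq_integral[symmetric]) (auto simp: square_integrable_def)
  also have "\<dots> = (\<integral>\<^sup>+w. ennreal (exp (- (2 * l * t))) * ennreal ((xint f t w)\<^sup>2) \<partial>P \<mu>)"
    by (intro nn_integral_cong) (simp add: ennreal_mult[symmetric] power_mult_distrib exp_double[symmetric] mult.assoc)
  also have "\<dots> = ennreal (exp (- (2 * l * t))) * (\<integral>\<^sup>+w. ennreal ((xint f t w)\<^sup>2) \<partial>P \<mu>)"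
    using xint_measurable[OF poly_bdd_measurable[OF f] t] by (intro nn_integral_cmult) simp
  finally show ?thesis
    unfolding xint_second_moment[OF f t] by (simp add: ennreal_mult distrib_left mult_ac)
qed

lemma sg_eigenfun:
  assumes "0 \<le> t" shows "sg (eigenfun b \<sigma> p) t x = exp (- (real (mi_size p) * b * t)) * eigenfun b \<sigma> p x"
  using eigenfun_mehler[OF b_pos \<sigma>_pos w_bounds[OF assms], where p = p and x = x]
  by (simp add: sg_def exp_of_nat_mult[symmetric] mult_ac)

text \<open>The eigenvalue relation makes the inner square explicit, and the exponents combine as
  \<alpha> r + 2 l (t - r) = 2 l t - \<delta> r. This is where the threshold for \<alpha> against 2
  |p| b originates.\<close>

lemma sg_var_eigenfun:
  fixes p :: "'d \<Rightarrow> nat"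
  defines "\<phi> \<equiv> eigenfun b \<sigma> p" and "l \<equiv> \<alpha> - real (mi_size p) * b" and "\<delta> \<equiv> \<alpha> - 2 * real (mi_size p) * b"
  assumes t: "0 \<le> t"
  shows "sg_var \<phi> t x = ennreal (exp (2 * l * t)) * (\<integral>\<^sup>+r\<in>{0..t}. ennreal (exp (- (\<delta> * r)) * sg (\<lambda>y. (\<phi> y)\<^sup>2) r x) \<partial>lborel)"
proof -
  have p: "poly_bdd \<phi>" unfolding \<phi>_def by (intro poly_bdd_eigenfun b_pos \<sigma>_pos)
  have p2: "poly_bdd (\<lambda>y. (\<phi> y)\<^sup>2)" by (intro poly_bdd_power p)
  note [measurable] = poly_bdd_measurable[OF p] poly_bdd_measurable[OF p2]
  have "sg_var \<phi> t x = (\<integral>\<^sup>+r. ennreal (exp (2 * l * t)) * (ennreal (exp (- (\<delta> * r)) * sg (\<lambda>y. (\<phi> y)\<^sup>2) r x) * indicator {0..t} r) \<partial>lborel)"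
    unfolding sg_var_def
  proof (intro nn_integral_cong)
    fix r :: real
    show "ennreal (exp (\<alpha> * r)) * (\<integral>\<^sup>+y. ennreal ((exp (\<alpha> * (t - r)) * sg \<phi> (t - r) y)\<^sup>2) \<partial>Q r x) * indicator {0..t} r
      = ennreal (exp (2 * l * t)) * (ennreal (exp (- (\<delta> * r)) * sg (\<lambda>y. (\<phi> y)\<^sup>2) r x) * indicator {0..t} r)"
    proof (cases "r \<in> {0..t}")
      case True
      then have r: "0 \<le> r" "0 \<le> t - r" by auto
      have e: "exp (\<alpha> * (t - r)) * sg \<phi> (t - r) y = exp (l * (t - r)) * \<phi> y" for y
        unfolding \<phi>_def sg_eigenfun[OF r(2)] l_def by (simp add: exp_add[symmetric] algebra_simps)
      have "(\<integral>\<^sup>+y. ennreal ((exp (\<alpha> * (t - r)) * sg \<phi> (t - r) y)\<^sup>2) \<partial>Q r x)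
          = (\<integral>\<^sup>+y. ennreal (exp (2 * l * (t - r))) * ennreal ((\<phi> y)\<^sup>2) \<partial>Q r x)"
        unfolding e by (intro nn_integral_cong) (simp add: ennreal_mult[symmetric] power_mult_distrib exp_double[symmetric] mult.assoc)
      also have "\<dots> = ennreal (exp (2 * l * (t - r))) * (\<integral>\<^sup>+y. ennreal ((\<phi> y)\<^sup>2) \<partial>Q r x)"
        by (rule nn_integral_cmult) measurable
      also have "(\<integral>\<^sup>+y. ennreal ((\<phi> y)\<^sup>2) \<partial>Q r x) = ennreal (sg (\<lambda>y. (\<phi> y)\<^sup>2) r x)"
        unfolding sg_def by (intro nn_integral_eq_integral Q_integrable p2 r) auto
      finally have *: "ennreal (exp (\<alpha> * r)) * (\<integral>\<^sup>+y. ennreal ((exp (\<alpha> * (t - r)) * sg \<phi> (t - r) y)\<^sup>2) \<partial>Q r x)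
        = ennreal (exp (\<alpha> * r) * exp (2 * l * (t - r))) * ennreal (sg (\<lambda>y. (\<phi> y)\<^sup>2) r x)"
        by (simp add: ennreal_mult mult.assoc)
      have ee: "exp (\<alpha> * r) * exp (2 * l * (t - r)) = exp (2 * l * t) * exp (- (\<delta> * r))"
        unfolding exp_add[symmetric] l_def \<delta>_def by (simp add: algebra_simps)
      have "0 \<le> sg (\<lambda>y. (\<phi> y)\<^sup>2) r x" unfolding sg_def by simp
      then show ?thesis using True unfolding * ee by (simp add: ennreal_mult mult.assoc)
    qed simp
  qed
  also have "\<dots> = ennreal (exp (2 * l * t)) * (\<integral>\<^sup>+r\<in>{0..t}. ennreal (exp (- (\<delta> * r)) * sg (\<lambda>y. (\<phi> y)\<^sup>2) r x) \<partial>lborel)"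
    by (rule nn_integral_cmult) measurable
  finally show ?thesis .
qed

text \<open>By \<open>cross_moment\<close> increments are orthogonal to the past, so the squared L2
  distance between the times s and s + t is the growth of the second moment. That growth is the tail
  of an integral with rate \<delta> > 0, hence exponentially small, and the \<open>SOME\<close> in
  \<open>mart_H_lim\<close> has a witness.\<close>

lemma mart_H_L2:
  fixes p :: "'d \<Rightarrow> nat"
  assumes ap: "2 * real (mi_size p) * b < \<alpha>"
  shows "tendsto_L2 (P \<mu>) (mart_H b \<sigma> \<alpha> X p) (mart_H_lim b \<sigma> \<alpha> X (P \<mu>) p) at_top"
proof -
  define \<phi> where "\<phi> = eigenfun b \<sigma> p"
  define l where "l = \<alpha> - real (mi_size p) * b"
  define \<delta> where "\<delta> = \<alpha> - 2 * real (mi_size p) * b"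
  have \<delta>: "0 < \<delta>" using ap by (simp add: \<delta>_def)
  have p: "poly_bdd \<phi>" unfolding \<phi>_def by (intro poly_bdd_eigenfun b_pos \<sigma>_pos)
  have p2: "poly_bdd (\<lambda>y. (\<phi> y)\<^sup>2)" by (intro poly_bdd_power p)
  note [measurable] = poly_bdd_measurable[OF p] poly_bdd_measurable[OF p2]
  have s\<mu> [measurable_cong]: "sets \<mu> = sets borel" by (rule MF_D(2)[OF \<mu>])
  define H where "H t w = exp (- l * t) * xint \<phi> t w" for t w
  have Hm: "mart_H b \<sigma> \<alpha> X p = H" by (intro ext) (simp add: mart_H_def H_def xint_def l_def \<phi>_def)
  have sqH: "square_integrable (P \<mu>) (H t)" if "0 \<le> t" for t
    unfolding H_def by (intro square_integrable_cmult square_integrable_xint p that)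
  \<comment> \<open>The normalisation cancels the factor \<open>exp (2 * l * t)\<close> of
    \<open>sg_var_eigenfun\<close>, so the second moment depends on t only through the upper limit
    of this integral.\<close>
  define W where "W t = (\<integral>\<^sup>+x. (\<integral>\<^sup>+r\<in>{0..t}. ennreal (exp (- (\<delta> * r)) * sg (\<lambda>y. (\<phi> y)\<^sup>2) r x) \<partial>lborel) \<partial>\<mu>)" for t
  define e where "e t = (\<integral>w. (H t w)\<^sup>2 \<partial>P \<mu>)" for t
  define m where "m = (\<integral>x. \<phi> x \<partial>\<mu>)"
  have mm: "mm \<phi> t = exp (l * t) * m" if t: "0 \<le> t" for t
  proof -
    have "mm \<phi> t = exp (\<alpha> * t) * exp (- (real (mi_size p) * b * t)) * m"
      unfolding mm_def \<phi>_def sg_eigenfun[OF t] m_def by simp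
    then show ?thesis unfolding exp_add[symmetric] l_def by (simp add: algebra_simps)
  qed
  have et: "ennreal (e t) = ennreal (m\<^sup>2) + ennreal (2 * kap) * W t" if t: "0 \<le> t" for t
  proof -
    have V: "(\<integral>\<^sup>+x. sg_var \<phi> t x \<partial>\<mu>) = ennreal (exp (2 * l * t)) * W t"
      unfolding W_def sg_var_eigenfun[OF t, of p, folded \<phi>_def l_def \<delta>_def] by (rule nn_integral_cmult) measurable
    have 1: "exp (- (2 * l * t)) * (exp (l * t) * m)\<^sup>2 = m\<^sup>2"
      unfolding power_mult_distrib exp_double[symmetric] mult.assoc[symmetric] exp_add[symmetric] by simp
    have "ennreal (exp (- (2 * l * t))) * (ennreal (exp (2 * l * t)) * W t) = W t"
      unfolding mult.assoc[symmetric] ennreal_mult[symmetric, OF exp_ge_zero exp_ge_zero] exp_add[symmetric] by simp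
    then show ?thesis
      unfolding e_def H_def xint_second_moment_scaled[OF p t] mm[OF t] V 1 by simp
  qed
  obtain g where g: "poly_bdd g" "\<And>y. 0 \<le> g y" "\<And>r y. 0 \<le> r \<Longrightarrow> \<bar>sg (\<lambda>y. (\<phi> y)\<^sup>2) r y\<bar> \<le> g y"
    using sg_poly_bound[OF p2] by metis
  note [measurable] = poly_bdd_measurable[OF g(1)]
  define G where "G = (\<integral>x. g x \<partial>\<mu>)"
  have G0: "0 \<le> G" unfolding G_def using g(2) by simp
  \<comment> \<open>Beyond s the integral is bounded by the tail of
    \<open>exp (- (\<delta> * r))\<close>, since the averages of the squared eigenfunction have a
    majorant g independent of time.\<close>
  have W: "W (s + t) \<le> W s + ennreal (G / \<delta> * exp (- (\<delta> * s)))" if st: "0 \<le> s" "0 \<le> t" for s t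
  proof -
    have 1: "(\<integral>\<^sup>+r\<in>{0..s+t}. ennreal (exp (- (\<delta> * r)) * sg (\<lambda>y. (\<phi> y)\<^sup>2) r x) \<partial>lborel)
      \<le> (\<integral>\<^sup>+r\<in>{0..s}. ennreal (exp (- (\<delta> * r)) * sg (\<lambda>y. (\<phi> y)\<^sup>2) r x) \<partial>lborel) + ennreal (exp (- (\<delta> * s)) / \<delta>) * ennreal (g x)" for x
    proof -
      have "(\<integral>\<^sup>+r\<in>{0..s+t}. ennreal (exp (- (\<delta> * r)) * sg (\<lambda>y. (\<phi> y)\<^sup>2) r x) \<partial>lborel)
        \<le> (\<integral>\<^sup>+r. ennreal (exp (- (\<delta> * r)) * sg (\<lambda>y. (\<phi> y)\<^sup>2) r x) * indicator {0..s} r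
             + ennreal (exp (- (\<delta> * r))) * indicator {s..} r * ennreal (g x) \<partial>lborel)"
      proof (intro nn_integral_mono)
        fix r :: real
        have "ennreal (exp (- (\<delta> * r)) * sg (\<lambda>y. (\<phi> y)\<^sup>2) r x) \<le> ennreal (exp (- (\<delta> * r))) * ennreal (g x)" if "0 \<le> r"
          using g(3)[OF that, of x] g(2)[of x] by (auto simp: ennreal_mult[symmetric] intro!: ennreal_leI)
        then show "ennreal (exp (- (\<delta> * r)) * sg (\<lambda>y. (\<phi> y)\<^sup>2) r x) * indicator {0..s+t} r
          \<le> ennreal (exp (- (\<delta> * r)) * sg (\<lambda>y. (\<phi> y)\<^sup>2) r x) * indicator {0..s} r + ennreal (exp (- (\<delta> * r))) * indicator {s..} r * ennreal (g x)"
          using st by (cases "0 \<le> r"; cases "r \<le> s"; auto simp: indicator_def)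
      qed
      also have "\<dots> = (\<integral>\<^sup>+r\<in>{0..s}. ennreal (exp (- (\<delta> * r)) * sg (\<lambda>y. (\<phi> y)\<^sup>2) r x) \<partial>lborel)
         + (\<integral>\<^sup>+r. ennreal (exp (- (\<delta> * r))) * indicator {s..} r * ennreal (g x) \<partial>lborel)"
        by (rule nn_integral_add) measurable
      also have "(\<integral>\<^sup>+r. ennreal (exp (- (\<delta> * r))) * indicator {s..} r * ennreal (g x) \<partial>lborel)
         = (\<integral>\<^sup>+r. ennreal (exp (- (\<delta> * r))) * indicator {s..} r \<partial>lborel) * ennreal (g x)"
        by (rule nn_integral_multc) measurable
      finally show ?thesis by (simp only: nn_integral_exp_tail[OF \<delta>])
    qed
    have "W (s + t) \<le> (\<integral>\<^sup>+x. (\<integral>\<^sup>+r\<in>{0..s}. ennreal (exp (- (\<delta> * r)) * sg (\<lambda>y. (\<phi> y)\<^sup>2) r x) \<partial>lborel) + ennreal (exp (- (\<delta> * s)) / \<delta>) * ennreal (g x) \<partial>\<mu>)"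
      unfolding W_def by (intro nn_integral_mono 1)
    also have "\<dots> = W s + (\<integral>\<^sup>+x. ennreal (exp (- (\<delta> * s)) / \<delta>) * ennreal (g x) \<partial>\<mu>)"
      unfolding W_def by (rule nn_integral_add) measurable
    also have "(\<integral>\<^sup>+x. ennreal (exp (- (\<delta> * s)) / \<delta>) * ennreal (g x) \<partial>\<mu>) = ennreal (exp (- (\<delta> * s)) / \<delta>) * (\<integral>\<^sup>+x. ennreal (g x) \<partial>\<mu>)"
      by (rule nn_integral_cmult) measurable
    also have "(\<integral>\<^sup>+x. ennreal (g x) \<partial>\<mu>) = ennreal G"
      unfolding G_def using g(2) by (intro nn_integral_eq_integral poly_bdd_integrable_init g(1)) auto
    also have "ennreal (exp (- (\<delta> * s)) / \<delta>) * ennreal G = ennreal (G / \<delta> * exp (- (\<delta> * s)))"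
      using \<delta> G0 by (simp add: ennreal_mult[symmetric] mult.commute)
    finally show ?thesis .
  qed
  have e0: "0 \<le> e t" for t unfolding e_def by simp
  define K where "K = 2 * kap * (G / \<delta>)"
  have K0: "0 \<le> K" unfolding K_def using kap_nonneg G0 \<delta> by simp
  have e_le: "e (s + t) \<le> e s + K * exp (- (\<delta> * s))" if st: "0 \<le> s" "0 \<le> t" for s t
  proof -
    have "ennreal (e (s + t)) \<le> ennreal (m\<^sup>2) + ennreal (2 * kap) * (W s + ennreal (G / \<delta> * exp (- (\<delta> * s))))"
      unfolding et[OF add_nonneg_nonneg[OF st]] by (intro add_left_mono mult_left_mono W st) simp
    also have "\<dots> = ennreal (e s) + ennreal (2 * kap) * ennreal (G / \<delta> * exp (- (\<delta> * s)))"
      unfolding et[OF st(1)] by (simp add: distrib_left add.assoc)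
    also have "\<dots> = ennreal (e s + K * exp (- (\<delta> * s)))"
      using kap_nonneg G0 \<delta> e0 by (simp add: K_def ennreal_mult[symmetric] ennreal_plus[symmetric] mult.assoc del: ennreal_plus)
    finally show ?thesis using e0[of s] K0 by (subst (asm) ennreal_le_iff) auto
  qed
  \<comment> \<open>The martingale property in the form needed: the product of the values at s and s
    + t has the same expectation as the square at s.\<close>
  have cross: "(\<integral>w. H s w * H (s + t) w \<partial>P \<mu>) = e s" if st: "0 \<le> s" "0 \<le> t" for s t
  proof -
    have sgf: "sg \<phi> t = (\<lambda>x. exp (- (real (mi_size p) * b * t)) * \<phi> x)"
      unfolding \<phi>_def by (intro ext sg_eigenfun st)
    have sq: "xint \<phi> s w * (c * xint \<phi> s w) = c * (xint \<phi> s w)\<^sup>2" for c w by (simp add: power2_eq_square)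
    have cm: "(\<integral>w. xint \<phi> s w * xint \<phi> (s + t) w \<partial>P \<mu>)
        = exp (\<alpha> * t) * (exp (- (real (mi_size p) * b * t)) * (\<integral>w. (xint \<phi> s w)\<^sup>2 \<partial>P \<mu>))"
      unfolding cross_moment[OF p st] sgf xint_cmult sq by simp
    have "H s w * H (s + t) w = (exp (- l * s) * exp (- l * (s + t))) * (xint \<phi> s w * xint \<phi> (s + t) w)" for w
      unfolding H_def by (simp only: mult_ac)
    then have "(\<integral>w. H s w * H (s + t) w \<partial>P \<mu>)
        = (exp (- l * s) * exp (- l * (s + t)) * exp (\<alpha> * t) * exp (- (real (mi_size p) * b * t))) * (\<integral>w. (xint \<phi> s w)\<^sup>2 \<partial>P \<mu>)"
      by (simp only: integral_mult_right_zero cm mult.assoc)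
    also have "exp (- l * s) * exp (- l * (s + t)) * exp (\<alpha> * t) * exp (- (real (mi_size p) * b * t)) = (exp (- l * s))\<^sup>2"
      unfolding exp_double[symmetric] exp_add[symmetric] l_def by (simp add: algebra_simps)
    also have "(exp (- l * s))\<^sup>2 * (\<integral>w. (xint \<phi> s w)\<^sup>2 \<partial>P \<mu>) = e s"
      unfolding e_def H_def power_mult_distrib by simp
    finally show ?thesis .
  qed
  have "\<exists>Z. tendsto_L2 (P \<mu>) H Z at_top"
  proof (rule tendsto_L2_exp_Cauchy[OF _ sqH _ \<delta>])
    show "prob_space (P \<mu>)" by (rule X.prob[OF \<mu>])
    fix s t :: real assume st: "0 \<le> s" "0 \<le> t"
    then have st': "0 \<le> s + t" by simp
    have i: "integrable (P \<mu>) (\<lambda>w. (H s w)\<^sup>2)" "integrable (P \<mu>) (\<lambda>w. (H (s + t) w)\<^sup>2)"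
      using sqH st st' by (auto simp: square_integrable_def)
    have i2: "integrable (P \<mu>) (\<lambda>w. H s w * H (s + t) w)"
      using sqH[OF st(1)] sqH[OF st'] by (intro integral_Cauchy_Schwarz(1)) (auto simp: square_integrable_def)
    have "(\<integral>w. (H (s + t) w - H s w)\<^sup>2 \<partial>P \<mu>) = (\<integral>w. (H (s + t) w)\<^sup>2 + (H s w)\<^sup>2 - 2 * (H s w * H (s + t) w) \<partial>P \<mu>)"
      by (simp add: power2_diff mult_ac)
    also have "\<dots> = e (s + t) + e s - 2 * e s" using i i2 cross[OF st] by (simp add: e_def)
    also have "\<dots> \<le> K * exp (- \<delta> * s)" using e_le[OF st] by simp
    finally show "(\<integral>w. (H (s + t) w - H s w)\<^sup>2 \<partial>P \<mu>) \<le> K * exp (- \<delta> * s)" .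
  qed
  then show ?thesis unfolding mart_H_lim_def Hm by (rule someI_ex)
qed

end

section \<open>Decay of the semigroup from a fixed starting point\<close>

context super_OU_process
begin

text \<open>Positive and negative parts reduce this to the identity \<open>ou_law_semigroup\<close>
  in \<open>ennreal\<close>.\<close>

lemma sg_semigroup:
  assumes f: "poly_bdd f" and s: "0 \<le> s" and t: "0 \<le> t"
  shows "sg f (s + t) x = sg (sg f t) s x"
proof -
  have st: "0 \<le> s + t" using s t by simp
  have nn: "sg h (s + t) x = sg (sg h t) s x" if h: "poly_bdd h" "\<And>y. 0 \<le> h y" for h
  proof -
    note [measurable] = poly_bdd_measurable[OF h(1)]
    have sg0: "0 \<le> sg h r y" for r y unfolding sg_def using h(2) by simp
    have e: "(\<integral>\<^sup>+z. ennreal (h z) \<partial>Q r y) = ennreal (sg h r y)" if "0 \<le> r" for r y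
      unfolding sg_def using h(2) by (intro nn_integral_eq_integral Q_integrable h(1) that) auto
    have "ennreal (sg h (s + t) x) = (\<integral>\<^sup>+y. (\<integral>\<^sup>+z. ennreal (h z) \<partial>Q t y) \<partial>Q s x)"
      unfolding e[OF st, symmetric] by (rule ou_law_semigroup[OF s t, symmetric]) measurable
    also have "\<dots> = ennreal (sg (sg h t) s x)"
      unfolding e[OF t] sg_def[of "sg h t"] using sg0 by (intro nn_integral_eq_integral Q_integrable poly_bdd_sg h(1) s t) auto
    finally show ?thesis using sg0 by (subst (asm) ennreal_inj) (auto simp: sg_def[of "sg h t"])
  qed
  define g where "g = (\<lambda>x. max (f x) 0)"
  define h where "h = (\<lambda>x. max (- f x) 0)"
  have gh: "poly_bdd g" "poly_bdd h" "\<And>x. 0 \<le> g x" "\<And>x. 0 \<le> h x"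
    using poly_bdd_measurable[OF f] by (auto intro!: poly_bdd_mono[OF f] simp: g_def h_def max_def)
  have f_eq: "f = (\<lambda>x. g x - h x)" by (auto simp: g_def h_def max_def)
  have "sg f (s + t) x = sg (sg g t) s x - sg (sg h t) s x"
    unfolding f_eq sg_linear(2)[OF gh(1,2) st] using nn[OF gh(1,3)] nn[OF gh(2,4)] by simp
  also have "\<dots> = sg (\<lambda>y. sg g t y - sg h t y) s x"
    by (rule sg_linear(2)[OF poly_bdd_sg[OF gh(1) t] poly_bdd_sg[OF gh(2) t] s, symmetric])
  also have "(\<lambda>y. sg g t y - sg h t y) = sg f t"
    unfolding f_eq by (intro ext sg_linear(2)[OF gh(1,2) t, symmetric])
  finally show ?thesis .
qed

text \<open>For s \<ge> 1 the density of \<open>Q s x\<close> with respect to the invariant law is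
  bounded, so the L2 decay of \<open>mehler_decay\<close> applies. The condition
  \<open>2 \<le> r + s\<close> ensures that otherwise r \<ge> 1, and time can be shifted from the
  inner to the outer semigroup.\<close>

lemma sg_sq_decay:
  fixes g :: "real^'d \<Rightarrow> real"
  assumes g: "poly_bdd g"
    and orth: "\<And>p. mi_size p \<le> k \<Longrightarrow> (\<integral>y. g y * eigenfun b \<sigma> p y \<partial>gauss (b / \<sigma>\<^sup>2)) = 0"
  obtains C where "0 \<le> C" "\<And>r s x. 0 \<le> r \<Longrightarrow> 0 \<le> s \<Longrightarrow> 2 \<le> r + s \<Longrightarrow>
    (\<integral>\<^sup>+y. ennreal ((sg g r y)\<^sup>2) \<partial>Q s x) \<le> ennreal (C * exp (b / \<sigma>\<^sup>2 * (norm x)\<^sup>2) * exp (- (2 * real (Suc k) * b * r)))"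
proof -
  define c where "c = 2 * real (Suc k) * b"
  have c: "0 < c" using b_pos by (simp add: c_def)
  \<comment> \<open>Bounds the prefactor of \<open>mker_le\<close> for all s \<ge> 1.\<close>
  define D where "D = (1 / sqrt (1 - (exp (- b))\<^sup>2)) ^ CARD('d)"
  have eb: "exp (- b) < 1" using b_pos by simp
  have eb2: "(exp (- b))\<^sup>2 < 1" using eb by (simp add: power_less_one_iff)
  have D: "0 \<le> D" using eb2 by (simp add: D_def)
  have ce: "exp (- 2 * real (Suc k) * b * t) = exp (- (c * t))" for t unfolding c_def by (simp add: algebra_simps)
  obtain C0 where "0 \<le> C0" and "\<And>t. t \<ge> 0 \<Longrightarrow> (\<integral>x. (\<integral>z. g z \<partial>Q t x)\<^sup>2 \<partial>gauss (b / \<sigma>\<^sup>2)) \<le> C0 * exp (- 2 * real (Suc k) * b * t)"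
    by (rule mehler_decay[OF b_pos \<sigma>_pos g orth], assumption) (rule that)
  then have C0: "0 \<le> C0" "\<And>t. t \<ge> 0 \<Longrightarrow> (\<integral>x. (sg g t x)\<^sup>2 \<partial>gauss (b / \<sigma>\<^sup>2)) \<le> C0 * exp (- (c * t))"
    unfolding sg_def ce by simp_all
  define E where "E x = exp (b / \<sigma>\<^sup>2 * (norm x)\<^sup>2)" for x :: "real^'d"
  note [measurable] = poly_bdd_measurable[OF g]
  have case1: "(\<integral>\<^sup>+y. ennreal ((sg g r y)\<^sup>2) \<partial>Q s x) \<le> ennreal (D * C0 * E x * exp (- (c * r)))"
    if r: "0 \<le> r" and s: "1 \<le> s" for r s x
  proof -
    have w: "0 \<le> exp (- b * s)" "exp (- b * s) < 1" "exp (- b * s) \<le> exp (- b)" using s b_pos by auto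
    have pg: "poly_bdd (\<lambda>y. (sg g r y)\<^sup>2)" by (intro poly_bdd_power poly_bdd_sg g r)
    have e: "(exp (- b * s))\<^sup>2 \<le> (exp (- b))\<^sup>2" using w by (intro power_mono) auto
    have "1 / sqrt (1 - (exp (- b * s))\<^sup>2) \<le> 1 / sqrt (1 - (exp (- b))\<^sup>2)"
    proof (rule divide_left_mono)
      show "sqrt (1 - (exp (- b))\<^sup>2) \<le> sqrt (1 - (exp (- b * s))\<^sup>2)" using e by (intro real_sqrt_le_mono diff_left_mono)
      show "0 < sqrt (1 - (exp (- b * s))\<^sup>2) * sqrt (1 - (exp (- b))\<^sup>2)"
        using le_less_trans[OF e eb2] eb2 by (intro mult_pos_pos) (simp_all only: real_sqrt_gt_0_iff diff_gt_0_iff_gt)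
    qed simp
    then have "(1 / sqrt (1 - (exp (- b * s))\<^sup>2)) ^ CARD('d) \<le> D"
      unfolding D_def using le_less_trans[OF e eb2]
      by (intro power_mono divide_nonneg_nonneg real_sqrt_ge_zero) (simp_all only: diff_ge_0_iff_ge less_imp_le zero_le_one)
    then have le: "(1 / sqrt (1 - (exp (- b * s))\<^sup>2)) ^ CARD('d) * E x \<le> D * E x"
      by (rule mult_right_mono) (simp add: E_def)
    have "(\<integral>\<^sup>+y. ennreal ((sg g r y)\<^sup>2) \<partial>Q s x)
      \<le> ennreal ((1 / sqrt (1 - (exp (- b * s))\<^sup>2)) ^ CARD('d) * E x) * (\<integral>\<^sup>+y. ennreal ((sg g r y)\<^sup>2) \<partial>gauss (b / \<sigma>\<^sup>2))"
      unfolding E_def by (rule nn_integral_ou_law_le[OF a_pos w(1,2)]) measurable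
    also have "(\<integral>\<^sup>+y. ennreal ((sg g r y)\<^sup>2) \<partial>gauss (b / \<sigma>\<^sup>2)) = ennreal (\<integral>y. (sg g r y)\<^sup>2 \<partial>gauss (b / \<sigma>\<^sup>2))"
      by (intro nn_integral_eq_integral poly_bdd_integrable_gauss a_pos pg) auto
    also have "ennreal ((1 / sqrt (1 - (exp (- b * s))\<^sup>2)) ^ CARD('d) * E x) * \<dots> \<le> ennreal (D * E x) * ennreal (C0 * exp (- (c * r)))"
      by (intro mult_mono ennreal_leI le C0 r) auto
    also have "\<dots> = ennreal (D * C0 * E x * exp (- (c * r)))"
      using D C0(1) by (simp add: E_def ennreal_mult[symmetric] mult_ac)
    finally show ?thesis .
  qed
  show thesis
  proof (rule that)
    \<comment> \<open>The factor \<open>exp c\<close> pays for the unit of inner time given up when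
      s < 1.\<close>
    show "0 \<le> D * C0 * exp c" using D C0 by simp
    fix r s :: real and x :: "real^'d"
    assume rs: "0 \<le> r" "0 \<le> s" "2 \<le> r + s"
    have E0: "0 \<le> D * C0 * E x" using D C0 by (simp add: E_def)
    have "(\<integral>\<^sup>+y. ennreal ((sg g r y)\<^sup>2) \<partial>Q s x) \<le> ennreal (D * C0 * exp c * E x * exp (- (c * r)))"
    proof (cases "1 \<le> s")
      case True
      have "D * C0 * E x * exp (- (c * r)) * 1 \<le> D * C0 * E x * exp (- (c * r)) * exp c"
        using c E0 by (intro mult_left_mono) auto
      then have "D * C0 * E x * exp (- (c * r)) \<le> D * C0 * exp c * E x * exp (- (c * r))" by (simp add: mult_ac)
      then show ?thesis using case1[OF rs(1) True, of x] by (meson ennreal_leI order_trans)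
    next
      case False
      \<comment> \<open>Jensen's inequality for \<open>T\<^sub>r g = T\<^sub>1 T\<^bsub>r-1\<^esub> g\<close> moves one unit of time to the outer average.\<close>
      then have r1: "0 \<le> r - 1" using rs by simp
      have pg: "poly_bdd (sg g (r - 1))" "poly_bdd (\<lambda>y. (sg g (r - 1) y)\<^sup>2)" by (intro poly_bdd_power poly_bdd_sg g r1)+
      have "ennreal ((sg g r y)\<^sup>2) \<le> (\<integral>\<^sup>+z. ennreal ((sg g (r - 1) z)\<^sup>2) \<partial>Q 1 y)" for y
      proof -
        have "sg g r y = (\<integral>z. sg g (r - 1) z \<partial>Q 1 y)"
          using sg_semigroup[OF g _ r1, of 1 y] by (simp add: sg_def[of "sg g (r - 1)"])
        also have "\<dots>\<^sup>2 \<le> (\<integral>z. (sg g (r - 1) z)\<^sup>2 \<partial>Q 1 y)"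
          by (intro integral_sq_le_prob Q_prob Q_integrable pg) (use poly_bdd_measurable[OF pg(1)] in measurable)
        finally have "ennreal ((sg g r y)\<^sup>2) \<le> ennreal (\<integral>z. (sg g (r - 1) z)\<^sup>2 \<partial>Q 1 y)" by (rule ennreal_leI)
        also have "\<dots> = (\<integral>\<^sup>+z. ennreal ((sg g (r - 1) z)\<^sup>2) \<partial>Q 1 y)"
          by (intro nn_integral_eq_integral[symmetric] Q_integrable pg) auto
        finally show ?thesis .
      qed
      then have "(\<integral>\<^sup>+y. ennreal ((sg g r y)\<^sup>2) \<partial>Q s x) \<le> (\<integral>\<^sup>+y. (\<integral>\<^sup>+z. ennreal ((sg g (r - 1) z)\<^sup>2) \<partial>Q 1 y) \<partial>Q s x)"
        by (rule nn_integral_mono)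
      also have "\<dots> = (\<integral>\<^sup>+z. ennreal ((sg g (r - 1) z)\<^sup>2) \<partial>Q (s + 1) x)"
        by (rule ou_law_semigroup[OF rs(2)]) (simp, measurable)
      also have "\<dots> \<le> ennreal (D * C0 * E x * exp (- (c * (r - 1))))" by (rule case1[OF r1]) (use rs in simp)
      also have "exp (- (c * (r - 1))) = exp c * exp (- (c * r))" unfolding exp_add[symmetric] by (simp add: algebra_simps)
      finally show ?thesis by (simp add: mult_ac)
    qed
    then show "(\<integral>\<^sup>+y. ennreal ((sg g r y)\<^sup>2) \<partial>Q s x) \<le> ennreal (D * C0 * exp c * exp (b / \<sigma>\<^sup>2 * (norm x)\<^sup>2) * exp (- (2 * real (Suc k) * b * r)))"
      by (simp only: E_def c_def)
  qed
qed

end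

context super_OU_process_start
begin

text \<open>After normalisation the variance integrand decays like exp (- (\<alpha> - 2 k b) s - 2 b
  (t - s)): the assumption on \<alpha> controls large s, and the order k + 1 of g controls small s.
  Compact support of \<mu> turns the factor exp (a |x|^2) of \<open>sg_sq_decay\<close> into a
  constant.\<close>

lemma remainder_decay:
  fixes g :: "real^'d \<Rightarrow> real"
  assumes g: "poly_bdd g"
    and orth: "\<And>p. mi_size p \<le> k \<Longrightarrow> (\<integral>y. g y * eigenfun b \<sigma> p y \<partial>gauss (b / \<sigma>\<^sup>2)) = 0"
    and ak: "2 * real k * b < \<alpha>"
  shows "tendsto_L2 (P \<mu>) (\<lambda>t w. exp (- (\<alpha> - real k * b) * t) * xint g t w) (\<lambda>_. 0) at_top"
proof -
  interpret \<mu>: finite_measure \<mu> by (rule MF_D(1)[OF \<mu>])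
  have s\<mu> [measurable_cong]: "sets \<mu> = sets borel" by (rule MF_D(2)[OF \<mu>])
  note [measurable] = poly_bdd_measurable[OF g]
  define l where "l = \<alpha> - real k * b"
  define c where "c = 2 * real (Suc k) * b"
  \<comment> \<open>The smaller of the two competing rates. Replacing both by it makes the integrand
    constant in s, at the price of a factor t.\<close>
  define \<eta> where "\<eta> = min (\<alpha> - 2 * real k * b) (2 * b)"
  have \<eta>: "0 < \<eta>" using ak b_pos by (simp add: \<eta>_def)
  obtain C where C: "0 \<le> C" "\<And>r s x. 0 \<le> r \<Longrightarrow> 0 \<le> s \<Longrightarrow> 2 \<le> r + s \<Longrightarrow>
    (\<integral>\<^sup>+y. ennreal ((sg g r y)\<^sup>2) \<partial>Q s x) \<le> ennreal (C * exp (b / \<sigma>\<^sup>2 * (norm x)\<^sup>2) * exp (- (c * r)))"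
    by (rule sg_sq_decay[OF g orth], assumption) (rule that[unfolded c_def])
  obtain K where K: "compact K" "emeasure \<mu> (- K) = 0" using cs by (auto simp: compactly_supported_def)
  obtain B where B: "\<And>x. x \<in> K \<Longrightarrow> norm x \<le> B" using compact_imp_bounded[OF K(1)] by (auto simp: bounded_iff)
  have Kb: "- K \<in> sets \<mu>" using compact_imp_closed[OF K(1)] by (simp add: s\<mu>)
  have AE_K: "AE x in \<mu>. x \<in> K" by (rule AE_I[of _ _ "- K"]) (use K Kb in auto)
  define L where "L = C * exp (b / \<sigma>\<^sup>2 * B\<^sup>2)"
  have L: "0 \<le> L" using C by (simp add: L_def)
  have bnd: "(\<integral>\<^sup>+y. ennreal ((sg g r y)\<^sup>2) \<partial>Q s x) \<le> ennreal (L * exp (- (c * r)))"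
    if rs: "0 \<le> r" "0 \<le> s" "2 \<le> r + s" and x: "x \<in> K" for r s x
  proof -
    have "(norm x)\<^sup>2 \<le> B\<^sup>2" using B[OF x] by (intro power_mono) auto
    then have "exp (b / \<sigma>\<^sup>2 * (norm x)\<^sup>2) \<le> exp (b / \<sigma>\<^sup>2 * B\<^sup>2)"
      unfolding exp_le_cancel_iff by (intro mult_left_mono less_imp_le[OF a_pos])
    then have "C * exp (b / \<sigma>\<^sup>2 * (norm x)\<^sup>2) * exp (- (c * r)) \<le> L * exp (- (c * r))"
      unfolding L_def using C(1) by (intro mult_right_mono mult_left_mono) auto
    with C(2)[OF rs, of x] show ?thesis by (meson ennreal_leI order_trans)
  qed
  define m where "m = measure \<mu> (space \<mu>)"
  have m: "emeasure \<mu> (space \<mu>) = ennreal m" "0 \<le> m" by (simp_all add: m_def \<mu>.emeasure_eq_measure)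
  \<comment> \<open>The bound at s = 0, where \<open>Q 0 x\<close> is the unit mass at x.\<close>
  have mean: "exp (- (2 * l * t)) * (mm g t)\<^sup>2 \<le> L * m\<^sup>2 * exp (- (2 * b * t))" if t: "2 \<le> t" for t
  proof -
    have "\<bar>\<integral>x. sg g t x \<partial>\<mu>\<bar> \<le> (\<integral>x. \<bar>sg g t x\<bar> \<partial>\<mu>)" by (rule integral_abs_bound)
    also have "\<dots> \<le> (\<integral>x. sqrt (L * exp (- (c * t))) \<partial>\<mu>)"
    proof (rule integral_mono_AE)
      show "integrable \<mu> (\<lambda>x. \<bar>sg g t x\<bar>)" using t by (intro poly_bdd_integrable_init poly_bdd_abs poly_bdd_sg g) auto
      show "AE x in \<mu>. \<bar>sg g t x\<bar> \<le> sqrt (L * exp (- (c * t)))"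
        using AE_K
      proof eventually_elim
        case (elim x)
        have "ennreal ((sg g t x)\<^sup>2) = (\<integral>\<^sup>+y. ennreal ((sg g t y)\<^sup>2) \<partial>Q 0 x)" by (rule Q_0[symmetric]) measurable
        also have "\<dots> \<le> ennreal (L * exp (- (c * t)))" using t by (intro bnd elim) auto
        finally have "\<bar>sg g t x\<bar>\<^sup>2 \<le> L * exp (- (c * t))" using L by (subst (asm) ennreal_le_iff) auto
        then show ?case by (rule real_le_rsqrt)
      qed
    qed simp
    also have "\<dots> = sqrt (L * exp (- (c * t))) * m" by (simp add: m_def)
    finally have "\<bar>\<integral>x. sg g t x \<partial>\<mu>\<bar>\<^sup>2 \<le> (sqrt (L * exp (- (c * t))) * m)\<^sup>2" by (intro power_mono) auto
    also have "\<dots> = L * exp (- (c * t)) * m\<^sup>2" using L by (simp add: power_mult_distrib)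
    finally have "(\<integral>x. sg g t x \<partial>\<mu>)\<^sup>2 \<le> L * exp (- (c * t)) * m\<^sup>2" by simp
    then have "exp (- (2 * l * t)) * (exp (\<alpha> * t))\<^sup>2 * (\<integral>x. sg g t x \<partial>\<mu>)\<^sup>2 \<le> exp (- (2 * l * t)) * (exp (\<alpha> * t))\<^sup>2 * (L * exp (- (c * t)) * m\<^sup>2)"
      by (intro mult_left_mono) auto
    also have "\<dots> = L * m\<^sup>2 * (exp (- (2 * l * t)) * (exp (\<alpha> * t))\<^sup>2 * exp (- (c * t)))" by (simp only: mult_ac)
    also have "exp (- (2 * l * t)) * (exp (\<alpha> * t))\<^sup>2 * exp (- (c * t)) = exp (- (2 * b * t))"
      unfolding exp_double[symmetric] exp_add[symmetric] l_def c_def by (simp add: algebra_simps)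
    finally show ?thesis by (simp add: mm_def power_mult_distrib mult.assoc)
  qed
  have var: "ennreal (exp (- (2 * l * t))) * (\<integral>\<^sup>+x. sg_var g t x \<partial>\<mu>) \<le> ennreal (L * m * (t * exp (- (\<eta> * t))))" if t: "2 \<le> t" for t
  proof -
    have t0: "0 \<le> t" using t by simp
    have "sg_var g t x \<le> ennreal (L * exp (2 * l * t) * exp (- (\<eta> * t)) * t)" if x: "x \<in> K" for x
    proof -
      have "sg_var g t x \<le> (\<integral>\<^sup>+s. ennreal (L * exp (2 * l * t) * exp (- (\<eta> * t))) * indicator {0..t} s \<partial>lborel)"
        unfolding sg_var_def
      proof (intro nn_integral_mono)
        fix s :: real
        show "ennreal (exp (\<alpha> * s)) * (\<integral>\<^sup>+y. ennreal ((exp (\<alpha> * (t - s)) * sg g (t - s) y)\<^sup>2) \<partial>Q s x) * indicator {0..t} s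
           \<le> ennreal (L * exp (2 * l * t) * exp (- (\<eta> * t))) * indicator {0..t} s"
        proof (cases "s \<in> {0..t}")
          case True
          then have s: "0 \<le> s" "0 \<le> t - s" by auto
          have "(\<integral>\<^sup>+y. ennreal ((exp (\<alpha> * (t - s)) * sg g (t - s) y)\<^sup>2) \<partial>Q s x)
             = (\<integral>\<^sup>+y. ennreal ((exp (\<alpha> * (t - s)))\<^sup>2) * ennreal ((sg g (t - s) y)\<^sup>2) \<partial>Q s x)"
            by (intro nn_integral_cong) (simp add: ennreal_mult[symmetric] power_mult_distrib)
          also have "\<dots> = ennreal ((exp (\<alpha> * (t - s)))\<^sup>2) * (\<integral>\<^sup>+y. ennreal ((sg g (t - s) y)\<^sup>2) \<partial>Q s x)"
            by (rule nn_integral_cmult) measurable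
          also have "\<dots> \<le> ennreal ((exp (\<alpha> * (t - s)))\<^sup>2) * ennreal (L * exp (- (c * (t - s))))"
            using s t by (intro mult_left_mono bnd x) auto
          finally have "ennreal (exp (\<alpha> * s)) * (\<integral>\<^sup>+y. ennreal ((exp (\<alpha> * (t - s)) * sg g (t - s) y)\<^sup>2) \<partial>Q s x)
            \<le> ennreal (exp (\<alpha> * s)) * (ennreal ((exp (\<alpha> * (t - s)))\<^sup>2) * ennreal (L * exp (- (c * (t - s)))))"
            by (rule mult_left_mono) simp
          also have "\<dots> = ennreal (L * (exp (\<alpha> * s) * (exp (\<alpha> * (t - s)))\<^sup>2 * exp (- (c * (t - s)))))"
            using L by (simp add: ennreal_mult[symmetric] mult_ac)
          also have "exp (\<alpha> * s) * (exp (\<alpha> * (t - s)))\<^sup>2 * exp (- (c * (t - s)))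
             = exp (2 * l * t) * exp (- ((\<alpha> - 2 * real k * b) * s + 2 * b * (t - s)))"
            unfolding exp_double[symmetric] exp_add[symmetric] l_def c_def by (simp add: algebra_simps)
          also have "ennreal (L * (exp (2 * l * t) * exp (- ((\<alpha> - 2 * real k * b) * s + 2 * b * (t - s)))))
            \<le> ennreal (L * (exp (2 * l * t) * exp (- (\<eta> * t))))"
          proof (intro ennreal_leI mult_left_mono L)
            have "\<eta> * s \<le> (\<alpha> - 2 * real k * b) * s" "\<eta> * (t - s) \<le> 2 * b * (t - s)"
              using s by (auto simp: \<eta>_def intro!: mult_right_mono)
            then show "exp (- ((\<alpha> - 2 * real k * b) * s + 2 * b * (t - s))) \<le> exp (- (\<eta> * t))"
              by (simp add: right_diff_distrib)
          qed auto
          finally show ?thesis using True by (simp add: mult.assoc)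
        qed simp
      qed
      also have "\<dots> = ennreal (L * exp (2 * l * t) * exp (- (\<eta> * t))) * emeasure lborel {0..t}" by (rule nn_integral_cmult_indicator) simp
      also have "\<dots> = ennreal (L * exp (2 * l * t) * exp (- (\<eta> * t)) * t)" using t0 L by (simp add: ennreal_mult[symmetric])
      finally show ?thesis .
    qed
    then have "(\<integral>\<^sup>+x. sg_var g t x \<partial>\<mu>) \<le> (\<integral>\<^sup>+x. ennreal (L * exp (2 * l * t) * exp (- (\<eta> * t)) * t) \<partial>\<mu>)"
      using AE_K by (intro nn_integral_mono_AE) auto
    also have "\<dots> = ennreal (L * exp (2 * l * t) * exp (- (\<eta> * t)) * t * m)"
      using L t0 m by (simp add: ennreal_mult[symmetric])
    finally have "ennreal (exp (- (2 * l * t))) * (\<integral>\<^sup>+x. sg_var g t x \<partial>\<mu>) \<le> ennreal (exp (- (2 * l * t))) * ennreal (L * exp (2 * l * t) * exp (- (\<eta> * t)) * t * m)"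
      by (rule mult_left_mono) simp
    also have "\<dots> = ennreal ((exp (- (2 * l * t)) * exp (2 * l * t)) * (L * m * (t * exp (- (\<eta> * t)))))"
      using L t0 m by (simp add: ennreal_mult[symmetric] mult_ac)
    also have "exp (- (2 * l * t)) * exp (2 * l * t) = 1" by (simp add: exp_add[symmetric])
    finally show ?thesis by simp
  qed
  \<comment> \<open>The factor t is absorbed by half of the rate, using t \<le> (2 / \<eta>) exp
    (\<eta> t / 2).\<close>
  define F where "F t = L * m\<^sup>2 * exp (- (2 * b * t)) + 2 * kap * (L * m * (2 / \<eta> * exp (- (\<eta> / 2 * t))))" for t
  have main: "(\<integral>w. (exp (- l * t) * xint g t w - 0)\<^sup>2 \<partial>P \<mu>) \<le> F t" if t: "2 \<le> t" for t
  proof -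
    have t0: "0 \<le> t" using t by simp
    have "ennreal (\<integral>w. (exp (- l * t) * xint g t w)\<^sup>2 \<partial>P \<mu>) \<le> ennreal (L * m\<^sup>2 * exp (- (2 * b * t))) + ennreal (2 * kap) * ennreal (L * m * (t * exp (- (\<eta> * t))))"
      unfolding xint_second_moment_scaled[OF g t0]
      by (intro add_mono mult_left_mono ennreal_leI mean var t) auto
    also have "\<dots> = ennreal (L * m\<^sup>2 * exp (- (2 * b * t)) + 2 * kap * (L * m * (t * exp (- (\<eta> * t)))))"
      using L m kap_nonneg t0 by (simp add: ennreal_mult[symmetric] ennreal_plus[symmetric] mult.assoc del: ennreal_plus)
    also have "\<dots> \<le> ennreal (F t)"
    proof -
      have "\<eta> / 2 * t \<le> exp (\<eta> / 2 * t)" using exp_ge_add_one_self[of "\<eta> / 2 * t"] by linarith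
      then have "t \<le> 2 / \<eta> * exp (\<eta> / 2 * t)" using \<eta> by (simp add: field_simps)
      then have "t * exp (- (\<eta> * t)) \<le> 2 / \<eta> * exp (\<eta> / 2 * t) * exp (- (\<eta> * t))" by (rule mult_right_mono) simp
      also have "\<dots> = 2 / \<eta> * exp (- (\<eta> / 2 * t))" unfolding mult.assoc exp_add[symmetric] by simp
      finally show ?thesis unfolding F_def using L m kap_nonneg by (intro ennreal_leI add_left_mono mult_left_mono) auto
    qed
    finally show ?thesis using L m kap_nonneg \<eta> by (subst (asm) ennreal_le_iff) (auto simp: F_def)
  qed
  have "((\<lambda>t. \<integral>w. (exp (- l * t) * xint g t w - 0)\<^sup>2 \<partial>P \<mu>) \<longlongrightarrow> 0) at_top"
  proof (rule tendsto_sandwich[OF _ _ tendsto_const])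
    show "\<forall>\<^sub>F t in at_top. (\<integral>w. (exp (- l * t) * xint g t w - 0)\<^sup>2 \<partial>P \<mu>) \<le> F t"
      using eventually_ge_at_top[of 2] by eventually_elim (rule main)
    have e: "((\<lambda>t. exp (- (2 * b * t))) \<longlongrightarrow> 0) at_top" "((\<lambda>t. exp (- (\<eta> / 2 * t))) \<longlongrightarrow> 0) at_top"
      using b_pos \<eta> by (intro exp_decay; simp)+
    show "(F \<longlongrightarrow> 0) at_top"
      unfolding F_def by (intro tendsto_add_zero tendsto_mult_right_zero e)
  qed auto
  moreover have "\<forall>\<^sub>F t in at_top. square_integrable (P \<mu>) (\<lambda>w. exp (- l * t) * xint g t w)"
    using eventually_ge_at_top[of 0] by eventually_elim (intro square_integrable_cmult square_integrable_xint g)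
  ultimately show ?thesis by (simp add: tendsto_L2_def l_def square_integrable_def)
qed

end

section \<open>Splitting off the component of lowest order\<close>

lemma OU_coeff_eq:
  fixes f :: "real^'d::finite \<Rightarrow> real"
  assumes b: "0 < b" "0 < \<sigma>" and f: "poly_bdd f"
  shows "OU_coeff b \<sigma> f p = (\<integral>y. f y * eigenfun b \<sigma> p y \<partial>gauss (b / \<sigma>\<^sup>2))"
proof -
  have a: "0 < b / \<sigma>\<^sup>2" using b by simp
  have p: "poly_bdd (\<lambda>y. f y * eigenfun b \<sigma> p y)" by (intro poly_bdd_mult f poly_bdd_eigenfun b)
  have "has_bochner_integral (gauss (b / \<sigma>\<^sup>2)) (\<lambda>y. f y * eigenfun b \<sigma> p y) (\<integral>y. f y * eigenfun b \<sigma> p y \<partial>gauss (b / \<sigma>\<^sup>2))"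
    by (rule has_bochner_integral_integrable[OF poly_bdd_integrable_gauss[OF a p]])
  then show ?thesis
    unfolding has_bochner_integral_gauss[OF a poly_bdd_measurable[OF p]] OU_coeff_def OU_density_eq[OF b]
    by (simp add: has_bochner_integral_iff mult_ac)
qed

context super_OU_process_start
begin

text \<open>Subtracting the component of order k leaves a function to which
  \<open>remainder_decay\<close> applies, while the component itself is a finite combination of
  martingales. The two parts are recombined almost surely, as \<open>xint\<close> is additive only
  where the integrals exist.\<close>

lemma xint_L2_limit:
  fixes f :: "real^'d \<Rightarrow> real"
  assumes f: "poly_bdd f" and low: "\<And>p. mi_size p < k \<Longrightarrow> OU_coeff b \<sigma> f p = 0" and ak: "2 * real k * b < \<alpha>"
  shows "tendsto_L2 (P \<mu>) (\<lambda>t w. exp (- (\<alpha> - real k * b) * t) * xint f t w)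
    (\<lambda>w. \<Sum>p | mi_size p = k. OU_coeff b \<sigma> f p * mart_H_lim b \<sigma> \<alpha> X (P \<mu>) p w) at_top"
proof -
  define S where "S = {p :: 'd \<Rightarrow> nat. mi_size p = k}"
  have S: "finite S" unfolding S_def by (rule finite_subset[OF _ finite_mi_le[of k]]) auto
  define c where "c p = OU_coeff b \<sigma> f p" for p
  define \<phi> :: "('d \<Rightarrow> nat) \<Rightarrow> real^'d \<Rightarrow> real" where "\<phi> = eigenfun b \<sigma>"
  have \<phi>: "poly_bdd (\<phi> p)" for p unfolding \<phi>_def by (intro poly_bdd_eigenfun b_pos \<sigma>_pos)
  define g where "g = (\<lambda>x. f x - (\<Sum>p\<in>S. c p * \<phi> p x))"
  have g: "poly_bdd g" unfolding g_def by (intro poly_bdd_diff f poly_bdd_sum poly_bdd_cmult \<phi> S)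
  \<comment> \<open>For |q| = k the subtracted component cancels the coefficient; for |q| < k the
    coefficient is 0 by assumption and the component does not contribute.\<close>
  have orth: "(\<integral>y. g y * eigenfun b \<sigma> q y \<partial>gauss (b / \<sigma>\<^sup>2)) = 0" if q: "mi_size q \<le> k" for q
  proof -
    have o: "has_bochner_integral (gauss (b / \<sigma>\<^sup>2)) (\<lambda>y. \<phi> p y * \<phi> q y) (if p = q then 1 else 0)" for p
      unfolding \<phi>_def by (rule eigenfun_orthonormal[OF b_pos \<sigma>_pos])
    have i: "integrable (gauss (b / \<sigma>\<^sup>2)) (\<lambda>y. f y * \<phi> q y)"
      by (intro poly_bdd_integrable_gauss a_pos poly_bdd_mult f \<phi>)
    have "(\<integral>y. g y * \<phi> q y \<partial>gauss (b / \<sigma>\<^sup>2)) = (\<integral>y. f y * \<phi> q y - (\<Sum>p\<in>S. c p * (\<phi> p y * \<phi> q y)) \<partial>gauss (b / \<sigma>\<^sup>2))"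
      unfolding g_def left_diff_distrib sum_distrib_right mult.assoc ..
    also have "\<dots> = (\<integral>y. f y * \<phi> q y \<partial>gauss (b / \<sigma>\<^sup>2)) - (\<Sum>p\<in>S. c p * (\<integral>y. \<phi> p y * \<phi> q y \<partial>gauss (b / \<sigma>\<^sup>2)))"
      using o i by (simp add: has_bochner_integral_iff)
    also have "(\<Sum>p\<in>S. c p * (\<integral>y. \<phi> p y * \<phi> q y \<partial>gauss (b / \<sigma>\<^sup>2))) = (\<Sum>p\<in>S. if p = q then c p else 0)"
      using o by (intro sum.cong refl) (simp add: has_bochner_integral_iff)
    also have "\<dots> = (if q \<in> S then c q else 0)" using S by simp
    also have "(\<integral>y. f y * \<phi> q y \<partial>gauss (b / \<sigma>\<^sup>2)) = c q"
      unfolding c_def \<phi>_def by (rule OU_coeff_eq[OF b_pos \<sigma>_pos f, symmetric])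
    finally show ?thesis using low[of q] q by (auto simp: \<phi>_def c_def S_def)
  qed
  have "tendsto_L2 (P \<mu>) (\<lambda>t w. exp (- (\<alpha> - real k * b) * t) * xint g t w + (\<Sum>p\<in>S. c p * mart_H b \<sigma> \<alpha> X p t w))
     (\<lambda>w. 0 + (\<Sum>p\<in>S. c p * mart_H_lim b \<sigma> \<alpha> X (P \<mu>) p w)) at_top"
    using ak by (intro tendsto_L2_add remainder_decay[OF g orth] tendsto_L2_sum S tendsto_L2_cmult mart_H_L2) (auto simp: S_def)
  then have "tendsto_L2 (P \<mu>) (\<lambda>t w. exp (- (\<alpha> - real k * b) * t) * xint f t w)
     (\<lambda>w. 0 + (\<Sum>p\<in>S. c p * mart_H_lim b \<sigma> \<alpha> X (P \<mu>) p w)) at_top"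
  proof (rule tendsto_L2_cong_AE)
    show "\<forall>\<^sub>F t in at_top. (\<lambda>w. exp (- (\<alpha> - real k * b) * t) * xint f t w) \<in> borel_measurable (P \<mu>) \<and>
       (AE w in P \<mu>. exp (- (\<alpha> - real k * b) * t) * xint g t w + (\<Sum>p\<in>S. c p * mart_H b \<sigma> \<alpha> X p t w) = exp (- (\<alpha> - real k * b) * t) * xint f t w)"
      using eventually_ge_at_top[of 0]
    proof eventually_elim
      case (elim t)
      note [measurable] = xint_measurable[OF poly_bdd_measurable[OF f] elim]
      have "AE w in P \<mu>. \<forall>p\<in>S. integrable (X t w) (\<phi> p)"
        by (rule AE_finite_allI[OF S AE_integrable_X[OF \<phi> elim]])
      then have "AE w in P \<mu>. exp (- (\<alpha> - real k * b) * t) * xint g t w + (\<Sum>p\<in>S. c p * mart_H b \<sigma> \<alpha> X p t w) = exp (- (\<alpha> - real k * b) * t) * xint f t w"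
        using AE_integrable_X[OF f elim]
      proof eventually_elim
        case (elim w)
        have "xint g t w = xint f t w - (\<Sum>p\<in>S. c p * xint (\<phi> p) t w)"
          unfolding xint_def g_def using elim by (simp add: integrable_sum)
        moreover have "(\<Sum>p\<in>S. c p * mart_H b \<sigma> \<alpha> X p t w) = exp (- (\<alpha> - real k * b) * t) * (\<Sum>p\<in>S. c p * xint (\<phi> p) t w)"
          unfolding sum_distrib_left by (intro sum.cong refl) (simp add: mart_H_def S_def xint_def \<phi>_def mult_ac)
        ultimately show ?case by (simp add: right_diff_distrib)
      qed
      then show ?case by simp
    qed
  qed
  then show ?thesis by (simp add: S_def c_def)
qed

end

theorem theorem1p1:
  fixes b \<sigma> \<alpha> \<beta> :: real and n :: "real measure"
    and N :: "'v measure" and \<xi> :: "real \<Rightarrow> 'v \<Rightarrow> real^'d::finite" and Pr :: "real^'d \<Rightarrow> 'v measure"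
    and M :: "'w measure" and X :: "real \<Rightarrow> 'w \<Rightarrow> (real^'d) measure"
    and P :: "(real^'d) measure \<Rightarrow> 'w measure"
    and \<mu> :: "(real^'d) measure" and f :: "real^'d \<Rightarrow> real"
  assumes "super_OU_process b \<sigma> N \<xi> Pr \<alpha> \<beta> n M X P"
    and "\<mu> \<in> space MF" and "compactly_supported \<mu>"
    and "f \<in> poly_growth"
    and "ereal \<alpha> > 2 * ereal_of_enat (OU_order b \<sigma> f) * ereal b"
  shows "tendsto_L2 (P \<mu>)
    (\<lambda>t \<omega>. exp (- (\<alpha> - real (the_enat (OU_order b \<sigma> f)) * b) * t) * (\<integral>x. f x \<partial>X t \<omega>))
    (\<lambda>\<omega>. \<Sum>p | mi_size p = the_enat (OU_order b \<sigma> f).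
            OU_coeff b \<sigma> f p * mart_H_lim b \<sigma> \<alpha> X (P \<mu>) p \<omega>)
    at_top"
proof -
  interpret super_OU_process b \<sigma> N \<xi> Pr \<alpha> \<beta> n M X P by fact
  interpret super_OU_process_start b \<sigma> N \<xi> Pr \<alpha> \<beta> n M X P \<mu>
    by unfold_locales (fact assms)+
  \<comment> \<open>The order is finite: since b > 0, an infinite order would make the right-hand
    side of the assumption on \<alpha> infinite.\<close>
  obtain k where k: "OU_order b \<sigma> f = enat k"
    using assms(5) b_pos by (cases "OU_order b \<sigma> f") (simp_all add: ereal_mult_infty)
  have low: "OU_coeff b \<sigma> f p = 0" if "mi_size p < k" for p
  proof (rule ccontr)
    assume "OU_coeff b \<sigma> f p \<noteq> 0"
    then have "OU_order b \<sigma> f \<le> enat (mi_size p)" unfolding OU_order_def by (intro Inf_lower) auto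
    with that k show False by simp
  qed
  have "2 * real k * b < \<alpha>" using assms(5) by (simp add: k)
  from xint_L2_limit[OF poly_growth_imp_poly_bdd[OF assms(4)] low this]
  show ?thesis by (simp add: k xint_def)
qed

end
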